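(* Let $K$ be a field, $p,q\in K^*$, $f=pt\in K[t]$ and let $g\in K[t]$ be a homogeneous polynomial of degree $2$. Let $\mathcal{H}_q(f,g)$ be the $K$-algebra generated by $x,y,t$ with defining relations $$tx=xf,\qquad yt=fy,\qquad yx-qxy=g,$$ graded by $\deg x=\deg y=\deg t=1$. Then $\mathcal{H}_q(f,g)$ is Koszul, Artin--Schelter regular and graded skew Calabi--Yau of dimension $3$.
   Context: Algebras are associative unital $K$-algebras; $K^*=K\setminus\{0\}$. A homogeneous polynomial of degree $2$ in $K[t]$ is one of the form $ct^2$, $c\in K$. A graded algebra $B=\bigoplus_{m\ge 0}B_m$ is connected if $B_0=K$; then $K=B/B_{\ge 1}$ is the trivial module. Koszul: a connected graded algebra $B$ is Koszul if the trivial module $K$ has a graded projective resolution $\cdots\to P_i\to\cdots\to P_0\to K\to 0$ with each $P_i$ generated in degree $i$. Artin--Schelter regular: a connected graded algebra $B$ is Artin--Schelter regular of dimension $d$ if $B$ has finite global dimension $d$, $\mathrm{Ext}^i_B(K,B)=0$ for $i\ne d$, and $\mathrm{Ext}^d_B(K,B)\cong K(l)$ for some $l\in\mathbb{Z}$ (a degree shift). Graded skew Calabi--Yau: let $B^e=B\otimes_K B^{op}$. A graded algebra $B$ is graded skew Calabi--Yau of dimension $d$ if $B$ has, as a $B^e$-module, a projective resolution of finite length with finitely generated terms, and there is an algebra automorphism $\nu$ of $B$ such that, as $B^e$-modules, $\mathrm{Ext}^i_{B^e}(B,B^e)=0$ for $i\neq d$ and $\mathrm{Ext}^d_{B^e}(B,B^e)\cong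 B^{\nu}(l)$ for some integer $l$, where $B^\nu$ is $B$ with the right action twisted by $\nu$. *)

theory Defs
  imports
    "HOL-Library.Poly_Mapping"
    "HOL-Library.Extended_Nat"
    "HOL-Computational_Algebra.Polynomial"
    "HOL-Algebra.Module"
    "HOL-Algebra.QuotRing"
begin

section \<open>Modules over noncommutative rings\<close>

text \<open>
  The library locale \<open>module\<close> asks for a commutative base ring.  Below, a module is a record of the
  library type \<open>module\<close> of which only the fields \<open>carrier\<close>, \<open>add\<close>, \<open>zero\<close> and \<open>smult\<close> matter.
  A right \<open>A\<close>-module is a left module over \<open>opp A\<close>.
\<close>

locale left_module = A?: ring A + M?: abelian_group M for A (structure) and M (structure) +
  assumes smult_closed:
      "\<lbrakk> a \<in> carrier A; x \<in> carrier M \<rbrakk> \<Longrightarrow> a \<odot>\<^bsub>M\<^esub> x \<in> carrier M"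
    and smult_l_distr:
      "\<lbrakk> a \<in> carrier A; b \<in> carrier A; x \<in> carrier M \<rbrakk> \<Longrightarrow>
       (a \<oplus> b) \<odot>\<^bsub>M\<^esub> x = a \<odot>\<^bsub>M\<^esub> x \<oplus>\<^bsub>M\<^esub> b \<odot>\<^bsub>M\<^esub> x"
    and smult_r_distr:
      "\<lbrakk> a \<in> carrier A; x \<in> carrier M; y \<in> carrier M \<rbrakk> \<Longrightarrow>
       a \<odot>\<^bsub>M\<^esub> (x \<oplus>\<^bsub>M\<^esub> y) = a \<odot>\<^bsub>M\<^esub> x \<oplus>\<^bsub>M\<^esub> a \<odot>\<^bsub>M\<^esub> y"
    and smult_assoc:
      "\<lbrakk> a \<in> carrier A; b \<in> carrier A; x \<in> carrier M \<rbrakk> \<Longrightarrow>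
       (a \<otimes> b) \<odot>\<^bsub>M\<^esub> x = a \<odot>\<^bsub>M\<^esub> (b \<odot>\<^bsub>M\<^esub> x)"
    and smult_one:
      "x \<in> carrier M \<Longrightarrow> \<one> \<odot>\<^bsub>M\<^esub> x = x"

definition opp :: "('a, 'r) ring_scheme \<Rightarrow> ('a, 'r) ring_scheme" where
  "opp A = A\<lparr>mult := \<lambda>x y. y \<otimes>\<^bsub>A\<^esub> x\<rparr>"

definition with_smult :: "('m, 'r) ring_scheme \<Rightarrow> ('a \<Rightarrow> 'm \<Rightarrow> 'm) \<Rightarrow> ('a, 'm) module" where
  "with_smult R s = ring.extend (ring.truncate R) (module.fields s)"

definition regular :: "('a, 'r) ring_scheme \<Rightarrow> ('a, 'a) module" where
  "regular A = with_smult A (\<lambda>a x. a \<otimes>\<^bsub>A\<^esub> x)"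

text \<open>
  Quotient by a subgroup of the additive group; for \<open>N\<close> a submodule (two-sided ideal) this is the
  quotient module (quotient algebra).
\<close>

definition quot :: "('a, 'm, 's) module_scheme \<Rightarrow> 'm set \<Rightarrow> ('a, 'm set) module" where
  "quot M N = with_smult (M Quot N) (\<lambda>a X. \<Union>x\<in>X. N +>\<^bsub>M\<^esub> (a \<odot>\<^bsub>M\<^esub> x))"

text \<open>Linear maps are extensional functions, so that equality of maps is equality in HOL.\<close>

definition lin_maps ::
  "('a, 'r) ring_scheme \<Rightarrow> ('a, 'm, 's) module_scheme \<Rightarrow> ('a, 'n, 't) module_scheme \<Rightarrow> ('m \<Rightarrow> 'n) set" where
  "lin_maps A M N = {h \<in> carrier M \<rightarrow>\<^sub>E carrier N.
     (\<forall>x\<in>carrier M. \<forall>y\<in>carrier M. h (x \<oplus>\<^bsub>M\<^esub> y) = h x \<oplus>\<^bsub>N\<^esub> h y) \<and>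
     (\<forall>a\<in>carrier A. \<forall>x\<in>carrier M. h (a \<odot>\<^bsub>M\<^esub> x) = a \<odot>\<^bsub>N\<^esub> h x)}"

definition generates ::
  "('a, 'r) ring_scheme \<Rightarrow> ('a, 'm, 's) module_scheme \<Rightarrow> 'm set \<Rightarrow> bool" where
  "generates A M S \<longleftrightarrow>
     S \<subseteq> carrier M \<and> (\<forall>N. submodule N A M \<and> S \<subseteq> N \<longrightarrow> N = carrier M)"

definition finitely_generated ::
  "('a, 'r) ring_scheme \<Rightarrow> ('a, 'm, 's) module_scheme \<Rightarrow> bool" where
  "finitely_generated A M \<longleftrightarrow> (\<exists>S. finite S \<and> generates A M S)"

definition free_module :: "('a, 'r) ring_scheme \<Rightarrow> 'i set \<Rightarrow> ('a, 'i \<Rightarrow> 'a) module" where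
  "free_module A I =
     \<lparr>carrier = {f. (\<forall>i\<in>I. f i \<in> carrier A) \<and> (\<forall>i. i \<notin> I \<longrightarrow> f i = \<zero>\<^bsub>A\<^esub>) \<and> finite {i. f i \<noteq> \<zero>\<^bsub>A\<^esub>}},
      mult = undefined, one = undefined,
      zero = (\<lambda>i. \<zero>\<^bsub>A\<^esub>), add = (\<lambda>f g i. f i \<oplus>\<^bsub>A\<^esub> g i),
      smult = (\<lambda>a f i. a \<otimes>\<^bsub>A\<^esub> f i)\<rparr>"

text \<open>
  Projective: a direct summand of a free module.  A basis inside the type of \<open>P\<close> is no restriction,
  since \<open>P\<close> is a quotient of the free module on \<open>carrier P\<close>, and this splits when \<open>P\<close> is projective.
\<close>

definition projective ::
  "('a, 'r) ring_scheme \<Rightarrow> ('a, 'p, 's) module_scheme \<Rightarrow> bool" where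
  "projective A P \<longleftrightarrow> left_module A P \<and>
     (\<exists>(I :: 'p set). \<exists>s\<in>lin_maps A P (free_module A I). \<exists>r\<in>lin_maps A (free_module A I) P.
        \<forall>x\<in>carrier P. r (s x) = x)"

text \<open>A resolution \<open>\<cdots> \<rightarrow> P 1 \<rightarrow> P 0 \<rightarrow> M \<rightarrow> 0\<close> has differentials \<open>d i : P (i + 1) \<rightarrow> P i\<close> and
  augmentation \<open>e : P 0 \<rightarrow> M\<close>.\<close>

definition projective_resolution ::
  "('a, 'r) ring_scheme \<Rightarrow> ('a, 'm, 's) module_scheme \<Rightarrow>
   (nat \<Rightarrow> ('a, 'p) module) \<Rightarrow> (nat \<Rightarrow> 'p \<Rightarrow> 'p) \<Rightarrow> ('p \<Rightarrow> 'm) \<Rightarrow> bool" where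
  "projective_resolution A M P d e \<longleftrightarrow>
     left_module A M \<and> (\<forall>i. projective A (P i)) \<and>
     e \<in> lin_maps A (P 0) M \<and> (\<forall>i. d i \<in> lin_maps A (P (Suc i)) (P i)) \<and>
     e ` carrier (P 0) = carrier M \<and>
     {x \<in> carrier (P 0). e x = \<zero>\<^bsub>M\<^esub>} = d 0 ` carrier (P 1) \<and>
     (\<forall>i. {x \<in> carrier (P (Suc i)). d i x = \<zero>\<^bsub>P i\<^esub>} = d (Suc i) ` carrier (P (Suc (Suc i))))"

definition length_at_most :: "(nat \<Rightarrow> ('a, 'p) module) \<Rightarrow> nat \<Rightarrow> bool" where
  "length_at_most P n \<longleftrightarrow> (\<forall>i>n. carrier (P i) = {\<zero>\<^bsub>P i\<^esub>})"

text \<open>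
  HOL cannot quantify over types inside a formula, so the terms of resolutions of an \<open>A\<close>-module
  with elements in \<open>'m\<close> are taken in the following type.  It contains free \<open>A\<close>-modules of rank
  \<open>max |'m| |'a| \<aleph>\<^sub>0\<close>; covering \<open>M\<close> and then successive kernels by free modules never leaves
  that rank, so every module has a free resolution in this type, and the type does not affect the
  length of the shortest projective resolution.
\<close>

type_synonym ('a, 'm) res = "('m + 'a) list \<Rightarrow> 'a"

definition proj_dim :: "('a, 'r) ring_scheme \<Rightarrow> ('a, 'm, 's) module_scheme \<Rightarrow> enat" where
  "proj_dim A M = (INF n \<in> {n. \<exists>(P :: nat \<Rightarrow> ('a, ('a, 'm) res) module) d e.
     projective_resolution A M P d e \<and> length_at_most P n}. enat n)"

text \<open>
  Left global dimension: supremum of the projective dimensions of all left modules.  The type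
  \<open>'m\<close> is arbitrary, so modules of any size are covered; the summand \<open>'a set\<close> makes sure that
  the cyclic modules \<open>A / J\<close> always occur, so that (by Auslander's theorem) the value does not
  depend on \<open>'m\<close>.
\<close>

definition global_dim :: "'m itself \<Rightarrow> ('a, 'r) ring_scheme \<Rightarrow> enat" where
  "global_dim _ A = (SUP M \<in> {M :: ('a, 'a set + 'm) module. left_module A M}. proj_dim A M)"


section \<open>Graded rings and modules\<close>

text \<open>Rings and modules are graded by the integers; an \<open>\<nat>\<close>-grading is zero in negative degrees.\<close>

definition internal_direct_sum :: "('m, 'r) ring_scheme \<Rightarrow> (int \<Rightarrow> 'm set) \<Rightarrow> bool" where
  "internal_direct_sum M G \<longleftrightarrow> (\<forall>n. additive_subgroup (G n) M) \<and>
     (\<forall>x\<in>carrier M. \<exists>!f. (\<forall>n. f n \<in> G n) \<and> finite {n. f n \<noteq> \<zero>\<^bsub>M\<^esub>} \<and>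
        x = (\<Oplus>\<^bsub>M\<^esub>n\<in>{n. f n \<noteq> \<zero>\<^bsub>M\<^esub>}. f n))"

definition graded_ring :: "('a, 'r) ring_scheme \<Rightarrow> (int \<Rightarrow> 'a set) \<Rightarrow> bool" where
  "graded_ring A GA \<longleftrightarrow> ring A \<and> internal_direct_sum A GA \<and> \<one>\<^bsub>A\<^esub> \<in> GA 0 \<and>
     (\<forall>i j. \<forall>a\<in>GA i. \<forall>b\<in>GA j. a \<otimes>\<^bsub>A\<^esub> b \<in> GA (i + j))"

definition graded_module ::
  "('a, 'r) ring_scheme \<Rightarrow> (int \<Rightarrow> 'a set) \<Rightarrow> ('a, 'm, 's) module_scheme \<Rightarrow> (int \<Rightarrow> 'm set) \<Rightarrow> bool" where
  "graded_module A GA M GM \<longleftrightarrow> graded_ring A GA \<and> left_module A M \<and> internal_direct_sum M GM \<and>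
     (\<forall>i j. \<forall>a\<in>GA i. \<forall>x\<in>GM j. a \<odot>\<^bsub>M\<^esub> x \<in> GM (i + j))"

definition quot_grading :: "('m, 'r) ring_scheme \<Rightarrow> 'm set \<Rightarrow> (int \<Rightarrow> 'm set) \<Rightarrow> int \<Rightarrow> 'm set set" where
  "quot_grading M N GM n = (\<lambda>x. N +>\<^bsub>M\<^esub> x) ` GM n"

definition shift :: "(int \<Rightarrow> 'm set) \<Rightarrow> int \<Rightarrow> int \<Rightarrow> 'm set" where
  "shift GM l n = GM (n + l)"

definition graded_iso ::
  "('a, 'r) ring_scheme \<Rightarrow> ('a, 'm, 's) module_scheme \<Rightarrow> (int \<Rightarrow> 'm set) \<Rightarrow>
   ('a, 'n, 't) module_scheme \<Rightarrow> (int \<Rightarrow> 'n set) \<Rightarrow> bool" where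
  "graded_iso A M GM N GN \<longleftrightarrow>
     (\<exists>h\<in>lin_maps A M N. bij_betw h (carrier M) (carrier N) \<and> (\<forall>n. h ` GM n = GN n))"

text \<open>A projective object of the category of graded modules is the same as a graded module that is
  projective as a module.\<close>

definition graded_projective_resolution ::
  "('a, 'r) ring_scheme \<Rightarrow> (int \<Rightarrow> 'a set) \<Rightarrow> ('a, 'm, 's) module_scheme \<Rightarrow> (int \<Rightarrow> 'm set) \<Rightarrow>
   (nat \<Rightarrow> ('a, 'p) module) \<Rightarrow> (nat \<Rightarrow> int \<Rightarrow> 'p set) \<Rightarrow> (nat \<Rightarrow> 'p \<Rightarrow> 'p) \<Rightarrow> ('p \<Rightarrow> 'm) \<Rightarrow> bool" where
  "graded_projective_resolution A GA M GM P GP d e \<longleftrightarrow>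
     projective_resolution A M P d e \<and>
     graded_module A GA M GM \<and> (\<forall>i. graded_module A GA (P i) (GP i)) \<and>
     (\<forall>n. e ` GP 0 n \<subseteq> GM n) \<and> (\<forall>i n. d i ` GP (Suc i) n \<subseteq> GP i n)"


section \<open>Graded Ext with values in the ring\<close>

text \<open>
  The graded dual \<open>\<Oplus>\<^sub>n Hom\<^sub>A(P, A(n))\<^sub>0\<close> of a graded left module \<open>P\<close>: the linear maps \<open>P \<rightarrow> A\<close>
  that are finite sums of homogeneous ones, with the right action \<open>(h a) x = (h x) a\<close>.
\<close>

definition homogeneous_maps ::
  "('a, 'r) ring_scheme \<Rightarrow> (int \<Rightarrow> 'a set) \<Rightarrow> ('a, 'p, 's) module_scheme \<Rightarrow> (int \<Rightarrow> 'p set) \<Rightarrow>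
   int \<Rightarrow> ('p \<Rightarrow> 'a) set" where
  "homogeneous_maps A GA P GP n =
     {h \<in> lin_maps A P (regular A). \<forall>m. h ` GP m \<subseteq> GA (m + n)}"

definition graded_dual ::
  "('a, 'r) ring_scheme \<Rightarrow> (int \<Rightarrow> 'a set) \<Rightarrow> ('a, 'p, 's) module_scheme \<Rightarrow> (int \<Rightarrow> 'p set) \<Rightarrow>
   ('a, 'p \<Rightarrow> 'a) module" where
  "graded_dual A GA P GP =
     \<lparr>carrier = {h \<in> lin_maps A P (regular A). \<exists>N f. finite N \<and>
        (\<forall>n\<in>N. f n \<in> homogeneous_maps A GA P GP n) \<and>
        (\<forall>x\<in>carrier P. h x = (\<Oplus>\<^bsub>A\<^esub>n\<in>N. f n x))},
      mult = undefined, one = undefined,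
      zero = (\<lambda>x\<in>carrier P. \<zero>\<^bsub>A\<^esub>),
      add = (\<lambda>h k. \<lambda>x\<in>carrier P. h x \<oplus>\<^bsub>A\<^esub> k x),
      smult = (\<lambda>a h. \<lambda>x\<in>carrier P. h x \<otimes>\<^bsub>A\<^esub> a)\<rparr>"

text \<open>The \<open>i\<close>-th cohomology of the dual complex \<open>P 0\<^sup>* \<rightarrow> P 1\<^sup>* \<rightarrow> \<cdots>\<close> is \<open>cocycles\<close> modulo
  \<open>coboundaries\<close>, a right \<open>A\<close>-module.\<close>

definition cocycles ::
  "('a, 'r) ring_scheme \<Rightarrow> (int \<Rightarrow> 'a set) \<Rightarrow> (nat \<Rightarrow> ('a, 'p) module) \<Rightarrow> (nat \<Rightarrow> int \<Rightarrow> 'p set) \<Rightarrow>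
   (nat \<Rightarrow> 'p \<Rightarrow> 'p) \<Rightarrow> nat \<Rightarrow> ('a, 'p \<Rightarrow> 'a) module" where
  "cocycles A GA P GP d i = (graded_dual A GA (P i) (GP i))
     \<lparr>carrier := {h \<in> carrier (graded_dual A GA (P i) (GP i)).
        \<forall>x\<in>carrier (P (Suc i)). h (d i x) = \<zero>\<^bsub>A\<^esub>}\<rparr>"

fun coboundaries ::
  "('a, 'r) ring_scheme \<Rightarrow> (int \<Rightarrow> 'a set) \<Rightarrow> (nat \<Rightarrow> ('a, 'p) module) \<Rightarrow> (nat \<Rightarrow> int \<Rightarrow> 'p set) \<Rightarrow>
   (nat \<Rightarrow> 'p \<Rightarrow> 'p) \<Rightarrow> nat \<Rightarrow> ('p \<Rightarrow> 'a) set" where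
  "coboundaries A GA P GP d 0 = {\<zero>\<^bsub>graded_dual A GA (P 0) (GP 0)\<^esub>}"
| "coboundaries A GA P GP d (Suc i) =
     (\<lambda>h. compose (carrier (P (Suc i))) h (d i)) ` carrier (graded_dual A GA (P i) (GP i))"

definition cohomology ::
  "('a, 'r) ring_scheme \<Rightarrow> (int \<Rightarrow> 'a set) \<Rightarrow> (nat \<Rightarrow> ('a, 'p) module) \<Rightarrow> (nat \<Rightarrow> int \<Rightarrow> 'p set) \<Rightarrow>
   (nat \<Rightarrow> 'p \<Rightarrow> 'p) \<Rightarrow> nat \<Rightarrow> ('a, ('p \<Rightarrow> 'a) set) module" where
  "cohomology A GA P GP d i = quot (cocycles A GA P GP d i) (coboundaries A GA P GP d i)"

definition cohomology_grading ::
  "('a, 'r) ring_scheme \<Rightarrow> (int \<Rightarrow> 'a set) \<Rightarrow> (nat \<Rightarrow> ('a, 'p) module) \<Rightarrow> (nat \<Rightarrow> int \<Rightarrow> 'p set) \<Rightarrow>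
   (nat \<Rightarrow> 'p \<Rightarrow> 'p) \<Rightarrow> nat \<Rightarrow> int \<Rightarrow> ('p \<Rightarrow> 'a) set set" where
  "cohomology_grading A GA P GP d i =
     quot_grading (cocycles A GA P GP d i) (coboundaries A GA P GP d i)
       (\<lambda>n. homogeneous_maps A GA (P i) (GP i) n \<inter> carrier (cocycles A GA P GP d i))"

text \<open>
  \<open>Ext_iso A GA M GM i E GE\<close>: the graded right module \<open>E\<close> is isomorphic to \<open>Ext\<^sup>i\<^sub>A(M, A)\<close>.
  As usual, Ext is computed from some graded projective resolution of \<open>M\<close>; it is well defined up
  to isomorphism by the comparison theorem.
\<close>

definition Ext_iso ::
  "('a, 'r) ring_scheme \<Rightarrow> (int \<Rightarrow> 'a set) \<Rightarrow> ('a, 'm, 's) module_scheme \<Rightarrow> (int \<Rightarrow> 'm set) \<Rightarrow> nat \<Rightarrow>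
   ('a, 'e, 't) module_scheme \<Rightarrow> (int \<Rightarrow> 'e set) \<Rightarrow> bool" where
  "Ext_iso A GA M GM i E GE \<longleftrightarrow>
     (\<exists>(P :: nat \<Rightarrow> ('a, ('a, 'm) res) module) GP d e.
        graded_projective_resolution A GA M GM P GP d e \<and>
        graded_iso (opp A) (cohomology A GA P GP d i) (cohomology_grading A GA P GP d i) E GE)"

definition zero_module :: "('a, unit) module" where
  "zero_module = \<lparr>carrier = {()}, mult = undefined, one = (), zero = (), add = (\<lambda>_ _. ()),
     smult = (\<lambda>_ _. ())\<rparr>"

definition Ext_zero ::
  "('a, 'r) ring_scheme \<Rightarrow> (int \<Rightarrow> 'a set) \<Rightarrow> ('a, 'm, 's) module_scheme \<Rightarrow> (int \<Rightarrow> 'm set) \<Rightarrow> nat \<Rightarrow> bool" where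
  "Ext_zero A GA M GM i \<longleftrightarrow> Ext_iso A GA M GM i zero_module (\<lambda>_. {()})"


section \<open>Graded algebras over a field\<close>

text \<open>The ground field is the type \<open>'k\<close>; the field \<open>smult\<close> of an algebra is the scalar multiplication.\<close>

locale k_algebra = ring B for B :: "('k::field, 'b, 's) module_scheme" (structure) +
  assumes scale_closed: "x \<in> carrier B \<Longrightarrow> c \<odot> x \<in> carrier B"
    and scale_l_distr: "x \<in> carrier B \<Longrightarrow> (c + c') \<odot> x = c \<odot> x \<oplus> c' \<odot> x"
    and scale_r_distr: "\<lbrakk> x \<in> carrier B; y \<in> carrier B \<rbrakk> \<Longrightarrow> c \<odot> (x \<oplus> y) = c \<odot> x \<oplus> c \<odot> y"
    and scale_scale: "x \<in> carrier B \<Longrightarrow> (c * c') \<odot> x = c \<odot> (c' \<odot> x)"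
    and scale_one: "x \<in> carrier B \<Longrightarrow> 1 \<odot> x = x"
    and scale_mult_l: "\<lbrakk> x \<in> carrier B; y \<in> carrier B \<rbrakk> \<Longrightarrow> c \<odot> (x \<otimes> y) = (c \<odot> x) \<otimes> y"
    and scale_mult_r: "\<lbrakk> x \<in> carrier B; y \<in> carrier B \<rbrakk> \<Longrightarrow> c \<odot> (x \<otimes> y) = x \<otimes> (c \<odot> y)"

definition graded_algebra ::
  "('k::field, 'b, 's) module_scheme \<Rightarrow> (int \<Rightarrow> 'b set) \<Rightarrow> bool" where
  "graded_algebra B GB \<longleftrightarrow> k_algebra B \<and> graded_ring B GB \<and>
     (\<forall>n<0. GB n = {\<zero>\<^bsub>B\<^esub>}) \<and> (\<forall>c n. \<forall>x\<in>GB n. c \<odot>\<^bsub>B\<^esub> x \<in> GB n)"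

definition connected_graded_algebra ::
  "('k::field, 'b, 's) module_scheme \<Rightarrow> (int \<Rightarrow> 'b set) \<Rightarrow> bool" where
  "connected_graded_algebra B GB \<longleftrightarrow> graded_algebra B GB \<and> \<one>\<^bsub>B\<^esub> \<noteq> \<zero>\<^bsub>B\<^esub> \<and>
     GB 0 = range (\<lambda>c. c \<odot>\<^bsub>B\<^esub> \<one>\<^bsub>B\<^esub>)"

definition positive_part :: "('b, 'r) ring_scheme \<Rightarrow> (int \<Rightarrow> 'b set) \<Rightarrow> 'b set" where
  "positive_part B GB =
     {\<Oplus>\<^bsub>B\<^esub>n\<in>N. f n | N f. finite N \<and> N \<subseteq> {1..} \<and> (\<forall>n\<in>N. f n \<in> GB n)}"

text \<open>\<open>K = B / B\<^sub>\<ge>\<^sub>1\<close> as a left module over \<open>B\<close>; applied to \<open>opp B\<close> it is the right module \<open>K\<close>.\<close>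

definition trivial_module :: "('b, 'r) ring_scheme \<Rightarrow> (int \<Rightarrow> 'b set) \<Rightarrow> ('b, 'b set) module" where
  "trivial_module B GB = quot (regular B) (positive_part B GB)"

definition trivial_grading :: "('b, 'r) ring_scheme \<Rightarrow> (int \<Rightarrow> 'b set) \<Rightarrow> int \<Rightarrow> 'b set set" where
  "trivial_grading B GB = quot_grading (regular B) (positive_part B GB) GB"

definition koszul :: "('k::field, 'b, 's) module_scheme \<Rightarrow> (int \<Rightarrow> 'b set) \<Rightarrow> bool" where
  "koszul B GB \<longleftrightarrow> connected_graded_algebra B GB \<and>
     (\<exists>(P :: nat \<Rightarrow> ('b, ('b, 'b set) res) module) GP d e.
        graded_projective_resolution B GB (trivial_module B GB) (trivial_grading B GB) P GP d e \<and>
        (\<forall>i. generates B (P i) (GP i (int i))))"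

definition AS_regular ::
  "'m itself \<Rightarrow> ('k::field, 'b, 's) module_scheme \<Rightarrow> (int \<Rightarrow> 'b set) \<Rightarrow> nat \<Rightarrow> bool" where
  "AS_regular T B GB \<delta> \<longleftrightarrow> connected_graded_algebra B GB \<and> global_dim T B = enat \<delta> \<and>
     (\<forall>i. i \<noteq> \<delta> \<longrightarrow> Ext_zero B GB (trivial_module B GB) (trivial_grading B GB) i) \<and>
     (\<exists>l. Ext_iso B GB (trivial_module B GB) (trivial_grading B GB) \<delta>
        (trivial_module (opp B) GB) (shift (trivial_grading (opp B) GB) l))"


section \<open>Monoid algebras, tensor products and the enveloping algebra\<close>

definition scale :: "'k::field \<Rightarrow> ('w \<Rightarrow>\<^sub>0 'k) \<Rightarrow> ('w \<Rightarrow>\<^sub>0 'k)" where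
  "scale c u = Poly_Mapping.map ((*) c) u"

definition monoid_algebra :: "('w, 'z) monoid_scheme \<Rightarrow> ('k::field, 'w \<Rightarrow>\<^sub>0 'k) module" where
  "monoid_algebra W =
     \<lparr>carrier = {u. Poly_Mapping.keys u \<subseteq> carrier W},
      mult = (\<lambda>u v. \<Sum>a\<in>Poly_Mapping.keys u. \<Sum>b\<in>Poly_Mapping.keys v.
        Poly_Mapping.single (a \<otimes>\<^bsub>W\<^esub> b) (Poly_Mapping.lookup u a * Poly_Mapping.lookup v b)),
      one = Poly_Mapping.single \<one>\<^bsub>W\<^esub> 1,
      zero = 0, add = (+), smult = scale\<rparr>"

text \<open>
  The tensor product \<open>A \<otimes> C\<close> over the field is the monoid algebra of the multiplicative monoid
  \<open>A \<times> C\<close> modulo bilinearity: the linear span of the relators is already a two-sided ideal, since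
  multiplying a relator by a basis element gives a relator.  The pure tensor of \<open>a\<close> and \<open>c\<close> is the
  class of \<open>Poly_Mapping.single (a, c) 1\<close>.
\<close>

definition tensor_relators ::
  "('k::field, 'a, 's) module_scheme \<Rightarrow> ('k, 'c, 't) module_scheme \<Rightarrow> ('a \<times> 'c \<Rightarrow>\<^sub>0 'k) set" where
  "tensor_relators A C =
     (let s = (\<lambda>a c. Poly_Mapping.single (a, c) (1::'k)) in
       {s (a \<oplus>\<^bsub>A\<^esub> a') c - s a c - s a' c | a a' c. a \<in> carrier A \<and> a' \<in> carrier A \<and> c \<in> carrier C} \<union>
       {s a (c \<oplus>\<^bsub>C\<^esub> c') - s a c - s a c' | a c c'. a \<in> carrier A \<and> c \<in> carrier C \<and> c' \<in> carrier C} \<union>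
       {s (z \<odot>\<^bsub>A\<^esub> a) c - scale z (s a c) | z a c. a \<in> carrier A \<and> c \<in> carrier C} \<union>
       {s a (z \<odot>\<^bsub>C\<^esub> c) - scale z (s a c) | z a c. a \<in> carrier A \<and> c \<in> carrier C})"

definition tensor_ideal ::
  "('k::field, 'a, 's) module_scheme \<Rightarrow> ('k, 'c, 't) module_scheme \<Rightarrow> ('a \<times> 'c \<Rightarrow>\<^sub>0 'k) set" where
  "tensor_ideal A C = genideal (monoid_algebra (A \<times>\<times> C)) (tensor_relators A C)"

definition tensor ::
  "('k::field, 'a, 's) module_scheme \<Rightarrow> ('k, 'c, 't) module_scheme \<Rightarrow>
   ('k, ('a \<times> 'c \<Rightarrow>\<^sub>0 'k) set) module" where
  "tensor A C = quot (monoid_algebra (A \<times>\<times> C)) (tensor_ideal A C)"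

definition tensor_grading ::
  "('k::field, 'a, 's) module_scheme \<Rightarrow> (int \<Rightarrow> 'a set) \<Rightarrow> ('k, 'c, 't) module_scheme \<Rightarrow> (int \<Rightarrow> 'c set) \<Rightarrow>
   int \<Rightarrow> ('a \<times> 'c \<Rightarrow>\<^sub>0 'k) set set" where
  "tensor_grading A GA C GC =
     quot_grading (monoid_algebra (A \<times>\<times> C) :: ('k, 'a \<times> 'c \<Rightarrow>\<^sub>0 'k) module) (tensor_ideal A C)
       (\<lambda>n. {u. \<forall>(a, c)\<in>Poly_Mapping.keys u. \<exists>i j. i + j = n \<and> a \<in> GA i \<and> c \<in> GC j})"

type_synonym ('k, 'b) env = "('b \<times> 'b \<Rightarrow>\<^sub>0 'k) set"

definition enveloping :: "('k::field, 'b, 's) module_scheme \<Rightarrow> ('k, ('k, 'b) env) module" where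
  "enveloping B = tensor B (opp B)"

definition enveloping_grading ::
  "('k::field, 'b, 's) module_scheme \<Rightarrow> (int \<Rightarrow> 'b set) \<Rightarrow> int \<Rightarrow> ('k, 'b) env set" where
  "enveloping_grading B GB = tensor_grading B GB (opp B) GB"

text \<open>The value at a class in \<open>B \<otimes> B\<^sup>o\<^sup>p\<close> of the linear map \<open>B \<otimes> B\<^sup>o\<^sup>p \<rightarrow> B\<close> with
  \<open>u \<otimes> v \<mapsto> h (u, v)\<close>, for bilinear \<open>h\<close>.\<close>

definition tensor_lift ::
  "('k::field, 'b, 's) module_scheme \<Rightarrow> ('b \<times> 'b \<Rightarrow> 'b) \<Rightarrow> ('k, 'b) env \<Rightarrow> 'b" where
  "tensor_lift B h X =
     the_elem ((\<lambda>z. \<Oplus>\<^bsub>B\<^esub>w\<in>Poly_Mapping.keys z. Poly_Mapping.lookup z w \<odot>\<^bsub>B\<^esub> h w) ` X)"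

text \<open>\<open>B\<close> as a left module over its enveloping algebra: \<open>(u \<otimes> v) m = u m v\<close>.\<close>

definition bimodule :: "('k::field, 'b, 's) module_scheme \<Rightarrow> (('k, 'b) env, 'b) module" where
  "bimodule B = with_smult B (\<lambda>X m. tensor_lift B (\<lambda>(u, v). u \<otimes>\<^bsub>B\<^esub> m \<otimes>\<^bsub>B\<^esub> v) X)"

text \<open>
  \<open>B\<^sup>\<nu>\<close> is the bimodule \<open>B\<close> with \<open>v \<cdot> m \<cdot> u = v m \<nu>(u)\<close>.  It is compared with Ext, a right module
  over \<open>B \<otimes> B\<^sup>o\<^sup>p\<close>, hence is taken as a right module too, with \<open>m (u \<otimes> v) = v \<cdot> m \<cdot> u\<close>.  For
  \<open>B \<otimes> B\<^sup>o\<^sup>p\<close> itself this rule turns right multiplication into the inner bimodule structure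
  \<open>v \<cdot> (a \<otimes> b) \<cdot> u = a u \<otimes> v b\<close>.
\<close>

definition twisted_bimodule ::
  "('k::field, 'b, 's) module_scheme \<Rightarrow> ('b \<Rightarrow> 'b) \<Rightarrow> (('k, 'b) env, 'b) module" where
  "twisted_bimodule B \<nu> = with_smult B (\<lambda>X m. tensor_lift B (\<lambda>(u, v). v \<otimes>\<^bsub>B\<^esub> m \<otimes>\<^bsub>B\<^esub> \<nu> u) X)"

definition algebra_automorphism :: "('k::field, 'b, 's) module_scheme \<Rightarrow> ('b \<Rightarrow> 'b) \<Rightarrow> bool" where
  "algebra_automorphism B \<nu> \<longleftrightarrow> \<nu> \<in> ring_hom B B \<and> bij_betw \<nu> (carrier B) (carrier B) \<and>
     (\<forall>c. \<forall>x\<in>carrier B. \<nu> (c \<odot>\<^bsub>B\<^esub> x) = c \<odot>\<^bsub>B\<^esub> \<nu> x)"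

definition graded_skew_CY ::
  "('k::field, 'b, 's) module_scheme \<Rightarrow> (int \<Rightarrow> 'b set) \<Rightarrow> nat \<Rightarrow> bool" where
  "graded_skew_CY B GB \<delta> \<longleftrightarrow> graded_algebra B GB \<and>
     (\<exists>(P :: nat \<Rightarrow> (('k, 'b) env, (('k, 'b) env, 'b) res) module) d e n.
        projective_resolution (enveloping B) (bimodule B) P d e \<and> length_at_most P n \<and>
        (\<forall>i. finitely_generated (enveloping B) (P i))) \<and>
     (\<exists>\<nu> l. algebra_automorphism B \<nu> \<and>
        (\<forall>i. i \<noteq> \<delta> \<longrightarrow> Ext_zero (enveloping B) (enveloping_grading B GB) (bimodule B) GB i) \<and>
        Ext_iso (enveloping B) (enveloping_grading B GB) (bimodule B) GB \<delta>
          (twisted_bimodule B \<nu>) (shift GB l))"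


section \<open>The algebras \<open>H\<^sub>q(f, g)\<close>\<close>

datatype gen = X | Y | T

definition free_algebra :: "('k::field, gen list \<Rightarrow>\<^sub>0 'k) module" where
  "free_algebra = monoid_algebra \<lparr>carrier = UNIV, mult = (@), one = []\<rparr>"

definition var :: "gen \<Rightarrow> gen list \<Rightarrow>\<^sub>0 'k::field" where
  "var a = Poly_Mapping.single [a] 1"

definition poly_at :: "('k::field, 'b, 's) module_scheme \<Rightarrow> 'k poly \<Rightarrow> 'b \<Rightarrow> 'b" where
  "poly_at B f b = (\<Oplus>\<^bsub>B\<^esub>n\<in>{..degree f}. coeff f n \<odot>\<^bsub>B\<^esub> (b [^]\<^bsub>B\<^esub> n))"

definition H_ideal :: "'k::field \<Rightarrow> 'k poly \<Rightarrow> 'k poly \<Rightarrow> (gen list \<Rightarrow>\<^sub>0 'k) set" where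
  "H_ideal q f g =
     (let F = free_algebra; x = var X; y = var Y; t = var T in
       genideal F
        {t \<otimes>\<^bsub>F\<^esub> x \<ominus>\<^bsub>F\<^esub> x \<otimes>\<^bsub>F\<^esub> poly_at F f t,
         y \<otimes>\<^bsub>F\<^esub> t \<ominus>\<^bsub>F\<^esub> poly_at F f t \<otimes>\<^bsub>F\<^esub> y,
         (y \<otimes>\<^bsub>F\<^esub> x \<ominus>\<^bsub>F\<^esub> q \<odot>\<^bsub>F\<^esub> (x \<otimes>\<^bsub>F\<^esub> y)) \<ominus>\<^bsub>F\<^esub> poly_at F g t})"

definition H_algebra ::
  "'k::field \<Rightarrow> 'k poly \<Rightarrow> 'k poly \<Rightarrow> ('k, (gen list \<Rightarrow>\<^sub>0 'k) set) module" where
  "H_algebra q f g = quot free_algebra (H_ideal q f g)"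

text \<open>All generators have degree 1.\<close>

definition H_grading ::
  "'k::field \<Rightarrow> 'k poly \<Rightarrow> 'k poly \<Rightarrow> int \<Rightarrow> (gen list \<Rightarrow>\<^sub>0 'k) set set" where
  "H_grading q f g =
     quot_grading (free_algebra :: ('k, gen list \<Rightarrow>\<^sub>0 'k) module) (H_ideal q f g)
       (\<lambda>n. {u. \<forall>w\<in>Poly_Mapping.keys u. int (length w) = n})"

end

theory Submission imports Defs begin

text \<open>
  The monomials \<open>x\<^sup>i t\<^sup>j y\<^sup>k\<close> form a basis of \<open>H\<close>.  Hence right multiplication by \<open>t\<close>, then by \<open>y\<close> on
  the monomials without \<open>t\<close>, then by \<open>x\<close> on the powers of \<open>x\<close>, is a weighted shift, and
  \<open>\<rho>(u) \<otimes> w - k u \<otimes> \<lambda>(w)\<close> is injective with known cokernel for each such shift \<open>\<rho>\<close> and every linear \<open>\<lambda>\<close>.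
  This makes the complex with ranks 1, 3, 3, 1 on generators, relations and the overlap \<open>ytx\<close> exact whenever
  \<open>H\<close> acts from the right on the first factor and from the left on the second; left multiplication is
  symmetric under \<open>x \<leftrightarrow> y\<close>.  The second factor \<open>k\<close> gives the Koszul resolution of the trivial module, a module
  \<open>M\<close> gives a resolution of \<open>M\<close> of length 3, and \<open>H\<^sup>o\<^sup>p\<close> gives the resolution of \<open>H\<close> over \<open>H \<otimes> H\<^sup>o\<^sup>p\<close>.
  The dual complex is, up to invertible rescaling, the same complex for the left multiplications, which
  yields the Ext groups and the Nakayama automorphism.
  The entries of the differentials have degree 1, so the Koszul resolution is minimal and no shorter one exists.
\<close>

text \<open>The exactness proof never sees an algebra, only operators on coordinate vectors and the
  relations between them, so the second factor can be anything on which the generators act. Its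
  engine is division with remainder: a vector is divided by the t-step, the remainder by the y-step,
  that remainder by the x-step. Since yt = p ty, moving one step past another changes the scalars;
  this is why k has to be arbitrary although the first differential uses only k = 1. The relations
  make it easy to see that the monomials span; independence is the obstacle. It comes from an
  explicit action of the free algebra on the space with this basis: the relations hold there, so the
  action descends to the quotient, and acting on the monomial 1 returns the coordinates. The
  constant p q of the duality is produced by the overlap: resolving ytx in two ways gives a syzygy
  in which the two sides of x, and those of y, carry the coefficients p q and 1 up to sign. These
  entries of the last matrix become the cokernel relations of the dual complex, so they dictate the
  Nakayama automorphism.\<close>

lemma lookup_scale [simp]: "Poly_Mapping.lookup (scale c u) i = c * Poly_Mapping.lookup u i"
  by (simp add: scale_def Poly_Mapping.map.rep_eq when_def)

global_interpretation sc: vector_space "scale :: 'k::field \<Rightarrow> ('w \<Rightarrow>\<^sub>0 'k) \<Rightarrow> ('w \<Rightarrow>\<^sub>0 'k)"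
  by unfold_locales (auto intro!: poly_mapping_eqI simp: lookup_add algebra_simps)

abbreviation lk :: "('w \<Rightarrow>\<^sub>0 'k::zero) \<Rightarrow> 'w \<Rightarrow> 'k" where "lk \<equiv> Poly_Mapping.lookup"
abbreviation keys :: "('w \<Rightarrow>\<^sub>0 'k::zero) \<Rightarrow> 'w set" where "keys \<equiv> Poly_Mapping.keys"
abbreviation sg :: "'w \<Rightarrow> 'k::zero \<Rightarrow> ('w \<Rightarrow>\<^sub>0 'k)" where "sg \<equiv> Poly_Mapping.single"
abbreviation bas :: "'w \<Rightarrow> ('w \<Rightarrow>\<^sub>0 'k::zero_neq_one)" where "bas i \<equiv> Poly_Mapping.single i 1"

lemma lk_sum [simp]: "lk (sum f A) i = (\<Sum>a\<in>A. lk (f a) i)"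
  by (induction A rule: infinite_finite_induct) (auto simp: lookup_add)

lemma scale_sg [simp]: "scale c (sg i d) = sg i (c * d)"
  by (rule poly_mapping_eqI) (simp add: lookup_single when_def)

lemma keys_scale: "keys (scale c u) \<subseteq> keys u"
  by (auto simp: in_keys_iff)

lemma keys_diff: "keys (u - v :: 'w \<Rightarrow>\<^sub>0 'k::ab_group_add) \<subseteq> keys u \<union> keys v"
  by (auto simp: in_keys_iff lookup_minus)

lemma keys_sum_subset: "keys (sum f A :: 'w \<Rightarrow>\<^sub>0 'k::ab_group_add) \<subseteq> (\<Union>a\<in>A. keys (f a))"
proof
  fix i assume "i \<in> keys (sum f A)"
  hence "(\<Sum>a\<in>A. lk (f a) i) \<noteq> 0" by (simp add: in_keys_iff)
  then obtain a where "a \<in> A" "lk (f a) i \<noteq> 0" by (meson sum.neutral)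
  thus "i \<in> (\<Union>a\<in>A. keys (f a))" by (auto simp: in_keys_iff)
qed

section \<open>Linear maps between spaces of finitely supported functions\<close>

definition klin :: "(('i \<Rightarrow>\<^sub>0 'k::field) \<Rightarrow> ('j \<Rightarrow>\<^sub>0 'k)) \<Rightarrow> bool" where
  "klin F \<longleftrightarrow> (\<forall>u v. F (u + v) = F u + F v) \<and> (\<forall>c u. F (scale c u) = scale c (F u))"

lemma klinI:
  "(\<And>u v. F (u + v) = F u + F v) \<Longrightarrow> (\<And>c u. F (scale c u) = scale c (F u)) \<Longrightarrow> klin F"
  by (auto simp: klin_def)

lemma klin_add: "klin F \<Longrightarrow> F (u + v) = F u + F v"
  and klin_scale: "klin F \<Longrightarrow> F (scale c u) = scale c (F u)"
  by (auto simp: klin_def)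

lemma klin_zero: "klin F \<Longrightarrow> F 0 = 0"
  using klin_scale[of F 0 0] by simp

lemma klin_minus: "klin F \<Longrightarrow> F (- u) = - F u"
  using klin_scale[of F "- 1" u] by simp

lemma klin_diff: "klin F \<Longrightarrow> F (u - v) = F u - F v"
  using klin_add[of F u "- v"] by (simp add: klin_minus)

lemma klin_sum: "klin F \<Longrightarrow> F (sum f A) = (\<Sum>a\<in>A. F (f a))"
  by (induction A rule: infinite_finite_induct) (auto simp: klin_zero klin_add)

lemmas klin_simps = klin_add klin_scale klin_zero klin_minus klin_diff klin_sum

lemma klin_compose: "klin F \<Longrightarrow> klin G \<Longrightarrow> klin (\<lambda>u. F (G u))"
  by (simp add: klin_def)

lemma klin_id: "klin (\<lambda>u. u)" by (simp add: klin_def)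

lemma klin_zero_fun: "klin (\<lambda>u. 0)" by (simp add: klin_def)

lemma klin_plus: "klin F \<Longrightarrow> klin G \<Longrightarrow> klin (\<lambda>u. F u + G u)"
  by (simp add: klin_def sc.scale_right_distrib)

lemma klin_sub: "klin F \<Longrightarrow> klin G \<Longrightarrow> klin (\<lambda>u. F u - G u)"
  by (simp add: klin_def sc.scale_right_diff_distrib)

lemma klin_smult: "klin F \<Longrightarrow> klin (\<lambda>u. scale c (F u))"
  by (simp add: klin_def sc.scale_right_distrib mult.commute)

text \<open>The linear map with prescribed values on the basis vectors. Most maps below are given in
  this form, so that two of them are compared on basis vectors by \<open>klin_eqI\<close>.\<close>

definition lext :: "('i \<Rightarrow> ('j \<Rightarrow>\<^sub>0 'k::field)) \<Rightarrow> ('i \<Rightarrow>\<^sub>0 'k) \<Rightarrow> ('j \<Rightarrow>\<^sub>0 'k)" where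
  "lext f u = (\<Sum>i\<in>keys u. scale (lk u i) (f i))"

lemma lext_superset: "finite A \<Longrightarrow> keys u \<subseteq> A \<Longrightarrow> lext f u = (\<Sum>i\<in>A. scale (lk u i) (f i))"
  unfolding lext_def by (rule sum.mono_neutral_left) (auto simp: in_keys_iff)

lemma klin_lext: "klin (lext f)"
proof (rule klinI)
  fix u v :: "'a \<Rightarrow>\<^sub>0 'b"
  let ?A = "keys u \<union> keys v"
  have "lext f (u + v) = (\<Sum>i\<in>?A. scale (lk (u + v) i) (f i))"
    by (rule lext_superset) (auto simp: Poly_Mapping.keys_add)
  also have "\<dots> = (\<Sum>i\<in>?A. scale (lk u i) (f i)) + (\<Sum>i\<in>?A. scale (lk v i) (f i))"
    by (simp add: lookup_add sc.scale_left_distrib sum.distrib)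
  also have "\<dots> = lext f u + lext f v" by (simp add: lext_superset[of ?A])
  finally show "lext f (u + v) = lext f u + lext f v" .
next
  fix c :: 'b and u :: "'a \<Rightarrow>\<^sub>0 'b"
  have "lext f (scale c u) = (\<Sum>i\<in>keys u. scale (lk (scale c u) i) (f i))"
    by (rule lext_superset) (auto simp: keys_scale)
  thus "lext f (scale c u) = scale c (lext f u)"
    by (simp add: lext_def sc.scale_sum_right)
qed

lemmas lext_simps = klin_simps[OF klin_lext]

lemma lext_single [simp]: "lext f (sg i c) = scale c (f i)"
  by (simp add: lext_superset[of "{i}"])

lemma lext_cong: "(\<And>i. i \<in> keys u \<Longrightarrow> f i = g i) \<Longrightarrow> lext f u = lext g u"
  by (simp add: lext_def)

lemma klin_lext_out: "klin F \<Longrightarrow> F (lext f u) = lext (\<lambda>i. F (f i)) u"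
  by (simp add: lext_def klin_simps)

lemma lext_bas [simp]: "lext bas u = u"
  by (rule poly_mapping_eqI) (auto simp: lext_def lookup_single when_def in_keys_iff)

lemma klin_expand: "klin F \<Longrightarrow> F u = lext (\<lambda>i. F (bas i)) u"
  using klin_lext_out[of F bas u] by simp

lemma klin_eqI: "klin F \<Longrightarrow> klin G \<Longrightarrow> (\<And>i. F (bas i) = G (bas i)) \<Longrightarrow> F u = G u"
  using klin_expand[of F u] klin_expand[of G u] by simp

text \<open>Agreement is required only on the support of \<open>u\<close>: a monoid algebra consists
  of the vectors supported in the carrier of the monoid, and its rules hold only there.\<close>

lemma klin_eq_onI:
  "klin F \<Longrightarrow> klin G \<Longrightarrow> (\<And>i. i \<in> keys u \<Longrightarrow> F (bas i) = G (bas i)) \<Longrightarrow> F u = G u"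
  using klin_expand[of F u] klin_expand[of G u] by (metis (no_types, lifting) lext_cong)

lemma lext_add_fun: "lext (\<lambda>i. f i + g i) u = lext f u + lext g u"
  by (simp add: lext_def sc.scale_right_distrib sum.distrib)

lemma lext_scale_fun: "lext (\<lambda>i. scale c (f i)) u = scale c (lext f u)"
  by (simp add: lext_def sc.scale_sum_right mult.commute)

lemma lext_zero_fun [simp]: "lext (\<lambda>i. 0) u = 0"
  by (simp add: lext_def)

lemma klin_lext_fun: "(\<And>i. klin (\<lambda>v. F i v)) \<Longrightarrow> klin (\<lambda>v. lext (\<lambda>i. F i v) u)"
  by (auto simp: klin_def lext_add_fun lext_scale_fun)

lemma keys_lext: "keys (lext f u) \<subseteq> (\<Union>i\<in>keys u. keys (f i))"
  unfolding lext_def using keys_sum_subset keys_scale by fastforce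

lemma klin_keys: "klin F \<Longrightarrow> keys (F u) \<subseteq> (\<Union>i\<in>keys u. keys (F (bas i)))"
  using keys_lext[of "\<lambda>i. F (bas i)" u] by (simp add: klin_expand[symmetric])

lemma lk_lext: "lk (lext f u) j = (\<Sum>i\<in>keys u. lk u i * lk (f i) j)"
  by (simp add: lext_def)

section \<open>Tensors\<close>

text \<open>Coordinates of a pure tensor: pairs of basis indices form the basis of the tensor
  product.\<close>

definition tens :: "('i \<Rightarrow>\<^sub>0 'k::field) \<Rightarrow> ('j \<Rightarrow>\<^sub>0 'k) \<Rightarrow> ('i \<times> 'j \<Rightarrow>\<^sub>0 'k)" where
  "tens u v = lext (\<lambda>i. lext (\<lambda>j. bas (i, j)) v) u"

lemma klin_tens1: "klin (\<lambda>u. tens u v)"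
  unfolding tens_def by (rule klin_lext)

lemma klin_tens2: "klin (\<lambda>v. tens u v)"
  unfolding tens_def by (intro klin_lext_fun klin_lext)

lemmas tens_simps = klin_simps[OF klin_tens1] klin_simps[OF klin_tens2]

lemma tens_sg [simp]: "tens (sg i c) (sg j d) = sg (i, j) (c * d)"
  by (simp add: tens_def)

lemma lk_tens: "lk (tens u v) (i, j) = lk u i * lk v j"
proof -
  have "lk (lext (\<lambda>j. bas (i', j)) v) (i, j) = (if i' = i then lk v j else 0)" for i'
  proof -
    have "lk (lext (\<lambda>j. bas (i', j)) v) (i, j)
        = (\<Sum>j'\<in>keys v. if j' = j then (if i' = i then lk v j else 0) else 0)"
      unfolding lk_lext by (intro sum.cong refl) (auto simp: lookup_single when_def)
    thus ?thesis by (auto simp: in_keys_iff)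
  qed
  hence "lk (tens u v) (i, j) = (\<Sum>i'\<in>keys u. if i' = i then lk u i * lk v j else 0)"
    unfolding tens_def lk_lext by (intro sum.cong refl) auto
  thus ?thesis by (auto simp: in_keys_iff)
qed

lemma keys_tens: "keys (tens u v) = keys u \<times> keys v"
  by (auto simp: in_keys_iff lk_tens)

lemma tens_eqI:
  assumes "klin F" "klin G" "\<And>i j. F (tens (bas i) (bas j)) = G (tens (bas i) (bas j))"
  shows "F u = G u"
  using assms(1,2) by (rule klin_eqI) (use assms(3) in auto)

text \<open>These are \<open>F \<otimes> id\<close> and, in \<open>op2\<close>,
  \<open>id \<otimes> F\<close>. Only the values of \<open>F\<close> on basis vectors enter, so
  linearity of \<open>F\<close> appears as an assumption wherever \<open>F\<close> meets a general
  vector.\<close>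

definition op1 :: "(('i \<Rightarrow>\<^sub>0 'k::field) \<Rightarrow> ('i' \<Rightarrow>\<^sub>0 'k)) \<Rightarrow> ('i \<times> 'j \<Rightarrow>\<^sub>0 'k) \<Rightarrow> ('i' \<times> 'j \<Rightarrow>\<^sub>0 'k)" where
  "op1 F = lext (\<lambda>(i, j). tens (F (bas i)) (bas j))"

definition op2 :: "(('j \<Rightarrow>\<^sub>0 'k::field) \<Rightarrow> ('j' \<Rightarrow>\<^sub>0 'k)) \<Rightarrow> ('i \<times> 'j \<Rightarrow>\<^sub>0 'k) \<Rightarrow> ('i \<times> 'j' \<Rightarrow>\<^sub>0 'k)" where
  "op2 F = lext (\<lambda>(i, j). tens (bas i) (F (bas j)))"

lemma klin_op1: "klin (op1 F)" and klin_op2: "klin (op2 F)"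
  unfolding op1_def op2_def by (rule klin_lext)+

lemmas op_simps = klin_simps[OF klin_op1] klin_simps[OF klin_op2]

lemma op1_bas [simp]: "op1 F (sg (i, j) c) = scale c (tens (F (bas i)) (bas j))"
  and op2_bas [simp]: "op2 G (sg (i, j) c) = scale c (tens (bas i) (G (bas j)))"
  by (simp_all add: op1_def op2_def)

lemma op1_tens: assumes "klin F" shows "op1 F (tens u v) = tens (F u) v"
proof (rule klin_eqI[of "\<lambda>v. op1 F (tens u v)" "\<lambda>v. tens (F u) v"])
  fix j
  show "op1 F (tens u (bas j)) = tens (F u) (bas j)"
  proof (rule klin_eqI[of "\<lambda>u. op1 F (tens u (bas j))" "\<lambda>u. tens (F u) (bas j)"])
    show "klin (\<lambda>u. op1 F (tens u (bas j)))" by (rule klin_compose[OF klin_op1 klin_tens1])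
    show "klin (\<lambda>u. tens (F u) (bas j))" by (rule klin_compose[OF klin_tens1 assms])
  qed simp
qed (rule klin_compose[OF klin_op1 klin_tens2], rule klin_tens2)

lemma op2_tens: assumes "klin F" shows "op2 F (tens u v) = tens u (F v)"
proof (rule klin_eqI[of "\<lambda>u. op2 F (tens u v)" "\<lambda>u. tens u (F v)"])
  fix i
  show "op2 F (tens (bas i) v) = tens (bas i) (F v)"
  proof (rule klin_eqI[of "\<lambda>v. op2 F (tens (bas i) v)" "\<lambda>v. tens (bas i) (F v)"])
    show "klin (\<lambda>v. op2 F (tens (bas i) v))" by (rule klin_compose[OF klin_op2 klin_tens2])
    show "klin (\<lambda>v. tens (bas i) (F v))" by (rule klin_compose[OF klin_tens2 assms])
  qed simp
qed (rule klin_compose[OF klin_op2 klin_tens1], rule klin_tens1)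

text \<open>The source of all commutation rules in \<open>koszul_ops\<close>: operators on different
  factors commute, whatever the second one is.\<close>

lemma op1_op2_commute: assumes "klin F" "klin G" shows "op1 F (op2 G u) = op2 G (op1 F u)"
proof (rule tens_eqI[of "\<lambda>u. op1 F (op2 G u)" "\<lambda>u. op2 G (op1 F u)"])
  show "klin (\<lambda>u. op1 F (op2 G u))" by (rule klin_compose[OF klin_op1 klin_op2])
  show "klin (\<lambda>u. op2 G (op1 F u))" by (rule klin_compose[OF klin_op2 klin_op1])
qed (simp only: op1_tens[OF assms(1)] op2_tens[OF assms(2)])

lemma op1_op1: assumes "klin F" "klin G" shows "op1 F (op1 G u) = op1 (\<lambda>v. F (G v)) u"
proof (rule tens_eqI[of "\<lambda>u. op1 F (op1 G u)" "op1 (\<lambda>v. F (G v))"])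
  show "klin (\<lambda>u. op1 F (op1 G u))" by (rule klin_compose[OF klin_op1 klin_op1])
qed (simp_all only: klin_op1 op1_tens[OF assms(1)] op1_tens[OF assms(2)] op1_tens[OF klin_compose[OF assms]])

lemma op2_op2: assumes "klin F" "klin G" shows "op2 F (op2 G u) = op2 (\<lambda>v. F (G v)) u"
proof (rule tens_eqI[of "\<lambda>u. op2 F (op2 G u)" "op2 (\<lambda>v. F (G v))"])
  show "klin (\<lambda>u. op2 F (op2 G u))" by (rule klin_compose[OF klin_op2 klin_op2])
qed (simp_all only: klin_op2 op2_tens[OF assms(1)] op2_tens[OF assms(2)] op2_tens[OF klin_compose[OF assms]])

lemma op1_plus: "op1 (\<lambda>u. F u + G u) u = op1 F u + op1 G u"
  and op1_smult: "op1 (\<lambda>u. scale c (F u)) u = scale c (op1 F u)"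
  unfolding op1_def by (simp_all only: case_prod_unfold klin_add[OF klin_tens1]
      klin_scale[OF klin_tens1] lext_add_fun lext_scale_fun)

lemma op2_plus: "op2 (\<lambda>u. F u + G u) u = op2 F u + op2 G u"
  and op2_smult: "op2 (\<lambda>u. scale c (F u)) u = scale c (op2 F u)"
  unfolding op2_def by (simp_all only: case_prod_unfold klin_add[OF klin_tens2]
      klin_scale[OF klin_tens2] lext_add_fun lext_scale_fun)

lemma op1_id: "op1 (\<lambda>u. u) u = u" and op2_id: "op2 (\<lambda>u. u) u = u"
  by (simp_all add: op1_def op2_def case_prod_unfold)

lemma op2_zero [simp]: "op2 (\<lambda>u. 0) u = 0"
  by (simp add: op2_def klin_zero[OF klin_tens2] case_prod_unfold)

section \<open>The Koszul complex of commuting operators\<close>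

text \<open>Division by \<open>\<rho> - \<mu>\<close> with remainders in \<open>W\<close>,
  uniqueness. From \<open>u = w + \<rho> v\<close> follows
  \<open>\<rho> (u - \<mu> v) = (\<rho> u - \<mu> u) + \<mu> w\<close>, which lies in
  \<open>W\<close>; hence \<open>u = \<mu> v\<close>. As \<open>\<mu>\<close> preserves the
  filtration \<open>U\<close>, this puts \<open>u\<close> one step lower, and the filtration starts
  at 0.\<close>

lemma ore_step_unique:
  fixes \<rho> \<mu> :: "'q::ab_group_add \<Rightarrow> 'q"
  assumes U0: "U 0 \<subseteq> {0}"
    and mono: "\<And>n. U n \<subseteq> U (Suc n)"
    and diff: "\<And>n u v. u \<in> U n \<Longrightarrow> v \<in> U n \<Longrightarrow> u - v \<in> U n"
    and decomp: "\<And>n u. u \<in> U (Suc n) \<Longrightarrow> \<exists>w\<in>W. \<exists>v\<in>U n. u = w + \<rho> v"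
    and W: "\<And>u v. u \<in> W \<Longrightarrow> v \<in> W \<Longrightarrow> u + v \<in> W"
    and \<rho>: "\<And>u v. \<rho> (u - v) = \<rho> u - \<rho> v"
    and \<mu>: "\<And>u v. \<mu> (u + v) = \<mu> u + \<mu> v"
    and \<mu>U: "\<And>n u. u \<in> U n \<Longrightarrow> \<mu> u \<in> U n" and \<mu>W: "\<And>w. w \<in> W \<Longrightarrow> \<mu> w \<in> W"
    and comm: "\<And>u. \<rho> (\<mu> u) = \<mu> (\<rho> u)"
    and inj: "\<And>n u. u \<in> U n \<Longrightarrow> \<rho> u \<in> W \<Longrightarrow> u = 0"
    and u: "u \<in> U n" "\<rho> u - \<mu> u \<in> W"
  shows "u = 0"
  using u
proof (induction n arbitrary: u)
  case 0
  thus ?case using U0 by auto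
next
  case (Suc n)
  obtain w v where wv: "w \<in> W" "v \<in> U n" "u = w + \<rho> v" using decomp Suc.prems(1) by blast
  have "\<rho> (u - \<mu> v) = (\<rho> u - \<mu> u) + \<mu> w" using wv by (simp add: \<rho> \<mu> comm)
  hence "\<rho> (u - \<mu> v) \<in> W" using W Suc.prems(2) \<mu>W wv by simp
  hence "u - \<mu> v = 0" using inj[of "u - \<mu> v" "Suc n"] diff mono Suc.prems(1) \<mu>U wv by blast
  hence "u \<in> U n" using \<mu>U[OF wv(2)] by simp
  thus ?case using Suc by blast
qed

text \<open>Division by \<open>\<rho> - \<mu>\<close>, existence:
  \<open>u = w + \<rho> v = w + (\<rho> v - \<mu> v) + \<mu> v\<close>, and \<open>\<mu> v\<close>
  lies one step lower in the filtration.\<close>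

lemma ore_step_span:
  fixes \<rho> \<mu> :: "'q::ab_group_add \<Rightarrow> 'q"
  assumes U0: "U 0 \<subseteq> {0}"
    and add: "\<And>n u v. u \<in> U n \<Longrightarrow> v \<in> U n \<Longrightarrow> u + v \<in> U n"
    and sub: "\<And>n. U n \<subseteq> U'" "0 \<in> U'"
    and addU: "\<And>u v. u \<in> U' \<Longrightarrow> v \<in> U' \<Longrightarrow> u + v \<in> U'"
    and decomp: "\<And>n u. u \<in> U (Suc n) \<Longrightarrow> \<exists>w\<in>W. \<exists>v\<in>U n. u = w + \<rho> v"
    and W: "0 \<in> W" "\<And>u v. u \<in> W \<Longrightarrow> v \<in> W \<Longrightarrow> u + v \<in> W"
    and \<rho>: "\<And>u v. \<rho> (u + v) = \<rho> u + \<rho> v"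
    and \<mu>: "\<And>u v. \<mu> (u + v) = \<mu> u + \<mu> v"
    and \<mu>U: "\<And>n u. u \<in> U n \<Longrightarrow> \<mu> u \<in> U n"
    and u: "u \<in> U n"
  shows "\<exists>w\<in>W. \<exists>v\<in>U'. u = w + (\<rho> v - \<mu> v)"
  using u
proof (induction n arbitrary: u)
  case 0
  have "\<rho> 0 = 0" "\<mu> 0 = 0" using \<rho>[of 0 0] \<mu>[of 0 0] by auto
  moreover have "u = 0" using 0 U0 by auto
  ultimately show ?case using W(1) sub by (intro bexI[of _ 0]) auto
next
  case (Suc n)
  obtain w v where wv: "w \<in> W" "v \<in> U n" "u = w + \<rho> v" using decomp Suc.prems(1) by blast
  obtain w' v' where wv': "w' \<in> W" "v' \<in> U'" "\<mu> v = w' + (\<rho> v' - \<mu> v')"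
    using Suc.IH[OF \<mu>U[OF wv(2)]] by blast
  have "u = (w + w') + (\<rho> (v + v') - \<mu> (v + v'))"
    using wv(3) wv'(3) by (simp add: \<rho> \<mu> algebra_simps)
  thus ?case using W(2) addU sub wv wv' by blast
qed

section \<open>Division by weighted shifts\<close>

definition KS :: "'i set \<Rightarrow> ('i \<times> 's \<Rightarrow>\<^sub>0 'k::field) set" where
  "KS A = {u. keys u \<subseteq> A \<times> UNIV}"

lemma KS_iff: "u \<in> KS A \<longleftrightarrow> (\<forall>i s. lk u (i, s) \<noteq> 0 \<longrightarrow> i \<in> A)"
  by (auto simp: KS_def in_keys_iff)

lemma KS_closed:
  "u \<in> KS A \<Longrightarrow> v \<in> KS A \<Longrightarrow> u + v \<in> KS A" "u \<in> KS A \<Longrightarrow> v \<in> KS A \<Longrightarrow> u - v \<in> KS A"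
  "0 \<in> KS A" "u \<in> KS A \<Longrightarrow> scale a u \<in> KS A"
     apply (simp add: KS_iff lookup_add, metis add.right_neutral)
    apply (simp add: KS_iff lookup_minus, metis diff_zero)
  by (auto simp: KS_iff)

lemma KS_mono: "A \<subseteq> B \<Longrightarrow> KS A \<subseteq> KS B" by (auto simp: KS_def)

lemma KS_op2: "u \<in> KS A \<Longrightarrow> op2 l u \<in> KS A"
  unfolding KS_def op2_def using keys_lext by (fastforce simp: keys_tens)

lemma KS_op1:
  assumes "u \<in> KS A" "\<And>i. i \<in> A \<Longrightarrow> keys (r (bas i)) \<subseteq> B"
  shows "op1 r u \<in> KS B"
proof -
  have "keys (op1 r u) \<subseteq> (\<Union>x\<in>keys u. keys (case x of (i, j) \<Rightarrow> tens (r (bas i)) (bas j)))"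
    unfolding op1_def by (rule keys_lext)
  thus ?thesis using assms unfolding KS_def by (fastforce simp: keys_tens)
qed

text \<open>\<open>d\<close> counts how often \<open>r\<close> can be undone: \<open>s\<close>
  raises it by one, and every index of positive \<open>d\<close> is hit exactly once. Hence the
  indices with \<open>d i = 0\<close> span a complement of the image, also after tensoring with any
  second factor.\<close>

locale weighted_shift =
  fixes r :: "('i \<Rightarrow>\<^sub>0 'k::field) \<Rightarrow> ('i \<Rightarrow>\<^sub>0 'k)" and A :: "'i set" and s w and d :: "'i \<Rightarrow> nat"
  assumes shift: "i \<in> A \<Longrightarrow> r (bas i) = sg (s i) (w i)"
    and weight: "i \<in> A \<Longrightarrow> w i \<noteq> 0"
    and inA: "i \<in> A \<Longrightarrow> s i \<in> A"
    and inj: "inj_on s A"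
    and deg: "i \<in> A \<Longrightarrow> d (s i) = Suc (d i)"
    and onto: "i \<in> A \<Longrightarrow> d i > 0 \<Longrightarrow> i \<in> s ` A"
begin

abbreviation "W \<equiv> KS {i\<in>A. d i = 0} :: ('i \<times> 's \<Rightarrow>\<^sub>0 'k) set"

definition U :: "nat \<Rightarrow> ('i \<times> 's \<Rightarrow>\<^sub>0 'k) set" where "U n = KS {i\<in>A. d i < n}"

text \<open>As \<open>s\<close> is injective on \<open>A\<close>, the coefficient at
  \<open>(s i, m)\<close> has \<open>(i, m)\<close> as its only source.\<close>

lemma lk_op1:
  assumes "u \<in> KS A" "i \<in> A"
  shows "lk (op1 r u) (s i, m) = w i * lk u (i, m)"
proof -
  have "lk (op1 r u) (s i, m) = (\<Sum>x\<in>keys u. if x = (i, m) then w i * lk u (i, m) else 0)"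
    unfolding op1_def lk_lext
    using assms inj by (intro sum.cong refl)
      (auto simp: lk_tens lookup_single when_def shift KS_def inj_on_def split: if_splits)
  thus ?thesis by (auto simp: in_keys_iff)
qed

text \<open>\<open>wi\<close> is the part at depth 0; on the rest \<open>r\<close> is inverted by
  undoing \<open>s\<close> and dividing by the weight.\<close>

lemma U_decomp:
  assumes u: "u \<in> U (Suc n)"
  shows "\<exists>w\<in>W. \<exists>v\<in>U n. u = w + op1 r v"
proof -
  define g where "g = inv_into A s"
  define wi where "wi = lext (\<lambda>(i, m). if d i = 0 then bas (i, m) else 0) u"
  define v where "v = lext (\<lambda>(i, m). if d i = 0 then 0 else sg (g i, m) (1 / w (g i))) u"
  have keysu: "i \<in> A \<and> d i < Suc n" if "(i, m) \<in> keys u" for i m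
    using u that by (auto simp: U_def KS_def)
  have g: "g i \<in> A" "s (g i) = i" "d i = Suc (d (g i))" if "i \<in> A" "d i > 0" for i
    using onto[OF that] deg[of "g i"] unfolding g_def by (auto simp: inv_into_into f_inv_into_f)
  have "keys wi \<subseteq> {i\<in>A. d i = 0} \<times> UNIV"
    unfolding wi_def by (rule order_trans[OF keys_lext]) (auto dest: keysu split: if_splits)
  moreover have "keys v \<subseteq> {i\<in>A. d i < n} \<times> UNIV"
    unfolding v_def by (rule order_trans[OF keys_lext])
      (fastforce dest: keysu g split: if_splits)
  moreover have "u = wi + op1 r v"
  proof -
    have "op1 r v = lext (\<lambda>x. op1 r (case x of (i, m) \<Rightarrow> if d i = 0 then 0 else sg (g i, m) (1 / w (g i)))) u"
      unfolding v_def by (rule klin_lext_out[OF klin_op1])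
    hence "wi + op1 r v = lext (\<lambda>x. (case x of (i, m) \<Rightarrow> if d i = 0 then bas (i, m) else 0) +
        op1 r (case x of (i, m) \<Rightarrow> if d i = 0 then 0 else sg (g i, m) (1 / w (g i)))) u"
      unfolding wi_def by (simp add: lext_add_fun)
    also have "\<dots> = lext bas u"
      by (rule lext_cong) (auto dest!: keysu simp: g(1,2) shift weight klin_zero[OF klin_op1])
    finally show ?thesis by simp
  qed
  ultimately show ?thesis unfolding U_def KS_def by blast
qed

text \<open>Finite support bounds the depth. The sum of all depths serves as the bound, which avoids
  a maximum over a possibly empty set.\<close>

lemma U_exhaust: assumes "u \<in> KS A" obtains n where "u \<in> U n"
proof -
  let ?n = "Suc (\<Sum>x\<in>keys u. d (fst x))"
  have "d i < ?n" if "(i, m) \<in> keys u" for i m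
    using member_le_sum[of "(i, m)" "keys u" "d \<circ> fst"] that by auto
  thus ?thesis using assms by (intro that[of ?n]) (auto simp: U_def KS_def)
qed

lemma step_unique:
  assumes u: "u \<in> KS A" "op1 r u - scale k (op2 l u) \<in> W" and kr: "klin r" "klin l"
  shows "u = 0"
proof -
  obtain n where n: "u \<in> U n" using U_exhaust[OF u(1)] by blast
  show ?thesis
  proof (rule ore_step_unique[where U = U and W = W and \<rho> = "op1 r" and \<mu> = "\<lambda>u. scale k (op2 l u)"])
    show "U 0 \<subseteq> {0}" by (auto simp: U_def KS_def)
    show "U n \<subseteq> U (Suc n)" for n unfolding U_def by (rule KS_mono) auto
    \<comment> \<open>All coefficients of \<open>op1 r u\<close> sit at positive depth, so
      membership in \<open>W\<close> makes them vanish; dividing by the nonzero weights gives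
      \<open>u = 0\<close>.\<close>
    show "u = 0" if "u \<in> U n" "op1 r u \<in> W" for n u
    proof (rule poly_mapping_eqI, clarify)
      fix i m
      have uA: "u \<in> KS A" using that(1) KS_mono[of "{i\<in>A. d i < n}" A] unfolding U_def by blast
      show "lk u (i, m) = lk 0 (i, m)"
      proof (cases "i \<in> A")
        case True
        have "lk (op1 r u) (s i, m) = 0"
          using that(2) deg[OF True] unfolding KS_iff by fastforce
        thus ?thesis using lk_op1[OF uA True, of m] weight[OF True] by simp
      qed (use uA in \<open>auto simp: KS_iff\<close>)
    qed
  qed (use n u kr U_decomp in \<open>auto simp: op_simps KS_closed KS_op2 U_def
        op1_op2_commute sc.scale_right_distrib\<close>)
qed

lemma step_span:
  assumes u: "u \<in> KS A"
  shows "\<exists>w\<in>W. \<exists>v\<in>KS A. u = w + (op1 r v - scale k (op2 l v))"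
proof -
  obtain n where n: "u \<in> U n" using U_exhaust[OF u(1)] by blast
  show ?thesis
  proof (rule ore_step_span[where U = U and W = W and \<rho> = "op1 r" and \<mu> = "\<lambda>u. scale k (op2 l u)"])
    show "U 0 \<subseteq> {0}" by (auto simp: U_def KS_def)
    show "U n \<subseteq> KS A" for n unfolding U_def by (rule KS_mono) auto
  qed (use n U_decomp in \<open>auto simp: op_simps KS_closed KS_op2 U_def sc.scale_right_distrib\<close>)
qed

end

text \<open>\<open>rx, ry, rt\<close> are the right multiplications on the first tensor factor, \<open>lx, ly, lt\<close> the left
  multiplications on the second; \<open>W0 \<supseteq> W1 \<supseteq> W2\<close> are complements of the images of \<open>rt - k lt\<close>, of
  \<open>ry - k ly\<close> on \<open>W0\<close>, and of \<open>rx - k lx\<close> on \<open>W1\<close>.\<close>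

locale koszul_ops =
  fixes p q c :: "'k::field" and rx ry rt lx ly lt :: "('i \<Rightarrow>\<^sub>0 'k) \<Rightarrow> ('i \<Rightarrow>\<^sub>0 'k)"
    and W0 W1 W2 :: "('i \<Rightarrow>\<^sub>0 'k) set"
  assumes pq: "p \<noteq> 0" "q \<noteq> 0"
    and lin: "klin rx" "klin ry" "klin rt" "klin lx" "klin ly" "klin lt"
    and rel: "\<And>u. rx (rt u) = scale p (rt (rx u))" "\<And>u. rt (ry u) = scale p (ry (rt u))"
      "\<And>u. rx (ry u) = scale q (ry (rx u)) + scale c (rt (rt u))"
      "\<And>u. lt (lx u) = scale p (lx (lt u))" "\<And>u. ly (lt u) = scale p (lt (ly u))"
      "\<And>u. ly (lx u) = scale q (lx (ly u)) + scale c (lt (lt u))"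
    and comm: "\<And>u. lx (rx u) = rx (lx u)" "\<And>u. lx (ry u) = ry (lx u)" "\<And>u. lx (rt u) = rt (lx u)"
      "\<And>u. ly (rx u) = rx (ly u)" "\<And>u. ly (ry u) = ry (ly u)" "\<And>u. ly (rt u) = rt (ly u)"
      "\<And>u. lt (rx u) = rx (lt u)" "\<And>u. lt (ry u) = ry (lt u)" "\<And>u. lt (rt u) = rt (lt u)"
    and W: "0 \<in> W0" "0 \<in> W1" "0 \<in> W2" "W2 \<subseteq> W1" "W1 \<subseteq> W0"
    and W_diff: "\<And>u v. u \<in> W0 \<Longrightarrow> v \<in> W0 \<Longrightarrow> u - v \<in> W0" "\<And>u v. u \<in> W1 \<Longrightarrow> v \<in> W1 \<Longrightarrow> u - v \<in> W1"
    and W_scale: "\<And>k u. u \<in> W0 \<Longrightarrow> scale k u \<in> W0"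
    and W_ops: "\<And>u. u \<in> W0 \<Longrightarrow> ry u \<in> W0" "\<And>u. u \<in> W0 \<Longrightarrow> ly u \<in> W0"
       "\<And>u. u \<in> W1 \<Longrightarrow> rx u \<in> W1" "\<And>u. u \<in> W1 \<Longrightarrow> lx u \<in> W1"
    and t1: "\<And>k u. rt u - scale k (lt u) \<in> W0 \<Longrightarrow> u = 0"
    and t2: "\<And>k u. \<exists>w\<in>W0. \<exists>v. u = w + (rt v - scale k (lt v))"
    and y1: "\<And>k u. u \<in> W0 \<Longrightarrow> ry u - scale k (ly u) \<in> W1 \<Longrightarrow> u = 0"
    and y2: "\<And>k u. u \<in> W0 \<Longrightarrow> \<exists>w\<in>W1. \<exists>v\<in>W0. u = w + (ry v - scale k (ly v))"
    and x1: "\<And>k u. u \<in> W1 \<Longrightarrow> rx u - scale k (lx u) \<in> W2 \<Longrightarrow> u = 0"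
    and x2: "\<And>k u. u \<in> W1 \<Longrightarrow> \<exists>w\<in>W2. \<exists>v\<in>W1. u = w + (rx v - scale k (lx v))"
begin

lemmas opl = lin[THEN klin_add] lin[THEN klin_diff] lin[THEN klin_scale] lin[THEN klin_minus] lin[THEN klin_zero]

text \<open>Read as rewrite rules, the relations sort every word of operators into the order
  \<open>ry\<close>, \<open>rt\<close>, \<open>rx\<close>, \<open>lx\<close>, \<open>lt\<close>,
  \<open>ly\<close> from outside to inside; identities between the differentials then become
  comparisons of coefficients.\<close>

lemmas norm = opl rel comm sc.scale_right_distrib sc.scale_right_diff_distrib algebra_simps

definition d1 where "d1 a b e = (rx a - lx a) + (ry b - ly b) + (rt e - lt e)"
text \<open>The arguments \<open>u\<close>, \<open>v\<close>, \<open>w\<close> belong to the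
  relations tx - p xt, yt - p ty, yx - q xy - c t^2, and the endings x, y, t of the names to the
  generators. Each occurrence of a generator in a relation contributes what stands to its left as
  right multiplication on the first factor and what stands to its right as left multiplication on
  the second.\<close>

definition d2x where "d2x u w = (rt u - scale p (lt u)) + (ry w - scale q (ly w))"
definition d2y where "d2y v w = (lt v - scale p (rt v)) + (lx w - scale q (rx w))"
definition d2t where "d2t u v w = (lx u - scale p (rx u)) + (ry v - scale p (ly v)) - scale c (rt w + lt w)"
text \<open>For the three relations r1, r2, r3 the free algebra satisfies y r1 - pq r1 y + pq x r2 -
  r2 x - p (t r3 - r3 t) = 0, which compares the two reductions of the overlap ytx. The coefficients
  at r1, r2, r3 are \<open>d3u\<close>, \<open>d3v\<close>, \<open>d3w\<close>.\<close>

definition d3u where "d3u z = ry z - scale (p * q) (ly z)"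
definition d3v where "d3v z = scale (p * q) (rx z) - lx z"
definition d3w where "d3w z = - scale p (rt z - lt z)"

lemma d1_d2: "d1 (d2x u w) (d2y v w) (d2t u v w) = 0"
  by (simp add: d1_def d2x_def d2y_def d2t_def norm)

lemma d2_d3: "d2x (d3u z) (d3w z) = 0" "d2y (d3v z) (d3w z) = 0" "d2t (d3u z) (d3v z) (d3w z) = 0"
  by (simp_all add: d3u_def d3v_def d3w_def d2x_def d2y_def d2t_def norm)

lemma d1_add: "d1 (a + a') (b + b') (e + e') = d1 a b e + d1 a' b' e'"
  and d1_diff: "d1 (a - a') (b - b') (e - e') = d1 a b e - d1 a' b' e'"
  by (simp_all add: d1_def norm)

lemma d2_diff: "d2x (u - u') (w - w') = d2x u w - d2x u' w'" "d2y (v - v') (w - w') = d2y v w - d2y v' w'"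
  "d2t (u - u') (v - v') (w - w') = d2t u v w - d2t u' v' w'"
  by (simp_all add: d2x_def d2y_def d2t_def norm)

text \<open>The t-step and the y-step can be exchanged because yt = p ty, at the price of new
  scalars. Hence the division properties \<open>t1\<close> to \<open>x2\<close> are stated for all
  \<open>k\<close>.\<close>

lemma swap_yt:
  "ry (rt v - scale (k' / p) (lt v)) - scale k (ly (rt v - scale (k' / p) (lt v)))
   = rt (scale (1 / p) (ry v) - scale k (ly v)) - scale k' (lt (scale (1 / p) (ry v) - scale k (ly v)))"
  using pq by (simp add: norm)

text \<open>The two steps form a regular sequence up to the change of scalars. Dividing
  \<open>b\<close> by the t-step leaves a remainder \<open>w\<close> in \<open>W0\<close>; its image
  under the y-step lies in \<open>W0\<close> and is divisible by the t-step, so it is 0, and then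
  \<open>w = 0\<close>.\<close>

lemma regular_yt:
  assumes "ry b - scale k (ly b) = rt e - scale k' (lt e)"
  shows "\<exists>v. b = rt v - scale (k' / p) (lt v) \<and> e = scale (1 / p) (ry v) - scale k (ly v)"
proof -
  obtain w v where wv: "w \<in> W0" "b = w + (rt v - scale (k' / p) (lt v))" using t2 by blast
  define x where "x = rt v - scale (k' / p) (lt v)"
  define e0 where "e0 = scale (1 / p) (ry v) - scale k (ly v)"
  have "ry w - scale k (ly w) = (ry b - scale k (ly b)) - (ry x - scale k (ly x))"
    unfolding wv(2) x_def[symmetric] by (simp add: opl sc.scale_right_distrib)
  also have "\<dots> = (rt e - scale k' (lt e)) - (rt e0 - scale k' (lt e0))"
    unfolding x_def e0_def by (simp only: assms swap_yt)
  also have "\<dots> = rt (e - e0) - scale k' (lt (e - e0))"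
    by (simp add: opl sc.scale_right_diff_distrib)
  finally have eq: "ry w - scale k (ly w) = rt (e - e0) - scale k' (lt (e - e0))" .
  have "ry w - scale k (ly w) \<in> W0" by (intro W_diff W_ops W_scale wv(1))
  hence e: "e - e0 = 0" using t1[of "e - e0" k'] eq by simp
  hence "ry w - scale k (ly w) = 0" using eq by (simp add: opl)
  hence "w = 0" using y1[OF wv(1), of k] W by simp
  thus ?thesis using wv(2) e by (intro exI[of _ v]) (simp add: e0_def)
qed

text \<open>The division that shows that \<open>W2\<close> meets the image of \<open>d1\<close> only
  in 0 also shows that the first component of a cycle is the first component of a boundary; for this
  reason both facts are proved together.\<close>

lemma exact0_unique:
  assumes "m \<in> W2" "d1 a b e = m"
  shows "m = 0 \<and> (\<exists>u w. a = d2x u w)"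
proof -
  \<comment> \<open>The scalars \<open>p\<close> and \<open>q\<close> are those of
    \<open>d2x\<close>: modulo the boundary of \<open>(u, 0, w)\<close> the first component is
    reduced to the remainder \<open>w1\<close>.\<close>
  obtain w0 u where a: "w0 \<in> W0" "a = w0 + (rt u - scale p (lt u))" using t2 by blast
  obtain w1 w where w0: "w1 \<in> W1" "w0 = w1 + (ry w - scale q (ly w))" using y2[OF a(1)] by blast
  have a': "a = w1 + d2x u w" using a w0 by (simp add: d2x_def)
  define b' where "b' = b - d2y 0 w"
  define e' where "e' = e - d2t u 0 w"
  have "d1 w1 b' e' = m"
    using assms(2) d1_diff[of a "d2x u w" b "d2y 0 w" e "d2t u 0 w"] d1_d2[of u w 0]
    by (simp add: a' b'_def e'_def)
  moreover obtain w0' v where b': "w0' \<in> W0" "b' = w0' + (rt v - scale (1 / p) (lt v))" using t2 by blast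
  \<comment> \<open>By \<open>swap_yt\<close> the part of \<open>b'\<close> divisible by the t-step
    contributes a t-step, so it can be moved into the third component.\<close>
  define e'' where "e'' = e' + scale (1 / p) (ry v) - ly v"
  have "d1 w1 b' e' = d1 w1 w0' e''"
    using swap_yt[of v 1 1] unfolding b'(2) d1_def e''_def by (simp add: opl)
  ultimately have eq: "d1 w1 w0' e'' = m" by simp
  have in0: "ry w0' - ly w0' \<in> W0" by (intro W_diff W_ops b'(1))
  have in1: "m - (rx w1 - lx w1) \<in> W1" using assms(1) W by (intro W_diff W_ops w0(1)) blast
  \<comment> \<open>The three summands are now peeled off one at a time: the t-step lands in
    \<open>W0\<close>, then the y-step in \<open>W1\<close>, then the x-step in \<open>W2\<close>,
    so each argument is 0.\<close>
  have "rt e'' - lt e'' = (m - (rx w1 - lx w1)) - (ry w0' - ly w0')"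
    using eq unfolding d1_def by (simp add: algebra_simps)
  hence "rt e'' - scale 1 (lt e'') \<in> W0" using in0 in1 W W_diff by auto
  hence e'': "e'' = 0" by (rule t1)
  have "ry w0' - ly w0' = m - (rx w1 - lx w1)"
    using eq unfolding d1_def e'' by (simp add: opl algebra_simps)
  hence w0': "w0' = 0" using y1[OF b'(1), of 1] in1 by simp
  have *: "rx w1 - lx w1 = m" using eq unfolding d1_def e'' w0' by (simp add: opl)
  hence "w1 = 0" using x1[OF w0(1), of 1] assms by simp
  thus ?thesis using * a' by (auto simp: opl)
qed

lemma exact0_span: "\<exists>m\<in>W2. \<exists>a b e. u = m + d1 a b e"
proof -
  obtain w0 e where 1: "w0 \<in> W0" "u = w0 + (rt e - scale 1 (lt e))" using t2 by blast
  obtain w1 b where 2: "w1 \<in> W1" "w0 = w1 + (ry b - scale 1 (ly b))" using y2[OF 1(1)] by blast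
  obtain m a where 3: "m \<in> W2" "w1 = m + (rx a - scale 1 (lx a))" using x2[OF 2(1)] by blast
  show ?thesis using 1 2 3 by (intro bexI[of _ m] exI) (auto simp: d1_def)
qed

text \<open>After subtracting the boundary found in \<open>exact0_unique\<close> the first component
  is 0, and \<open>regular_yt\<close> treats the other two. The factor -1/p turns the t-step with
  scalar 1/p into \<open>d2y\<close>.\<close>

lemma exact1:
  assumes "d1 a b e = 0"
  shows "\<exists>u v w. a = d2x u w \<and> b = d2y v w \<and> e = d2t u v w"
proof -
  obtain u w where a: "a = d2x u w" using exact0_unique[OF W(3) assms] by blast
  define b' where "b' = b - d2y 0 w"
  define e' where "e' = e - d2t u 0 w"
  have "d1 0 b' e' = 0"
    using assms d1_diff[of a "d2x u w" b "d2y 0 w" e "d2t u 0 w"] d1_d2[of u w 0]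
    by (simp add: a b'_def e'_def)
  hence "ry b' - scale 1 (ly b') = rt (- e') - scale 1 (lt (- e'))"
    by (simp add: d1_def opl eq_neg_iff_add_eq_0 algebra_simps)
  then obtain v where v: "b' = rt v - scale (1 / p) (lt v)" "- e' = scale (1 / p) (ry v) - scale 1 (ly v)"
    using regular_yt by blast
  have "b = d2y (scale (- (1 / p)) v) w"
    using v(1) pq by (simp add: b'_def d2y_def norm)
  moreover have "e = d2t u (scale (- (1 / p)) v) w"
    using arg_cong[OF v(2), of uminus] pq by (simp add: e'_def d2t_def norm)
  ultimately show ?thesis using a by blast
qed

text \<open>The equation for x makes \<open>w\<close> divisible by \<open>regular_yt\<close>, so
  \<open>w = d3w z\<close>. After subtracting the image of \<open>z\<close> the two equations are,
  up to a factor, t-steps applied to single vectors, and these are injective.\<close>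

lemma exact2:
  assumes "d2x u w = 0" "d2y v w = 0"
  shows "\<exists>z. u = d3u z \<and> v = d3v z \<and> w = d3w z"
proof -
  have "ry w - scale q (ly w) = rt (- u) - scale p (lt (- u))"
    using assms(1) by (simp add: d2x_def opl eq_neg_iff_add_eq_0 algebra_simps)
  then obtain z' where z': "w = rt z' - scale (p / p) (lt z')" using regular_yt by blast
  define z where "z = scale (- (1 / p)) z'"
  have w: "w = d3w z" using pq by (simp add: z' z_def d3w_def norm)
  have "d2x (u - d3u z) (w - d3w z) = 0" "d2y (v - d3v z) (w - d3w z) = 0"
    using assms d2_d3 by (simp_all add: d2_diff)
  hence 1: "rt (u - d3u z) - scale p (lt (u - d3u z)) = 0" "lt (v - d3v z) - scale p (rt (v - d3v z)) = 0"
    unfolding w d2x_def d2y_def by (simp_all add: opl)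
  have "rt (v - d3v z) - scale (1 / p) (lt (v - d3v z)) = - scale (1 / p) (lt (v - d3v z) - scale p (rt (v - d3v z)))"
    using pq by (simp add: sc.scale_right_diff_distrib)
  hence "rt (v - d3v z) - scale (1 / p) (lt (v - d3v z)) = 0" using 1 by simp
  hence "u - d3u z = 0" "v - d3v z = 0"
    using 1(1) t1[of "u - d3u z" p] t1[of "v - d3v z" "1 / p"] W(1) by simp_all
  thus ?thesis using w by auto
qed

lemma exact3: "d3w z = 0 \<Longrightarrow> z = 0"
  using t1[of z 1] W(1) pq by (simp add: d3w_def)

end

section \<open>Modules and linear maps\<close>

lemma with_smult_simps [simp]:
  "carrier (with_smult R s) = carrier R" "mult (with_smult R s) = mult R" "one (with_smult R s) = one R"
  "zero (with_smult R s) = zero R" "add (with_smult R s) = add R" "smult (with_smult R s) = s"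
  by (simp_all add: with_smult_def ring.defs module.defs)

lemma regular_simps [simp]:
  "carrier (regular A) = carrier A" "zero (regular A) = zero A" "add (regular A) = add A"
  "smult (regular A) = (\<lambda>a x. a \<otimes>\<^bsub>A\<^esub> x)"
  by (simp_all add: regular_def)

lemma opp_simps [simp]:
  "carrier (opp A) = carrier A" "mult (opp A) x y = y \<otimes>\<^bsub>A\<^esub> x" "one (opp A) = one A"
  "zero (opp A) = zero A" "add (opp A) = add A"
  by (simp_all add: opp_def)

lemma abelian_group_cong:
  assumes "abelian_group M" "carrier N = carrier M" "zero N = zero M" "add N = add M"
  shows "abelian_group N"
proof -
  interpret M: abelian_group M by fact
  show ?thesis
  proof (rule abelian_groupI)
    fix x assume x: "x \<in> carrier N"
    show "\<exists>y\<in>carrier N. y \<oplus>\<^bsub>N\<^esub> x = \<zero>\<^bsub>N\<^esub>"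
      using x assms M.l_neg by (intro bexI[of _ "\<ominus>\<^bsub>M\<^esub> x"]) auto
  qed (use assms in \<open>auto simp: M.a_ac\<close>)
qed

context left_module
begin

lemma idem_zero: "x \<in> carrier M \<Longrightarrow> x \<oplus>\<^bsub>M\<^esub> x = x \<Longrightarrow> x = \<zero>\<^bsub>M\<^esub>"
  by (metis M.r_neg1 M.l_neg)

lemma smult_l_null [simp]: "x \<in> carrier M \<Longrightarrow> \<zero> \<odot>\<^bsub>M\<^esub> x = \<zero>\<^bsub>M\<^esub>"
  by (rule idem_zero) (auto simp: smult_closed simp flip: smult_l_distr)

lemma smult_r_null [simp]: "a \<in> carrier A \<Longrightarrow> a \<odot>\<^bsub>M\<^esub> \<zero>\<^bsub>M\<^esub> = \<zero>\<^bsub>M\<^esub>"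
  by (rule idem_zero) (auto simp: smult_closed simp flip: smult_r_distr)

lemma smult_finsum:
  assumes "a \<in> carrier A" "f \<in> J \<rightarrow> carrier M"
  shows "a \<odot>\<^bsub>M\<^esub> (\<Oplus>\<^bsub>M\<^esub>i\<in>J. f i) = (\<Oplus>\<^bsub>M\<^esub>i\<in>J. a \<odot>\<^bsub>M\<^esub> f i)"
  using assms(2)
  by (induction J rule: infinite_finite_induct)
     (auto simp: assms(1) smult_closed smult_r_distr Pi_iff M.finsum_insert)

end

text \<open>Linearity without the extensionality built into \<open>lin_maps\<close>, so that
  composites and lambda terms are linear as they stand; \<open>linmap_restrict\<close> leads
  back.\<close>

definition linmap ::
  "('a, 'r) ring_scheme \<Rightarrow> ('a, 'm, 's) module_scheme \<Rightarrow> ('a, 'n, 't) module_scheme \<Rightarrow> ('m \<Rightarrow> 'n) \<Rightarrow> bool" where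
  "linmap A M N h \<longleftrightarrow> (\<forall>x\<in>carrier M. h x \<in> carrier N) \<and>
     (\<forall>x\<in>carrier M. \<forall>y\<in>carrier M. h (x \<oplus>\<^bsub>M\<^esub> y) = h x \<oplus>\<^bsub>N\<^esub> h y) \<and>
     (\<forall>a\<in>carrier A. \<forall>x\<in>carrier M. h (a \<odot>\<^bsub>M\<^esub> x) = a \<odot>\<^bsub>N\<^esub> h x)"

lemma lin_maps_iff: "h \<in> lin_maps A M N \<longleftrightarrow> linmap A M N h \<and> h \<in> extensional (carrier M)"
  by (auto simp: lin_maps_def linmap_def PiE_iff)

lemma linmapD:
  assumes "linmap A M N h"
  shows "x \<in> carrier M \<Longrightarrow> h x \<in> carrier N"
    "x \<in> carrier M \<Longrightarrow> y \<in> carrier M \<Longrightarrow> h (x \<oplus>\<^bsub>M\<^esub> y) = h x \<oplus>\<^bsub>N\<^esub> h y"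
    "a \<in> carrier A \<Longrightarrow> x \<in> carrier M \<Longrightarrow> h (a \<odot>\<^bsub>M\<^esub> x) = a \<odot>\<^bsub>N\<^esub> h x"
  using assms by (auto simp: linmap_def)

lemma linmap_compose: "linmap A M N f \<Longrightarrow> linmap A L M g \<Longrightarrow> linmap A L N (\<lambda>x. f (g x))"
  by (simp add: linmap_def)

lemma linmap_restrict: "left_module A M \<Longrightarrow> linmap A M N f \<Longrightarrow> restrict f (carrier M) \<in> lin_maps A M N"
  by (auto simp: lin_maps_iff linmap_def left_module.smult_closed
      abelian_monoid.a_closed abelian_group.axioms(1) left_module.axioms(2))

lemma linmap_zero:
  assumes "left_module A M" "left_module A N" "linmap A M N h"
  shows "h \<zero>\<^bsub>M\<^esub> = \<zero>\<^bsub>N\<^esub>"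
proof -
  interpret M: left_module A M by fact
  interpret N: left_module A N by fact
  show ?thesis
    by (rule N.idem_zero)
      (use linmapD(1)[OF assms(3), of "\<zero>\<^bsub>M\<^esub>"] linmapD(2)[OF assms(3), of "\<zero>\<^bsub>M\<^esub>" "\<zero>\<^bsub>M\<^esub>"] in auto)
qed

lemma linmap_finsum:
  assumes "left_module A M" "left_module A N" "linmap A M N h" "f \<in> J \<rightarrow> carrier M"
  shows "h (\<Oplus>\<^bsub>M\<^esub>i\<in>J. f i) = (\<Oplus>\<^bsub>N\<^esub>i\<in>J. h (f i))"
proof -
  interpret M: left_module A M by fact
  interpret N: left_module A N by fact
  show ?thesis
    using assms(4)
    by (induction J rule: infinite_finite_induct)
      (auto simp: linmap_zero[OF assms(1-3)] linmapD[OF assms(3)] Pi_iff)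
qed

lemma linmap_uminus:
  assumes "left_module A M" "left_module A N" "linmap A M N h" "x \<in> carrier M"
  shows "h (\<ominus>\<^bsub>M\<^esub> x) = \<ominus>\<^bsub>N\<^esub> h x"
proof -
  interpret M: left_module A M by fact
  interpret N: left_module A N by fact
  have "h (\<ominus>\<^bsub>M\<^esub> x) \<oplus>\<^bsub>N\<^esub> h x = h (\<ominus>\<^bsub>M\<^esub> x \<oplus>\<^bsub>M\<^esub> x)"
    using assms(4) linmapD(2)[OF assms(3)] by auto
  also have "\<dots> = \<zero>\<^bsub>N\<^esub>" using assms(4) by (simp add: M.l_neg linmap_zero[OF assms(1-3)])
  finally show ?thesis
    using assms(4) linmapD(1)[OF assms(3)] by (intro N.minus_equality[symmetric]) auto
qed

lemma linmap_minus:
  assumes "left_module A M" "left_module A N" "linmap A M N h" "x \<in> carrier M" "y \<in> carrier M"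
  shows "h (x \<ominus>\<^bsub>M\<^esub> y) = h x \<ominus>\<^bsub>N\<^esub> h y"
proof -
  interpret M: left_module A M by fact
  show ?thesis using assms linmap_uminus[OF assms(1-3)] linmapD[OF assms(3)] by (simp add: a_minus_def)
qed

section \<open>Free modules\<close>

lemma free_simps [simp]:
  "f \<in> carrier (free_module A I) \<longleftrightarrow> (\<forall>i\<in>I. f i \<in> carrier A) \<and> (\<forall>i. i \<notin> I \<longrightarrow> f i = \<zero>\<^bsub>A\<^esub>)
     \<and> finite {i. f i \<noteq> \<zero>\<^bsub>A\<^esub>}"
  "zero (free_module A I) = (\<lambda>i. \<zero>\<^bsub>A\<^esub>)" "add (free_module A I) f g = (\<lambda>i. f i \<oplus>\<^bsub>A\<^esub> g i)"
  "smult (free_module A I) a f = (\<lambda>i. a \<otimes>\<^bsub>A\<^esub> f i)"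
  by (simp_all add: free_module_def)

lemma free_module_eqI:
  "u \<in> carrier (free_module A I) \<Longrightarrow> v \<in> carrier (free_module A I) \<Longrightarrow> (\<And>i. i \<in> I \<Longrightarrow> u i = v i) \<Longrightarrow> u = v"
  by (rule ext) (metis free_simps(1))

context ring
begin

lemma free_in_carrier: "f \<in> carrier (free_module R I) \<Longrightarrow> f i \<in> carrier R"
  by (cases "i \<in> I") auto

lemma free_left_module: "left_module R (free_module R I)"
proof -
  let ?F = "free_module R I"
  have fin2: "finite {i. f i \<oplus> g i \<noteq> \<zero>}" if "finite {i. f i \<noteq> \<zero>}" "finite {i. g i \<noteq> \<zero>}" for f g :: "'c \<Rightarrow> 'a"
    by (rule finite_subset[OF _ finite_UnI[OF that]]) auto
  have fin1: "finite {i. a \<otimes> f i \<noteq> \<zero>}" if "finite {i. f i \<noteq> \<zero>}" "a \<in> carrier R" for f :: "'c \<Rightarrow> 'a" and a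
    by (rule finite_subset[OF _ that(1)]) (use that(2) in auto)
  have "abelian_group ?F"
  proof (rule abelian_groupI)
    fix f assume f: "f \<in> carrier ?F"
    have "finite {i. \<ominus> f i \<noteq> \<zero>}"
      by (rule finite_subset[of _ "{i. f i \<noteq> \<zero>}"]) (use f in auto)
    thus "\<exists>g\<in>carrier ?F. g \<oplus>\<^bsub>?F\<^esub> f = \<zero>\<^bsub>?F\<^esub>"
      using f free_in_carrier[OF f] by (intro bexI[of _ "\<lambda>i. \<ominus> f i"]) (auto simp: l_neg)
  next
    fix x y assume "x \<in> carrier ?F" "y \<in> carrier ?F"
    thus "x \<oplus>\<^bsub>?F\<^esub> y \<in> carrier ?F" by (auto simp: fin2)
  next
    show "\<zero>\<^bsub>?F\<^esub> \<in> carrier ?F" by simp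
  next
    fix x y z assume "x \<in> carrier ?F" "y \<in> carrier ?F" "z \<in> carrier ?F"
    hence "x i \<in> carrier R" "y i \<in> carrier R" "z i \<in> carrier R" for i
      by (simp_all only: free_in_carrier)
    thus "x \<oplus>\<^bsub>?F\<^esub> y \<oplus>\<^bsub>?F\<^esub> z = x \<oplus>\<^bsub>?F\<^esub> (y \<oplus>\<^bsub>?F\<^esub> z)" by (simp add: a_assoc)
  next
    fix x y assume "x \<in> carrier ?F" "y \<in> carrier ?F"
    hence "x i \<in> carrier R" "y i \<in> carrier R" for i by (simp_all only: free_in_carrier)
    thus "x \<oplus>\<^bsub>?F\<^esub> y = y \<oplus>\<^bsub>?F\<^esub> x" by (simp add: a_comm)
  next
    fix x assume "x \<in> carrier ?F"
    hence "x i \<in> carrier R" for i by (simp only: free_in_carrier)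
    thus "\<zero>\<^bsub>?F\<^esub> \<oplus>\<^bsub>?F\<^esub> x = x" by simp
  qed
  thus ?thesis
  proof (intro left_module.intro ring_axioms left_module_axioms.intro)
    show "a \<odot>\<^bsub>?F\<^esub> x \<in> carrier ?F" if "a \<in> carrier R" "x \<in> carrier ?F" for a x
      using that by (auto simp: fin1)
  qed (auto simp: free_in_carrier[of _ I] l_distr r_distr m_assoc)
qed

definition dl :: "'i \<Rightarrow> 'i \<Rightarrow> 'a" where "dl i = (\<lambda>j. if j = i then \<one> else \<zero>)"

lemma dl_in [simp]: "i \<in> I \<Longrightarrow> dl i \<in> carrier (free_module R I)"
  by (auto simp: dl_def)

lemma dl_simps [simp]: "dl i i = \<one>" "j \<noteq> i \<Longrightarrow> dl i j = \<zero>"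
  by (auto simp: dl_def)

lemma linmap_free_expand:
  fixes M :: "('a, 'm, 's) module_scheme"
  assumes N: "left_module R M" and h: "linmap R (free_module R I) M h"
    and u: "u \<in> carrier (free_module R I)" and J: "finite J" "{i. u i \<noteq> \<zero>} \<subseteq> J" "J \<subseteq> I"
  shows "h u = (\<Oplus>\<^bsub>M\<^esub>i\<in>J. u i \<odot>\<^bsub>M\<^esub> h (dl i))"
proof -
  interpret M: left_module R M by fact
  interpret F: left_module R "free_module R I" by (rule free_left_module)
  from J u show ?thesis
  proof (induction J arbitrary: u)
    case empty
    hence "u = \<zero>\<^bsub>free_module R I\<^esub>" by auto
    thus ?case using linmap_zero[OF F.left_module_axioms N h] by simp
  next
    case (insert j J)
    let ?v = "u(j := \<zero>)"
    have hd: "h (dl i) \<in> carrier M" if "i \<in> I" for i by (rule linmapD(1)[OF h dl_in[OF that]])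
    have uc: "u i \<in> carrier R" for i using insert.prems(3) by (rule free_in_carrier)
    have "finite {i. ?v i \<noteq> \<zero>}"
      by (rule finite_subset[of _ "{i. u i \<noteq> \<zero>}"]) (use insert.prems in auto)
    hence v: "?v \<in> carrier (free_module R I)" using insert.prems by auto
    have j: "u j \<odot>\<^bsub>free_module R I\<^esub> dl j \<in> carrier (free_module R I)"
      using insert.prems by (intro F.smult_closed dl_in uc) auto
    have "u = u j \<odot>\<^bsub>free_module R I\<^esub> dl j \<oplus>\<^bsub>free_module R I\<^esub> ?v"
      using uc by (auto simp: dl_def)
    hence "h u = h (u j \<odot>\<^bsub>free_module R I\<^esub> dl j) \<oplus>\<^bsub>M\<^esub> h ?v"
      using linmapD(2)[OF h j v] by simp
    also have "h (u j \<odot>\<^bsub>free_module R I\<^esub> dl j) = u j \<odot>\<^bsub>M\<^esub> h (dl j)"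
      using insert.prems by (intro linmapD(3)[OF h] uc dl_in) auto
    also have "h ?v = (\<Oplus>\<^bsub>M\<^esub>i\<in>J. ?v i \<odot>\<^bsub>M\<^esub> h (dl i))"
      using insert.prems by (intro insert.IH v) auto
    also have "\<dots> = (\<Oplus>\<^bsub>M\<^esub>i\<in>J. u i \<odot>\<^bsub>M\<^esub> h (dl i))"
      using insert.hyps insert.prems
      by (intro M.finsum_cong') (auto intro!: M.smult_closed uc hd)
    finally show ?case
      using insert.hyps insert.prems
      by (subst M.finsum_insert) (auto intro!: M.smult_closed uc hd)
  qed
qed

text \<open>The linear map out of a free module with the values \<open>n i\<close> on the basis, a
  converse to \<open>linmap_free_expand\<close>.\<close>

definition fext :: "('a, 'm, 's) module_scheme \<Rightarrow> ('i \<Rightarrow> 'm) \<Rightarrow> ('i \<Rightarrow> 'a) \<Rightarrow> 'm" where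
  "fext M n u = (\<Oplus>\<^bsub>M\<^esub>i\<in>{i. u i \<noteq> \<zero>}. u i \<odot>\<^bsub>M\<^esub> n i)"

lemma fext_superset:
  fixes M :: "('a, 'm, 's) module_scheme"
  assumes N: "left_module R M" and n: "\<And>i. i \<in> I \<Longrightarrow> n i \<in> carrier M"
    and u: "u \<in> carrier (free_module R I)" and J: "finite J" "{i. u i \<noteq> \<zero>} \<subseteq> J" "J \<subseteq> I"
  shows "fext M n u = (\<Oplus>\<^bsub>M\<^esub>i\<in>J. u i \<odot>\<^bsub>M\<^esub> n i)"
proof -
  interpret M: left_module R M by fact
  show ?thesis unfolding fext_def
    using J n free_in_carrier[OF u]
    by (intro M.add.finprod_mono_neutral_cong_left) (auto intro!: M.smult_closed)
qed

lemma fext_linmap: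
  fixes M :: "('a, 'm, 's) module_scheme"
  assumes N: "left_module R M" and n: "\<And>i. i \<in> I \<Longrightarrow> n i \<in> carrier M"
  shows "linmap R (free_module R I) M (fext M n)"
proof -
  interpret M: left_module R M by fact
  interpret F: left_module R "free_module R I" by (rule free_left_module)
  note sup = fext_superset[OF N n]
  have supp: "i \<in> I" if "u \<in> carrier (free_module R I)" "u i \<noteq> \<zero>" for u i
    using that by auto
  show ?thesis unfolding linmap_def
  proof (intro conjI ballI)
    fix u assume u: "u \<in> carrier (free_module R I)"
    show "fext M n u \<in> carrier M" unfolding fext_def
      using n supp[OF u] free_in_carrier[OF u] by (intro M.finsum_closed) (auto intro!: M.smult_closed)
  next
    fix u v assume u: "u \<in> carrier (free_module R I)" and v: "v \<in> carrier (free_module R I)"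
    let ?J = "{i. u i \<noteq> \<zero>} \<union> {i. v i \<noteq> \<zero>}"
    have J: "finite ?J" "?J \<subseteq> I" using u v by auto
    have uv: "u \<oplus>\<^bsub>free_module R I\<^esub> v \<in> carrier (free_module R I)" using u v by (rule F.M.a_closed)
    have "fext M n (u \<oplus>\<^bsub>free_module R I\<^esub> v)
      = (\<Oplus>\<^bsub>M\<^esub>i\<in>?J. (u \<oplus>\<^bsub>free_module R I\<^esub> v) i \<odot>\<^bsub>M\<^esub> n i)"
      by (rule sup) (use uv J in auto)
    also have "\<dots> = (\<Oplus>\<^bsub>M\<^esub>i\<in>?J. u i \<odot>\<^bsub>M\<^esub> n i \<oplus>\<^bsub>M\<^esub> v i \<odot>\<^bsub>M\<^esub> n i)"
      using J n free_in_carrier[OF u] free_in_carrier[OF v]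
      by (intro M.finsum_cong') (auto simp: M.smult_l_distr intro!: M.smult_closed M.M.a_closed)
    also have "\<dots> = (\<Oplus>\<^bsub>M\<^esub>i\<in>?J. u i \<odot>\<^bsub>M\<^esub> n i) \<oplus>\<^bsub>M\<^esub> (\<Oplus>\<^bsub>M\<^esub>i\<in>?J. v i \<odot>\<^bsub>M\<^esub> n i)"
      using J n free_in_carrier[OF u] free_in_carrier[OF v]
      by (intro M.finsum_addf) (auto intro!: M.smult_closed)
    also have "(\<Oplus>\<^bsub>M\<^esub>i\<in>?J. u i \<odot>\<^bsub>M\<^esub> n i) = fext M n u"
      by (rule sup[symmetric]) (use u J in auto)
    also have "(\<Oplus>\<^bsub>M\<^esub>i\<in>?J. v i \<odot>\<^bsub>M\<^esub> n i) = fext M n v"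
      by (rule sup[symmetric]) (use v J in auto)
    finally show "fext M n (u \<oplus>\<^bsub>free_module R I\<^esub> v) = fext M n u \<oplus>\<^bsub>M\<^esub> fext M n v" .
  next
    fix a u assume a: "a \<in> carrier R" and u: "u \<in> carrier (free_module R I)"
    let ?J = "{i. u i \<noteq> \<zero>}"
    have J: "finite ?J" "?J \<subseteq> I" using u by auto
    have au: "a \<odot>\<^bsub>free_module R I\<^esub> u \<in> carrier (free_module R I)" using a u by (rule F.smult_closed)
    have "fext M n (a \<odot>\<^bsub>free_module R I\<^esub> u) = (\<Oplus>\<^bsub>M\<^esub>i\<in>?J. (a \<odot>\<^bsub>free_module R I\<^esub> u) i \<odot>\<^bsub>M\<^esub> n i)"
      by (rule sup) (use au J a in auto)
    also have "\<dots> = (\<Oplus>\<^bsub>M\<^esub>i\<in>?J. a \<odot>\<^bsub>M\<^esub> (u i \<odot>\<^bsub>M\<^esub> n i))"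
      using J n a free_in_carrier[OF u]
      by (intro M.finsum_cong') (auto simp: M.smult_assoc intro!: M.smult_closed)
    also have "\<dots> = a \<odot>\<^bsub>M\<^esub> fext M n u" unfolding fext_def
      using J n a free_in_carrier[OF u]
      by (intro M.smult_finsum[symmetric]) (auto intro!: M.smult_closed)
    finally show "fext M n (a \<odot>\<^bsub>free_module R I\<^esub> u) = a \<odot>\<^bsub>M\<^esub> fext M n u" .
  qed
qed

text \<open>The basis is transported into the type of the module along \<open>dl\<close>.\<close>

lemma projective_free:
  fixes I :: "'i set"
  assumes nz: "\<one> \<noteq> \<zero>"
  shows "projective R (free_module R I)"
proof -
  let ?F = "free_module R I" and ?B = "dl ` I :: ('i \<Rightarrow> 'a) set"
  interpret F: left_module R ?F by (rule free_left_module)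
  interpret G: left_module R "free_module R ?B" by (rule free_left_module)
  have inj: "inj (dl :: 'i \<Rightarrow> 'i \<Rightarrow> 'a)" by (rule injI) (metis dl_simps nz)
  define s where "s u = (\<lambda>b. if b \<in> ?B then u (inv_into UNIV dl b) else \<zero>)" for u :: "'i \<Rightarrow> 'a"
  define r where "r v = (\<lambda>i. if i \<in> I then v (dl i) else \<zero>)" for v :: "('i \<Rightarrow> 'a) \<Rightarrow> 'a"
  have s: "linmap R ?F (free_module R ?B) s" unfolding linmap_def
  proof (intro conjI ballI)
    fix u assume u: "u \<in> carrier ?F"
    have "{b. s u b \<noteq> \<zero>} \<subseteq> dl ` {i. u i \<noteq> \<zero>}"
      by (auto simp: s_def inv_f_f[OF inj])
    hence "finite {b. s u b \<noteq> \<zero>}" by (rule finite_subset) (use u in auto)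
    thus "s u \<in> carrier (free_module R ?B)" using u by (auto simp: s_def inv_f_f[OF inj])
  qed (auto simp: s_def)
  have r: "linmap R (free_module R ?B) ?F r" unfolding linmap_def
  proof (intro conjI ballI)
    fix v assume v: "v \<in> carrier (free_module R ?B)"
    have "dl ` {i. r v i \<noteq> \<zero>} \<subseteq> {b. v b \<noteq> \<zero>}" by (auto simp: r_def)
    hence "finite (dl ` {i. r v i \<noteq> \<zero>} :: ('i \<Rightarrow> 'a) set)" by (rule finite_subset) (use v in auto)
    hence "finite {i. r v i \<noteq> \<zero>}" by (rule finite_imageD) (rule inj_on_subset[OF inj], simp)
    thus "r v \<in> carrier ?F" using v by (auto simp: r_def)
  qed (auto simp: r_def)
  have "r (s u) = u" if "u \<in> carrier ?F" for u
    using that by (auto simp: r_def s_def inv_f_f[OF inj])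
  moreover have "s u \<in> carrier (free_module R ?B)" if "u \<in> carrier ?F" for u
    using linmapD(1)[OF s that] .
  ultimately show ?thesis unfolding projective_def
    by (intro conjI F.left_module_axioms exI[of _ ?B]
        bexI[of _ "restrict s (carrier ?F)"] bexI[of _ "restrict r (carrier (free_module R ?B))"]
        linmap_restrict s r F.left_module_axioms G.left_module_axioms) (simp del: free_simps)
qed

end

section \<open>Lifting, comparison of resolutions and homotopies\<close>

lemma projective_lift:
  fixes P :: "('a, 'p, 's) module_scheme"
  assumes P: "projective A P" and N: "left_module A N" and M: "left_module A M"
    and g: "linmap A N M g" and h: "linmap A P M h" and im: "h ` carrier P \<subseteq> g ` carrier N"
  shows "\<exists>k. linmap A P N k \<and> (\<forall>x\<in>carrier P. g (k x) = h x)"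
proof -
  interpret N: left_module A N by fact
  interpret M: left_module A M by fact
  have Pm: "left_module A P" using P by (simp add: projective_def)
  obtain I :: "'p set" and s r where "s \<in> lin_maps A P (free_module A I)" "r \<in> lin_maps A (free_module A I) P"
    and rs: "\<And>x. x \<in> carrier P \<Longrightarrow> r (s x) = x"
    using P unfolding projective_def by blast
  hence s: "linmap A P (free_module A I) s" and r: "linmap A (free_module A I) P r"
    by (simp_all add: lin_maps_iff)
  let ?F = "free_module A I"
  have F: "left_module A ?F" by (rule N.free_left_module)
  \<comment> \<open>The basis of the free module is sent to chosen preimages under \<open>g\<close>;
    composing the extension with the section \<open>s\<close> gives the lift on the summand.\<close>
  define n where "n i = (SOME y. y \<in> carrier N \<and> g y = h (r (N.dl i)))" for i
  have n: "n i \<in> carrier N" "g (n i) = h (r (N.dl i))" if "i \<in> I" for i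
  proof -
    have "h (r (N.dl i)) \<in> g ` carrier N" using that im linmapD(1)[OF r N.dl_in[OF that]] by blast
    then obtain y where "y \<in> carrier N" "g y = h (r (N.dl i))" by auto
    hence "\<exists>y. y \<in> carrier N \<and> g y = h (r (N.dl i))" by blast
    from someI_ex[OF this] show "n i \<in> carrier N" "g (n i) = h (r (N.dl i))" by (simp_all add: n_def)
  qed
  define k where "k = N.fext N n"
  have k: "linmap A ?F N k" unfolding k_def by (rule N.fext_linmap[OF N n(1)])
  have "g (k u) = h (r u)" if u: "u \<in> carrier ?F" for u
  proof -
    let ?J = "{i. u i \<noteq> \<zero>\<^bsub>A\<^esub>}"
    have J: "finite ?J" "?J \<subseteq> I" using u by auto
    have nJ: "n i \<in> carrier N" "g (n i) = h (r (N.dl i))" if "i \<in> ?J" for i using n J(2) that by blast+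
    have uJ: "u i \<in> carrier A" for i by (rule N.free_in_carrier[OF u])
    have "g (k u) = (\<Oplus>\<^bsub>M\<^esub>i\<in>?J. g (u i \<odot>\<^bsub>N\<^esub> n i))"
      unfolding k_def N.fext_def using nJ uJ by (intro linmap_finsum[OF N M g]) (auto intro!: N.smult_closed)
    also have "\<dots> = (\<Oplus>\<^bsub>M\<^esub>i\<in>?J. u i \<odot>\<^bsub>M\<^esub> h (r (N.dl i)))"
    proof (rule M.finsum_cong')
      show "(\<lambda>i. u i \<odot>\<^bsub>M\<^esub> h (r (N.dl i))) \<in> ?J \<rightarrow> carrier M"
        using nJ uJ linmapD(1)[OF g nJ(1)] by (auto intro!: M.smult_closed)
      show "g (u i \<odot>\<^bsub>N\<^esub> n i) = u i \<odot>\<^bsub>M\<^esub> h (r (N.dl i))" if "i \<in> ?J" for i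
        using linmapD(3)[OF g uJ[of i] nJ(1)[OF that]] nJ(2)[OF that] by simp
    qed simp
    also have "\<dots> = h (r u)"
      by (rule N.linmap_free_expand[OF M linmap_compose[OF h r] u, symmetric]) (use J in auto)
    finally show ?thesis .
  qed
  thus ?thesis
    using linmap_compose[OF k s] linmapD(1)[OF s] rs by (intro exI[of _ "\<lambda>x. k (s x)"]) simp
qed

lemma projective_resolutionD:
  assumes "projective_resolution A M P d e"
  shows "left_module A M" "left_module A (P i)" "projective A (P i)"
    "linmap A (P 0) M e" "linmap A (P (Suc i)) (P i) (d i)" "e ` carrier (P 0) = carrier M"
    "x \<in> carrier (P 0) \<Longrightarrow> e x = \<zero>\<^bsub>M\<^esub> \<Longrightarrow> x \<in> d 0 ` carrier (P (Suc 0))"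
    "y \<in> carrier (P (Suc 0)) \<Longrightarrow> e (d 0 y) = \<zero>\<^bsub>M\<^esub>"
    "x' \<in> carrier (P (Suc i)) \<Longrightarrow> d i x' = \<zero>\<^bsub>P i\<^esub> \<Longrightarrow> x' \<in> d (Suc i) ` carrier (P (Suc (Suc i)))"
    "y' \<in> carrier (P (Suc (Suc i))) \<Longrightarrow> d i (d (Suc i) y') = \<zero>\<^bsub>P i\<^esub>"
proof -
  have ex: "{x \<in> carrier (P 0). e x = \<zero>\<^bsub>M\<^esub>} = d 0 ` carrier (P (Suc 0))"
    "{x \<in> carrier (P (Suc i)). d i x = \<zero>\<^bsub>P i\<^esub>} = d (Suc i) ` carrier (P (Suc (Suc i)))" for i
    using assms by (simp_all add: projective_resolution_def)
  show "y \<in> carrier (P (Suc 0)) \<Longrightarrow> e (d 0 y) = \<zero>\<^bsub>M\<^esub>"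
    "y' \<in> carrier (P (Suc (Suc i))) \<Longrightarrow> d i (d (Suc i) y') = \<zero>\<^bsub>P i\<^esub>"
    "x \<in> carrier (P 0) \<Longrightarrow> e x = \<zero>\<^bsub>M\<^esub> \<Longrightarrow> x \<in> d 0 ` carrier (P (Suc 0))"
    "x' \<in> carrier (P (Suc i)) \<Longrightarrow> d i x' = \<zero>\<^bsub>P i\<^esub> \<Longrightarrow> x' \<in> d (Suc i) ` carrier (P (Suc (Suc i)))"
    using ex by blast+
  note * = assms[unfolded projective_resolution_def]
  show "left_module A M" by (rule *[THEN conjunct1])
  show "projective A (P i)" by (rule *[THEN conjunct2, THEN conjunct1, THEN spec])
  thus "left_module A (P i)" by (simp add: projective_def)
  show "linmap A (P 0) M e"
    using *[THEN conjunct2, THEN conjunct2, THEN conjunct1] by (simp add: lin_maps_iff)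
  show "linmap A (P (Suc i)) (P i) (d i)"
    using *[THEN conjunct2, THEN conjunct2, THEN conjunct2, THEN conjunct1, THEN spec, of i] by (simp add: lin_maps_iff)
  show "e ` carrier (P 0) = carrier M"
    by (rule *[THEN conjunct2, THEN conjunct2, THEN conjunct2, THEN conjunct2, THEN conjunct1])
qed

lemma comparison:
  fixes P :: "nat \<Rightarrow> ('a, 'p) module" and F :: "nat \<Rightarrow> ('a, 'f) module"
  assumes F: "projective_resolution A M F d' e'" and P: "projective_resolution A M P d e"
  shows "\<exists>f. (\<forall>i. linmap A (F i) (P i) (f i)) \<and> (\<forall>x\<in>carrier (F 0). e (f 0 x) = e' x) \<and>
    (\<forall>i. \<forall>x\<in>carrier (F (Suc i)). d i (f (Suc i) x) = f i (d' i x))"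
proof -
  note FD = projective_resolutionD[OF F] and PD = projective_resolutionD[OF P]
  \<comment> \<open>The invariant says that the next map can be lifted: \<open>f\<close> carries
    boundaries of \<open>F\<close> to boundaries of \<open>P\<close>. The clause for
    \<open>n = 0\<close> keeps track of the augmentation.\<close>
  define Q where "Q n f \<longleftrightarrow> linmap A (F n) (P n) f \<and>
    (\<forall>x\<in>carrier (F (Suc n)). f (d' n x) \<in> d n ` carrier (P (Suc n))) \<and>
    (n = 0 \<longrightarrow> (\<forall>x\<in>carrier (F 0). e (f x) = e' x))" for n f
  have "\<exists>f. \<forall>n. Q n (f n) \<and> (\<forall>x\<in>carrier (F (Suc n)). d n (f (Suc n) x) = f n (d' n x))"
  proof (rule dependent_nat_choice)
    have "e' ` carrier (F 0) \<subseteq> e ` carrier (P 0)" using FD(6) PD(6) by simp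
    then obtain f where f: "linmap A (F 0) (P 0) f" "\<forall>x\<in>carrier (F 0). e (f x) = e' x"
      using projective_lift[OF FD(3) PD(2) PD(1) PD(4) FD(4)] by blast
    have "f (d' 0 x) \<in> d 0 ` carrier (P (Suc 0))" if "x \<in> carrier (F (Suc 0))" for x
    proof (rule PD(7))
      show "f (d' 0 x) \<in> carrier (P 0)" using that linmapD(1)[OF FD(5)] linmapD(1)[OF f(1)] by blast
      show "e (f (d' 0 x)) = \<zero>\<^bsub>M\<^esub>" using that linmapD(1)[OF FD(5)] f(2) FD(8) by simp
    qed
    thus "\<exists>f. Q 0 f" using f unfolding Q_def by blast
  next
    fix f n assume Q: "Q n f"
    hence f: "linmap A (F n) (P n) f" and im: "(\<lambda>x. f (d' n x)) ` carrier (F (Suc n)) \<subseteq> d n ` carrier (P (Suc n))"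
      unfolding Q_def by auto
    obtain g where g: "linmap A (F (Suc n)) (P (Suc n)) g" "\<forall>x\<in>carrier (F (Suc n)). d n (g x) = f (d' n x)"
      using projective_lift[OF FD(3) PD(2) PD(2) PD(5) linmap_compose[OF f FD(5)] im] by blast
    have "g (d' (Suc n) x) \<in> d (Suc n) ` carrier (P (Suc (Suc n)))" if "x \<in> carrier (F (Suc (Suc n)))" for x
    proof (rule PD(9))
      show "g (d' (Suc n) x) \<in> carrier (P (Suc n))" using that linmapD(1)[OF FD(5)] linmapD(1)[OF g(1)] by blast
      show "d n (g (d' (Suc n) x)) = \<zero>\<^bsub>P n\<^esub>"
        using that linmapD(1)[OF FD(5)] g(2) FD(10) linmap_zero[OF FD(2) PD(2) f] by simp
    qed
    thus "\<exists>g. Q (Suc n) g \<and> (\<forall>x\<in>carrier (F (Suc n)). d n (g x) = f (d' n x))"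
      using g unfolding Q_def by blast
  qed
  then obtain f where f: "\<And>n. Q n (f n)"
    "\<And>n x. x \<in> carrier (F (Suc n)) \<Longrightarrow> d n (f (Suc n) x) = f n (d' n x)" by blast
  show ?thesis by (rule exI[of _ f]) (use f in \<open>simp add: Q_def\<close>)
qed

lemma linmap_diff_fun:
  assumes "left_module A M" "left_module A N" "linmap A M N f" "linmap A M N g"
  shows "linmap A M N (\<lambda>x. f x \<ominus>\<^bsub>N\<^esub> g x)"
proof -
  interpret M: left_module A M by fact
  interpret N: left_module A N by fact
  show ?thesis unfolding linmap_def
  proof (intro conjI ballI)
    fix x y assume xy: "x \<in> carrier M" "y \<in> carrier M"
    hence "f x \<in> carrier N" "f y \<in> carrier N" "g x \<in> carrier N" "g y \<in> carrier N"
      using linmapD(1)[OF assms(3)] linmapD(1)[OF assms(4)] by auto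
    thus "f (x \<oplus>\<^bsub>M\<^esub> y) \<ominus>\<^bsub>N\<^esub> g (x \<oplus>\<^bsub>M\<^esub> y) = f x \<ominus>\<^bsub>N\<^esub> g x \<oplus>\<^bsub>N\<^esub> (f y \<ominus>\<^bsub>N\<^esub> g y)"
      using xy by (simp add: linmapD(2)[OF assms(3)] linmapD(2)[OF assms(4)] a_minus_def N.M.minus_add N.M.a_ac)
  next
    fix a x assume ax: "a \<in> carrier A" "x \<in> carrier M"
    have *: "linmap A N N (\<lambda>y. y)" by (simp add: linmap_def)
    have fg: "f x \<in> carrier N" "g x \<in> carrier N"
      using ax linmapD(1)[OF assms(3)] linmapD(1)[OF assms(4)] by auto
    have "a \<odot>\<^bsub>N\<^esub> (\<ominus>\<^bsub>N\<^esub> g x) \<oplus>\<^bsub>N\<^esub> a \<odot>\<^bsub>N\<^esub> g x = \<zero>\<^bsub>N\<^esub>"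
      using ax fg by (simp add: N.M.l_neg flip: N.smult_r_distr)
    hence "a \<odot>\<^bsub>N\<^esub> (\<ominus>\<^bsub>N\<^esub> g x) = \<ominus>\<^bsub>N\<^esub> (a \<odot>\<^bsub>N\<^esub> g x)"
      using ax fg by (intro N.M.minus_equality[symmetric]) (auto intro: N.smult_closed)
    thus "f (a \<odot>\<^bsub>M\<^esub> x) \<ominus>\<^bsub>N\<^esub> g (a \<odot>\<^bsub>M\<^esub> x) = a \<odot>\<^bsub>N\<^esub> (f x \<ominus>\<^bsub>N\<^esub> g x)"
      using ax fg by (simp add: linmapD(3)[OF assms(3)] linmapD(3)[OF assms(4)] a_minus_def N.smult_r_distr)
  qed (use linmapD(1)[OF assms(3)] linmapD(1)[OF assms(4)] in auto)
qed

text \<open>The composite of the comparison maps to a short resolution and back is null-homotopic to the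
  identity, and it vanishes in the degrees where the short resolution does.\<close>

lemma resolution_retraction:
  fixes P :: "nat \<Rightarrow> ('a, 'p) module" and F :: "nat \<Rightarrow> ('a, 'f) module"
  assumes F: "projective_resolution A M F d' e'" and P: "projective_resolution A M P d e"
    and len: "length_at_most P n" and zero: "carrier (F (Suc (Suc n))) = {\<zero>\<^bsub>F (Suc (Suc n))\<^esub>}"
    and n: "n > 0"
  shows "\<exists>h. linmap A (F n) (F (Suc n)) h \<and> (\<forall>x\<in>carrier (F (Suc n)). h (d' n x) = x)"
proof -
  note FD = projective_resolutionD[OF F] and PD = projective_resolutionD[OF P]
  have dF: "x \<in> carrier (F (Suc i)) \<Longrightarrow> d' i x \<in> carrier (F i)" for i x by (rule linmapD(1)[OF FD(5)])
  obtain f where f: "\<And>i. linmap A (F i) (P i) (f i)" "\<And>x. x \<in> carrier (F 0) \<Longrightarrow> e (f 0 x) = e' x"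
    "\<And>i x. x \<in> carrier (F (Suc i)) \<Longrightarrow> d i (f (Suc i) x) = f i (d' i x)"
    using comparison[OF F P] by blast
  obtain g where g: "\<And>i. linmap A (P i) (F i) (g i)" "\<And>x. x \<in> carrier (P 0) \<Longrightarrow> e' (g 0 x) = e x"
    "\<And>i x. x \<in> carrier (P (Suc i)) \<Longrightarrow> d' i (g (Suc i) x) = g i (d i x)"
    using comparison[OF P F] by blast
  have fF: "x \<in> carrier (F i) \<Longrightarrow> f i x \<in> carrier (P i)" for i x by (rule linmapD(1)[OF f(1)])
  have gP: "x \<in> carrier (P i) \<Longrightarrow> g i x \<in> carrier (F i)" for i x by (rule linmapD(1)[OF g(1)])
  \<comment> \<open>The homotopy \<open>h\<close> is built with \<open>d' h + h d' = k\<close>. The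
    invariant \<open>Q\<close> below states that the obstruction \<open>k - h d'\<close> in the next
    degree is a boundary, so that \<open>h\<close> can be continued by lifting.\<close>
  define k where "k i x = x \<ominus>\<^bsub>F i\<^esub> g i (f i x)" for i x
  have idl: "linmap A N N (\<lambda>x. x)" for N :: "('a, 'f) module" by (simp add: linmap_def)
  have klin: "linmap A (F i) (F i) (k i)" for i
    unfolding k_def by (intro linmap_diff_fun FD(2) idl linmap_compose[OF g(1) f(1)])
  have kF: "x \<in> carrier (F i) \<Longrightarrow> k i x \<in> carrier (F i)" for i x by (rule linmapD(1)[OF klin])
  have kd: "d' i (k (Suc i) x) = k i (d' i x)" if "x \<in> carrier (F (Suc i))" for i x
    using that linmap_minus[OF FD(2) FD(2) FD(5), of x i "g (Suc i) (f (Suc i) x)"]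
    by (simp add: k_def gP fF f(3) g(3))
  define Q where "Q m h \<longleftrightarrow> linmap A (F m) (F (Suc m)) h \<and>
    (\<forall>x\<in>carrier (F (Suc m)). k (Suc m) x \<ominus>\<^bsub>F (Suc m)\<^esub> h (d' m x) \<in> d' (Suc m) ` carrier (F (Suc (Suc m))))" for m h
  have minus_self: "x \<ominus>\<^bsub>F i\<^esub> x = \<zero>\<^bsub>F i\<^esub>" if "x \<in> carrier (F i)" for i x
  proof -
    interpret Fi: left_module A "F i" by (rule FD(2))
    show ?thesis using that by (simp add: a_minus_def Fi.M.r_neg)
  qed
  have "\<exists>h. \<forall>m. Q m (h m) \<and> (\<forall>x\<in>carrier (F (Suc m)). d' (Suc m) (h (Suc m) x) = k (Suc m) x \<ominus>\<^bsub>F (Suc m)\<^esub> h m (d' m x))"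
  proof (rule dependent_nat_choice)
    have im: "k 0 ` carrier (F 0) \<subseteq> d' 0 ` carrier (F (Suc 0))"
    proof (intro subsetI, elim imageE, clarify, rule FD(7))
      fix x assume x: "x \<in> carrier (F 0)"
      thus "k 0 x \<in> carrier (F 0)" by (rule kF)
      interpret M: left_module A M by (rule FD(1))
      have "e' (k 0 x) = e' x \<ominus>\<^bsub>M\<^esub> e' (g 0 (f 0 x))"
        unfolding k_def using x by (intro linmap_minus[OF FD(2) FD(1) FD(4)] gP fF)
      also have "\<dots> = \<zero>\<^bsub>M\<^esub>"
        using x linmapD(1)[OF FD(4) x] by (simp add: g(2) fF f(2) a_minus_def M.M.r_neg)
      finally show "e' (k 0 x) = \<zero>\<^bsub>M\<^esub>" .
    qed
    obtain h where h: "linmap A (F 0) (F (Suc 0)) h" "\<forall>x\<in>carrier (F 0). d' 0 (h x) = k 0 x"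
      using projective_lift[OF FD(3) FD(2) FD(2) FD(5) klin im] by blast
    have "k (Suc 0) x \<ominus>\<^bsub>F (Suc 0)\<^esub> h (d' 0 x) \<in> d' (Suc 0) ` carrier (F (Suc (Suc 0)))" if x: "x \<in> carrier (F (Suc 0))" for x
    proof (rule FD(9))
      have hx: "h (d' 0 x) \<in> carrier (F (Suc 0))" using linmapD(1)[OF h(1)] dF[OF x] by blast
      interpret F1: left_module A "F (Suc 0)" by (rule FD(2))
      show "k (Suc 0) x \<ominus>\<^bsub>F (Suc 0)\<^esub> h (d' 0 x) \<in> carrier (F (Suc 0))" using hx kF[OF x] by simp
      have "d' 0 (k (Suc 0) x \<ominus>\<^bsub>F (Suc 0)\<^esub> h (d' 0 x)) = d' 0 (k (Suc 0) x) \<ominus>\<^bsub>F 0\<^esub> d' 0 (h (d' 0 x))"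
        by (intro linmap_minus[OF FD(2) FD(2) FD(5)] kF x hx)
      also have "\<dots> = \<zero>\<^bsub>F 0\<^esub>" using h(2) dF[OF x] kF[OF dF[OF x]] by (simp add: kd[OF x] minus_self)
      finally show "d' 0 (k (Suc 0) x \<ominus>\<^bsub>F (Suc 0)\<^esub> h (d' 0 x)) = \<zero>\<^bsub>F 0\<^esub>" .
    qed
    thus "\<exists>h. Q 0 h" using h(1) unfolding Q_def by blast
  next
    fix h m assume Q: "Q m h"
    define y where "y x = k (Suc m) x \<ominus>\<^bsub>F (Suc m)\<^esub> h (d' m x)" for x
    have hlin: "linmap A (F m) (F (Suc m)) h" and im: "y ` carrier (F (Suc m)) \<subseteq> d' (Suc m) ` carrier (F (Suc (Suc m)))"
      using Q unfolding Q_def y_def by auto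
    have ylin: "linmap A (F (Suc m)) (F (Suc m)) y" unfolding y_def
      by (intro linmap_diff_fun FD(2) klin linmap_compose[OF hlin FD(5)])
    obtain h' where h': "linmap A (F (Suc m)) (F (Suc (Suc m))) h'" "\<forall>x\<in>carrier (F (Suc m)). d' (Suc m) (h' x) = y x"
      using projective_lift[OF FD(3) FD(2) FD(2) FD(5) ylin im] by blast
    have "k (Suc (Suc m)) x \<ominus>\<^bsub>F (Suc (Suc m))\<^esub> h' (d' (Suc m) x) \<in> d' (Suc (Suc m)) ` carrier (F (Suc (Suc (Suc m))))"
      if x: "x \<in> carrier (F (Suc (Suc m)))" for x
    proof (rule FD(9))
      have hx: "h' (d' (Suc m) x) \<in> carrier (F (Suc (Suc m)))" using linmapD(1)[OF h'(1)] dF[OF x] by blast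
      interpret F2: left_module A "F (Suc (Suc m))" by (rule FD(2))
      interpret F1: left_module A "F (Suc m)" by (rule FD(2))
      show "k (Suc (Suc m)) x \<ominus>\<^bsub>F (Suc (Suc m))\<^esub> h' (d' (Suc m) x) \<in> carrier (F (Suc (Suc m)))"
        using hx kF[OF x] by simp
      have "d' (Suc m) (k (Suc (Suc m)) x \<ominus>\<^bsub>F (Suc (Suc m))\<^esub> h' (d' (Suc m) x))
          = d' (Suc m) (k (Suc (Suc m)) x) \<ominus>\<^bsub>F (Suc m)\<^esub> d' (Suc m) (h' (d' (Suc m) x))"
        by (intro linmap_minus[OF FD(2) FD(2) FD(5)] kF x hx)
      also have "\<dots> = k (Suc m) (d' (Suc m) x) \<ominus>\<^bsub>F (Suc m)\<^esub> y (d' (Suc m) x)"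
        using h'(2) dF[OF x] by (simp add: kd[OF x])
      also have "y (d' (Suc m) x) = k (Suc m) (d' (Suc m) x)"
        using kF[OF dF[OF x]] FD(10)[OF x] linmap_zero[OF FD(2) FD(2) hlin] by (simp add: y_def a_minus_def)
      finally show "d' (Suc m) (k (Suc (Suc m)) x \<ominus>\<^bsub>F (Suc (Suc m))\<^esub> h' (d' (Suc m) x)) = \<zero>\<^bsub>F (Suc m)\<^esub>"
        using kF[OF dF[OF x]] by (simp add: minus_self)
    qed
    thus "\<exists>h'. Q (Suc m) h' \<and> (\<forall>x\<in>carrier (F (Suc m)). d' (Suc m) (h' x) = k (Suc m) x \<ominus>\<^bsub>F (Suc m)\<^esub> h (d' m x))"
      using h' unfolding Q_def y_def by blast
  qed
  then obtain h where h: "\<And>m. linmap A (F m) (F (Suc m)) (h m)"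
    "\<And>m x. x \<in> carrier (F (Suc m)) \<Longrightarrow> d' (Suc m) (h (Suc m) x) = k (Suc m) x \<ominus>\<^bsub>F (Suc m)\<^esub> h m (d' m x)"
    unfolding Q_def by blast
  have "h n (d' n x) = x" if x: "x \<in> carrier (F (Suc n))" for x
  proof -
    obtain m where m: "n = Suc m" using n by (cases n) auto
    interpret Fn: left_module A "F n" by (rule FD(2))
    interpret Fm: left_module A "F (Suc m)" by (rule FD(2))
    interpret Fs: left_module A "F (Suc n)" by (rule FD(2))
    have dx: "d' n x \<in> carrier (F n)" by (rule dF[OF x])
    \<comment> \<open>The image of \<open>d' n x\<close> in \<open>P n\<close> is a cycle, hence a
      boundary from \<open>P (Suc n)\<close>, which is 0. So \<open>k n\<close> fixes
      \<open>d' n x\<close>.\<close>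
    have "d m (f n (d' n x)) = f m (d' m (d' n x))" unfolding m by (rule f(3)) (use dx m in simp)
    also have "\<dots> = \<zero>\<^bsub>P m\<^esub>" using FD(10)[of x m] x m linmap_zero[OF FD(2) PD(2) f(1)] by simp
    finally have "f n (d' n x) \<in> d n ` carrier (P (Suc n))" using PD(9)[of "f n (d' n x)" m] fF[OF dx] m by simp
    moreover have "carrier (P (Suc n)) = {\<zero>\<^bsub>P (Suc n)\<^esub>}" using len by (simp add: length_at_most_def)
    ultimately have "f n (d' n x) = \<zero>\<^bsub>P n\<^esub>" using linmap_zero[OF PD(2) PD(2) PD(5)] by auto
    hence "k n (d' n x) = d' n x" using dx linmap_zero[OF PD(2) FD(2) g(1)] by (simp add: k_def a_minus_def)
    moreover have "d' m (d' n x) = \<zero>\<^bsub>F m\<^esub>" using FD(10)[of x m] x m by simp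
    ultimately have dh: "d' n (h n (d' n x)) = d' n x"
      using h(2)[of "d' n x" m] dx m linmap_zero[OF FD(2) FD(2) h(1)] by (simp add: a_minus_def)
    \<comment> \<open>\<open>h n (d' n x)\<close> and \<open>x\<close> have the same image under
      \<open>d' n\<close>; they differ by a boundary coming from the zero module in degree
      \<open>Suc (Suc n)\<close>.\<close>
    let ?z = "h n (d' n x) \<ominus>\<^bsub>F (Suc n)\<^esub> x"
    have hd: "h n (d' n x) \<in> carrier (F (Suc n))" by (rule linmapD(1)[OF h(1) dx])
    have "d' n ?z = \<zero>\<^bsub>F n\<^esub>" using linmap_minus[OF FD(2) FD(2) FD(5) hd x] dh dx by (simp add: minus_self)
    hence "?z \<in> d' (Suc n) ` carrier (F (Suc (Suc n)))" using FD(9)[of ?z n] hd x by simp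
    hence "?z = \<zero>\<^bsub>F (Suc n)\<^esub>" using zero linmap_zero[OF FD(2) FD(2) FD(5)] by auto
    moreover have "h n (d' n x) = ?z \<oplus>\<^bsub>F (Suc n)\<^esub> x"
      using hd x by (simp add: a_minus_def Fs.M.a_assoc Fs.M.l_neg)
    ultimately show ?thesis using x by simp
  qed
  thus ?thesis using h(1) by blast
qed

section \<open>Quotients\<close>

lemma quot_simps:
  "carrier (quot M N) = a_rcosets\<^bsub>M\<^esub> N" "zero (quot M N) = N" "one (quot M N) = N +>\<^bsub>M\<^esub> \<one>\<^bsub>M\<^esub>"
  "mult (quot M N) C C' = rcoset_mult M N C C'" "add (quot M N) C C' = C <+>\<^bsub>M\<^esub> C'"
  "smult (quot M N) a C = (\<Union>x\<in>C. N +>\<^bsub>M\<^esub> (a \<odot>\<^bsub>M\<^esub> x))"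
  by (simp_all add: quot_def FactRing_def)

lemma quot_carrier_iff: "C \<in> carrier (quot M N) \<longleftrightarrow> (\<exists>x\<in>carrier M. C = N +>\<^bsub>M\<^esub> x)"
  by (auto simp: quot_simps A_RCOSETS_defs a_r_coset_def r_coset_def)

locale quotient_group = abelian_subgroup N M for N and M :: "('a, 'm, 's) module_scheme" (structure)
begin

lemma cos_eq_iff: "x \<in> carrier M \<Longrightarrow> y \<in> carrier M \<Longrightarrow> N +> x = N +> y \<longleftrightarrow> x \<ominus> y \<in> N"
  by (metis a_rcos_self a_repr_independence' a_rcos_module a_minus_def)

lemma cos_add: "x \<in> carrier M \<Longrightarrow> y \<in> carrier M \<Longrightarrow> (N +> x) \<oplus>\<^bsub>quot M N\<^esub> (N +> y) = N +> (x \<oplus> y)"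
  by (simp add: quot_simps a_rcos_sum)

lemma quot_abelian: "abelian_group (quot M N)"
proof (rule abelian_group_cong)
  show "abelian_group (M Quot N)"
    by (rule comm_group_abelian_groupI)
      (simp add: FactRing_def a_factorgroup_is_comm_group[unfolded A_FactGroup_def'])
qed (simp_all add: quot_def)

lemma cos_in [simp]: "x \<in> carrier M \<Longrightarrow> N +> x \<in> carrier (quot M N)"
  by (auto simp: quot_carrier_iff)

lemma cos_zero: "N +> \<zero> = N"
  by (simp add: a_subset)

lemma cos_smult:
  assumes "\<And>x. x \<in> carrier M \<Longrightarrow> a \<odot> x \<in> carrier M"
    "\<And>x y. x \<in> carrier M \<Longrightarrow> y \<in> carrier M \<Longrightarrow> a \<odot> (x \<oplus> y) = a \<odot> x \<oplus> a \<odot> y"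
    "\<And>x. x \<in> N \<Longrightarrow> a \<odot> x \<in> N" "x \<in> carrier M"
  shows "a \<odot>\<^bsub>quot M N\<^esub> (N +> x) = N +> (a \<odot> x)"
proof -
  have *: "N +> (a \<odot> y) = N +> (a \<odot> x)" if "y \<in> N +> x" for y
  proof -
    obtain n where n: "n \<in> N" "y = n \<oplus> x" using \<open>y \<in> N +> x\<close> by (auto simp: a_r_coset_def r_coset_def)
    have "a \<odot> y = a \<odot> n \<oplus> a \<odot> x" unfolding n(2) using n(1) a_Hcarr assms by simp
    hence "a \<odot> y \<in> N +> (a \<odot> x)" using assms(3)[OF n(1)] by (auto simp: a_r_coset_def r_coset_def)
    thus ?thesis by (rule a_repr_independence'[symmetric]) (rule assms(1)[OF assms(4)])
  qed
  have "x \<in> N +> x" by (rule a_rcos_self[OF assms(4)])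
  hence ne: "N +> x \<noteq> {}" by blast
  have "a \<odot>\<^bsub>quot M N\<^esub> (N +> x) = (\<Union>y\<in>N +> x. N +> (a \<odot> x))"
    unfolding quot_simps by (rule SUP_cong[OF refl]) (rule *)
  thus ?thesis using ne by (simp only: UN_constant if_False)
qed

end

lemma quotient_groupI:
  assumes "abelian_group M" "N \<subseteq> carrier M" "\<zero>\<^bsub>M\<^esub> \<in> N"
    "\<And>x y. x \<in> N \<Longrightarrow> y \<in> N \<Longrightarrow> x \<oplus>\<^bsub>M\<^esub> y \<in> N" "\<And>x. x \<in> N \<Longrightarrow> \<ominus>\<^bsub>M\<^esub> x \<in> N"
  shows "quotient_group N M"
proof -
  interpret M: abelian_group M by fact
  have "additive_subgroup N M"
    using assms by unfold_locales (auto simp flip: a_inv_def)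
  thus ?thesis unfolding quotient_group_def
    by (rule abelian_subgroupI3) fact
qed

lemma quotient_group_kernel:
  assumes "left_module S Z" "left_module S E" "linmap S Z E F"
  shows "quotient_group {z\<in>carrier Z. F z = \<zero>\<^bsub>E\<^esub>} Z"
proof -
  interpret Z: left_module S Z by fact
  interpret E: left_module S E by fact
  show ?thesis
    by (rule quotient_groupI)
      (auto simp: Z.M.abelian_group_axioms linmap_zero[OF assms] linmapD[OF assms(3)] linmap_uminus[OF assms])
qed

text \<open>The first isomorphism theorem. The formula for \<open>h\<close> on cosets is kept in the
  conclusion because the gradings are compared through it.\<close>

lemma quot_iso:
  assumes "left_module S Z" "left_module S E" "linmap S Z E F" "F ` carrier Z = carrier E"
    and N: "N = {z\<in>carrier Z. F z = \<zero>\<^bsub>E\<^esub>}"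
  shows "\<exists>h\<in>lin_maps S (quot Z N) E. bij_betw h (carrier (quot Z N)) (carrier E) \<and>
    (\<forall>z\<in>carrier Z. h (N +>\<^bsub>Z\<^esub> z) = F z)"
proof -
  interpret Z: left_module S Z by fact
  interpret E: left_module S E by fact
  interpret quotient_group N Z unfolding N by (rule quotient_group_kernel) fact+
  note F = linmapD[OF assms(3)]
  define h where "h = (\<lambda>C\<in>carrier (quot Z N). the_elem (F ` C))"
  have h: "h (N +>\<^bsub>Z\<^esub> z) = F z" if z: "z \<in> carrier Z" for z
  proof -
    have "F ` (N +>\<^bsub>Z\<^esub> z) = {F z}"
    proof (intro subset_antisym subsetI)
      fix y assume "y \<in> F ` (N +>\<^bsub>Z\<^esub> z)"
      then obtain n where n: "n \<in> N" "y = F (n \<oplus>\<^bsub>Z\<^esub> z)" by (auto simp: a_r_coset_def r_coset_def)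
      from n(1) have "n \<in> carrier Z" "F n = \<zero>\<^bsub>E\<^esub>" unfolding N by auto
      thus "y \<in> {F z}" using z n(2) F(1)[OF z] by (simp add: F(2))
    next
      fix y assume "y \<in> {F z}"
      moreover have "z \<in> N +>\<^bsub>Z\<^esub> z" by (rule a_rcos_self[OF z])
      ultimately show "y \<in> F ` (N +>\<^bsub>Z\<^esub> z)" by auto
    qed
    thus ?thesis using z by (simp add: h_def)
  qed
  have sm: "a \<odot>\<^bsub>quot Z N\<^esub> (N +>\<^bsub>Z\<^esub> z) = N +>\<^bsub>Z\<^esub> (a \<odot>\<^bsub>Z\<^esub> z)" if "a \<in> carrier S" "z \<in> carrier Z" for a z
    proof (rule cos_smult)
    show "a \<odot>\<^bsub>Z\<^esub> x \<in> N" if "x \<in> N" for x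
      using that \<open>a \<in> carrier S\<close> unfolding N by (simp add: F(3) Z.smult_closed)
  qed (use that in \<open>simp_all add: Z.smult_closed Z.smult_r_distr\<close>)
  have "h \<in> lin_maps S (quot Z N) E" unfolding lin_maps_iff linmap_def
  proof (intro conjI ballI)
    show "h \<in> extensional (carrier (quot Z N))" by (simp add: h_def)
    fix C assume "C \<in> carrier (quot Z N)"
    then obtain x where x: "x \<in> carrier Z" "C = N +>\<^bsub>Z\<^esub> x" by (auto simp: quot_carrier_iff)
    show "h C \<in> carrier E" using x by (simp add: h F)
    show "h (a \<odot>\<^bsub>quot Z N\<^esub> C) = a \<odot>\<^bsub>E\<^esub> h C" if "a \<in> carrier S" for a
      using x that by (simp add: sm h F Z.smult_closed)
    fix C' assume "C' \<in> carrier (quot Z N)"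
    then obtain y where y: "y \<in> carrier Z" "C' = N +>\<^bsub>Z\<^esub> y" by (auto simp: quot_carrier_iff)
    show "h (C \<oplus>\<^bsub>quot Z N\<^esub> C') = h C \<oplus>\<^bsub>E\<^esub> h C'" using x y by (simp add: cos_add h F)
  qed
  moreover have "inj_on h (carrier (quot Z N))"
  proof (rule inj_onI)
    fix C C' assume "C \<in> carrier (quot Z N)" "C' \<in> carrier (quot Z N)" and eq: "h C = h C'"
    then obtain x y where xy: "x \<in> carrier Z" "C = N +>\<^bsub>Z\<^esub> x" "y \<in> carrier Z" "C' = N +>\<^bsub>Z\<^esub> y"
      by (auto simp: quot_carrier_iff)
    have Fxy: "F x = F y" using xy eq by (simp add: h)
    have "F (x \<ominus>\<^bsub>Z\<^esub> y) = F x \<ominus>\<^bsub>E\<^esub> F y" by (rule linmap_minus[OF assms(1-3)]) (use xy in auto)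
    also have "\<dots> = \<zero>\<^bsub>E\<^esub>" using F(1)[OF xy(3)] by (simp add: Fxy a_minus_def E.M.r_neg)
    finally have "F (x \<ominus>\<^bsub>Z\<^esub> y) = \<zero>\<^bsub>E\<^esub>" .
    hence "x \<ominus>\<^bsub>Z\<^esub> y \<in> N" unfolding N using xy(1,3) by simp
    thus "C = C'" unfolding xy(2,4) using cos_eq_iff[OF xy(1,3)] by blast
  qed
  moreover have "h ` carrier (quot Z N) = carrier E"
  proof -
    have "carrier (quot Z N) = (\<lambda>z. N +>\<^bsub>Z\<^esub> z) ` carrier Z" by (auto simp: quot_carrier_iff)
    hence "h ` carrier (quot Z N) = F ` carrier Z" using h by (simp add: image_image)
    thus ?thesis using assms(4) by simp
  qed
  ultimately show ?thesis using h by (auto simp: bij_betw_def)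
qed

lemma quot_left_module:
  assumes "left_module S M" and q: "quotient_group N M" and sm: "\<And>a x. a \<in> carrier S \<Longrightarrow> x \<in> N \<Longrightarrow> a \<odot>\<^bsub>M\<^esub> x \<in> N"
  shows "left_module S (quot M N)"
    and "\<And>a x. a \<in> carrier S \<Longrightarrow> x \<in> carrier M \<Longrightarrow> a \<odot>\<^bsub>quot M N\<^esub> (N +>\<^bsub>M\<^esub> x) = N +>\<^bsub>M\<^esub> (a \<odot>\<^bsub>M\<^esub> x)"
proof -
  interpret M: left_module S M by fact
  interpret quotient_group N M by fact
  show *: "a \<odot>\<^bsub>quot M N\<^esub> (N +>\<^bsub>M\<^esub> x) = N +>\<^bsub>M\<^esub> (a \<odot>\<^bsub>M\<^esub> x)" if "a \<in> carrier S" "x \<in> carrier M" for a x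
    by (rule cos_smult) (use that sm in \<open>auto simp: M.smult_closed M.smult_r_distr\<close>)
  show "left_module S (quot M N)"
    by (intro left_module.intro left_module_axioms.intro quot_abelian M.A.ring_axioms)
      (auto simp: quot_carrier_iff * cos_add M.smult_closed M.smult_l_distr M.smult_r_distr M.smult_assoc M.smult_one)
qed

section \<open>Gradings\<close>

lemma (in abelian_monoid) finsum_delta:
  assumes "finite J" "\<And>j. j \<in> J \<Longrightarrow> f j \<in> carrier G" "\<And>j. j \<in> J \<Longrightarrow> j \<noteq> i \<Longrightarrow> f j = \<zero>" "i \<in> J"
  shows "(\<Oplus>j\<in>J. f j) = f i"
proof -
  have "(\<Oplus>j\<in>J. f j) = (\<Oplus>j\<in>J. if i = j then f j else \<zero>)"
    using assms by (intro finsum_cong') auto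
  also have "\<dots> = f i" using assms by (intro add.finprod_singleton) auto
  finally show ?thesis .
qed

lemma (in abelian_monoid) finsum_all_zero: "(\<And>j. j \<in> J \<Longrightarrow> f j = \<zero>) \<Longrightarrow> (\<Oplus>j\<in>J. f j) = \<zero>"
  by (rule add.finprod_one_eqI)

lemma (in abelian_monoid) finsum_swap:
  assumes "finite J" "finite K" "\<And>j k. j \<in> J \<Longrightarrow> k \<in> K \<Longrightarrow> f j k \<in> carrier G"
  shows "(\<Oplus>j\<in>J. \<Oplus>k\<in>K. f j k) = (\<Oplus>k\<in>K. \<Oplus>j\<in>J. f j k)"
  using assms(1,3)
proof (induction J rule: finite_induct)
  case (insert j J)
  have 1: "(\<Oplus>k\<in>K. f i k) \<in> carrier G" if "i \<in> insert j J" for i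
    using insert.prems that by (intro finsum_closed) auto
  have 2: "(\<Oplus>i\<in>J. f i k) \<in> carrier G" if "k \<in> K" for k
    using insert.prems that by (intro finsum_closed) auto
  have "(\<Oplus>i\<in>insert j J. \<Oplus>k\<in>K. f i k) = (\<Oplus>k\<in>K. f j k) \<oplus> (\<Oplus>k\<in>K. \<Oplus>i\<in>J. f i k)"
    using insert 1 by (subst finsum_insert) auto
  also have "\<dots> = (\<Oplus>k\<in>K. f j k \<oplus> (\<Oplus>i\<in>J. f i k))"
    using insert.prems 2 by (intro finsum_addf[symmetric]) auto
  also have "\<dots> = (\<Oplus>k\<in>K. \<Oplus>i\<in>insert j J. f i k)"
    using insert.hyps insert.prems 2 by (intro finsum_cong') (auto intro!: finsum_closed)
  finally show ?case .
qed (simp add: finsum_all_zero)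

lemma additive_map_finsum:
  assumes "abelian_group M" "abelian_group N" "\<And>x. x \<in> carrier M \<Longrightarrow> h x \<in> carrier N"
    "\<And>x y. x \<in> carrier M \<Longrightarrow> y \<in> carrier M \<Longrightarrow> h (x \<oplus>\<^bsub>M\<^esub> y) = h x \<oplus>\<^bsub>N\<^esub> h y" "f \<in> J \<rightarrow> carrier M"
  shows "h (\<Oplus>\<^bsub>M\<^esub>i\<in>J. f i) = (\<Oplus>\<^bsub>N\<^esub>i\<in>J. h (f i))" and "h \<zero>\<^bsub>M\<^esub> = \<zero>\<^bsub>N\<^esub>"
proof -
  interpret M: abelian_group M by fact
  interpret N: abelian_group N by fact
  have "h \<zero>\<^bsub>M\<^esub> \<oplus>\<^bsub>N\<^esub> h \<zero>\<^bsub>M\<^esub> = h \<zero>\<^bsub>M\<^esub>" using assms(4)[of "\<zero>\<^bsub>M\<^esub>" "\<zero>\<^bsub>M\<^esub>"] by simp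
  thus z: "h \<zero>\<^bsub>M\<^esub> = \<zero>\<^bsub>N\<^esub>" using assms(3)[OF M.zero_closed] by (metis N.r_neg1 N.l_neg)
  show "h (\<Oplus>\<^bsub>M\<^esub>i\<in>J. f i) = (\<Oplus>\<^bsub>N\<^esub>i\<in>J. h (f i))"
    using assms(5)
    by (induction J rule: infinite_finite_induct) (auto simp: z assms(3,4) Pi_iff)
qed

text \<open>Additive projections onto the pieces settle uniqueness: applied to any decomposition of
  \<open>x\<close>, the projection with index \<open>m\<close> returns its component of index
  \<open>m\<close>.\<close>

lemma internal_direct_sumI:
  fixes M :: "('m, 'r) ring_scheme" (structure)
  assumes M: "abelian_group M" and sub: "\<And>n. additive_subgroup (G n) M"
    and add: "\<And>n x y. x \<in> carrier M \<Longrightarrow> y \<in> carrier M \<Longrightarrow> \<pi> n (x \<oplus> y) = \<pi> n x \<oplus> \<pi> n y"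
    and id: "\<And>n x. x \<in> G n \<Longrightarrow> \<pi> n x = x" and other: "\<And>m n x. x \<in> G m \<Longrightarrow> m \<noteq> n \<Longrightarrow> \<pi> n x = \<zero>"
    and mem: "\<And>n x. x \<in> carrier M \<Longrightarrow> \<pi> n x \<in> G n"
    and fin: "\<And>x. x \<in> carrier M \<Longrightarrow> finite {n. \<pi> n x \<noteq> \<zero>}"
    and sum: "\<And>x. x \<in> carrier M \<Longrightarrow> x = (\<Oplus>n\<in>{n. \<pi> n x \<noteq> \<zero>}. \<pi> n x)"
  shows "internal_direct_sum M G"
proof -
  interpret M: abelian_group M by fact
  have sub': "G n \<subseteq> carrier M" for n by (rule additive_subgroup.a_subset[OF sub])
  show ?thesis unfolding internal_direct_sum_def
  proof (intro conjI allI ballI sub ex1I)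
    fix x assume x: "x \<in> carrier M"
    show "\<pi> n x \<in> G n" for n by (rule mem[OF x])
    show "finite {n. \<pi> n x \<noteq> \<zero>}" by (rule fin[OF x])
    show "x = (\<Oplus>n\<in>{n. \<pi> n x \<noteq> \<zero>}. \<pi> n x)" by (rule sum[OF x])
    fix f assume f: "(\<forall>n. f n \<in> G n) \<and> finite {n. f n \<noteq> \<zero>} \<and> x = (\<Oplus>n\<in>{n. f n \<noteq> \<zero>}. f n)"
    let ?S = "{n. f n \<noteq> \<zero>}"
    have fc: "f n \<in> carrier M" for n using f sub' by blast
    have \<pi>f: "m \<noteq> n \<Longrightarrow> \<pi> m (f n) = \<zero>" for m n using other[of "f n" n m] f by blast
    have \<pi>c: "x \<in> carrier M \<Longrightarrow> \<pi> n x \<in> carrier M" for n x using mem sub' by blast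
    show "f = (\<lambda>n. \<pi> n x)"
    proof
      fix m
      have "\<pi> m x = \<pi> m (\<Oplus>n\<in>?S. f n)" using f by simp
      also have "\<dots> = (\<Oplus>n\<in>?S. \<pi> m (f n))"
        by (rule additive_map_finsum(1)[OF M M]) (use \<pi>c fc add in auto)
      also have "\<dots> = f m"
      proof (cases "m \<in> ?S")
        case True
        have "(\<Oplus>n\<in>?S. \<pi> m (f n)) = \<pi> m (f m)"
          by (rule M.finsum_delta) (use f True fc \<pi>c \<pi>f in auto)
        thus ?thesis using f id by simp
      next
        case False
        have "(\<Oplus>n\<in>?S. \<pi> m (f n)) = \<zero>" by (rule M.finsum_all_zero, rule \<pi>f) (use False in auto)
        thus ?thesis using False by simp
      qed
      finally show "f m = \<pi> m x" by simp
    qed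
  qed
qed

locale graded_group = abelian_group M for M (structure) +
  fixes G :: "int \<Rightarrow> 'm set"
  assumes ids: "internal_direct_sum M G"
begin

lemma sub: "additive_subgroup (G n) M" using ids by (simp add: internal_direct_sum_def)

lemma G_carrier: "x \<in> G n \<Longrightarrow> x \<in> carrier M"
  using additive_subgroup.a_subset[OF sub] by blast

lemma G_closed [simp]: "\<zero> \<in> G n" "x \<in> G n \<Longrightarrow> y \<in> G n \<Longrightarrow> x \<oplus> y \<in> G n"
  using additive_subgroup.zero_closed[OF sub] additive_subgroup.a_closed[OF sub] by auto

lemma G_uminus: "x \<in> G n \<Longrightarrow> \<ominus> x \<in> G n"
  using additive_subgroup.a_inv_closed[OF sub] abelian_group_axioms by blast

lemma G_finsum: "(\<And>j. j \<in> J \<Longrightarrow> f j \<in> G n) \<Longrightarrow> (\<Oplus>j\<in>J. f j) \<in> G n"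
proof (induction J rule: infinite_finite_induct)
  case (insert j J)
  thus ?case using G_carrier by (subst finsum_insert) auto
qed auto

definition comp :: "int \<Rightarrow> 'm \<Rightarrow> 'm" where
  "comp n x = (THE f. (\<forall>n. f n \<in> G n) \<and> finite {n. f n \<noteq> \<zero>} \<and> x = (\<Oplus>n\<in>{n. f n \<noteq> \<zero>}. f n)) n"

lemma
  assumes "x \<in> carrier M"
  shows comp_in: "comp n x \<in> G n" and comp_fin: "finite {n. comp n x \<noteq> \<zero>}"
    and comp_sum0: "x = (\<Oplus>n\<in>{n. comp n x \<noteq> \<zero>}. comp n x)"
proof -
  have "\<exists>!f. (\<forall>n. f n \<in> G n) \<and> finite {n. f n \<noteq> \<zero>} \<and> x = (\<Oplus>n\<in>{n. f n \<noteq> \<zero>}. f n)"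
    using ids assms by (simp add: internal_direct_sum_def)
  from theI'[OF this] show "comp n x \<in> G n" "finite {n. comp n x \<noteq> \<zero>}"
    "x = (\<Oplus>n\<in>{n. comp n x \<noteq> \<zero>}. comp n x)" unfolding comp_def by simp_all
qed

lemma finsum_supp:
  assumes "\<And>n. f n \<in> carrier M" "finite J" "{n. f n \<noteq> \<zero>} \<subseteq> J"
  shows "(\<Oplus>n\<in>{n. f n \<noteq> \<zero>}. f n) = (\<Oplus>n\<in>J. f n)"
  using assms by (intro add.finprod_mono_neutral_cong_left) auto

lemma comp_sum:
  "x \<in> carrier M \<Longrightarrow> finite J \<Longrightarrow> {n. comp n x \<noteq> \<zero>} \<subseteq> J \<Longrightarrow> (\<Oplus>n\<in>J. comp n x) = x"
  using comp_sum0[of x] finsum_supp[of "\<lambda>n. comp n x" J, OF G_carrier[OF comp_in]] by simp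

lemma comp_unique:
  assumes f: "\<And>n. f n \<in> G n" "finite J" "{n. f n \<noteq> \<zero>} \<subseteq> J" and x: "x = (\<Oplus>n\<in>J. f n)"
  shows "comp n x = f n"
proof -
  have xc: "x \<in> carrier M" unfolding x using f(1) G_carrier by (intro finsum_closed) auto
  have ex: "\<exists>!f. (\<forall>n. f n \<in> G n) \<and> finite {n. f n \<noteq> \<zero>} \<and> x = (\<Oplus>n\<in>{n. f n \<noteq> \<zero>}. f n)"
    using ids xc by (simp add: internal_direct_sum_def)
  have "x = (\<Oplus>n\<in>{n. f n \<noteq> \<zero>}. f n)"
    unfolding x by (rule finsum_supp[symmetric]) (use f G_carrier in auto)
  moreover have "finite {n. f n \<noteq> \<zero>}" using f by (auto intro: finite_subset)
  ultimately have "(THE f. (\<forall>n. f n \<in> G n) \<and> finite {n. f n \<noteq> \<zero>} \<and> x = (\<Oplus>n\<in>{n. f n \<noteq> \<zero>}. f n)) = f"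
    using f(1) by (intro the1_equality[OF ex]) auto
  thus ?thesis by (simp add: comp_def)
qed

lemma comp_id: "x \<in> G n \<Longrightarrow> comp m x = (if m = n then x else \<zero>)"
  by (rule comp_unique[where J = "{n}"]) (auto simp: G_carrier)

lemma comp_add:
  assumes "x \<in> carrier M" "y \<in> carrier M"
  shows "comp n (x \<oplus> y) = comp n x \<oplus> comp n y"
proof (rule comp_unique)
  let ?J = "{n. comp n x \<noteq> \<zero>} \<union> {n. comp n y \<noteq> \<zero>}"
  show "comp n x \<oplus> comp n y \<in> G n" for n using comp_in assms by simp
  show J: "finite ?J" using comp_fin assms by simp
  show "{n. comp n x \<oplus> comp n y \<noteq> \<zero>} \<subseteq> ?J" by auto
  have "(\<Oplus>n\<in>?J. comp n x \<oplus> comp n y) = (\<Oplus>n\<in>?J. comp n x) \<oplus> (\<Oplus>n\<in>?J. comp n y)"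
    using comp_in assms G_carrier by (intro finsum_addf) auto
  also have "(\<Oplus>n\<in>?J. comp n x) = x" by (rule comp_sum[OF assms(1) J]) auto
  also have "(\<Oplus>n\<in>?J. comp n y) = y" by (rule comp_sum[OF assms(2) J]) auto
  finally show "x \<oplus> y = (\<Oplus>n\<in>?J. comp n x \<oplus> comp n y)" by simp
qed

end

lemma graded_ringD:
  assumes "graded_ring A GA"
  shows "ring A" "graded_group A GA" "\<one>\<^bsub>A\<^esub> \<in> GA 0" "a \<in> GA i \<Longrightarrow> b \<in> GA j \<Longrightarrow> a \<otimes>\<^bsub>A\<^esub> b \<in> GA (i + j)"
  using assms by (auto simp: graded_ring_def graded_group_def graded_group_axioms_def ring_def)

section \<open>Complexes of matrices\<close>

text \<open>Basis indices have to live in the list type prescribed by \<open>res\<close>; the list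
  of length \<open>k\<close> stands for the index \<open>k\<close>, and its entries carry no
  information.\<close>

definition tg :: "nat \<Rightarrow> ('m + 'a) list" where "tg k = replicate k (Inl undefined)"

lemma tg_inj [simp]: "tg k = tg l \<longleftrightarrow> k = l" by (metis tg_def length_replicate)

context ring
begin

definition fv :: "nat \<Rightarrow> (nat \<Rightarrow> 'a) \<Rightarrow> (('m + 'a) list \<Rightarrow> 'a)" where
  "fv n v = (\<lambda>l. if l \<in> tg ` {..<n} then v (length l) else \<zero>)"

lemma fv_tg [simp]: "k < n \<Longrightarrow> fv n v (tg k) = v k"
  by (auto simp: fv_def tg_def)

lemma fv_in: "(\<And>k. k < n \<Longrightarrow> v k \<in> carrier R) \<Longrightarrow> fv n v \<in> carrier (free_module R (tg ` {..<n}))"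
  by (auto simp: fv_def tg_def intro: finite_subset[of _ "tg ` {..<n}"])

lemma free_tg_eqI:
  fixes u v :: "('m + 'a) list \<Rightarrow> 'a"
  assumes "u \<in> carrier (free_module R (tg ` {..<n}))" "v \<in> carrier (free_module R (tg ` {..<n}))"
    "\<And>k. k < n \<Longrightarrow> u (tg k) = v (tg k)"
  shows "u = v"
  using assms by (intro free_module_eqI[OF assms(1,2)]) auto

lemma finsum_tg:
  fixes M :: "('a, 'm, 's) module_scheme"
  assumes "left_module R M" "\<And>k. k < n \<Longrightarrow> f (tg k :: ('i + 'a) list) \<in> carrier M"
  shows "(\<Oplus>\<^bsub>M\<^esub>i\<in>tg ` {..<n}. f i) = (\<Oplus>\<^bsub>M\<^esub>k\<in>{..<n}. f (tg k))"
proof -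
  interpret M: left_module R M by fact
  show ?thesis using assms(2) by (intro M.M.add.finprod_reindex) (auto simp: inj_on_def)
qed

lemma linmap_free_tg:
  fixes M :: "('a, 'm, 's) module_scheme"
  assumes N: "left_module R M" and h: "linmap R (free_module R (tg ` {..<n} :: ('i + 'a) list set)) M h"
    and u: "u \<in> carrier (free_module R (tg ` {..<n}))"
  shows "h u = (\<Oplus>\<^bsub>M\<^esub>k\<in>{..<n}. u (tg k) \<odot>\<^bsub>M\<^esub> h (dl (tg k)))"
proof -
  interpret M: left_module R M by fact
  have "h u = (\<Oplus>\<^bsub>M\<^esub>i\<in>tg ` {..<n}. u i \<odot>\<^bsub>M\<^esub> h (dl i))"
    by (rule linmap_free_expand[OF N h u]) (use u in auto)
  also have "\<dots> = (\<Oplus>\<^bsub>M\<^esub>k\<in>{..<n}. u (tg k) \<odot>\<^bsub>M\<^esub> h (dl (tg k)))"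
    by (rule finsum_tg[OF N]) (intro M.smult_closed free_in_carrier[OF u] linmapD(1)[OF h] dl_in, auto)
  finally show ?thesis .
qed

text \<open>Row vector times matrix, the form of a left linear differential. The transpose
  \<open>rmul\<close> multiplies a column from the left and is what acts on duals.\<close>

definition lmul :: "nat \<Rightarrow> (nat \<Rightarrow> nat \<Rightarrow> 'a) \<Rightarrow> (nat \<Rightarrow> 'a) \<Rightarrow> nat \<Rightarrow> 'a" where
  "lmul n D v j = (\<Oplus>k\<in>{..<n}. v k \<otimes> D k j)"

definition rmul :: "nat \<Rightarrow> (nat \<Rightarrow> nat \<Rightarrow> 'a) \<Rightarrow> (nat \<Rightarrow> 'a) \<Rightarrow> nat \<Rightarrow> 'a" where
  "rmul m D v k = (\<Oplus>j\<in>{..<m}. D k j \<otimes> v j)"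

lemma lmul_closed:
  "(\<And>k. k < n \<Longrightarrow> v k \<in> carrier R) \<Longrightarrow> (\<And>k. k < n \<Longrightarrow> D k j \<in> carrier R) \<Longrightarrow> lmul n D v j \<in> carrier R"
  unfolding lmul_def by (intro finsum_closed) auto

lemma rmul_closed:
  "(\<And>j. j < m \<Longrightarrow> v j \<in> carrier R) \<Longrightarrow> (\<And>j. j < m \<Longrightarrow> D k j \<in> carrier R) \<Longrightarrow> rmul m D v k \<in> carrier R"
  unfolding rmul_def by (intro finsum_closed) auto

lemma lmul_linmap:
  assumes D: "\<And>k j. k < n \<Longrightarrow> j < m \<Longrightarrow> D k j \<in> carrier R"
  shows "linmap R (free_module R (tg ` {..<n} :: ('i + 'a) list set)) (free_module R (tg ` {..<m} :: ('i + 'a) list set))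
    (\<lambda>u. fv m (lmul n D (\<lambda>k. u (tg k))))"
proof -
  let ?F = "free_module R (tg ` {..<n} :: ('i + 'a) list set)"
  let ?F' = "free_module R (tg ` {..<m} :: ('i + 'a) list set)"
  let ?h = "\<lambda>u :: ('i + 'a) list \<Rightarrow> 'a. fv m (lmul n D (\<lambda>k. u (tg k))) :: ('i + 'a) list \<Rightarrow> 'a"
  interpret F: left_module R ?F by (rule free_left_module)
  interpret F': left_module R ?F' by (rule free_left_module)
  have cl: "?h u \<in> carrier ?F'" if "u \<in> carrier ?F" for u
    using free_in_carrier[OF that] D by (intro fv_in lmul_closed) auto
  have add: "?h (u \<oplus>\<^bsub>?F\<^esub> v) = ?h u \<oplus>\<^bsub>?F'\<^esub> ?h v" if u: "u \<in> carrier ?F" and v: "v \<in> carrier ?F" for u v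
  proof (rule free_tg_eqI)
    note uc = free_in_carrier[OF u] and vc = free_in_carrier[OF v]
    fix j assume j: "j < m"
    have "lmul n D (\<lambda>k. (u \<oplus>\<^bsub>?F\<^esub> v) (tg k)) j = (\<Oplus>k\<in>{..<n}. u (tg k) \<otimes> D k j \<oplus> v (tg k) \<otimes> D k j)"
      unfolding lmul_def using uc vc D[OF _ j] by (intro finsum_cong') (auto simp: l_distr)
    also have "\<dots> = lmul n D (\<lambda>k. u (tg k)) j \<oplus> lmul n D (\<lambda>k. v (tg k)) j"
      unfolding lmul_def using uc vc D[OF _ j] by (intro finsum_addf) auto
    finally show "?h (u \<oplus>\<^bsub>?F\<^esub> v) (tg j) = (?h u \<oplus>\<^bsub>?F'\<^esub> ?h v) (tg j)" using j by simp
  qed (intro cl F.M.a_closed F'.M.a_closed u v)+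
  have sm: "?h (a \<odot>\<^bsub>?F\<^esub> u) = a \<odot>\<^bsub>?F'\<^esub> ?h u" if a: "a \<in> carrier R" and u: "u \<in> carrier ?F" for a u
  proof (rule free_tg_eqI)
    note uc = free_in_carrier[OF u]
    fix j assume j: "j < m"
    have "lmul n D (\<lambda>k. (a \<odot>\<^bsub>?F\<^esub> u) (tg k)) j = (\<Oplus>k\<in>{..<n}. a \<otimes> (u (tg k) \<otimes> D k j))"
      unfolding lmul_def using uc a D[OF _ j] by (intro finsum_cong') (auto simp: m_assoc)
    also have "\<dots> = a \<otimes> lmul n D (\<lambda>k. u (tg k)) j"
      unfolding lmul_def using uc a D[OF _ j] by (intro finsum_rdistr[symmetric]) auto
    finally show "?h (a \<odot>\<^bsub>?F\<^esub> u) (tg j) = (a \<odot>\<^bsub>?F'\<^esub> ?h u) (tg j)" using j by simp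
  qed (intro cl F.smult_closed F'.smult_closed u a)+
  show ?thesis unfolding linmap_def by (intro conjI ballI cl add sm)
qed

text \<open>The identity (uD)v = u(Dv). It turns vanishing matrix products into a complex and
  identifies the dual of \<open>lmul\<close> with \<open>rmul\<close>.\<close>

lemma lmul_assoc:
  assumes "\<And>k. k < n \<Longrightarrow> u k \<in> carrier R" "\<And>k j. k < n \<Longrightarrow> j < m \<Longrightarrow> D k j \<in> carrier R" "\<And>j. j < m \<Longrightarrow> v j \<in> carrier R"
  shows "(\<Oplus>j\<in>{..<m}. lmul n D u j \<otimes> v j) = (\<Oplus>k\<in>{..<n}. u k \<otimes> rmul m D v k)"
proof -
  have "(\<Oplus>j\<in>{..<m}. lmul n D u j \<otimes> v j) = (\<Oplus>j\<in>{..<m}. \<Oplus>k\<in>{..<n}. u k \<otimes> D k j \<otimes> v j)"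
    unfolding lmul_def using assms
    by (intro finsum_cong' finsum_ldistr) (auto intro!: finsum_closed)
  also have "\<dots> = (\<Oplus>k\<in>{..<n}. \<Oplus>j\<in>{..<m}. u k \<otimes> D k j \<otimes> v j)"
    using assms by (intro finsum_swap) auto
  also have "\<dots> = (\<Oplus>k\<in>{..<n}. \<Oplus>j\<in>{..<m}. u k \<otimes> (D k j \<otimes> v j))"
    using assms by (intro finsum_cong' refl) (auto intro!: finsum_closed finsum_cong' simp: m_assoc)
  also have "\<dots> = (\<Oplus>k\<in>{..<n}. u k \<otimes> rmul m D v k)"
    unfolding rmul_def using assms
    by (intro finsum_cong' finsum_rdistr[symmetric]) (auto intro!: finsum_closed)
  finally show ?thesis .
qed

end

lemma additive_subgroupI:
  assumes "abelian_group M" "N \<subseteq> carrier M" "\<zero>\<^bsub>M\<^esub> \<in> N"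
    "\<And>x y. x \<in> N \<Longrightarrow> y \<in> N \<Longrightarrow> x \<oplus>\<^bsub>M\<^esub> y \<in> N" "\<And>x. x \<in> N \<Longrightarrow> \<ominus>\<^bsub>M\<^esub> x \<in> N"
  shows "additive_subgroup N M"
proof -
  interpret M: abelian_group M by fact
  show ?thesis using assms by unfold_locales (auto simp flip: a_inv_def)
qed

lemma (in ring) regular_left_module: "left_module R (regular R)"
  by (intro left_module.intro left_module_axioms.intro ring_axioms abelian_group_cong[OF abelian_group_axioms])
     (auto simp: l_distr r_distr m_assoc)

lemma (in ring) opp_ring: "ring (opp R)"
proof (rule ringI)
  show "abelian_group (opp R)" by (rule abelian_group_cong[OF abelian_group_axioms]) auto
  show "Group.monoid (opp R)" by (rule monoidI) (auto simp: m_assoc)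
qed (auto simp: l_distr r_distr)

lemma (in ring) free_uminus: "u \<in> carrier (free_module R I) \<Longrightarrow> \<ominus>\<^bsub>free_module R I\<^esub> u = (\<lambda>i. \<ominus> u i)"
proof -
  assume u: "u \<in> carrier (free_module R I)"
  interpret F: left_module R "free_module R I" by (rule free_left_module)
  have fin: "finite {i. \<ominus> u i \<noteq> \<zero>}"
    by (rule finite_subset[of _ "{i. u i \<noteq> \<zero>}"]) (use u in auto)
  have "(\<lambda>i. \<ominus> u i) \<oplus>\<^bsub>free_module R I\<^esub> u = \<zero>\<^bsub>free_module R I\<^esub>"
    using free_in_carrier[OF u] by (simp add: l_neg)
  thus ?thesis using u fin by (intro F.M.minus_equality) auto
qed

section \<open>Resolutions given by matrices\<close>

type_synonym ('i, 'a) fvec = "('i + 'a) list \<Rightarrow> 'a"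

text \<open>All entries have degree 1; with the generators of the \<open>i\<close>-th term placed in
  degree \<open>i\<close> the differentials preserve degrees, which is the pattern required by the
  Koszul property. \<open>lex\<close> is exactness in the positions \<open>Suc i\<close>; position 0
  is left to an augmentation.\<close>

locale matrix_complex = ring A for A :: "('a, 'r) ring_scheme" (structure) +
  fixes GA :: "int \<Rightarrow> 'a set" and n :: "nat \<Rightarrow> nat" and D :: "nat \<Rightarrow> nat \<Rightarrow> nat \<Rightarrow> 'a"
  assumes gr: "graded_ring A GA" and nz: "\<one> \<noteq> \<zero>" and n0: "n 0 = 1"
    and Ddeg: "k < n (Suc i) \<Longrightarrow> j < n i \<Longrightarrow> D i k j \<in> GA 1"
    and cplx: "k < n (Suc (Suc i)) \<Longrightarrow> j < n i \<Longrightarrow> lmul (n (Suc i)) (D i) (D (Suc i) k) j = \<zero>"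
    and lex: "(\<And>k. k < n (Suc i) \<Longrightarrow> u k \<in> carrier A) \<Longrightarrow> (\<And>j. j < n i \<Longrightarrow> lmul (n (Suc i)) (D i) u j = \<zero>) \<Longrightarrow>
      \<exists>v. (\<forall>k<n (Suc (Suc i)). v k \<in> carrier A) \<and> (\<forall>k<n (Suc i). u k = lmul (n (Suc (Suc i))) (D (Suc i)) v k)"
begin

sublocale G: graded_group A GA by (rule graded_ringD(2)[OF gr])

lemma Dc: "k < n (Suc i) \<Longrightarrow> j < n i \<Longrightarrow> D i k j \<in> carrier A"
  using Ddeg G.G_carrier by blast

definition P :: "nat \<Rightarrow> ('a, ('i, 'a) fvec) module" where
  "P i = free_module A (tg ` {..<n i})"

definition d :: "nat \<Rightarrow> ('i, 'a) fvec \<Rightarrow> ('i, 'a) fvec" where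
  "d i = restrict (\<lambda>u. fv (n i) (lmul (n (Suc i)) (D i) (\<lambda>k. u (tg k)))) (carrier (P (Suc i)))"

definition GP :: "nat \<Rightarrow> int \<Rightarrow> ('i, 'a) fvec set" where
  "GP i m = {u \<in> carrier (P i). \<forall>k<n i. u (tg k) \<in> GA (m - int i)}"

lemma P_module: "left_module A (P i)" unfolding P_def by (rule free_left_module)

lemma P_zero: "\<zero>\<^bsub>P i\<^esub> \<in> carrier (P i)" by (simp add: P_def)

lemma P_projective: "projective A (P i)" unfolding P_def by (rule projective_free[OF nz])

lemma Pc: "u \<in> carrier (P i) \<Longrightarrow> u l \<in> carrier A" unfolding P_def by (rule free_in_carrier)

lemma P_simps: "\<zero>\<^bsub>P i\<^esub> = (\<lambda>l. \<zero>)" "u \<oplus>\<^bsub>P i\<^esub> v = (\<lambda>l. u l \<oplus> v l)" "a \<odot>\<^bsub>P i\<^esub> u = (\<lambda>l. a \<otimes> u l)"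
  by (simp_all add: P_def)

lemma P_eqI: "u \<in> carrier (P i) \<Longrightarrow> v \<in> carrier (P i) \<Longrightarrow> (\<And>k. k < n i \<Longrightarrow> u (tg k) = v (tg k)) \<Longrightarrow> u = v"
  unfolding P_def by (rule free_tg_eqI)

lemma P_zero_outside: "u \<in> carrier (P i) \<Longrightarrow> l \<notin> tg ` {..<n i} \<Longrightarrow> u l = \<zero>"
  by (simp add: P_def)

lemma fv_P: "(\<And>k. k < n i \<Longrightarrow> v k \<in> carrier A) \<Longrightarrow> fv (n i) v \<in> carrier (P i)"
  unfolding P_def by (rule fv_in)

lemma d_lin: "d i \<in> lin_maps A (P (Suc i)) (P i)"
  unfolding d_def
  by (rule linmap_restrict[OF P_module], unfold P_def, rule lmul_linmap) (rule Dc)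

lemma d_tg: "u \<in> carrier (P (Suc i)) \<Longrightarrow> j < n i \<Longrightarrow> d i u (tg j) = lmul (n (Suc i)) (D i) (\<lambda>k. u (tg k)) j"
  by (simp add: d_def)

lemma d_linmap: "linmap A (P (Suc i)) (P i) (d i)"
  by (rule conjunct1[OF iffD1[OF lin_maps_iff d_lin]])

lemma dP: "u \<in> carrier (P (Suc i)) \<Longrightarrow> d i u \<in> carrier (P i)"
  by (rule linmapD(1)[OF d_linmap])

lemma d_zero_iff:
  fixes u :: "('i, 'a) fvec"
  assumes "u \<in> carrier (P (Suc i))"
  shows "d i u = \<zero>\<^bsub>P i\<^esub> \<longleftrightarrow> (\<forall>j<n i. lmul (n (Suc i)) (D i) (\<lambda>k. u (tg k)) j = \<zero>)"
proof
  assume "d i u = \<zero>\<^bsub>P i\<^esub>"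
  thus "\<forall>j<n i. lmul (n (Suc i)) (D i) (\<lambda>k. u (tg k)) j = \<zero>"
    using d_tg[OF assms] by (simp add: P_simps)
next
  assume "\<forall>j<n i. lmul (n (Suc i)) (D i) (\<lambda>k. u (tg k)) j = \<zero>"
  thus "d i u = \<zero>\<^bsub>P i\<^esub>"
    using d_tg[OF assms] by (intro P_eqI[of _ i] dP P_zero assms) (auto simp: P_simps)
qed

lemma lmul_cplx:
  assumes "\<And>k. k < n (Suc (Suc i)) \<Longrightarrow> v k \<in> carrier A" "j < n i"
  shows "lmul (n (Suc i)) (D i) (lmul (n (Suc (Suc i))) (D (Suc i)) v) j = \<zero>"
proof -
  have "lmul (n (Suc i)) (D i) (lmul (n (Suc (Suc i))) (D (Suc i)) v) j
    = (\<Oplus>k\<in>{..<n (Suc (Suc i))}. v k \<otimes> rmul (n (Suc i)) (D (Suc i)) (\<lambda>l. D i l j) k)"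
    unfolding lmul_def[of "n (Suc i)" "D i"]
    by (rule lmul_assoc) (use assms Dc in auto)
  also have "\<dots> = \<zero>"
  proof (rule finsum_all_zero)
    fix k assume "k \<in> {..<n (Suc (Suc i))}"
    thus "v k \<otimes> rmul (n (Suc i)) (D (Suc i)) (\<lambda>l. D i l j) k = \<zero>"
      using cplx[of k i j] assms by (simp add: rmul_def lmul_def)
  qed
  finally show ?thesis .
qed

lemma d_exact: "{x \<in> carrier (P (Suc i) :: ('a, ('i, 'a) fvec) module). d i x = \<zero>\<^bsub>P i\<^esub>} = d (Suc i) ` carrier (P (Suc (Suc i)))"
proof (intro subset_antisym subsetI)
  fix u :: "('i, 'a) fvec" assume "u \<in> {x \<in> carrier (P (Suc i)). d i x = \<zero>\<^bsub>P i\<^esub>}"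
  hence u: "u \<in> carrier (P (Suc i))" "d i u = \<zero>\<^bsub>P i\<^esub>" by auto
  obtain v where v: "\<And>k. k < n (Suc (Suc i)) \<Longrightarrow> v k \<in> carrier A"
    "\<And>k. k < n (Suc i) \<Longrightarrow> u (tg k) = lmul (n (Suc (Suc i))) (D (Suc i)) v k"
    using lex[of i "\<lambda>k. u (tg k)"] u Pc[OF u(1)] d_zero_iff[OF u(1)] by blast
  have "u = d (Suc i) (fv (n (Suc (Suc i))) v)"
  proof (rule P_eqI[OF u(1) dP[OF fv_P]])
    show "k < n (Suc (Suc i)) \<Longrightarrow> v k \<in> carrier A" for k by (rule v(1))
    fix k assume k: "k < n (Suc i)"
    have "lmul (n (Suc (Suc i))) (D (Suc i)) (\<lambda>k. fv (n (Suc (Suc i))) v (tg k :: ('i + 'a) list)) k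
      = lmul (n (Suc (Suc i))) (D (Suc i)) v k"
      unfolding lmul_def using v(1) Dc k by (intro finsum_cong') auto
    moreover have "d (Suc i) (fv (n (Suc (Suc i))) v) (tg k :: ('i + 'a) list) =
      lmul (n (Suc (Suc i))) (D (Suc i)) (\<lambda>k. fv (n (Suc (Suc i))) v (tg k :: ('i + 'a) list)) k"
      using v(1) k by (intro d_tg fv_P)
    ultimately show "u (tg k) = d (Suc i) (fv (n (Suc (Suc i))) v) (tg k :: ('i + 'a) list)"
      using v(2)[OF k] by simp
  qed
  thus "u \<in> d (Suc i) ` carrier (P (Suc (Suc i)))" using fv_P v(1) by blast
next
  fix u :: "('i, 'a) fvec" assume "u \<in> d (Suc i) ` carrier (P (Suc (Suc i)))"
  then obtain v where v: "v \<in> carrier (P (Suc (Suc i)))" "u = d (Suc i) v" by auto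
  have u: "u \<in> carrier (P (Suc i))" using v dP by blast
  moreover have "lmul (n (Suc i)) (D i) (\<lambda>k. u (tg k)) j = \<zero>" if j: "j < n i" for j
  proof -
    have "lmul (n (Suc i)) (D i) (\<lambda>k. u (tg k)) j
        = lmul (n (Suc i)) (D i) (lmul (n (Suc (Suc i))) (D (Suc i)) (\<lambda>k. v (tg k))) j"
      unfolding lmul_def[of "n (Suc i)" "D i"]
      using v Pc[OF v(1)] Dc j by (intro finsum_cong') (auto simp: d_tg intro!: lmul_closed)
    thus ?thesis using lmul_cplx[of i "\<lambda>k. v (tg k)" j] Pc[OF v(1)] j by simp
  qed
  ultimately show "u \<in> {x \<in> carrier (P (Suc i)). d i x = \<zero>\<^bsub>P i\<^esub>}" using d_zero_iff by blast
qed

lemma dl_GP: "k < n i \<Longrightarrow> dl (tg k) \<in> GP i (int i)"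
  using graded_ringD(3)[OF gr] by (auto simp: GP_def P_def dl_def)

lemma P_generates: "generates A (P i :: ('a, ('i, 'a) fvec) module) (dl ` tg ` {..<n i})"
  unfolding generates_def
proof (intro conjI allI impI)
  let ?P = "P i :: ('a, ('i, 'a) fvec) module"
  show "dl ` tg ` {..<n i} \<subseteq> carrier ?P" by (auto simp: P_def dl_def)
  fix N assume N: "submodule N A ?P \<and> dl ` tg ` {..<n i} \<subseteq> N"
  interpret P: left_module A ?P by (rule P_module)
  interpret N: submodule N A ?P using N by blast
  have N_add: "x \<oplus>\<^bsub>?P\<^esub> y \<in> N" if "x \<in> N" "y \<in> N" for x y using N.m_closed that by simp
  have N_zero: "\<zero>\<^bsub>?P\<^esub> \<in> N" using N.one_closed by simp
  have N_sub: "N \<subseteq> carrier ?P" using N.subset by simp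
  have fin: "(\<Oplus>\<^bsub>?P\<^esub>k\<in>J. f k) \<in> N" if "\<And>k. k \<in> J \<Longrightarrow> f k \<in> N" for f :: "nat \<Rightarrow> _" and J
    using that
  proof (induction J rule: infinite_finite_induct)
    case (insert j J)
    thus ?case using N_add N_sub by (subst P.M.finsum_insert) auto
  qed (auto simp: N_zero)
  show "N = carrier ?P"
  proof (intro subset_antisym N_sub subsetI)
    fix u assume u: "u \<in> carrier ?P"
    have "u = (\<Oplus>\<^bsub>?P\<^esub>k\<in>{..<n i}. u (tg k) \<odot>\<^bsub>?P\<^esub> dl (tg k))"
      using u unfolding P_def by (intro linmap_free_tg free_left_module) (auto simp: linmap_def)
    also have "\<dots> \<in> N"
      using N Pc[OF u] by (intro fin N.smult_closed) auto
    finally show "u \<in> N" .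
  qed
qed

lemma P_generates_degree: "generates A (P i) (GP i (int i))"
proof -
  have "dl ` tg ` {..<n i} \<subseteq> GP i (int i)" using dl_GP by blast
  moreover have "GP i (int i) \<subseteq> carrier (P i)" by (auto simp: GP_def)
  ultimately show ?thesis using P_generates unfolding generates_def by (meson order_trans)
qed

lemma P_finitely_generated: "finitely_generated A (P i)"
  unfolding finitely_generated_def using P_generates by (intro exI[of _ "dl ` tg ` {..<n i}"]) simp

text \<open>Homogeneous components are taken entry by entry, in degree \<open>m - i\<close> because
  the basis of \<open>P i\<close> has degree \<open>i\<close>.\<close>

lemma P_graded: "graded_module A GA (P i :: ('a, ('i, 'a) fvec) module) (GP i)"
proof -
  interpret P: left_module A "P i :: ('a, ('i, 'a) fvec) module" by (rule P_module)
  let ?P = "P i :: ('a, ('i, 'a) fvec) module"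
  have comp0: "G.comp m \<zero> = \<zero>" for m using G.comp_id[of \<zero> m m] by simp
  define \<pi> where "\<pi> m u = (\<lambda>l. G.comp (m - int i) (u l))" for m and u :: "('i, 'a) fvec"
  have compc: "x \<in> carrier A \<Longrightarrow> G.comp m x \<in> carrier A" for m x using G.comp_in G.G_carrier by blast
  have \<pi>P: "\<pi> m u \<in> carrier (?P)" if u: "u \<in> carrier (?P)" for m u
  proof -
    have "{l. \<pi> m u l \<noteq> \<zero>} \<subseteq> tg ` {..<n i}" using P_zero_outside[OF u] comp0 unfolding \<pi>_def by fastforce
    hence "finite {l. \<pi> m u l \<noteq> \<zero>}" by (rule finite_subset) simp
    thus ?thesis using P_zero_outside[OF u] compc[OF Pc[OF u]] by (simp add: P_def \<pi>_def comp0)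
  qed
  have eval: "(\<Oplus>\<^bsub>?P\<^esub>j\<in>J. f j) l = (\<Oplus>j\<in>J. f j l)" if "f \<in> J \<rightarrow> carrier (?P)" for f :: "int \<Rightarrow> ('i, 'a) fvec" and J l
    by (rule additive_map_finsum(1)[of "?P" A "\<lambda>u. u l"])
       (use that P.M.abelian_group_axioms abelian_group_axioms in \<open>auto simp: P_simps Pc\<close>)
  have "internal_direct_sum (?P) (GP i)"
  proof (rule internal_direct_sumI[where \<pi> = \<pi>])
    show "abelian_group (?P)" ..
    show "additive_subgroup (GP i m) (?P)" for m
    proof (rule additive_subgroupI[OF P.M.abelian_group_axioms])
      show "\<ominus>\<^bsub>?P\<^esub> x \<in> GP i m" if "x \<in> GP i m" for x
        using that G.G_uminus free_uminus[of x "tg ` {..<n i}"] P.M.a_inv_closed[of x]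
        by (auto simp: GP_def P_def)
    qed (auto simp: GP_def P_simps intro: P.M.zero_closed[unfolded P_simps] P.M.a_closed[unfolded P_simps])
    show "\<pi> m (x \<oplus>\<^bsub>?P\<^esub> y) = \<pi> m x \<oplus>\<^bsub>?P\<^esub> \<pi> m y" if "x \<in> carrier (?P)" "y \<in> carrier (?P)" for m x y
      using Pc[OF that(1)] Pc[OF that(2)] by (simp add: \<pi>_def P_simps G.comp_add)
    show "\<pi> m x = x" if "x \<in> GP i m" for m x
    proof (rule P_eqI)
      show "x \<in> carrier (?P)" "\<pi> m x \<in> carrier (?P)" using that \<pi>P by (auto simp: GP_def)
    qed (use that in \<open>auto simp: GP_def \<pi>_def G.comp_id\<close>)
    show "\<pi> m x = \<zero>\<^bsub>?P\<^esub>" if "x \<in> GP i m'" "m' \<noteq> m" for m m' x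
    proof (rule P_eqI)
      show "\<pi> m x \<in> carrier (?P)" "\<zero>\<^bsub>?P\<^esub> \<in> carrier (?P)" using that \<pi>P by (auto simp: GP_def)
      fix k assume "k < n i"
      hence "x (tg k) \<in> GA (m' - int i)" using that by (auto simp: GP_def)
      thus "\<pi> m x (tg k) = \<zero>\<^bsub>?P\<^esub> (tg k)" using that(2) by (simp add: \<pi>_def P_simps G.comp_id)
    qed
    fix x assume x: "x \<in> carrier (?P)"
    show "\<pi> m x \<in> GP i m" for m using \<pi>P[OF x] Pc[OF x] by (simp add: GP_def \<pi>_def G.comp_in)
    let ?S = "{m. \<pi> m x \<noteq> \<zero>\<^bsub>?P\<^esub>}"
    have "?S \<subseteq> (\<Union>k<n i. (\<lambda>m. m + int i) ` {m. G.comp m (x (tg k)) \<noteq> \<zero>})"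
    proof
      fix m assume "m \<in> ?S"
      then obtain k where "k < n i" "\<pi> m x (tg k) \<noteq> \<zero>\<^bsub>?P\<^esub> (tg k)"
        using P_eqI[OF \<pi>P[OF x] P.M.zero_closed] by blast
      thus "m \<in> (\<Union>k<n i. (\<lambda>m. m + int i) ` {m. G.comp m (x (tg k)) \<noteq> \<zero>})"
        by (auto simp: \<pi>_def P_simps intro!: bexI[of _ k] image_eqI[of _ _ "m - int i"])
    qed
    thus fin: "finite ?S" by (rule finite_subset) (use G.comp_fin Pc[OF x] in auto)
    show "x = (\<Oplus>\<^bsub>?P\<^esub>m\<in>?S. \<pi> m x)"
    proof (rule P_eqI[OF x P.M.finsum_closed])
      show "(\<lambda>m. \<pi> m x) \<in> ?S \<rightarrow> carrier (?P)" using \<pi>P[OF x] by auto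
      fix k assume k: "k < n i"
      let ?y = "x (tg k)" and ?S' = "(\<lambda>m. m - int i) ` ?S"
      have "(\<Oplus>\<^bsub>?P\<^esub>m\<in>?S. \<pi> m x) (tg k) = (\<Oplus>m\<in>?S. G.comp (m - int i) ?y)"
        using \<pi>P[OF x] by (subst eval) (auto simp: \<pi>_def)
      also have "\<dots> = (\<Oplus>m\<in>?S'. G.comp m ?y)"
        using compc[OF Pc[OF x]] by (intro add.finprod_reindex[symmetric]) (auto simp: inj_on_def)
      also have "\<dots> = ?y"
      proof (rule G.comp_sum[OF Pc[OF x]])
        show "{m. G.comp m ?y \<noteq> \<zero>} \<subseteq> ?S'"
        proof
          fix m assume "m \<in> {m. G.comp m ?y \<noteq> \<zero>}"
          hence "\<pi> (m + int i) x (tg k) \<noteq> \<zero>\<^bsub>?P\<^esub> (tg k)" by (simp add: \<pi>_def P_simps)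
          hence "m + int i \<in> ?S" by auto
          thus "m \<in> ?S'" by (rule image_eqI[rotated]) simp
        qed
      qed (use fin in simp)
      finally show "x (tg k) = (\<Oplus>\<^bsub>?P\<^esub>m\<in>?S. \<pi> m x) (tg k)" by simp
    qed
  qed
  moreover have "a \<odot>\<^bsub>?P\<^esub> x \<in> GP i (i' + j)" if "a \<in> GA i'" "x \<in> GP i j"
    for x :: "('i, 'a) fvec" and a i' j using that P.smult_closed[of a x] G.G_carrier graded_ringD(4)[OF gr, of a i' _ "j - int i"]
    by (auto simp: GP_def P_simps add_diff_eq)
  ultimately show ?thesis unfolding graded_module_def using gr P_module by blast
qed

lemma d_degree: "d i ` GP (Suc i) m \<subseteq> GP i m"
proof
  fix v assume "v \<in> d i ` GP (Suc i) m"
  then obtain u where u: "u \<in> GP (Suc i) m" "v = d i u" by auto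
  hence uc: "u \<in> carrier (P (Suc i))" by (simp add: GP_def)
  have "d i u (tg j) \<in> GA (m - int i)" if j: "j < n i" for j
    unfolding d_tg[OF uc j] lmul_def
  proof (rule G.G_finsum)
    fix k assume "k \<in> {..<n (Suc i)}"
    hence "u (tg k) \<in> GA (m - int (Suc i))" "D i k j \<in> GA 1" using u Ddeg j by (auto simp: GP_def)
    from graded_ringD(4)[OF gr this] show "u (tg k) \<otimes> D i k j \<in> GA (m - int i)" by simp
  qed
  thus "v \<in> GP i m" using dP[OF uc] u by (simp add: GP_def)
qed

end

text \<open>Since \<open>P 0\<close> has rank one, the augmentation can be given on the ring itself;
  its kernel is generated by the entries of the first matrix.\<close>

locale matrix_resolution = matrix_complex A GA n D for A :: "('a, 'r) ring_scheme" (structure) and GA n D +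
  fixes N :: "('a, 'm, 's) module_scheme" and GN :: "int \<Rightarrow> 'm set" and \<epsilon> :: "'a \<Rightarrow> 'm"
  assumes GN: "graded_module A GA N GN" and \<epsilon>: "linmap A (regular A) N \<epsilon>"
    and \<epsilon>_surj: "\<epsilon> ` carrier A = carrier N"
    and \<epsilon>_ker: "a \<in> carrier A \<Longrightarrow> \<epsilon> a = \<zero>\<^bsub>N\<^esub> \<longleftrightarrow> (\<exists>v. (\<forall>k<n 1. v k \<in> carrier A) \<and> a = lmul (n 1) (D 0) v 0)"
    and \<epsilon>_deg: "a \<in> GA m \<Longrightarrow> \<epsilon> a \<in> GN m"
begin

definition e :: "(('m + 'a) list \<Rightarrow> 'a) \<Rightarrow> 'm" where "e = restrict (\<lambda>u. \<epsilon> (u (tg 0))) (carrier (P 0))"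

lemma resolution: "graded_projective_resolution A GA N GN P GP d e"
proof -
  have N: "left_module A N" using GN by (simp add: graded_module_def)
  have elin: "linmap A (P 0) N (\<lambda>u :: ('m, 'a) fvec. \<epsilon> (u (tg 0)))"
  proof -
    have "u (tg 0) \<in> carrier A" if "u \<in> carrier (P 0)" for u :: "('m, 'a) fvec" by (rule Pc[OF that])
    thus ?thesis using linmapD[OF \<epsilon>] by (simp add: linmap_def P_simps)
  qed
  have e_surj: "e ` carrier (P 0) = carrier N"
  proof (intro subset_antisym subsetI)
    show "y \<in> carrier N" if "y \<in> e ` carrier (P 0)" for y
      using that linmapD(1)[OF elin] by (auto simp: e_def)
    fix y assume "y \<in> carrier N"
    then obtain a where a: "a \<in> carrier A" "y = \<epsilon> a" using \<epsilon>_surj by auto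
    define u where "u = (fv (n 0) (\<lambda>_. a) :: ('m, 'a) fvec)"
    have u: "u \<in> carrier (P 0)" unfolding u_def using a by (intro fv_P)
    moreover have "u (tg 0) = a" using n0 by (simp add: u_def)
    ultimately have "e u = y" using a by (simp add: e_def)
    thus "y \<in> e ` carrier (P 0)" using u by blast
  qed
  have e_ker: "{x \<in> carrier (P 0). e x = \<zero>\<^bsub>N\<^esub>} = d 0 ` carrier (P 1)"
  proof (intro subset_antisym subsetI)
    fix u assume "u \<in> {x \<in> carrier (P 0). e x = \<zero>\<^bsub>N\<^esub>}"
    hence u: "u \<in> carrier (P 0)" "\<epsilon> (u (tg 0)) = \<zero>\<^bsub>N\<^esub>" by (auto simp: e_def)
    then obtain v where v: "\<And>k. k < n 1 \<Longrightarrow> v k \<in> carrier A" "u (tg 0) = lmul (n 1) (D 0) v 0"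
      using \<epsilon>_ker Pc[OF u(1)] by blast
    have fvP: "(fv (n 1) v :: ('m, 'a) fvec) \<in> carrier (P (Suc 0))" using fv_P[of "Suc 0" v] v by simp
    have "u = d 0 (fv (n 1) v)"
    proof (rule P_eqI[OF u(1) dP[OF fvP]])
      fix k assume k: "k < n 0"
      have "lmul (n 1) (D 0) (\<lambda>k. fv (n 1) v (tg k :: ('m + 'a) list)) 0 = lmul (n 1) (D 0) v 0"
        unfolding lmul_def using v(1) Dc[of _ 0 0] n0 by (intro finsum_cong') auto
      thus "u (tg k) = d 0 (fv (n 1) v) (tg k :: ('m + 'a) list)" using k n0 v d_tg[OF fvP k] by simp
    qed
    thus "u \<in> d 0 ` carrier (P 1)" using fvP by simp
  next
    fix u :: "('m, 'a) fvec" assume "u \<in> d 0 ` carrier (P 1)"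
    then obtain v where v: "v \<in> carrier (P (Suc 0))" "u = d 0 v" by auto
    have "u (tg 0) = lmul (n 1) (D 0) (\<lambda>k. v (tg k)) 0" using d_tg[OF v(1), of 0] n0 v by simp
    hence "\<exists>v. (\<forall>k<n 1. v k \<in> carrier A) \<and> u (tg 0) = lmul (n 1) (D 0) v 0"
      using Pc[OF v(1)] by (intro exI[of _ "\<lambda>k. v (tg k)"]) simp
    moreover have u: "u \<in> carrier (P 0)" using dP v by blast
    ultimately have "\<epsilon> (u (tg 0)) = \<zero>\<^bsub>N\<^esub>" using \<epsilon>_ker[OF Pc[OF u]] by blast
    thus "u \<in> {x \<in> carrier (P 0). e x = \<zero>\<^bsub>N\<^esub>}" using u by (simp add: e_def)
  qed
  have e_deg: "e ` GP 0 m \<subseteq> GN m" for m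
    using \<epsilon>_deg n0 by (auto simp: e_def GP_def)
  have e_lin: "e \<in> lin_maps A (P 0) N" unfolding e_def by (rule linmap_restrict[OF P_module elin])
  show ?thesis
    unfolding graded_projective_resolution_def projective_resolution_def
    by (intro conjI allI N P_projective e_lin d_lin e_surj e_ker d_exact GN P_graded e_deg d_degree)
qed

end

lemma zero_left_module: "ring A \<Longrightarrow> left_module A zero_module"
proof -
  assume "ring A"
  moreover have "abelian_group zero_module" by (rule abelian_groupI) (auto simp: zero_module_def)
  ultimately show ?thesis
    by (intro left_module.intro left_module_axioms.intro) (auto simp: zero_module_def)
qed

section \<open>The dual complex and Ext\<close>

context matrix_resolution
begin

abbreviation Q :: "nat \<Rightarrow> ('a, ('m, 'a) fvec) module" where "Q \<equiv> P"
abbreviation \<delta> :: "nat \<Rightarrow> ('m, 'a) fvec \<Rightarrow> ('m, 'a) fvec" where "\<delta> \<equiv> d"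
abbreviation GQ :: "nat \<Rightarrow> int \<Rightarrow> ('m, 'a) fvec set" where "GQ \<equiv> GP"
abbreviation L :: "nat \<Rightarrow> (('m, 'a) fvec \<Rightarrow> 'a) set" where "L i \<equiv> lin_maps A (Q i) (regular A)"
abbreviation Z where "Z \<equiv> cocycles A GA Q GQ \<delta>"
abbreviation B where "B \<equiv> coboundaries A GA Q GQ \<delta>"
abbreviation hom where "hom i \<equiv> homogeneous_maps A GA (Q i) (GQ i)"

text \<open>The values on the basis identify a map \<open>P i \<rightarrow> A\<close> with a column
  vector; \<open>hm\<close> is the inverse.\<close>

definition vl :: "(('m, 'a) fvec \<Rightarrow> 'a) \<Rightarrow> nat \<Rightarrow> 'a" where "vl h k = h (dl (tg k))"

lemma dlQ: "k < n i \<Longrightarrow> dl (tg k) \<in> carrier (Q i)"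
  unfolding P_def by (rule dl_in) simp

lemma LD:
  assumes "h \<in> L i"
  shows "x \<in> carrier (Q i) \<Longrightarrow> h x \<in> carrier A"
    "x \<in> carrier (Q i) \<Longrightarrow> y \<in> carrier (Q i) \<Longrightarrow> h (x \<oplus>\<^bsub>Q i\<^esub> y) = h x \<oplus> h y"
    "a \<in> carrier A \<Longrightarrow> x \<in> carrier (Q i) \<Longrightarrow> h (a \<odot>\<^bsub>Q i\<^esub> x) = a \<otimes> h x"
    "h \<in> extensional (carrier (Q i))"
  using assms linmapD[of A "Q i" "regular A" h] by (simp_all add: lin_maps_iff)

lemma LI:
  assumes "\<And>x. x \<in> carrier (Q i) \<Longrightarrow> h x \<in> carrier A"
    "\<And>x y. x \<in> carrier (Q i) \<Longrightarrow> y \<in> carrier (Q i) \<Longrightarrow> h (x \<oplus>\<^bsub>Q i\<^esub> y) = h x \<oplus> h y"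
    "\<And>a x. a \<in> carrier A \<Longrightarrow> x \<in> carrier (Q i) \<Longrightarrow> h (a \<odot>\<^bsub>Q i\<^esub> x) = a \<otimes> h x"
  shows "restrict h (carrier (Q i)) \<in> L i"
  by (rule linmap_restrict[OF P_module]) (simp add: linmap_def assms)

lemma vl_closed: "h \<in> L i \<Longrightarrow> k < n i \<Longrightarrow> vl h k \<in> carrier A"
  unfolding vl_def by (intro LD(1) dlQ)

lemma L_eval: "h \<in> L i \<Longrightarrow> u \<in> carrier (Q i) \<Longrightarrow> h u = (\<Oplus>k\<in>{..<n i}. u (tg k) \<otimes> vl h k)"
proof -
  assume h: "h \<in> L i" and u: "u \<in> carrier (Q i)"
  have "h u = (\<Oplus>\<^bsub>regular A\<^esub>k\<in>{..<n i}. u (tg k) \<otimes> vl h k)"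
    using linmap_free_tg[OF regular_left_module, of "n i" h u] h u
    by (simp add: vl_def lin_maps_iff P_def)
  also have "\<dots> = (\<Oplus>k\<in>{..<n i}. u (tg k) \<otimes> vl h k)"
    using vl_closed[OF h] Pc[OF u]
    by (intro additive_map_finsum(1)[of "regular A" A "\<lambda>x. x"] abelian_group_axioms
        left_module.axioms(2)[OF regular_left_module]) auto
  finally show ?thesis .
qed

lemma L_eqI:
  assumes h: "h \<in> L i" "h' \<in> L i" and "\<And>k. k < n i \<Longrightarrow> vl h k = vl h' k"
  shows "h = h'"
proof (rule extensionalityI[OF LD(4)[OF h(1)] LD(4)[OF h(2)]])
  fix u assume u: "u \<in> carrier (Q i)"
  show "h u = h' u"
    unfolding L_eval[OF h(1) u] L_eval[OF h(2) u]
    using assms(3) vl_closed[OF h(2)] Pc[OF u] by (intro finsum_cong') auto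
qed

definition hm :: "nat \<Rightarrow> (nat \<Rightarrow> 'a) \<Rightarrow> ('m, 'a) fvec \<Rightarrow> 'a" where
  "hm i v = (\<lambda>u\<in>carrier (Q i). \<Oplus>k\<in>{..<n i}. u (tg k) \<otimes> v k)"

lemma hm_L: assumes v: "\<And>k. k < n i \<Longrightarrow> v k \<in> carrier A" shows "hm i v \<in> L i"
  unfolding hm_def
proof (rule LI)
  fix x assume x: "x \<in> carrier (Q i)"
  show "(\<Oplus>k\<in>{..<n i}. x (tg k) \<otimes> v k) \<in> carrier A"
    using Pc[OF x] v by (intro finsum_closed) auto
  show "(\<Oplus>k\<in>{..<n i}. (x \<oplus>\<^bsub>Q i\<^esub> y) (tg k) \<otimes> v k) =
    (\<Oplus>k\<in>{..<n i}. x (tg k) \<otimes> v k) \<oplus> (\<Oplus>k\<in>{..<n i}. y (tg k) \<otimes> v k)" if y: "y \<in> carrier (Q i)" for y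
  proof -
    have "(\<Oplus>k\<in>{..<n i}. (x \<oplus>\<^bsub>Q i\<^esub> y) (tg k) \<otimes> v k) = (\<Oplus>k\<in>{..<n i}. x (tg k) \<otimes> v k \<oplus> y (tg k) \<otimes> v k)"
      using Pc[OF x] Pc[OF y] v by (intro finsum_cong') (auto simp: P_simps l_distr)
    also have "\<dots> = (\<Oplus>k\<in>{..<n i}. x (tg k) \<otimes> v k) \<oplus> (\<Oplus>k\<in>{..<n i}. y (tg k) \<otimes> v k)"
      using Pc[OF x] Pc[OF y] v by (intro finsum_addf) auto
    finally show ?thesis .
  qed
  show "(\<Oplus>k\<in>{..<n i}. (a \<odot>\<^bsub>Q i\<^esub> x) (tg k) \<otimes> v k) = a \<otimes> (\<Oplus>k\<in>{..<n i}. x (tg k) \<otimes> v k)"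
    if a: "a \<in> carrier A" for a
  proof -
    have "(\<Oplus>k\<in>{..<n i}. (a \<odot>\<^bsub>Q i\<^esub> x) (tg k) \<otimes> v k) = (\<Oplus>k\<in>{..<n i}. a \<otimes> (x (tg k) \<otimes> v k))"
      using Pc[OF x] v a by (intro finsum_cong') (auto simp: P_simps m_assoc)
    also have "\<dots> = a \<otimes> (\<Oplus>k\<in>{..<n i}. x (tg k) \<otimes> v k)"
      using Pc[OF x] v a by (intro finsum_rdistr[symmetric]) auto
    finally show ?thesis .
  qed
qed

lemma vl_hm: assumes v: "\<And>k. k < n i \<Longrightarrow> v k \<in> carrier A" and k: "k < n i" shows "vl (hm i v) k = v k"
proof -
  have "vl (hm i v) k = (\<Oplus>l\<in>{..<n i}. dl (tg k :: ('m + 'a) list) (tg l) \<otimes> v l)"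
    using dlQ[OF k] by (simp add: vl_def hm_def)
  also have "\<dots> = dl (tg k :: ('m + 'a) list) (tg k) \<otimes> v k"
    by (rule finsum_delta) (use v k in \<open>auto simp: dl_def\<close>)
  finally show ?thesis using v k by simp
qed

text \<open>The basis of \<open>P i\<close> has degree \<open>i\<close>, so a map of degree
  \<open>m\<close> has its values on it in degree \<open>i + m\<close>.\<close>

lemma hom_iff:
  assumes h: "h \<in> L i"
  shows "h \<in> hom i m \<longleftrightarrow> (\<forall>k<n i. vl h k \<in> GA (int i + m))"
proof
  assume "h \<in> hom i m"
  hence "h ` GQ i (int i) \<subseteq> GA (int i + m)" by (simp add: homogeneous_maps_def)
  thus "\<forall>k<n i. vl h k \<in> GA (int i + m)" using dl_GP unfolding vl_def by blast
next
  assume vl: "\<forall>k<n i. vl h k \<in> GA (int i + m)"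
  have "h u \<in> GA (m' + m)" if "u \<in> GQ i m'" for u m'
  proof -
    have u: "u \<in> carrier (Q i)" using that by (simp add: GP_def)
    have "u (tg k) \<otimes> vl h k \<in> GA (m' + m)" if "k < n i" for k
      using graded_ringD(4)[OF gr, of "u (tg k)" "m' - int i" "vl h k" "int i + m"] that \<open>u \<in> GQ i m'\<close> vl
      by (simp add: GP_def)
    thus ?thesis unfolding L_eval[OF h u] by (intro G.G_finsum) auto
  qed
  thus "h \<in> hom i m" using h by (auto simp: homogeneous_maps_def)
qed

text \<open>The graded dual is the full dual here: a map is determined by finitely many values, and
  splitting these into homogeneous components splits the map.\<close>

lemma dual_carrier: "carrier (graded_dual A GA (Q i) (GQ i)) = L i"
proof (intro subset_antisym subsetI)
  fix h assume h: "h \<in> L i"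
  \<comment> \<open>The degrees that occur: a component of degree \<open>m\<close> in a value
    belongs to a map of degree \<open>m - i\<close>.\<close>
  define S where "S = (\<Union>k<n i. (\<lambda>m. m - int i) ` {m. G.comp m (vl h k) \<noteq> \<zero>})"
  define f where "f m = hm i (\<lambda>k. G.comp (int i + m) (vl h k))" for m
  have cc: "G.comp m (vl h k) \<in> carrier A" "G.comp m (vl h k) \<in> GA m" if "k < n i" for k m
    using G.comp_in[OF vl_closed[OF h that]] G.G_carrier by blast+
  have S: "finite S" unfolding S_def using G.comp_fin vl_closed[OF h] by blast
  have fL: "f m \<in> L i" for m unfolding f_def by (rule hm_L) (rule cc)
  have fh: "f m \<in> hom i m" for m
    using cc unfolding hom_iff[OF fL] by (simp add: f_def vl_hm)
  have "h x = (\<Oplus>m\<in>S. f m x)" if x: "x \<in> carrier (Q i)" for x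
  proof -
    have "(\<Oplus>m\<in>S. f m x) = (\<Oplus>m\<in>S. \<Oplus>k\<in>{..<n i}. x (tg k) \<otimes> G.comp (int i + m) (vl h k))"
      using x by (simp add: f_def hm_def)
    also have "\<dots> = (\<Oplus>k\<in>{..<n i}. \<Oplus>m\<in>S. x (tg k) \<otimes> G.comp (int i + m) (vl h k))"
      using Pc[OF x] cc S by (intro finsum_swap) auto
    also have "\<dots> = (\<Oplus>k\<in>{..<n i}. x (tg k) \<otimes> vl h k)"
    proof (rule finsum_cong')
      fix k assume "k \<in> {..<n i}"
      hence k: "k < n i" by simp
      have "(\<Oplus>m\<in>S. x (tg k) \<otimes> G.comp (int i + m) (vl h k)) = x (tg k) \<otimes> (\<Oplus>m\<in>S. G.comp (int i + m) (vl h k))"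
        using Pc[OF x] cc[OF k] S by (intro finsum_rdistr[symmetric]) auto
      also have "(\<Oplus>m\<in>S. G.comp (int i + m) (vl h k)) = (\<Oplus>m\<in>(\<lambda>m. int i + m) ` S. G.comp m (vl h k))"
        using cc[OF k] by (intro add.finprod_reindex[symmetric]) (auto simp: inj_on_def)
      also have "\<dots> = vl h k"
      proof (rule G.comp_sum[OF vl_closed[OF h k]])
        show "{m. G.comp m (vl h k) \<noteq> \<zero>} \<subseteq> (\<lambda>m. int i + m) ` S"
        proof
          fix m assume "m \<in> {m. G.comp m (vl h k) \<noteq> \<zero>}"
          hence "m - int i \<in> S" using k unfolding S_def by blast
          thus "m \<in> (\<lambda>m. int i + m) ` S" by (rule image_eqI[rotated]) simp
        qed
      qed (use S in simp)
      finally show "(\<Oplus>m\<in>S. x (tg k) \<otimes> G.comp (int i + m) (vl h k)) = x (tg k) \<otimes> vl h k" .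
    qed (use Pc[OF x] vl_closed[OF h] in auto)
    also have "\<dots> = h x" by (rule L_eval[OF h x, symmetric])
    finally show ?thesis by simp
  qed
  hence "\<exists>N f. finite N \<and> (\<forall>m\<in>N. f m \<in> hom i m) \<and> (\<forall>x\<in>carrier (Q i). h x = (\<Oplus>m\<in>N. f m x))"
    using S fh by (intro exI[of _ S] exI[of _ f]) blast
  thus "h \<in> carrier (graded_dual A GA (Q i) (GQ i))" using h by (simp add: graded_dual_def)
qed (simp add: graded_dual_def)

lemma L_d:
  assumes h: "h \<in> L i" and u: "u \<in> carrier (Q (Suc i))"
  shows "h (\<delta> i u) = (\<Oplus>k\<in>{..<n (Suc i)}. u (tg k) \<otimes> rmul (n i) (D i) (vl h) k)"
proof -
  have "h (\<delta> i u) = (\<Oplus>j\<in>{..<n i}. \<delta> i u (tg j) \<otimes> vl h j)" by (rule L_eval[OF h dP[OF u]])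
  also have "\<dots> = (\<Oplus>j\<in>{..<n i}. lmul (n (Suc i)) (D i) (\<lambda>k. u (tg k)) j \<otimes> vl h j)"
    using vl_closed[OF h] Pc[OF u] Dc by (intro finsum_cong') (auto simp: d_tg[OF u] intro!: lmul_closed)
  also have "\<dots> = (\<Oplus>k\<in>{..<n (Suc i)}. u (tg k) \<otimes> rmul (n i) (D i) (vl h) k)"
    using vl_closed[OF h] Pc[OF u] Dc by (intro lmul_assoc) auto
  finally show ?thesis .
qed

lemma d_dl: assumes h: "h \<in> L i" and k: "k < n (Suc i)" shows "h (\<delta> i (dl (tg k))) = rmul (n i) (D i) (vl h) k"
proof -
  have rc: "rmul (n i) (D i) (vl h) k \<in> carrier A" if "k < n (Suc i)" for k
    using vl_closed[OF h] Dc that by (intro rmul_closed) auto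
  have "h (\<delta> i (dl (tg k))) = (\<Oplus>l\<in>{..<n (Suc i)}. dl (tg k :: ('m + 'a) list) (tg l) \<otimes> rmul (n i) (D i) (vl h) l)"
    by (rule L_d[OF h dlQ[OF k]])
  also have "\<dots> = dl (tg k :: ('m + 'a) list) (tg k) \<otimes> rmul (n i) (D i) (vl h) k"
    by (rule finsum_delta) (use rc k in \<open>auto simp: dl_def\<close>)
  finally show ?thesis using rc k by simp
qed

text \<open>From here on cocycles, and by \<open>B_Suc_iff\<close> coboundaries, are the kernels and
  images of the matrices acting on columns.\<close>

lemma Z_iff: "h \<in> carrier (Z i) \<longleftrightarrow> h \<in> L i \<and> (\<forall>k<n (Suc i). rmul (n i) (D i) (vl h) k = \<zero>)"
proof -
  have "(\<forall>x\<in>carrier (Q (Suc i)). h (\<delta> i x) = \<zero>) \<longleftrightarrow> (\<forall>k<n (Suc i). rmul (n i) (D i) (vl h) k = \<zero>)" if h: "h \<in> L i"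
  proof
    assume "\<forall>x\<in>carrier (Q (Suc i)). h (\<delta> i x) = \<zero>"
    thus "\<forall>k<n (Suc i). rmul (n i) (D i) (vl h) k = \<zero>" using d_dl[OF h] dlQ by metis
  next
    assume r: "\<forall>k<n (Suc i). rmul (n i) (D i) (vl h) k = \<zero>"
    show "\<forall>x\<in>carrier (Q (Suc i)). h (\<delta> i x) = \<zero>"
    proof
      fix x assume x: "x \<in> carrier (Q (Suc i))"
      show "h (\<delta> i x) = \<zero>"
        unfolding L_d[OF h x] by (rule finsum_all_zero) (use r Pc[OF x] in auto)
    qed
  qed
  thus ?thesis unfolding cocycles_def by (auto simp: dual_carrier)
qed

lemma B_Suc_iff: "g \<in> B (Suc i) \<longleftrightarrow>
   g \<in> L (Suc i) \<and> (\<exists>w. (\<forall>j<n i. w j \<in> carrier A) \<and> (\<forall>k<n (Suc i). vl g k = rmul (n i) (D i) w k))"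
proof -
  have comp: "compose (carrier (Q (Suc i))) h (\<delta> i) \<in> L (Suc i)"
    "\<And>k. k < n (Suc i) \<Longrightarrow> vl (compose (carrier (Q (Suc i))) h (\<delta> i)) k = rmul (n i) (D i) (vl h) k"
    if h: "h \<in> L i" for h
  proof -
    have hl: "linmap A (Q i) (regular A) h" using h by (simp add: lin_maps_iff)
    show "compose (carrier (Q (Suc i))) h (\<delta> i) \<in> L (Suc i)"
      unfolding compose_def by (rule linmap_restrict[OF P_module linmap_compose[OF hl d_linmap]])
    show "vl (compose (carrier (Q (Suc i))) h (\<delta> i)) k = rmul (n i) (D i) (vl h) k" if "k < n (Suc i)" for k
      using d_dl[OF h that] dlQ[OF that] by (simp add: vl_def compose_def)
  qed
  show ?thesis
  proof (intro iffI conjI)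
    assume "g \<in> B (Suc i)"
    then obtain h where h: "h \<in> L i" "g = compose (carrier (Q (Suc i))) h (\<delta> i)" by (auto simp: dual_carrier)
    show "g \<in> L (Suc i)" using comp(1)[OF h(1)] h(2) by simp
    show "\<exists>w. (\<forall>j<n i. w j \<in> carrier A) \<and> (\<forall>k<n (Suc i). vl g k = rmul (n i) (D i) w k)"
      using comp(2)[OF h(1)] h(2) vl_closed[OF h(1)] by (intro exI[of _ "vl h"]) simp
  next
    assume "g \<in> L (Suc i) \<and> (\<exists>w. (\<forall>j<n i. w j \<in> carrier A) \<and> (\<forall>k<n (Suc i). vl g k = rmul (n i) (D i) w k))"
    then obtain w where g: "g \<in> L (Suc i)" and w: "\<And>j. j < n i \<Longrightarrow> w j \<in> carrier A"
      "\<And>k. k < n (Suc i) \<Longrightarrow> vl g k = rmul (n i) (D i) w k" by blast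
    have hw: "hm i w \<in> L i" by (rule hm_L) (rule w(1))
    have "g = compose (carrier (Q (Suc i))) (hm i w) (\<delta> i)"
    proof (rule L_eqI[OF g comp(1)[OF hw]])
      fix k assume k: "k < n (Suc i)"
      have "rmul (n i) (D i) (vl (hm i w)) k = rmul (n i) (D i) w k"
        unfolding rmul_def using w Dc k by (intro finsum_cong') (auto simp: vl_hm)
      thus "vl g k = vl (compose (carrier (Q (Suc i))) (hm i w) (\<delta> i)) k" using comp(2)[OF hw k] w(2)[OF k] by simp
    qed
    thus "g \<in> B (Suc i)" using hw by (auto simp: dual_carrier)
  qed
qed

lemma B_0_iff: "g \<in> B 0 \<longleftrightarrow> g \<in> L 0 \<and> (\<forall>k<n 0. vl g k = \<zero>)"
proof -
  let ?z = "\<lambda>x\<in>carrier (Q 0). \<zero>"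
  have z: "?z \<in> L 0" by (rule LI) auto
  have vz: "vl ?z k = \<zero>" if "k < n 0" for k using dlQ[OF that] by (simp add: vl_def)
  have "g \<in> L 0 \<and> (\<forall>k<n 0. vl g k = \<zero>) \<longleftrightarrow> g = ?z"
    using z vz L_eqI[of g 0 ?z] by metis
  thus ?thesis by (simp add: graded_dual_def)
qed

lemma B_sub_Z: "B i \<subseteq> carrier (Z i)"
proof (cases i)
  case 0
  show ?thesis
  proof
    fix g assume "g \<in> B i"
    hence g: "g \<in> L i" "\<forall>k<n i. vl g k = \<zero>" using B_0_iff 0 by auto
    have "rmul (n i) (D i) (vl g) k = \<zero>" if "k < n (Suc i)" for k
      unfolding rmul_def by (rule finsum_all_zero) (use g Dc that in auto)
    thus "g \<in> carrier (Z i)" using g by (simp add: Z_iff)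
  qed
next
  case (Suc j)
  show ?thesis
  proof
    fix g assume "g \<in> B i"
    then obtain w where g: "g \<in> L (Suc j)" and w: "\<And>l. l < n j \<Longrightarrow> w l \<in> carrier A"
      "\<And>k. k < n (Suc j) \<Longrightarrow> vl g k = rmul (n j) (D j) w k" unfolding Suc B_Suc_iff by blast
    have "rmul (n (Suc j)) (D (Suc j)) (vl g) k = \<zero>" if k: "k < n (Suc (Suc j))" for k
    proof -
      have "rmul (n (Suc j)) (D (Suc j)) (vl g) k = (\<Oplus>l\<in>{..<n (Suc j)}. D (Suc j) k l \<otimes> rmul (n j) (D j) w l)"
        unfolding rmul_def[of "n (Suc j)"]
        using w Dc k by (intro finsum_cong') (auto intro!: rmul_closed)
      also have "\<dots> = (\<Oplus>l\<in>{..<n j}. lmul (n (Suc j)) (D j) (D (Suc j) k) l \<otimes> w l)"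
        by (rule lmul_assoc[symmetric]) (use w Dc k in auto)
      also have "\<dots> = \<zero>" by (rule finsum_all_zero) (use cplx[OF k] w in auto)
      finally show ?thesis .
    qed
    thus "g \<in> carrier (Z i)" using g by (simp add: Z_iff Suc)
  qed
qed

lemma Z_simps:
  "\<zero>\<^bsub>Z i\<^esub> = (\<lambda>x\<in>carrier (Q i). \<zero>)" "h \<oplus>\<^bsub>Z i\<^esub> k = (\<lambda>x\<in>carrier (Q i). h x \<oplus> k x)"
  "a \<odot>\<^bsub>Z i\<^esub> h = (\<lambda>x\<in>carrier (Q i). h x \<otimes> a)"
  by (simp_all add: cocycles_def graded_dual_def)

lemma Z_mem: "h \<in> carrier (Z i) \<longleftrightarrow> h \<in> L i \<and> (\<forall>x\<in>carrier (Q (Suc i)). h (\<delta> i x) = \<zero>)"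
  by (auto simp: cocycles_def dual_carrier)

lemma Z_eqI: "h \<in> carrier (Z i) \<Longrightarrow> k \<in> carrier (Z i) \<Longrightarrow> (\<And>x. x \<in> carrier (Q i) \<Longrightarrow> h x = k x) \<Longrightarrow> h = k"
  unfolding Z_mem using extensionalityI LD(4) by metis

lemma Z_module: "left_module (opp A) (Z i)"
proof -
  have Zc: "h x \<in> carrier A" if "h \<in> carrier (Z i)" "x \<in> carrier (Q i)" for h x
    using that LD(1) unfolding Z_mem by blast
  have add: "h \<oplus>\<^bsub>Z i\<^esub> k \<in> carrier (Z i)" if h: "h \<in> carrier (Z i)" "k \<in> carrier (Z i)" for h k
  proof -
    have "h \<in> L i" "k \<in> L i" using h by (auto simp: Z_mem)
    note hD = LD[OF this(1)] and kD = LD[OF this(2)]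
    have "(\<lambda>x\<in>carrier (Q i). h x \<oplus> k x) \<in> L i"
      by (rule LI) (auto simp: hD kD a_ac r_distr)
    thus ?thesis using h dP by (auto simp: Z_mem Z_simps)
  qed
  have zero: "\<zero>\<^bsub>Z i\<^esub> \<in> carrier (Z i)"
  proof -
    have "(\<lambda>x\<in>carrier (Q i). \<zero>) \<in> L i" by (rule LI) auto
    thus ?thesis using dP by (auto simp: Z_mem Z_simps)
  qed
  have neg: "(\<lambda>x\<in>carrier (Q i). \<ominus> h x) \<in> carrier (Z i)" if h: "h \<in> carrier (Z i)" for h
  proof -
    have "h \<in> L i" using h by (auto simp: Z_mem)
    note hD = LD[OF this(1)]
    have "(\<lambda>x\<in>carrier (Q i). \<ominus> h x) \<in> L i"
      by (rule LI) (auto simp: hD minus_add r_minus)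
    thus ?thesis using h dP by (auto simp: Z_mem)
  qed
  have sm: "a \<odot>\<^bsub>Z i\<^esub> h \<in> carrier (Z i)" if h: "a \<in> carrier A" "h \<in> carrier (Z i)" for a h
  proof -
    have "h \<in> L i" using h by (auto simp: Z_mem)
    note hD = LD[OF this(1)]
    have "(\<lambda>x\<in>carrier (Q i). h x \<otimes> a) \<in> L i"
      by (rule LI) (use h(1) in \<open>auto simp: hD l_distr m_assoc\<close>)
    thus ?thesis using h dP by (auto simp: Z_mem Z_simps)
  qed
  have "abelian_group (Z i)"
  proof (rule abelian_groupI)
    show "\<exists>y\<in>carrier (Z i). y \<oplus>\<^bsub>Z i\<^esub> x = \<zero>\<^bsub>Z i\<^esub>" if "x \<in> carrier (Z i)" for x
      using neg[OF that] Zc[OF that]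
      by (intro bexI[of _ "\<lambda>y\<in>carrier (Q i). \<ominus> x y"] Z_eqI[of _ i] add zero that) (auto simp: Z_simps l_neg)
    show "x \<oplus>\<^bsub>Z i\<^esub> y \<oplus>\<^bsub>Z i\<^esub> z = x \<oplus>\<^bsub>Z i\<^esub> (y \<oplus>\<^bsub>Z i\<^esub> z)"
      if "x \<in> carrier (Z i)" "y \<in> carrier (Z i)" "z \<in> carrier (Z i)" for x y z
      by (rule Z_eqI[of _ i], (intro add that)+) (use that Zc in \<open>auto simp: a_assoc Z_simps(2)\<close>)
    show "x \<oplus>\<^bsub>Z i\<^esub> y = y \<oplus>\<^bsub>Z i\<^esub> x" if "x \<in> carrier (Z i)" "y \<in> carrier (Z i)" for x y
      by (rule Z_eqI[of _ i], (intro add that)+) (use that Zc in \<open>auto simp: a_comm Z_simps(2)\<close>)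
    show "\<zero>\<^bsub>Z i\<^esub> \<oplus>\<^bsub>Z i\<^esub> x = x" if "x \<in> carrier (Z i)" for x
      by (rule Z_eqI[of _ i], (intro add zero that)+) (use that Zc in \<open>auto simp: Z_simps\<close>)
  qed (auto intro: add zero)
  thus ?thesis
  proof (intro left_module.intro left_module_axioms.intro opp_ring)
    fix a b x assume "a \<in> carrier (opp A)" "b \<in> carrier (opp A)" and x: "x \<in> carrier (Z i)"
    hence a: "a \<in> carrier A" and b: "b \<in> carrier A" by auto
    hence ab: "a \<oplus>\<^bsub>opp A\<^esub> b \<in> carrier A" "a \<otimes>\<^bsub>opp A\<^esub> b \<in> carrier A" by auto
    show "(a \<oplus>\<^bsub>opp A\<^esub> b) \<odot>\<^bsub>Z i\<^esub> x = a \<odot>\<^bsub>Z i\<^esub> x \<oplus>\<^bsub>Z i\<^esub> b \<odot>\<^bsub>Z i\<^esub> x"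
      by (rule Z_eqI[of _ i], (intro add sm a b x ab)+) (use a b Zc[OF x] in \<open>auto simp: r_distr Z_simps\<close>)
    show "(a \<otimes>\<^bsub>opp A\<^esub> b) \<odot>\<^bsub>Z i\<^esub> x = a \<odot>\<^bsub>Z i\<^esub> (b \<odot>\<^bsub>Z i\<^esub> x)"
      by (rule Z_eqI[of _ i], (intro add sm a b x ab)+) (use a b Zc[OF x] in \<open>auto simp: m_assoc Z_simps\<close>)
  next
    fix a x y assume "a \<in> carrier (opp A)" and x: "x \<in> carrier (Z i)" and y: "y \<in> carrier (Z i)"
    hence a: "a \<in> carrier A" by simp
    show "a \<odot>\<^bsub>Z i\<^esub> (x \<oplus>\<^bsub>Z i\<^esub> y) = a \<odot>\<^bsub>Z i\<^esub> x \<oplus>\<^bsub>Z i\<^esub> a \<odot>\<^bsub>Z i\<^esub> y"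
      by (rule Z_eqI[of _ i], (intro add sm a x y)+) (use a Zc[OF x] Zc[OF y] in \<open>auto simp: l_distr Z_simps\<close>)
  next
    fix x assume x: "x \<in> carrier (Z i)"
    have one: "\<one>\<^bsub>opp A\<^esub> \<in> carrier A" by simp
    show "\<one>\<^bsub>opp A\<^esub> \<odot>\<^bsub>Z i\<^esub> x = x"
      by (rule Z_eqI[of _ i], (intro sm x one)+) (use Zc[OF x] in \<open>auto simp: Z_simps\<close>)
  qed (use sm in auto)
qed

text \<open>Ext is identified by a map defined on cocycles whose kernel is the coboundaries, so that
  classes have to be handled only here.\<close>

lemma Ext_isoI:
  fixes E :: "('a, 'e, 't) module_scheme"
  assumes E: "left_module (opp A) E" and F: "linmap (opp A) (Z i) E F" and surj: "F ` carrier (Z i) = carrier E"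
    and ker: "\<And>h. h \<in> carrier (Z i) \<Longrightarrow> F h = \<zero>\<^bsub>E\<^esub> \<longleftrightarrow> h \<in> B i"
    and deg: "\<And>m. F ` (hom i m \<inter> carrier (Z i)) = GE m"
  shows "Ext_iso A GA N GN i E GE"
proof -
  have Beq: "B i = {z\<in>carrier (Z i). F z = \<zero>\<^bsub>E\<^esub>}" using ker B_sub_Z by blast
  obtain h where h: "h \<in> lin_maps (opp A) (quot (Z i) (B i)) E" "bij_betw h (carrier (quot (Z i) (B i))) (carrier E)"
    "\<And>z. z \<in> carrier (Z i) \<Longrightarrow> h (B i +>\<^bsub>Z i\<^esub> z) = F z"
    using quot_iso[OF Z_module E F surj Beq] by blast
  have "h ` cohomology_grading A GA Q GQ \<delta> i m = GE m" for m
    unfolding cohomology_grading_def quot_grading_def deg[of m, symmetric] image_image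
    by (rule image_cong[OF refl]) (simp add: h(3))
  hence "graded_iso (opp A) (cohomology A GA Q GQ \<delta> i) (cohomology_grading A GA Q GQ \<delta> i) E GE"
    unfolding graded_iso_def cohomology_def using h by blast
  thus ?thesis unfolding Ext_iso_def using resolution by blast
qed

end

text \<open>The complex of columns is exact away from position 3: \<open>rex0\<close> is position 0,
  \<open>rex\<close> is position \<open>Suc i\<close>, and \<open>i \<noteq> 2\<close> excludes the
  top. There \<open>\<epsilon>'\<close> identifies the cokernel of the last transposed matrix with
  \<open>E\<close>.\<close>

locale matrix_regular = matrix_resolution A GA n D N GN \<epsilon>
  for A :: "('a, 'r) ring_scheme" (structure) and GA n D and N :: "('a, 'm, 's) module_scheme" and GN \<epsilon> +
  fixes E :: "('a, 'e, 't) module_scheme" and GE :: "int \<Rightarrow> 'e set" and \<epsilon>' :: "'a \<Rightarrow> 'e"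
  assumes n3: "n 3 = 1" and n4: "\<And>i. i > 3 \<Longrightarrow> n i = 0"
    and rex0: "(\<And>j. j < n 0 \<Longrightarrow> w j \<in> carrier A) \<Longrightarrow> (\<And>k. k < n 1 \<Longrightarrow> rmul (n 0) (D 0) w k = \<zero>) \<Longrightarrow> j < n 0 \<Longrightarrow> w j = \<zero>"
    and rex: "i \<noteq> 2 \<Longrightarrow> (\<And>j. j < n (Suc i) \<Longrightarrow> w j \<in> carrier A) \<Longrightarrow>
      (\<And>k. k < n (Suc (Suc i)) \<Longrightarrow> rmul (n (Suc i)) (D (Suc i)) w k = \<zero>) \<Longrightarrow>
      \<exists>w'. (\<forall>j<n i. w' j \<in> carrier A) \<and> (\<forall>k<n (Suc i). w k = rmul (n i) (D i) w' k)"
    and E: "left_module (opp A) E" and \<epsilon>': "linmap (opp A) (regular (opp A)) E \<epsilon>'"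
    and \<epsilon>'_surj: "\<epsilon>' ` carrier A = carrier E"
    and \<epsilon>'_ker: "a \<in> carrier A \<Longrightarrow> \<epsilon>' a = \<zero>\<^bsub>E\<^esub> \<longleftrightarrow> (\<exists>w. (\<forall>j<n 2. w j \<in> carrier A) \<and> a = rmul (n 2) (D 2) w 0)"
    and \<epsilon>'_deg: "\<epsilon>' ` GA m = GE m"
begin

lemma P_length: "length_at_most P 3"
  unfolding length_at_most_def P_def by (auto simp: n4)

lemma Ext_zero_not_3:
  assumes "i \<noteq> 3" shows "Ext_zero A GA N GN i"
  unfolding Ext_zero_def
proof (rule Ext_isoI[where F = "\<lambda>_. ()"])
  show "left_module (opp A) zero_module" by (rule zero_left_module[OF opp_ring])
  have zero: "\<zero>\<^bsub>Z i\<^esub> \<in> carrier (Z i)"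
    using abelian_monoid.zero_closed[OF abelian_group.axioms(1)[OF left_module.axioms(2)[OF Z_module]]] .
  show "linmap (opp A) (Z i) zero_module (\<lambda>_. ())" by (simp add: linmap_def zero_module_def)
  show "(\<lambda>_. ()) ` carrier (Z i) = carrier zero_module" using zero by (auto simp: zero_module_def)
  have "\<zero>\<^bsub>Z i\<^esub> \<in> hom i m" for m
  proof -
    have "\<zero>\<^bsub>Z i\<^esub> \<in> L i" using zero by (simp add: Z_iff)
    thus ?thesis using dlQ by (subst hom_iff) (auto simp: Z_simps vl_def)
  qed
  thus "(\<lambda>_. ()) ` (hom i m \<inter> carrier (Z i)) = {()}" for m using zero by auto
  fix h assume h: "h \<in> carrier (Z i)"
  have "h \<in> B i"
  proof (cases i)
    case 0
    thus ?thesis using h rex0[of "vl h"] vl_closed[of h 0] by (auto simp: Z_iff B_0_iff simp del: coboundaries.simps)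
  next
    case (Suc j)
    have hL: "h \<in> L (Suc j)" and hz: "\<And>k. k < n (Suc (Suc j)) \<Longrightarrow> rmul (n (Suc j)) (D (Suc j)) (vl h) k = \<zero>"
      using h by (auto simp: Z_iff Suc)
    have "j \<noteq> 2" using assms Suc by simp
    from rex[OF this, of "vl h", OF vl_closed[OF hL] hz] hL show ?thesis
      unfolding Suc B_Suc_iff by blast
  qed
  thus "((\<lambda>_. ()) h = \<zero>\<^bsub>zero_module\<^esub>) = (h \<in> B i)" by (simp add: zero_module_def)
qed

text \<open>\<open>P 3\<close> has a single generator, of degree 3. Evaluating a map of degree
  \<open>m\<close> at it gives an element of degree \<open>m + 3\<close>, whence the shift.\<close>

lemma Ext_top: "Ext_iso A GA N GN 3 E (shift GE 3)"
proof (rule Ext_isoI[where F = "\<lambda>h. \<epsilon>' (vl h 0)"])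
  show "left_module (opp A) E" by (rule E)
  note \<epsilon>'D = linmapD[OF \<epsilon>', unfolded regular_simps opp_simps]
  have ZL: "h \<in> carrier (Z 3) \<longleftrightarrow> h \<in> L 3" for h by (simp add: Z_iff n4)
  have v: "vl h 0 \<in> carrier A" if "h \<in> L 3" for h using vl_closed[OF that] n3 by simp
  have dl0: "dl (tg 0) \<in> carrier (Q 3)" using dlQ n3 by simp
  show "linmap (opp A) (Z 3) E (\<lambda>h. \<epsilon>' (vl h 0))"
    unfolding linmap_def
  proof (intro conjI ballI)
    fix x assume x: "x \<in> carrier (Z 3)"
    show "\<epsilon>' (vl x 0) \<in> carrier E" using x v by (auto simp: ZL intro: \<epsilon>'D)
    show "\<epsilon>' (vl (x \<oplus>\<^bsub>Z 3\<^esub> y) 0) = \<epsilon>' (vl x 0) \<oplus>\<^bsub>E\<^esub> \<epsilon>' (vl y 0)" if "y \<in> carrier (Z 3)" for y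
      using \<epsilon>'D(2)[of "vl x 0" "vl y 0"] x that v dl0 by (simp add: ZL Z_simps vl_def)
    show "\<epsilon>' (vl (a \<odot>\<^bsub>Z 3\<^esub> x) 0) = a \<odot>\<^bsub>E\<^esub> \<epsilon>' (vl x 0)" if "a \<in> carrier (opp A)" for a
      using \<epsilon>'D(3)[of a "vl x 0"] x that v dl0 by (simp add: ZL Z_simps vl_def)
  qed
  have ex: "\<exists>h\<in>L 3. vl h 0 = a" if "a \<in> carrier A" for a
    using that n3 by (intro bexI[of _ "hm 3 (\<lambda>_. a)"] vl_hm hm_L) auto
  show "(\<lambda>h. \<epsilon>' (vl h 0)) ` carrier (Z 3) = carrier E"
  proof (intro subset_antisym subsetI)
    fix y assume "y \<in> carrier E"
    then obtain a where "a \<in> carrier A" "y = \<epsilon>' a" using \<epsilon>'_surj by auto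
    thus "y \<in> (\<lambda>h. \<epsilon>' (vl h 0)) ` carrier (Z 3)" using ex[of a] ZL by auto
  qed (use v \<epsilon>'D(1) ZL in auto)
  have three: "(3::nat) = Suc 2" by simp
  show "\<epsilon>' (vl h 0) = \<zero>\<^bsub>E\<^esub> \<longleftrightarrow> h \<in> B 3" if "h \<in> carrier (Z 3)" for h
  proof -
    have hL: "h \<in> L 3" using that ZL by simp
    have "h \<in> B 3 \<longleftrightarrow> (\<exists>w. (\<forall>j<n 2. w j \<in> carrier A) \<and> vl h 0 = rmul (n 2) (D 2) w 0)"
      using B_Suc_iff[of h 2] hL n3 unfolding three[symmetric] by (simp del: coboundaries.simps)
    thus ?thesis using \<epsilon>'_ker[OF v[OF hL]] by simp
  qed
  show "(\<lambda>h. \<epsilon>' (vl h 0)) ` (hom 3 m \<inter> carrier (Z 3)) = shift GE 3 m" for m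
  proof -
    have "(\<lambda>h. vl h 0) ` (hom 3 m \<inter> carrier (Z 3)) = GA (m + 3)"
    proof (intro subset_antisym subsetI)
      fix a assume a: "a \<in> GA (m + 3)"
      obtain h where h: "h \<in> L 3" "vl h 0 = a" using ex[OF G.G_carrier[OF a]] by blast
      have "h \<in> hom 3 m" using hom_iff[OF h(1)] h(2) a n3 by (simp add: add.commute)
      thus "a \<in> (\<lambda>h. vl h 0) ` (hom 3 m \<inter> carrier (Z 3))" using h ZL by auto
    next
      fix a assume "a \<in> (\<lambda>h. vl h 0) ` (hom 3 m \<inter> carrier (Z 3))"
      then obtain h where h: "h \<in> L 3" "h \<in> hom 3 m" "a = vl h 0" using ZL by auto
      thus "a \<in> GA (m + 3)" using hom_iff[OF h(1)] n3 by (simp add: add.commute)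
    qed
    hence "\<epsilon>' ` (\<lambda>h. vl h 0) ` (hom 3 m \<inter> carrier (Z 3)) = GE (m + 3)" using \<epsilon>'_deg by simp
    thus ?thesis by (simp add: image_image shift_def)
  qed
qed

end

section \<open>Algebras with coordinates\<close>

locale coord_algebra = k_algebra R for R :: "('k::field, 'a, 's) module_scheme" (structure) +
  fixes \<theta> :: "'a \<Rightarrow> ('i \<Rightarrow>\<^sub>0 'k)"
  assumes bij: "bij_betw \<theta> (carrier R) UNIV"
    and \<theta>_add: "a \<in> carrier R \<Longrightarrow> b \<in> carrier R \<Longrightarrow> \<theta> (a \<oplus> b) = \<theta> a + \<theta> b"
    and \<theta>_scale: "a \<in> carrier R \<Longrightarrow> \<theta> (z \<odot> a) = scale z (\<theta> a)"
begin

lemma \<theta>_zero [simp]: "\<theta> \<zero> = 0"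
  using \<theta>_add[of \<zero> \<zero>] by simp

lemma \<theta>_inj: "a \<in> carrier R \<Longrightarrow> b \<in> carrier R \<Longrightarrow> \<theta> a = \<theta> b \<longleftrightarrow> a = b"
  using bij by (auto simp: bij_betw_def inj_on_def)

lemma \<theta>_zero_iff: "a \<in> carrier R \<Longrightarrow> \<theta> a = 0 \<longleftrightarrow> a = \<zero>"
  using \<theta>_inj[of a \<zero>] by simp

lemma \<theta>_uminus: "a \<in> carrier R \<Longrightarrow> \<theta> (\<ominus> a) = - \<theta> a"
  using \<theta>_add[of "\<ominus> a" a] by (simp add: l_neg eq_neg_iff_add_eq_0)

lemma \<theta>_minus: "a \<in> carrier R \<Longrightarrow> b \<in> carrier R \<Longrightarrow> \<theta> (a \<ominus> b) = \<theta> a - \<theta> b"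
  by (simp add: a_minus_def \<theta>_add \<theta>_uminus)

lemma \<theta>_finsum: "(\<And>j. j \<in> J \<Longrightarrow> f j \<in> carrier R) \<Longrightarrow> \<theta> (\<Oplus>j\<in>J. f j) = (\<Sum>j\<in>J. \<theta> (f j))"
proof (induction J rule: infinite_finite_induct)
  case (insert j J)
  have "\<theta> (\<Oplus>j\<in>insert j J. f j) = \<theta> (f j \<oplus> (\<Oplus>j\<in>J. f j))"
    using insert by (subst finsum_insert) auto
  thus ?case using insert by (simp add: \<theta>_add Pi_iff)
qed auto

definition \<phi> :: "('i \<Rightarrow>\<^sub>0 'k) \<Rightarrow> 'a" where "\<phi> = inv_into (carrier R) \<theta>"

lemma \<phi>_in [simp]: "\<phi> u \<in> carrier R" and \<theta>_\<phi> [simp]: "\<theta> (\<phi> u) = u"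
  using bij unfolding \<phi>_def bij_betw_def by (auto intro: inv_into_into f_inv_into_f)

lemma \<phi>_\<theta>: "a \<in> carrier R \<Longrightarrow> \<phi> (\<theta> a) = a"
  using \<theta>_inj[of "\<phi> (\<theta> a)" a] by simp

lemma \<phi>_add: "\<phi> (u + v) = \<phi> u \<oplus> \<phi> v" and \<phi>_scale: "\<phi> (scale z u) = z \<odot> \<phi> u"
  by (rule \<theta>_inj[THEN iffD1]; simp add: \<theta>_add \<theta>_scale scale_closed)+

lemma \<phi>_zero [simp]: "\<phi> 0 = \<zero>" using \<phi>_\<theta>[of \<zero>] by simp

text \<open>Multiplication transported to coordinate vectors, the form in which
  \<open>koszul_ops\<close> receives it. Associativity of the ring becomes \<open>Lm_mult\<close>,
  \<open>Rm_mult\<close> and the commutation \<open>Lm_Rm\<close>.\<close>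

definition Lm :: "'a \<Rightarrow> ('i \<Rightarrow>\<^sub>0 'k) \<Rightarrow> ('i \<Rightarrow>\<^sub>0 'k)" where "Lm a u = \<theta> (a \<otimes> \<phi> u)"
definition Rm :: "'a \<Rightarrow> ('i \<Rightarrow>\<^sub>0 'k) \<Rightarrow> ('i \<Rightarrow>\<^sub>0 'k)" where "Rm a u = \<theta> (\<phi> u \<otimes> a)"

lemma klin_Lm: "a \<in> carrier R \<Longrightarrow> klin (Lm a)"
  by (rule klinI) (simp_all add: Lm_def \<phi>_add \<phi>_scale r_distr \<theta>_add scale_mult_r[symmetric] \<theta>_scale)

lemma klin_Rm: "a \<in> carrier R \<Longrightarrow> klin (Rm a)"
  by (rule klinI) (simp_all add: Rm_def \<phi>_add \<phi>_scale l_distr \<theta>_add scale_mult_l[symmetric] \<theta>_scale)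

lemma \<theta>_mult_L: "b \<in> carrier R \<Longrightarrow> \<theta> (a \<otimes> b) = Lm a (\<theta> b)"
  and \<theta>_mult_R: "a \<in> carrier R \<Longrightarrow> \<theta> (a \<otimes> b) = Rm b (\<theta> a)"
  by (simp_all add: Lm_def Rm_def \<phi>_\<theta>)

lemma Lm_mult: "a \<in> carrier R \<Longrightarrow> b \<in> carrier R \<Longrightarrow> Lm (a \<otimes> b) u = Lm a (Lm b u)"
  and Rm_mult: "a \<in> carrier R \<Longrightarrow> b \<in> carrier R \<Longrightarrow> Rm (a \<otimes> b) u = Rm b (Rm a u)"
  and Lm_Rm: "a \<in> carrier R \<Longrightarrow> b \<in> carrier R \<Longrightarrow> Lm a (Rm b u) = Rm b (Lm a u)"
  by (simp_all add: Lm_def Rm_def \<phi>_\<theta> m_assoc)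

lemma Lm_add: "a \<in> carrier R \<Longrightarrow> b \<in> carrier R \<Longrightarrow> Lm (a \<oplus> b) u = Lm a u + Lm b u"
  and Rm_add: "a \<in> carrier R \<Longrightarrow> b \<in> carrier R \<Longrightarrow> Rm (a \<oplus> b) u = Rm a u + Rm b u"
  and Lm_scale: "a \<in> carrier R \<Longrightarrow> Lm (z \<odot> a) u = scale z (Lm a u)"
  and Rm_scale: "a \<in> carrier R \<Longrightarrow> Rm (z \<odot> a) u = scale z (Rm a u)"
  and Lm_one: "Lm \<one> u = u" and Rm_one: "Rm \<one> u = u"
  and Lm_zero: "Lm \<zero> u = 0" and Rm_zero: "Rm \<zero> u = 0"
  by (simp_all add: Lm_def Rm_def l_distr r_distr \<theta>_add \<theta>_scale scale_mult_l[symmetric] scale_mult_r[symmetric])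

lemma Lm_minus: "a \<in> carrier R \<Longrightarrow> b \<in> carrier R \<Longrightarrow> Lm (a \<ominus> b) u = Lm a u - Lm b u"
  and Rm_minus: "a \<in> carrier R \<Longrightarrow> b \<in> carrier R \<Longrightarrow> Rm (a \<ominus> b) u = Rm a u - Rm b u"
  by (simp_all add: Lm_def Rm_def a_minus_def l_distr r_distr \<theta>_add \<theta>_uminus l_minus r_minus)

lemma Lm_uminus: "a \<in> carrier R \<Longrightarrow> Lm (\<ominus> a) u = - Lm a u"
  and Rm_uminus: "a \<in> carrier R \<Longrightarrow> Rm (\<ominus> a) u = - Rm a u"
  by (simp_all add: Lm_def Rm_def \<theta>_uminus l_minus r_minus)

end

section \<open>The Koszul matrices and their transposes\<close>

definition kn :: "nat \<Rightarrow> nat" where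
  "kn i = (if i = 0 \<or> i = 3 then 1 else if i = 1 \<or> i = 2 then 3 else 0)"

lemma kn_simps [simp]:
  "kn 0 = 1" "kn (Suc 0) = 3" "kn (Suc (Suc 0)) = 3" "kn (Suc (Suc (Suc 0))) = 1" "kn (Suc (Suc (Suc (Suc i)))) = 0"
  by (simp_all add: kn_def)

lemma kn_numerals [simp]: "kn 1 = 3" "kn 2 = 3" "kn 3 = 1"
  by (simp_all add: kn_def)

lemma (in ring) finsum3:
  assumes "\<And>k. k < 3 \<Longrightarrow> f k \<in> carrier R"
  shows "(\<Oplus>k\<in>{..<3::nat}. f k) = f 0 \<oplus> (f 1 \<oplus> f 2)"
proof -
  have "{..<3::nat} = insert 0 (insert 1 (insert 2 {}))" by auto
  thus ?thesis using assms[of 0] assms[of 1] assms[of 2] by (simp add: finsum_insert)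
qed

lemma (in ring) finsum1: "f 0 \<in> carrier R \<Longrightarrow> (\<Oplus>k\<in>{..<1::nat}. f k) = f 0"
  by (simp add: lessThan_Suc)

lemma all_less_3: "(\<forall>k<3::nat. Q k) \<longleftrightarrow> Q 0 \<and> Q 1 \<and> Q 2"
  by (auto simp: less_Suc_eq numeral_3_eq_3 numeral_2_eq_2)

text \<open>The differentials multiply coordinates on the right, which is the business of
  \<open>K\<close>; the transposed complex belongs to \<open>K'\<close>. Transposition exchanges x
  and y, and the factors p q and 1/(p q) are those for which the entries \<open>y1 - p q y2\<close>
  and \<open>p q x1 - x2\<close> of the last matrix become the differences in \<open>d1\<close> of
  \<open>K'\<close>.\<close>

locale koszul_ring = coord_algebra R \<theta> for R :: "('k::field, 'a, 's) module_scheme" (structure)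
    and \<theta> :: "'a \<Rightarrow> ('i \<Rightarrow>\<^sub>0 'k)" +
  fixes GA :: "int \<Rightarrow> 'a set" and p q c :: 'k and x1 y1 t1 x2 y2 t2 :: 'a
    and W0 W1 W2 V0 V1 V2 :: "('i \<Rightarrow>\<^sub>0 'k) set"
  assumes grR: "graded_ring R GA" and one_neq: "\<one> \<noteq> \<zero>"
    and GA_scale: "a \<in> GA n \<Longrightarrow> z \<odot> a \<in> GA n"
    and gens: "x1 \<in> GA 1" "y1 \<in> GA 1" "t1 \<in> GA 1" "x2 \<in> GA 1" "y2 \<in> GA 1" "t2 \<in> GA 1"
    and K: "koszul_ops p q c (Rm x1) (Rm y1) (Rm t1) (Rm x2) (Rm y2) (Rm t2) W0 W1 W2"
    and K': "koszul_ops p q c (Lm y1) (Lm x1) (Lm t1) (\<lambda>u. scale (p * q) (Lm y2 u))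
      (\<lambda>u. scale (1 / (p * q)) (Lm x2 u)) (Lm t2) V0 V1 V2"
begin

sublocale K: koszul_ops p q c "Rm x1" "Rm y1" "Rm t1" "Rm x2" "Rm y2" "Rm t2" W0 W1 W2 by (rule K)
sublocale K': koszul_ops p q c "Lm y1" "Lm x1" "Lm t1" "\<lambda>u. scale (p * q) (Lm y2 u)"
  "\<lambda>u. scale (1 / (p * q)) (Lm x2 u)" "Lm t2" V0 V1 V2 by (rule K')

interpretation GR: graded_group R GA by (rule graded_ringD(2)[OF grR])

lemma gens_c [simp]: "x1 \<in> carrier R" "y1 \<in> carrier R" "t1 \<in> carrier R"
  "x2 \<in> carrier R" "y2 \<in> carrier R" "t2 \<in> carrier R"
  using gens GR.G_carrier by auto

text \<open>The rows of \<open>D 0\<close>, \<open>D 1\<close>, \<open>D 2\<close> correspond to the generators \<open>x, y, t\<close>, to the relations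
  \<open>tx - p xt\<close>, \<open>yt - p ty\<close>, \<open>yx - q xy - c t\<^sup>2\<close>, and to the overlap \<open>ytx\<close> of the relations.\<close>

definition D :: "nat \<Rightarrow> nat \<Rightarrow> nat \<Rightarrow> 'a" where
  "D i k j = (
    if i = 0 then
      (if k = 0 then x1 \<ominus> x2 else if k = 1 then y1 \<ominus> y2 else t1 \<ominus> t2)
    else if i = 1 then
      (if k = 0 then (if j = 0 then t1 \<ominus> p \<odot> t2 else if j = 1 then \<zero> else x2 \<ominus> p \<odot> x1)
       else if k = 1 then (if j = 0 then \<zero> else if j = 1 then t2 \<ominus> p \<odot> t1 else y1 \<ominus> p \<odot> y2)
       else (if j = 0 then y1 \<ominus> q \<odot> y2 else if j = 1 then x2 \<ominus> q \<odot> x1 else \<ominus> (c \<odot> (t1 \<oplus> t2))))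
    else if i = 2 then
      (if j = 0 then y1 \<ominus> (p * q) \<odot> y2 else if j = 1 then (p * q) \<odot> x1 \<ominus> x2 else \<ominus> (p \<odot> (t1 \<ominus> t2)))
    else \<zero>)"

lemma D_GA: "D i k j \<in> GA 1"
  unfolding D_def a_minus_def
  by (auto intro!: gens GA_scale GR.G_closed GR.G_uminus)

lemma D_c [simp]: "D i k j \<in> carrier R"
  using D_GA GR.G_carrier by blast

lemmas op_simps' = Rm_add Rm_minus Rm_uminus Rm_scale Rm_zero Lm_add Lm_minus Lm_uminus Lm_scale Lm_zero scale_closed

lemma vec3_c: "(\<And>k. k < (3::nat) \<Longrightarrow> u k \<in> carrier R) \<Longrightarrow> u 0 \<in> carrier R \<and> u 1 \<in> carrier R \<and> u (Suc 0) \<in> carrier R \<and> u 2 \<in> carrier R"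
  by auto

lemma lmul0:
  assumes "\<And>k. k < 3 \<Longrightarrow> u k \<in> carrier R"
  shows "\<theta> (lmul 3 (D 0) u j) = K.d1 (\<theta> (u 0)) (\<theta> (u 1)) (\<theta> (u 2))"
  using vec3_c[OF assms] unfolding lmul_def
  by (subst finsum3) (auto simp: assms \<theta>_add \<theta>_mult_R D_def K.d1_def op_simps')

lemma lmul1:
  assumes "\<And>k. k < 3 \<Longrightarrow> u k \<in> carrier R"
  shows "\<theta> (lmul 3 (D 1) u 0) = K.d2x (\<theta> (u 0)) (\<theta> (u 2))"
    "\<theta> (lmul 3 (D 1) u 1) = K.d2y (\<theta> (u 1)) (\<theta> (u 2))"
    "\<theta> (lmul 3 (D 1) u 2) = K.d2t (\<theta> (u 0)) (\<theta> (u 1)) (\<theta> (u 2))"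
  using vec3_c[OF assms] unfolding lmul_def
  by (subst finsum3; simp add: assms \<theta>_add \<theta>_mult_R D_def K.d2x_def K.d2y_def K.d2t_def op_simps')+

lemma lmul2:
  assumes "u 0 \<in> carrier R"
  shows "\<theta> (lmul 1 (D 2) u 0) = K.d3u (\<theta> (u 0))" "\<theta> (lmul 1 (D 2) u 1) = K.d3v (\<theta> (u 0))"
    "\<theta> (lmul 1 (D 2) u 2) = K.d3w (\<theta> (u 0))"
  using assms unfolding lmul_def
  by (subst finsum1; simp add: assms \<theta>_add \<theta>_mult_R D_def K.d3u_def K.d3v_def K.d3w_def op_simps')+

text \<open>Read backwards, the transposed complex is the Koszul complex of \<open>K'\<close> once
  the components at x, y, t are multiplied by 1, p q and -p. These factors come from matching the
  first matrix with \<open>d3\<close>; in \<open>rmul1\<close> and \<open>rmul2\<close> the same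
  factors appear on the arguments.\<close>

lemma rmul0:
  assumes "u 0 \<in> carrier R"
  shows "\<theta> (rmul 1 (D 0) u 0) = K'.d3u (\<theta> (u 0))" "scale (p * q) (\<theta> (rmul 1 (D 0) u 1)) = K'.d3v (\<theta> (u 0))"
    "scale (- p) (\<theta> (rmul 1 (D 0) u 2)) = K'.d3w (\<theta> (u 0))"
  using assms K.pq unfolding rmul_def
  by (subst finsum1; simp add: assms \<theta>_add \<theta>_mult_L D_def K'.d3u_def K'.d3v_def K'.d3w_def op_simps'
      sc.scale_right_diff_distrib)+

lemma rmul1:
  assumes "\<And>k. k < 3 \<Longrightarrow> u k \<in> carrier R"
  shows "\<theta> (rmul 3 (D 1) u 0) = K'.d2x (\<theta> (u 0)) (scale (- p) (\<theta> (u 2)))"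
    "scale (p * q) (\<theta> (rmul 3 (D 1) u 1)) = K'.d2y (scale (p * q) (\<theta> (u 1))) (scale (- p) (\<theta> (u 2)))"
    "scale (- p) (\<theta> (rmul 3 (D 1) u 2)) = K'.d2t (\<theta> (u 0)) (scale (p * q) (\<theta> (u 1))) (scale (- p) (\<theta> (u 2)))"
  using vec3_c[OF assms] K.pq unfolding rmul_def
  by (subst finsum3; simp add: assms \<theta>_add \<theta>_mult_L D_def K'.d2x_def K'.d2y_def K'.d2t_def op_simps'
      klin_simps[OF klin_Lm] sc.scale_right_diff_distrib sc.scale_right_distrib algebra_simps)+

lemma rmul2:
  assumes "\<And>k. k < 3 \<Longrightarrow> u k \<in> carrier R"
  shows "\<theta> (rmul 3 (D 2) u j) = K'.d1 (\<theta> (u 0)) (scale (p * q) (\<theta> (u 1))) (scale (- p) (\<theta> (u 2)))"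
  using vec3_c[OF assms] K.pq unfolding rmul_def
  by (subst finsum3) (auto simp: assms \<theta>_add \<theta>_mult_L D_def K'.d1_def op_simps'
      klin_simps[OF klin_Lm] sc.scale_right_diff_distrib sc.scale_right_distrib algebra_simps)

text \<open>The rows of a matrix are the images of the unit vectors, so the vanishing product
  follows from \<open>d1_d2\<close> evaluated at these.\<close>

lemma cplx01: "lmul 3 (D 0) (D 1 k) 0 = \<zero>"
proof -
  let ?e = "\<theta> \<one>" and ?u = "\<lambda>i j. if i = j then \<one> else \<zero>"
  \<comment> \<open>\<open>D 1\<close> repeats its last row for all \<open>k \<ge> 2\<close>, hence
    the minimum.\<close>
  have D1: "D 1 k j = lmul 3 (D 1) (?u (min k 2)) j" if "j < 3" for j
    unfolding lmul_def by (subst finsum3) (auto simp: D_def scale_closed min_def)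
  have uc: "?u i j \<in> carrier R" for i j :: nat by simp
  have "\<theta> (lmul 3 (D 0) (D 1 k) 0) = K.d1 (\<theta> (D 1 k 0)) (\<theta> (D 1 k 1)) (\<theta> (D 1 k 2))"
    by (rule lmul0) simp
  also have "\<dots> = 0" by (simp only: D1 lmul1[OF uc] K.d1_d2)
  finally show ?thesis by (simp add: \<theta>_zero_iff lmul_closed)
qed

lemma cplx12: "j < 3 \<Longrightarrow> lmul 3 (D 1) (D 2 k) j = \<zero>"
proof -
  let ?e = "\<lambda>_::nat. \<one>"
  have D2: "D 2 k j = lmul 1 (D 2) ?e j" for j
    unfolding lmul_def by (subst finsum1) (auto simp: D_def scale_closed)
  have 2: "\<theta> (D 2 k 0) = K.d3u (\<theta> \<one>)" "\<theta> (D 2 k 1) = K.d3v (\<theta> \<one>)" "\<theta> (D 2 k 2) = K.d3w (\<theta> \<one>)"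
    unfolding D2 by (rule lmul2, simp)+
  have "\<forall>j<3. \<theta> (lmul 3 (D 1) (D 2 k) j) = 0"
    unfolding all_less_3 using lmul1[where u = "D 2 k", OF D_c] by (simp only: 2 K.d2_d3)
  thus "j < 3 \<Longrightarrow> lmul 3 (D 1) (D 2 k) j = \<zero>" by (simp add: \<theta>_zero_iff lmul_closed)
qed

definition vec3 :: "'a \<Rightarrow> 'a \<Rightarrow> 'a \<Rightarrow> nat \<Rightarrow> 'a" where
  "vec3 a b e = (\<lambda>k. if k = 0 then a else if k = 1 then b else e)"

lemma vec3_simps [simp]: "vec3 a b e 0 = a" "vec3 a b e 1 = b" "vec3 a b e (Suc 0) = b" "vec3 a b e 2 = e"
  by (simp_all add: vec3_def)

lemma vec3_c': "a \<in> carrier R \<Longrightarrow> b \<in> carrier R \<Longrightarrow> e \<in> carrier R \<Longrightarrow> vec3 a b e k \<in> carrier R"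
  by (simp add: vec3_def)

lemma lex0:
  assumes u: "\<And>k. k < 3 \<Longrightarrow> u k \<in> carrier R" and z: "lmul 3 (D 0) u 0 = \<zero>"
  shows "\<exists>v. (\<forall>k<3. v k \<in> carrier R) \<and> (\<forall>k<3. u k = lmul 3 (D 1) v k)"
proof -
  have "K.d1 (\<theta> (u 0)) (\<theta> (u 1)) (\<theta> (u 2)) = 0" using lmul0[where u = u and j = 0, OF u] z by simp
  then obtain a b e where ab: "\<theta> (u 0) = K.d2x a e" "\<theta> (u 1) = K.d2y b e" "\<theta> (u 2) = K.d2t a b e"
    using K.exact1 by blast
  let ?v = "vec3 (\<phi> a) (\<phi> b) (\<phi> e)"
  have v: "?v k \<in> carrier R" for k by (simp add: vec3_c')
  have lc: "lmul 3 (D 1) ?v k \<in> carrier R" for k by (rule lmul_closed) (simp_all add: v)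
  have "\<forall>k<3. \<theta> (u k) = \<theta> (lmul 3 (D 1) ?v k)"
    unfolding all_less_3 using lmul1[OF v] ab by simp
  hence "\<forall>k<3. u k = lmul 3 (D 1) ?v k" using \<theta>_inj u lc by blast
  thus ?thesis using v by blast
qed

lemma lex1:
  assumes u: "\<And>k. k < 3 \<Longrightarrow> u k \<in> carrier R" and z: "\<And>j. j < 3 \<Longrightarrow> lmul 3 (D 1) u j = \<zero>"
  shows "\<exists>v. (\<forall>k<1. v k \<in> carrier R) \<and> (\<forall>k<3. u k = lmul 1 (D 2) v k)"
proof -
  have "K.d2x (\<theta> (u 0)) (\<theta> (u 2)) = 0" "K.d2y (\<theta> (u 1)) (\<theta> (u 2)) = 0"
    using lmul1(1,2)[where u = u, OF u] z[of 0] z[of 1] by simp_all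
  then obtain a where a: "\<theta> (u 0) = K.d3u a" "\<theta> (u 1) = K.d3v a" "\<theta> (u 2) = K.d3w a"
    using K.exact2 by blast
  let ?v = "\<lambda>_::nat. \<phi> a"
  have lc: "lmul 1 (D 2) ?v k \<in> carrier R" for k by (rule lmul_closed) simp_all
  have "\<forall>k<3. \<theta> (u k) = \<theta> (lmul 1 (D 2) ?v k)"
    unfolding all_less_3 using lmul2[of ?v] a by simp
  hence "\<forall>k<3. u k = lmul 1 (D 2) ?v k" using \<theta>_inj u lc by blast
  thus ?thesis by (intro exI[of _ ?v]) simp
qed

lemma lex2:
  assumes u: "u 0 \<in> carrier R" and z: "\<And>j. j < 3 \<Longrightarrow> lmul 1 (D 2) u j = \<zero>"
  shows "u 0 = \<zero>"
  using lmul2(3)[of u, OF u] z[of 2] K.exact3 \<theta>_zero_iff[OF u] by simp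

lemma rex0:
  assumes u: "u 0 \<in> carrier R" and z: "\<And>j. j < 3 \<Longrightarrow> rmul 1 (D 0) u j = \<zero>"
  shows "u 0 = \<zero>"
  using rmul0(3)[of u, OF u] z[of 2] K'.exact3 \<theta>_zero_iff[OF u] by simp

lemma rex1:
  assumes u: "\<And>k. k < 3 \<Longrightarrow> u k \<in> carrier R" and z: "\<And>j. j < 3 \<Longrightarrow> rmul 3 (D 1) u j = \<zero>"
  shows "\<exists>v. (\<forall>k<1. v k \<in> carrier R) \<and> (\<forall>k<3. u k = rmul 1 (D 0) v k)"
proof -
  have "K'.d2x (\<theta> (u 0)) (scale (- p) (\<theta> (u 2))) = 0"
    "K'.d2y (scale (p * q) (\<theta> (u 1))) (scale (- p) (\<theta> (u 2))) = 0"
    using rmul1(1,2)[where u = u, OF u] z[of 0] z[of 1] by simp_all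
  then obtain a where a: "\<theta> (u 0) = K'.d3u a" "scale (p * q) (\<theta> (u 1)) = K'.d3v a"
    "scale (- p) (\<theta> (u 2)) = K'.d3w a"
    using K'.exact2 by blast
  let ?v = "\<lambda>_::nat. \<phi> a"
  have lc: "rmul 1 (D 0) ?v k \<in> carrier R" for k by (rule rmul_closed) simp_all
  have "scale (p * q) (\<theta> (u 1)) = scale (p * q) (\<theta> (rmul 1 (D 0) ?v 1))"
    "scale (- p) (\<theta> (u 2)) = scale (- p) (\<theta> (rmul 1 (D 0) ?v 2))"
    using rmul0(2,3)[of ?v] a by simp_all
  hence "\<theta> (u 1) = \<theta> (rmul 1 (D 0) ?v 1)" "\<theta> (u 2) = \<theta> (rmul 1 (D 0) ?v 2)"
    using K.pq by (simp_all only: sc.scale_cancel_left) auto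
  hence "\<forall>k<3. \<theta> (u k) = \<theta> (rmul 1 (D 0) ?v k)"
    unfolding all_less_3 using rmul0(1)[of ?v] a by simp
  hence "\<forall>k<3. u k = rmul 1 (D 0) ?v k" using \<theta>_inj u lc by blast
  thus ?thesis by (intro exI[of _ ?v]) simp
qed

lemma rex2:
  assumes u: "\<And>k. k < 3 \<Longrightarrow> u k \<in> carrier R" and z: "rmul 3 (D 2) u 0 = \<zero>"
  shows "\<exists>v. (\<forall>k<3. v k \<in> carrier R) \<and> (\<forall>k<3. u k = rmul 3 (D 1) v k)"
proof -
  have "K'.d1 (\<theta> (u 0)) (scale (p * q) (\<theta> (u 1))) (scale (- p) (\<theta> (u 2))) = 0"
    using rmul2[where u = u and j = 0, OF u] z by simp
  then obtain a b e where ab: "\<theta> (u 0) = K'.d2x a e" "scale (p * q) (\<theta> (u 1)) = K'.d2y b e"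
    "scale (- p) (\<theta> (u 2)) = K'.d2t a b e"
    using K'.exact1 by blast
  \<comment> \<open>\<open>exact1\<close> delivers rescaled components; dividing by p q and -p
    yields the preimage under the matrix itself.\<close>
  let ?v = "vec3 (\<phi> a) (\<phi> (scale (1 / (p * q)) b)) (\<phi> (scale (- (1 / p)) e))"
  have v: "?v k \<in> carrier R" for k by (simp add: vec3_c')
  have lc: "rmul 3 (D 1) ?v k \<in> carrier R" for k by (rule rmul_closed, rule v, simp)
  have be: "scale (p * q) (scale (1 / (p * q)) b) = b" "scale (- p) (scale (- (1 / p)) e) = e"
    using K.pq by simp_all
  have "scale (p * q) (\<theta> (u 1)) = scale (p * q) (\<theta> (rmul 3 (D 1) ?v 1))"
    "scale (- p) (\<theta> (u 2)) = scale (- p) (\<theta> (rmul 3 (D 1) ?v 2))"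
    using rmul1(2,3)[OF v] ab by (simp_all only: vec3_simps \<theta>_\<phi> be)
  hence "\<theta> (u 1) = \<theta> (rmul 3 (D 1) ?v 1)" "\<theta> (u 2) = \<theta> (rmul 3 (D 1) ?v 2)"
    using K.pq by (simp_all only: sc.scale_cancel_left) auto
  moreover have "\<theta> (u 0) = \<theta> (rmul 3 (D 1) ?v 0)"
    using rmul1(1)[OF v] ab by (simp only: vec3_simps \<theta>_\<phi> be)
  ultimately have "\<forall>k<3. \<theta> (u k) = \<theta> (rmul 3 (D 1) ?v k)"
    unfolding all_less_3 by simp
  hence "\<forall>k<3. u k = rmul 3 (D 1) ?v k" using \<theta>_inj u lc by blast
  thus ?thesis using v by blast
qed

lemma kn_cases: "i = 0 \<or> i = 1 \<or> i = 2 \<or> (\<exists>j. i = Suc (Suc (Suc j)))"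
  by (metis One_nat_def Suc_1 not0_implies_Suc)

lemma matrix_complex: "matrix_complex R GA kn D"
proof (intro matrix_complex.intro matrix_complex_axioms.intro ring_axioms grR one_neq)
  fix k i j u
  show "D i k j \<in> GA 1" by (rule D_GA)
  show "kn 0 = 1" by simp
  show "k < kn (Suc (Suc i)) \<Longrightarrow> j < kn i \<Longrightarrow> lmul (kn (Suc i)) (D i) (D (Suc i) k) j = \<zero>"
    using kn_cases[of i] cplx01[of k] cplx12[of j k] by (auto simp: numeral_2_eq_2)
  assume u: "\<And>k. k < kn (Suc i) \<Longrightarrow> u k \<in> carrier R" and z: "\<And>j. j < kn i \<Longrightarrow> lmul (kn (Suc i)) (D i) u j = \<zero>"
  consider "i = 0" | "i = 1" | "i = 2" | j where "i = Suc (Suc (Suc j))" using kn_cases[of i] by blast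
  thus "\<exists>v. (\<forall>k<kn (Suc (Suc i)). v k \<in> carrier R) \<and> (\<forall>k<kn (Suc i). u k = lmul (kn (Suc (Suc i))) (D (Suc i)) v k)"
  proof cases
    case 1 thus ?thesis using lex0[of u] u z by simp
  next
    case 2 thus ?thesis using lex1[of u] u z by (simp add: numeral_2_eq_2)
  next
    case 3 thus ?thesis using lex2[of u] u z by (simp add: numeral_2_eq_2 lmul_def)
  next
    case 4 thus ?thesis by simp
  qed
qed

end

text \<open>An element is a remainder in \<open>W2\<close> plus a boundary. So exactness at the
  augmentation amounts to two facts: the generators of the boundaries are killed, and
  \<open>\<epsilon>\<close> is injective on remainders. The same holds for
  \<open>\<epsilon>'\<close> with the last matrix and \<open>V2\<close>.\<close>

locale koszul_ring_aug = koszul_ring R \<theta> GA p q c x1 y1 t1 x2 y2 t2 W0 W1 W2 V0 V1 V2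
  for R :: "('k::field, 'a, 's) module_scheme" (structure)
    and \<theta> :: "'a \<Rightarrow> ('i \<Rightarrow>\<^sub>0 'k)" and GA p q c x1 y1 t1 x2 y2 t2 W0 W1 W2 V0 V1 V2 +
  fixes N :: "('a, 'm, 'u) module_scheme" and GN :: "int \<Rightarrow> 'm set" and \<epsilon> :: "'a \<Rightarrow> 'm"
    and E :: "('a, 'e, 't) module_scheme" and GE :: "int \<Rightarrow> 'e set" and \<epsilon>' :: "'a \<Rightarrow> 'e"
  assumes N: "graded_module R GA N GN" and \<epsilon>: "linmap R (regular R) N \<epsilon>" "\<epsilon> ` carrier R = carrier N"
    and \<epsilon>0: "\<epsilon> (x1 \<ominus> x2) = \<zero>\<^bsub>N\<^esub>" "\<epsilon> (y1 \<ominus> y2) = \<zero>\<^bsub>N\<^esub>" "\<epsilon> (t1 \<ominus> t2) = \<zero>\<^bsub>N\<^esub>"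
    and \<epsilon>_inj: "a \<in> carrier R \<Longrightarrow> \<theta> a \<in> W2 \<Longrightarrow> \<epsilon> a = \<zero>\<^bsub>N\<^esub> \<Longrightarrow> a = \<zero>"
    and \<epsilon>_deg: "a \<in> GA m \<Longrightarrow> \<epsilon> a \<in> GN m"
    and E: "left_module (opp R) E" and \<epsilon>': "linmap (opp R) (regular (opp R)) E \<epsilon>'" "\<epsilon>' ` carrier R = carrier E"
    and \<epsilon>'0: "\<epsilon>' (y1 \<ominus> (p * q) \<odot> y2) = \<zero>\<^bsub>E\<^esub>" "\<epsilon>' ((p * q) \<odot> x1 \<ominus> x2) = \<zero>\<^bsub>E\<^esub>"
      "\<epsilon>' (\<ominus> (p \<odot> (t1 \<ominus> t2))) = \<zero>\<^bsub>E\<^esub>"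
    and \<epsilon>'_inj: "a \<in> carrier R \<Longrightarrow> \<theta> a \<in> V2 \<Longrightarrow> \<epsilon>' a = \<zero>\<^bsub>E\<^esub> \<Longrightarrow> a = \<zero>"
    and \<epsilon>'_deg: "\<epsilon>' ` GA m = GE m"
begin

lemma matrix_regular: "matrix_regular R GA kn D N GN \<epsilon> E GE \<epsilon>'"
proof (intro matrix_regular.intro matrix_resolution.intro matrix_complex
    matrix_resolution_axioms.intro matrix_regular_axioms.intro N \<epsilon> E \<epsilon>' \<epsilon>_deg \<epsilon>'_deg)
  interpret N: left_module R N using N by (simp add: graded_module_def)
  interpret E: left_module "opp R" E by (rule E)
  note \<epsilon>D = linmapD[OF \<epsilon>(1), unfolded regular_simps]
  note \<epsilon>'D = linmapD[OF \<epsilon>'(1), unfolded regular_simps opp_simps]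
  fix a assume a: "a \<in> carrier R"
  have im0: "\<epsilon> (lmul 3 (D 0) v 0) = \<zero>\<^bsub>N\<^esub>" if v: "\<And>k. k < 3 \<Longrightarrow> v k \<in> carrier R" for v
  proof -
    have "\<epsilon> (v k \<otimes> D 0 k 0) = \<zero>\<^bsub>N\<^esub>" if "k < 3" for k
    proof -
      have "\<epsilon> (D 0 k 0) = \<zero>\<^bsub>N\<^esub>" by (simp add: D_def \<epsilon>0)
      thus ?thesis using \<epsilon>D(3)[OF v[OF that] D_c, of 0 k 0] N.smult_r_null[OF v[OF that]] by simp
    qed
    thus ?thesis unfolding lmul_def using v
      by (subst finsum3) (auto simp: \<epsilon>D(2))
  qed
  show "\<epsilon> a = \<zero>\<^bsub>N\<^esub> \<longleftrightarrow> (\<exists>v. (\<forall>k<kn 1. v k \<in> carrier R) \<and> a = lmul (kn 1) (D 0) v 0)"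
  proof
    assume z: "\<epsilon> a = \<zero>\<^bsub>N\<^esub>"
    \<comment> \<open>Subtracting the boundary leaves an element with coordinates in
      \<open>W2\<close> that \<open>\<epsilon>\<close> still kills, and there
      \<open>\<epsilon>\<close> is injective.\<close>
    obtain m b1 b2 b3 where m: "m \<in> W2" "\<theta> a = m + K.d1 b1 b2 b3" using K.exact0_span by blast
    let ?v = "vec3 (\<phi> b1) (\<phi> b2) (\<phi> b3)"
    have v: "?v k \<in> carrier R" for k by (simp add: vec3_c')
    have lc: "lmul 3 (D 0) ?v 0 \<in> carrier R" by (rule lmul_closed) (simp_all add: v)
    have "a = \<phi> m \<oplus> lmul 3 (D 0) ?v 0"
      by (rule \<theta>_inj[THEN iffD1]) (use a lc lmul0[OF v] m in \<open>simp_all add: \<theta>_add\<close>)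
    moreover from this have "\<epsilon> (\<phi> m) = \<zero>\<^bsub>N\<^esub>" using z \<epsilon>D(2)[OF \<phi>_in lc] im0[OF v] \<epsilon>D(1)[OF \<phi>_in] by simp
    hence "\<phi> m = \<zero>" using \<epsilon>_inj[of "\<phi> m"] m by simp
    ultimately have "a = lmul 3 (D 0) ?v 0" using lc by simp
    thus "\<exists>v. (\<forall>k<kn 1. v k \<in> carrier R) \<and> a = lmul (kn 1) (D 0) v 0"
      using v by (intro exI[of _ ?v]) simp
  qed (use im0 in auto)
next
  interpret E: left_module "opp R" E by (rule E)
  note \<epsilon>'D = linmapD[OF \<epsilon>'(1), unfolded regular_simps opp_simps]
  fix a assume a: "a \<in> carrier R"
  have im0: "\<epsilon>' (rmul 3 (D 2) v 0) = \<zero>\<^bsub>E\<^esub>" if v: "\<And>k. k < 3 \<Longrightarrow> v k \<in> carrier R" for v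
  proof -
    have "\<epsilon>' (D 2 0 k \<otimes> v k) = \<zero>\<^bsub>E\<^esub>" if "k < 3" for k
    proof -
      have "\<epsilon>' (D 2 0 k) = \<zero>\<^bsub>E\<^esub>" by (simp add: D_def \<epsilon>'0)
      thus ?thesis using \<epsilon>'D(3)[OF v[OF that] D_c, of 2 0 k] E.smult_r_null[of "v k"] v[OF that] by simp
    qed
    thus ?thesis unfolding rmul_def using v
      by (subst finsum3) (auto simp: \<epsilon>'D(2))
  qed
  show "\<epsilon>' a = \<zero>\<^bsub>E\<^esub> \<longleftrightarrow> (\<exists>w. (\<forall>j<kn 2. w j \<in> carrier R) \<and> a = rmul (kn 2) (D 2) w 0)"
  proof
    assume z: "\<epsilon>' a = \<zero>\<^bsub>E\<^esub>"
    obtain m b1 b2 b3 where m: "m \<in> V2" "\<theta> a = m + K'.d1 b1 b2 b3" using K'.exact0_span by blast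
    let ?v = "vec3 (\<phi> b1) (\<phi> (scale (1 / (p * q)) b2)) (\<phi> (scale (- (1 / p)) b3))"
    have v: "?v k \<in> carrier R" for k by (simp add: vec3_c')
    have be: "scale (p * q) (scale (1 / (p * q)) b2) = b2" "scale (- p) (scale (- (1 / p)) b3) = b3"
      using K.pq by simp_all
    have lc: "rmul 3 (D 2) ?v 0 \<in> carrier R" by (rule rmul_closed, rule v, simp)
    have "\<theta> (rmul 3 (D 2) ?v 0) = K'.d1 b1 b2 b3"
      using rmul2[OF v, where j = 0] by (simp only: vec3_simps \<theta>_\<phi> be)
    hence "a = \<phi> m \<oplus> rmul 3 (D 2) ?v 0"
      by (intro \<theta>_inj[THEN iffD1]) (use a lc m in \<open>simp_all add: \<theta>_add\<close>)
    moreover from this have "\<epsilon>' (\<phi> m) = \<zero>\<^bsub>E\<^esub>" using z \<epsilon>'D(2)[OF \<phi>_in lc] im0[OF v] \<epsilon>'D(1)[OF \<phi>_in] by simp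
    hence "\<phi> m = \<zero>" using \<epsilon>'_inj[of "\<phi> m"] m by simp
    ultimately have "a = rmul 3 (D 2) ?v 0" using lc by simp
    thus "\<exists>w. (\<forall>j<kn 2. w j \<in> carrier R) \<and> a = rmul (kn 2) (D 2) w 0"
      using v by (intro exI[of _ ?v] conjI allI impI) (simp_all only: kn_numerals)
  qed (use im0 in auto)
next
  fix w j i
  show "kn 3 = 1" by simp
  show "3 < i \<Longrightarrow> kn i = 0" for i by (simp add: kn_def)
  show "w j = \<zero>" if "\<And>j. j < kn 0 \<Longrightarrow> w j \<in> carrier R" "\<And>k. k < kn 1 \<Longrightarrow> rmul (kn 0) (D 0) w k = \<zero>" "j < kn 0"
    using rex0[of w] that by simp
  assume i: "i \<noteq> 2" and w: "\<And>j. j < kn (Suc i) \<Longrightarrow> w j \<in> carrier R"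
    and z: "\<And>k. k < kn (Suc (Suc i)) \<Longrightarrow> rmul (kn (Suc i)) (D (Suc i)) w k = \<zero>"
  consider "i = 0" | "i = 1" | j where "i = Suc (Suc (Suc j))" using kn_cases[of i] i by blast
  thus "\<exists>w'. (\<forall>j<kn i. w' j \<in> carrier R) \<and> (\<forall>k<kn (Suc i). w k = rmul (kn i) (D i) w' k)"
  proof cases
    case 1 thus ?thesis using rex1[of w] w z by simp
  next
    case 2 thus ?thesis using rex2[of w] w z by (simp add: numeral_2_eq_2)
  next
    case 3 thus ?thesis by (intro exI[of _ "\<lambda>_. \<zero>"]) simp
  qed
qed

sublocale M: matrix_regular R GA kn D N GN \<epsilon> E GE \<epsilon>' by (rule matrix_regular)

end

text \<open>Because the division takes \<open>a3\<close> first, \<open>a2\<close> has to be a shift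
  only on indices of \<open>a3\<close>-depth 0, and \<open>a1\<close> only on those where both
  depths are 0. The operators on the second factor are an arbitrary solution of the
  relations.\<close>

lemma koszul_ops_tensorI:
  fixes a1 a2 a3 :: "('i \<Rightarrow>\<^sub>0 'k::field) \<Rightarrow> ('i \<Rightarrow>\<^sub>0 'k)" and b1 b2 b3 :: "('j \<Rightarrow>\<^sub>0 'k) \<Rightarrow> ('j \<Rightarrow>\<^sub>0 'k)"
  assumes pq: "p \<noteq> 0" "q \<noteq> 0" and a: "klin a1" "klin a2" "klin a3" and b: "klin b1" "klin b2" "klin b3"
    and rel_a: "\<And>u. a1 (a3 u) = scale p (a3 (a1 u))" "\<And>u. a3 (a2 u) = scale p (a2 (a3 u))"
      "\<And>u. a1 (a2 u) = scale q (a2 (a1 u)) + scale c (a3 (a3 u))"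
    and rel_b: "\<And>u. b3 (b1 u) = scale p (b1 (b3 u))" "\<And>u. b2 (b3 u) = scale p (b3 (b2 u))"
      "\<And>u. b2 (b1 u) = scale q (b1 (b2 u)) + scale c (b3 (b3 u))"
    and S3: "weighted_shift a3 UNIV s3 w3 d3" and S2: "weighted_shift a2 {i. d3 i = 0} s2 w2 d2"
    and S1: "weighted_shift a1 {i. d3 i = 0 \<and> d2 i = 0} s1 w1 d1"
  shows "koszul_ops p q c (op1 a1) (op1 a2) (op1 a3) (op2 b1) (op2 b2) (op2 b3)
    (KS {i. d3 i = 0}) (KS {i. d3 i = 0 \<and> d2 i = 0}) (KS {i. d3 i = 0 \<and> d2 i = 0 \<and> d1 i = 0})"
proof
  interpret S3: weighted_shift a3 UNIV s3 w3 d3 by fact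
  interpret S2: weighted_shift a2 "{i. d3 i = 0}" s2 w2 d2 by fact
  interpret S1: weighted_shift a1 "{i. d3 i = 0 \<and> d2 i = 0}" s1 w1 d1 by fact
  have UN: "u \<in> KS UNIV" for u :: "'i \<times> 'j \<Rightarrow>\<^sub>0 'k" by (simp add: KS_def)
  show "p \<noteq> 0" "q \<noteq> 0" by fact+
  show "op1 a1 (op1 a3 u) = scale p (op1 a3 (op1 a1 u))" "op1 a3 (op1 a2 u) = scale p (op1 a2 (op1 a3 u))"
    "op1 a1 (op1 a2 u) = scale q (op1 a2 (op1 a1 u)) + scale c (op1 a3 (op1 a3 u))" for u :: "'i \<times> 'j \<Rightarrow>\<^sub>0 'k"
    by (simp_all add: op1_op1 a rel_a op1_plus op1_smult)
  show "op2 b3 (op2 b1 u) = scale p (op2 b1 (op2 b3 u))" "op2 b2 (op2 b3 u) = scale p (op2 b3 (op2 b2 u))"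
    "op2 b2 (op2 b1 u) = scale q (op2 b1 (op2 b2 u)) + scale c (op2 b3 (op2 b3 u))" for u :: "'i \<times> 'j \<Rightarrow>\<^sub>0 'k"
    by (simp_all add: op2_op2 b rel_b op2_plus op2_smult)
  show "op2 b1 (op1 a1 u) = op1 a1 (op2 b1 u)" "op2 b1 (op1 a2 u) = op1 a2 (op2 b1 u)" "op2 b1 (op1 a3 u) = op1 a3 (op2 b1 u)"
    "op2 b2 (op1 a1 u) = op1 a1 (op2 b2 u)" "op2 b2 (op1 a2 u) = op1 a2 (op2 b2 u)" "op2 b2 (op1 a3 u) = op1 a3 (op2 b2 u)"
    "op2 b3 (op1 a1 u) = op1 a1 (op2 b3 u)" "op2 b3 (op1 a2 u) = op1 a2 (op2 b3 u)" "op2 b3 (op1 a3 u) = op1 a3 (op2 b3 u)"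
    for u by (simp_all only: op1_op2_commute a b)
  show "op1 a2 u \<in> KS {i. d3 i = 0}" if "u \<in> KS {i. d3 i = 0}" for u :: "'i \<times> 'j \<Rightarrow>\<^sub>0 'k"
  proof (rule KS_op1[OF that])
    fix i assume i: "i \<in> {i. d3 i = 0}"
    show "keys (a2 (bas i)) \<subseteq> {i. d3 i = 0}" using S2.inA[OF i] by (simp add: S2.shift[OF i])
  qed
  show "op1 a1 u \<in> KS {i. d3 i = 0 \<and> d2 i = 0}" if "u \<in> KS {i. d3 i = 0 \<and> d2 i = 0}" for u :: "'i \<times> 'j \<Rightarrow>\<^sub>0 'k"
  proof (rule KS_op1[OF that])
    fix i assume i: "i \<in> {i. d3 i = 0 \<and> d2 i = 0}"
    show "keys (a1 (bas i)) \<subseteq> {i. d3 i = 0 \<and> d2 i = 0}" using S1.inA[OF i] by (simp add: S1.shift[OF i])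
  qed
  have eqs: "{i \<in> UNIV. d3 i = 0} = {i. d3 i = 0}" "{i \<in> {i. d3 i = 0}. d2 i = 0} = {i. d3 i = 0 \<and> d2 i = 0}"
    "{i \<in> {i. d3 i = 0 \<and> d2 i = 0}. d1 i = 0} = {i. d3 i = 0 \<and> d2 i = 0 \<and> d1 i = 0}" by auto
  show "op1 a3 u - scale k (op2 b3 u) \<in> KS {i. d3 i = 0} \<Longrightarrow> u = 0" for k u
    using S3.step_unique[OF UN _ a(3) b(3), of u k] unfolding eqs by blast
  show "\<exists>w\<in>KS {i. d3 i = 0}. \<exists>v. u = w + (op1 a3 v - scale k (op2 b3 v))" for k u
    using S3.step_span[OF UN, of u k b3] unfolding eqs by blast
  show "u \<in> KS {i. d3 i = 0} \<Longrightarrow> op1 a2 u - scale k (op2 b2 u) \<in> KS {i. d3 i = 0 \<and> d2 i = 0} \<Longrightarrow> u = 0" for k u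
    using S2.step_unique[OF _ _ a(2) b(2), of u k] unfolding eqs by blast
  show "u \<in> KS {i. d3 i = 0} \<Longrightarrow> \<exists>w\<in>KS {i. d3 i = 0 \<and> d2 i = 0}. \<exists>v\<in>KS {i. d3 i = 0}. u = w + (op1 a2 v - scale k (op2 b2 v))" for k u
    using S2.step_span[of u k b2] unfolding eqs by blast
  show "u \<in> KS {i. d3 i = 0 \<and> d2 i = 0} \<Longrightarrow> op1 a1 u - scale k (op2 b1 u) \<in> KS {i. d3 i = 0 \<and> d2 i = 0 \<and> d1 i = 0} \<Longrightarrow> u = 0" for k u
    using S1.step_unique[OF _ _ a(1) b(1), of u k] unfolding eqs by blast
  show "u \<in> KS {i. d3 i = 0 \<and> d2 i = 0} \<Longrightarrow> \<exists>w\<in>KS {i. d3 i = 0 \<and> d2 i = 0 \<and> d1 i = 0}.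
      \<exists>v\<in>KS {i. d3 i = 0 \<and> d2 i = 0}. u = w + (op1 a1 v - scale k (op2 b1 v))" for k u
    using S1.step_span[of u k b1] unfolding eqs by blast
  show "KS {i. d3 i = 0 \<and> d2 i = 0 \<and> d1 i = 0} \<subseteq> KS {i. d3 i = 0 \<and> d2 i = 0}"
    "KS {i. d3 i = 0 \<and> d2 i = 0} \<subseteq> KS {i. d3 i = 0}"
    by (rule KS_mono; auto)+
qed (auto simp: klin_op1 klin_op2 KS_closed KS_op2)

section \<open>Monoid algebras and quotient algebras\<close>

lemma ring_cong:
  assumes "ring M" "carrier N = carrier M" "zero N = zero M" "add N = add M" "mult N = mult M" "one N = one M"
  shows "ring N"
proof -
  interpret M: ring M by fact
  show ?thesis
  proof (rule ringI)
    show "abelian_group N" by (rule abelian_group_cong[OF M.abelian_group_axioms assms(2-4)])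
    show "Group.monoid N" by (rule monoidI) (use assms in \<open>auto simp: M.m_assoc\<close>)
  qed (use assms in \<open>auto simp: M.l_distr M.r_distr\<close>)
qed

lemma monoid_algebra_simps [simp]:
  "u \<in> carrier (monoid_algebra W) \<longleftrightarrow> keys u \<subseteq> carrier W"
  "one (monoid_algebra W) = bas \<one>\<^bsub>W\<^esub>" "zero (monoid_algebra W) = 0" "add (monoid_algebra W) = (+)"
  "smult (monoid_algebra W) = scale"
  by (simp_all add: monoid_algebra_def)

lemma monoid_algebra_mult:
  "u \<otimes>\<^bsub>monoid_algebra W\<^esub> v = lext (\<lambda>a. lext (\<lambda>b. bas (a \<otimes>\<^bsub>W\<^esub> b)) v) u"
  by (simp add: monoid_algebra_def lext_def sc.scale_sum_right)

lemma monoid_algebra_mult_bas [simp]: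
  "sg a c \<otimes>\<^bsub>monoid_algebra W\<^esub> sg b d = sg (a \<otimes>\<^bsub>W\<^esub> b) (c * d)"
  by (simp add: monoid_algebra_mult)

lemma lext_lext: "lext g (lext f u) = lext (\<lambda>i. lext g (f i)) u"
  by (rule klin_lext_out[OF klin_lext])

lemma monoid_algebra_k_algebra:
  assumes "Group.monoid W"
  shows "k_algebra (monoid_algebra W :: ('k::field, 'w \<Rightarrow>\<^sub>0 'k) module)"
proof -
  interpret W: Group.monoid W by fact
  let ?A = "monoid_algebra W :: ('k, 'w \<Rightarrow>\<^sub>0 'k) module"
  have closed: "u \<otimes>\<^bsub>?A\<^esub> v \<in> carrier ?A" if uv: "u \<in> carrier ?A" "v \<in> carrier ?A" for u v
  proof -
    have "keys (lext (\<lambda>b. bas (a \<otimes>\<^bsub>W\<^esub> b)) v) \<subseteq> carrier W" if "a \<in> keys u" for a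
    proof -
      have "a \<in> carrier W" "keys v \<subseteq> carrier W" using uv that by auto
      thus ?thesis using keys_lext[of "\<lambda>b. bas (a \<otimes>\<^bsub>W\<^esub> b)" v] by (fastforce split: if_splits)
    qed
    thus ?thesis unfolding monoid_algebra_mult monoid_algebra_simps
      using keys_lext[of "\<lambda>a. lext (\<lambda>b. bas (a \<otimes>\<^bsub>W\<^esub> b)) v" u] by blast
  qed
  have assoc: "u \<otimes>\<^bsub>?A\<^esub> v \<otimes>\<^bsub>?A\<^esub> w = u \<otimes>\<^bsub>?A\<^esub> (v \<otimes>\<^bsub>?A\<^esub> w)"
    if "u \<in> carrier ?A" "v \<in> carrier ?A" "w \<in> carrier ?A" for u v w
    unfolding monoid_algebra_mult lext_lext lext_single sc.scale_one
    by (intro lext_cong) (use that in \<open>auto simp: W.m_assoc subset_iff\<close>)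
  have "ring ?A"
  proof (rule ringI)
    show "abelian_group ?A"
    proof (rule abelian_groupI)
      show "\<exists>y\<in>carrier ?A. y \<oplus>\<^bsub>?A\<^esub> x = \<zero>\<^bsub>?A\<^esub>" if "x \<in> carrier ?A" for x
        using that by (intro bexI[of _ "- x"]) auto
      show "x \<oplus>\<^bsub>?A\<^esub> y \<in> carrier ?A" if "x \<in> carrier ?A" "y \<in> carrier ?A" for x y
        using that Poly_Mapping.keys_add[of x y] by auto
    qed (auto simp: add_ac)
    show "Group.monoid ?A"
    proof (rule monoidI)
      show "\<one>\<^bsub>?A\<^esub> \<otimes>\<^bsub>?A\<^esub> x = x" if "x \<in> carrier ?A" for x
      proof -
        have "lext (\<lambda>b. bas (\<one>\<^bsub>W\<^esub> \<otimes>\<^bsub>W\<^esub> b)) x = lext bas x"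
          by (rule lext_cong) (use that in auto)
        thus ?thesis by (simp add: monoid_algebra_mult)
      qed
      show "x \<otimes>\<^bsub>?A\<^esub> \<one>\<^bsub>?A\<^esub> = x" if "x \<in> carrier ?A" for x
      proof -
        have "lext (\<lambda>b. bas (b \<otimes>\<^bsub>W\<^esub> \<one>\<^bsub>W\<^esub>)) x = lext bas x"
          by (rule lext_cong) (use that in auto)
        thus ?thesis by (simp add: monoid_algebra_mult)
      qed
    qed (use closed assoc in auto)
  qed (simp_all add: monoid_algebra_mult lext_simps lext_add_fun)
  moreover have "scale z u \<in> carrier ?A" if "u \<in> carrier ?A" for z and u :: "'w \<Rightarrow>\<^sub>0 'k"
    using that keys_scale[of z u] by auto
  ultimately show ?thesis
    by (intro k_algebra.intro k_algebra_axioms.intro)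
      (simp_all add: sc.scale_left_distrib sc.scale_right_distrib monoid_algebra_mult lext_simps lext_scale_fun)
qed

locale quotient_algebra = A: k_algebra A + A: ideal I A for I and A :: "('k::field, 'a, 's) module_scheme" (structure)
begin

abbreviation "B \<equiv> quot A I"

lemma quot_ring: "ring B"
  by (rule ring_cong[OF A.quotient_is_ring]) (simp_all add: quot_def)

lemma cls_carrier: "C \<in> carrier B \<longleftrightarrow> (\<exists>x\<in>carrier A. C = I +> x)" by (rule quot_carrier_iff)

lemma cls_in [simp]: "x \<in> carrier A \<Longrightarrow> I +> x \<in> carrier B" by (auto simp: cls_carrier)

lemma cls_add: "x \<in> carrier A \<Longrightarrow> y \<in> carrier A \<Longrightarrow> (I +> x) \<oplus>\<^bsub>B\<^esub> (I +> y) = I +> (x \<oplus> y)"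
  by (simp add: quot_simps A.a_rcos_sum)

lemma cls_mult: "x \<in> carrier A \<Longrightarrow> y \<in> carrier A \<Longrightarrow> (I +> x) \<otimes>\<^bsub>B\<^esub> (I +> y) = I +> (x \<otimes> y)"
  by (simp add: quot_simps A.rcoset_mult_add)

lemma cls_zero: "\<zero>\<^bsub>B\<^esub> = I +> \<zero>" using A.a_subset by (simp add: quot_simps)

lemma cls_one: "\<one>\<^bsub>B\<^esub> = I +> \<one>" by (simp add: quot_simps)

text \<open>Scalars act through multiples of 1, so a ring ideal is a subspace.\<close>

lemma I_scale: "x \<in> I \<Longrightarrow> z \<odot> x \<in> I"
  using A.I_l_closed[of x "z \<odot> \<one>"] A.a_Hcarr A.scale_closed[of \<one> z]
  by (simp add: A.scale_mult_l[symmetric])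

lemma quotient_group: "quotient_group I A" unfolding quotient_group_def ..

lemma cls_scale: "x \<in> carrier A \<Longrightarrow> z \<odot>\<^bsub>B\<^esub> (I +> x) = I +> (z \<odot> x)"
  by (rule quotient_group.cos_smult[OF quotient_group])
     (auto simp: A.scale_closed A.scale_r_distr I_scale)

lemma cls_eq_iff: "x \<in> carrier A \<Longrightarrow> y \<in> carrier A \<Longrightarrow> I +> x = I +> y \<longleftrightarrow> x \<ominus> y \<in> I"
  by (rule quotient_group.cos_eq_iff[OF quotient_group])

lemma quot_k_algebra: "k_algebra B"
proof (intro k_algebra.intro k_algebra_axioms.intro quot_ring)
qed (auto simp: cls_carrier cls_scale cls_add cls_mult A.scale_closed A.scale_l_distr A.scale_r_distr
      A.scale_scale A.scale_one A.scale_mult_l[symmetric] A.scale_mult_r[symmetric])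

text \<open>Values on cosets, such as coordinates and the action of a tensor, are defined by
  \<open>the_elem\<close> of an image; constancy on the coset allows evaluation at a
  representative.\<close>

lemma the_elem_cls:
  assumes "\<And>y. y \<in> carrier A \<Longrightarrow> y \<ominus> x \<in> I \<Longrightarrow> f y = f x" "x \<in> carrier A"
  shows "the_elem (f ` (I +> x)) = f x"
proof -
  have "f y = f x" if "y \<in> I +> x" for y
  proof -
    have "y \<in> carrier A" using that assms(2) A.a_r_coset_subset_G[OF A.a_subset] by blast
    moreover from this have "y \<ominus> x \<in> I"
      using that assms(2) A.a_rcos_module[of x y] by (simp add: a_minus_def)
    ultimately show ?thesis using assms(1) by blast
  qed
  moreover have "x \<in> I +> x" by (rule A.a_rcos_self[OF assms(2)])
  ultimately have "f ` (I +> x) = {f x}" by blast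
  thus ?thesis by simp
qed

end

section \<open>The Poincare-Birkhoff-Witt basis\<close>

text \<open>The coefficient of x^(i-1) t^2 in the normal form of y x^i: c times the sum of q^(i-1-j)
  p^(2j) over j < i, a two-parameter quantum integer.\<close>

primrec gauss :: "'k::field \<Rightarrow> 'k \<Rightarrow> 'k \<Rightarrow> nat \<Rightarrow> 'k" where
  "gauss p q c 0 = 0"
| "gauss p q c (Suc i) = q * gauss p q c i + c * p ^ (2 * i)"

context k_algebra
begin

lemma scale_swap: "x \<in> carrier B \<Longrightarrow> y \<in> carrier B \<Longrightarrow> (z \<odot> x) \<otimes> y = z \<odot> (x \<otimes> y)"
  "x \<in> carrier B \<Longrightarrow> y \<in> carrier B \<Longrightarrow> x \<otimes> (z \<odot> y) = z \<odot> (x \<otimes> y)"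
  by (simp_all add: scale_mult_l[symmetric] scale_mult_r[symmetric])

context
  fixes p q c x y t
  assumes c [simp]: "x \<in> carrier B" "y \<in> carrier B" "t \<in> carrier B"
    and tx: "t \<otimes> x = p \<odot> (x \<otimes> t)" and yt: "y \<otimes> t = p \<odot> (t \<otimes> y)"
    and yx: "y \<otimes> x = q \<odot> (x \<otimes> y) \<oplus> c \<odot> (t \<otimes> t)"
begin

definition "pbm i j k = x [^] (i::nat) \<otimes> (t [^] (j::nat) \<otimes> y [^] (k::nat))"

lemma pbm_c [simp]: "pbm i j k \<in> carrier B" by (simp add: pbm_def)

lemmas scl = scale_closed scale_swap scale_scale[symmetric] scale_r_distr

lemma pow_l: "a \<in> carrier B \<Longrightarrow> a \<otimes> a [^] (n::nat) = a [^] Suc n"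
  by (metis nat_pow_Suc2)

lemma t_xpow: "t \<otimes> x [^] (i::nat) = p ^ i \<odot> (x [^] i \<otimes> t)"
proof (induction i)
  case 0 thus ?case by (simp add: scale_one)
next
  case (Suc i)
  have "t \<otimes> x [^] Suc i = (t \<otimes> x [^] i) \<otimes> x" by (simp add: m_assoc)
  also have "\<dots> = p ^ i \<odot> (x [^] i \<otimes> (t \<otimes> x))" by (simp add: Suc scl m_assoc)
  also have "\<dots> = p ^ Suc i \<odot> (x [^] Suc i \<otimes> t)" by (simp add: tx scl m_assoc mult.commute)
  finally show ?case .
qed

lemma y_tpow: "y \<otimes> t [^] (i::nat) = p ^ i \<odot> (t [^] i \<otimes> y)"
proof (induction i)
  case 0 thus ?case by (simp add: scale_one)
next
  case (Suc i)
  have "y \<otimes> t [^] Suc i = (y \<otimes> t [^] i) \<otimes> t" by (simp add: m_assoc)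
  also have "\<dots> = p ^ i \<odot> (t [^] i \<otimes> (y \<otimes> t))" by (simp add: Suc scl m_assoc)
  also have "\<dots> = p ^ Suc i \<odot> (t [^] Suc i \<otimes> y)" by (simp add: yt scl m_assoc mult.commute)
  finally show ?case .
qed

lemma ypow_t: "y [^] (k::nat) \<otimes> t = p ^ k \<odot> (t \<otimes> y [^] k)"
proof (induction k)
  case 0 thus ?case by (simp add: scale_one)
next
  case (Suc k)
  have "y [^] Suc k \<otimes> t = y [^] k \<otimes> (y \<otimes> t)" by (simp add: m_assoc)
  also have "\<dots> = p \<odot> ((y [^] k \<otimes> t) \<otimes> y)" by (simp add: yt scl m_assoc)
  also have "\<dots> = p ^ Suc k \<odot> (t \<otimes> y [^] Suc k)" by (simp add: Suc scl m_assoc)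
  finally show ?case .
qed

text \<open>Moving t^2 past x^i costs p^(2i), which gives the recursion of \<open>gauss\<close>. At
  \<open>i = 0\<close> the truncated exponent \<open>i - 1\<close> is harmless because the
  coefficient is 0.\<close>

lemma y_xpow: "y \<otimes> x [^] (i::nat) = q ^ i \<odot> (x [^] i \<otimes> y) \<oplus> gauss p q c i \<odot> (x [^] (i - 1) \<otimes> (t \<otimes> t))"
proof (induction i)
  case 0
  have "0 \<odot> (t \<otimes> t) = \<zero>" using scale_l_distr[of "t \<otimes> t" 0 0] scale_closed[of "t \<otimes> t" 0]
    by (metis add.l_cancel_one' add.right_neutral c(3) m_closed)
  thus ?case by (simp add: scale_one)
next
  case (Suc i)
  have ttx: "t \<otimes> (t \<otimes> x [^] i) = p ^ (2 * i) \<odot> (x [^] i \<otimes> (t \<otimes> t))"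
  proof -
    have "t \<otimes> (t \<otimes> x [^] i) = t \<otimes> (p ^ i \<odot> (x [^] i \<otimes> t))" by (simp only: t_xpow)
    also have "\<dots> = p ^ i \<odot> ((t \<otimes> x [^] i) \<otimes> t)" by (simp add: scl m_assoc)
    also have "\<dots> = p ^ i \<odot> ((p ^ i \<odot> (x [^] i \<otimes> t)) \<otimes> t)" by (simp only: t_xpow)
    also have "\<dots> = p ^ i \<odot> (p ^ i \<odot> (x [^] i \<otimes> (t \<otimes> t)))" by (simp add: scl m_assoc)
    also have "\<dots> = p ^ (2 * i) \<odot> (x [^] i \<otimes> (t \<otimes> t))"
      by (simp add: scale_scale[symmetric] power_add[symmetric] mult_2)
    finally show ?thesis .
  qed
  have xg: "gauss p q c i \<odot> (x \<otimes> (x [^] (i - 1) \<otimes> (t \<otimes> t))) = gauss p q c i \<odot> (x [^] i \<otimes> (t \<otimes> t))"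
  proof (cases i)
    case 0
    have "0 \<odot> a = \<zero>" if "a \<in> carrier B" for a using scale_l_distr[OF that, of 0 0] scale_closed[OF that, of 0]
      by (metis add.l_cancel_one' add.right_neutral)
    thus ?thesis by (simp add: 0)
  next
    case (Suc j)
    thus ?thesis by (simp add: m_assoc[symmetric] pow_l del: nat_pow_Suc)
  qed
  have "y \<otimes> x [^] Suc i = y \<otimes> (x \<otimes> x [^] i)" by (simp only: pow_l c)
  also have "\<dots> = (y \<otimes> x) \<otimes> x [^] i" by (simp add: m_assoc)
  also have "\<dots> = q \<odot> (x \<otimes> (y \<otimes> x [^] i)) \<oplus> c \<odot> (t \<otimes> (t \<otimes> x [^] i))"
    by (simp add: yx scl l_distr m_assoc)
  also have "\<dots> = q \<odot> (q ^ i \<odot> ((x \<otimes> x [^] i) \<otimes> y) \<oplus> gauss p q c i \<odot> (x \<otimes> (x [^] (i - 1) \<otimes> (t \<otimes> t)))) \<oplus> c \<odot> (t \<otimes> (t \<otimes> x [^] i))"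
    by (simp add: Suc r_distr scl m_assoc)
  also have "\<dots> = q ^ Suc i \<odot> (x [^] Suc i \<otimes> y) \<oplus> (q * gauss p q c i + c * p ^ (2 * i)) \<odot> (x [^] i \<otimes> (t \<otimes> t))"
    unfolding xg ttx by (simp add: scl scale_l_distr pow_l a_assoc del: nat_pow_Suc)
  finally show ?case by simp
qed

lemma t_tpow: "(t \<otimes> t) \<otimes> (t [^] (j::nat) \<otimes> a) = t [^] (j + 2) \<otimes> a" if "a \<in> carrier B"
proof -
  have "(t \<otimes> t) \<otimes> (t [^] j \<otimes> a) = (t \<otimes> (t \<otimes> t [^] j)) \<otimes> a" using that by (simp add: m_assoc)
  thus ?thesis by (simp only: pow_l c add_2_eq_Suc')
qed

lemma x_pbm: "x \<otimes> pbm i j k = pbm (Suc i) j k"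
  by (simp add: pbm_def m_assoc[symmetric] pow_l del: nat_pow_Suc)

lemma t_pbm: "t \<otimes> pbm i j k = p ^ i \<odot> pbm i (Suc j) k"
proof -
  have "t \<otimes> pbm i j k = (t \<otimes> x [^] i) \<otimes> (t [^] j \<otimes> y [^] k)" by (simp add: pbm_def m_assoc)
  also have "\<dots> = p ^ i \<odot> (x [^] i \<otimes> ((t \<otimes> t [^] j) \<otimes> y [^] k))" by (simp add: t_xpow scl m_assoc)
  finally show ?thesis by (simp add: pbm_def pow_l del: nat_pow_Suc)
qed

lemma y_pbm: "y \<otimes> pbm i j k = (q ^ i * p ^ j) \<odot> pbm i j (Suc k) \<oplus> gauss p q c i \<odot> pbm (i - 1) (j + 2) k"
proof -
  let ?r = "t [^] j \<otimes> y [^] k"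
  have "y \<otimes> pbm i j k = (y \<otimes> x [^] i) \<otimes> ?r" by (simp add: pbm_def m_assoc)
  also have "\<dots> = q ^ i \<odot> (x [^] i \<otimes> ((y \<otimes> t [^] j) \<otimes> y [^] k)) \<oplus> gauss p q c i \<odot> (x [^] (i - 1) \<otimes> ((t \<otimes> t) \<otimes> ?r))"
    by (simp add: y_xpow l_distr scl m_assoc)
  also have "\<dots> = q ^ i \<odot> (x [^] i \<otimes> ((p ^ j \<odot> (t [^] j \<otimes> y)) \<otimes> y [^] k)) \<oplus> gauss p q c i \<odot> pbm (i - 1) (j + 2) k"
    by (simp only: y_tpow t_tpow[OF nat_pow_closed[OF c(2)]] pbm_def)
  also have "\<dots> = q ^ i \<odot> (p ^ j \<odot> (x [^] i \<otimes> (t [^] j \<otimes> (y \<otimes> y [^] k)))) \<oplus> gauss p q c i \<odot> pbm (i - 1) (j + 2) k"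
    by (simp add: scl m_assoc)
  finally show ?thesis by (simp add: pbm_def pow_l scale_scale del: nat_pow_Suc)
qed

lemma pbm_y: "pbm i j k \<otimes> y = pbm i j (Suc k)"
  by (simp add: pbm_def m_assoc)

lemma pbm_t: "pbm i j k \<otimes> t = p ^ k \<odot> pbm i (Suc j) k"
proof -
  have "pbm i j k \<otimes> t = x [^] i \<otimes> (t [^] j \<otimes> (y [^] k \<otimes> t))" by (simp add: pbm_def m_assoc)
  thus ?thesis by (simp add: pbm_def ypow_t scl m_assoc)
qed

text \<open>Right multiplication by x is a shift on powers of x; division by x takes place there,
  after t and y have been divided out.\<close>

lemma pbm_x: "pbm i 0 0 \<otimes> x = pbm (Suc i) 0 0"
  by (simp add: pbm_def)

end

end

type_synonym 'k pbw = "nat \<times> nat \<times> nat \<Rightarrow>\<^sub>0 'k"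

text \<open>Left multiplication by a generator on the basis \<open>x\<^sup>i t\<^sup>j y\<^sup>k\<close>.\<close>

fun gop :: "'k::field \<Rightarrow> 'k \<Rightarrow> 'k \<Rightarrow> gen \<Rightarrow> 'k pbw \<Rightarrow> 'k pbw" where
  "gop p q c X = lext (\<lambda>(i, j, k). bas (Suc i, j, k))"
| "gop p q c T = lext (\<lambda>(i, j, k). sg (i, Suc j, k) (p ^ i))"
| "gop p q c Y = lext (\<lambda>(i, j, k). sg (i, j, Suc k) (q ^ i * p ^ j) + sg (i - 1, j + 2, k) (gauss p q c i))"

lemma klin_gop: "klin (gop p q c a)" by (cases a) (simp_all add: klin_lext)

text \<open>The heart of independence, in place of a confluence argument: the formulas dictated by
  \<open>x_pbm\<close>, \<open>t_pbm\<close> and \<open>y_pbm\<close> do define an action in which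
  the relations hold, so the quotient cannot collapse any combination of monomials.\<close>

lemma gop_rel:
  "gop p q c T (gop p q c X u) = scale p (gop p q c X (gop p q c T u))"
  "gop p q c Y (gop p q c T u) = scale p (gop p q c T (gop p q c Y u))"
  "gop p q c Y (gop p q c X u) = scale q (gop p q c X (gop p q c Y u)) + scale c (gop p q c T (gop p q c T u))"
proof -
  have eq: "F u = G u" if "klin F" "klin G" "\<And>i j k. F (bas (i, j, k)) = G (bas (i, j, k))" for F G :: "'a pbw \<Rightarrow> 'a pbw"
    using that(1,2) by (rule klin_eqI) (use that(3) in auto)
  note kl = klin_compose[OF klin_gop klin_gop]
  show "gop p q c T (gop p q c X u) = scale p (gop p q c X (gop p q c T u))"
    by (rule eq[OF kl klin_smult[OF kl]]) (simp add: mult.commute)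
  show "gop p q c Y (gop p q c T u) = scale p (gop p q c T (gop p q c Y u))"
  proof (rule eq[OF kl klin_smult[OF kl]])
    \<comment> \<open>The case \<open>i = 0\<close> is separate since \<open>i - 1\<close> is
      truncated; \<open>gauss\<close> vanishes there.\<close>
    fix i j k
    show "gop p q c Y (gop p q c T (bas (i, j, k))) = scale p (gop p q c T (gop p q c Y (bas (i, j, k))))"
      by (cases i) (simp_all add: lext_simps sc.scale_right_distrib algebra_simps)
  qed
  show "gop p q c Y (gop p q c X u) = scale q (gop p q c X (gop p q c Y u)) + scale c (gop p q c T (gop p q c T u))"
  proof (rule eq[OF kl klin_plus[OF klin_smult[OF kl] klin_smult[OF kl]]])
    fix i j k :: nat
    show "gop p q c Y (gop p q c X (bas (i, j, k))) = scale q (gop p q c X (gop p q c Y (bas (i, j, k))))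
        + scale c (gop p q c T (gop p q c T (bas (i, j, k))))"
      by (cases i) (auto intro!: poly_mapping_eqI simp: lext_simps sc.scale_right_distrib lookup_add
          lookup_single when_def algebra_simps power_add mult_2 mult_2_right)
  qed
qed

definition wop :: "'k::field \<Rightarrow> 'k \<Rightarrow> 'k \<Rightarrow> gen list \<Rightarrow> 'k pbw \<Rightarrow> 'k pbw" where
  "wop p q c w v = foldr (gop p q c) w v"

definition act :: "'k::field \<Rightarrow> 'k \<Rightarrow> 'k \<Rightarrow> (gen list \<Rightarrow>\<^sub>0 'k) \<Rightarrow> 'k pbw \<Rightarrow> 'k pbw" where
  "act p q c u v = lext (\<lambda>w. wop p q c w v) u"

lemma wop_simps [simp]: "wop p q c [] v = v" "wop p q c (a # w) v = gop p q c a (wop p q c w v)"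
  "wop p q c (w @ w') v = wop p q c w (wop p q c w' v)"
  by (simp_all add: wop_def)

lemma klin_wop: "klin (wop p q c w)"
  by (induction w) (simp_all add: klin_def klin_simps[OF klin_gop])

abbreviation (input) FA :: "('k::field, gen list \<Rightarrow>\<^sub>0 'k) module" where "FA \<equiv> free_algebra"

lemma FA_k_algebra: "k_algebra FA"
  unfolding free_algebra_def by (rule monoid_algebra_k_algebra) (rule monoidI, auto)

lemma FA_carrier [simp]: "carrier FA = UNIV"
  by (simp add: free_algebra_def monoid_algebra_def)

lemma FA_simps [simp]: "one FA = bas []" "zero FA = 0" "add FA = (+)" "smult FA = scale"
  "sg w a \<otimes>\<^bsub>FA\<^esub> sg w' b = sg (w @ w') (a * b)"
  by (simp_all add: free_algebra_def)

lemma FA_mult: "u \<otimes>\<^bsub>FA\<^esub> v = lext (\<lambda>a. lext (\<lambda>b. bas (a @ b)) v) u"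
  by (simp add: free_algebra_def monoid_algebra_mult)

lemma FA_uminus [simp]: "\<ominus>\<^bsub>FA\<^esub> u = - u"
proof -
  interpret k_algebra FA by (rule FA_k_algebra)
  show ?thesis by (rule minus_equality) auto
qed

lemma FA_minus [simp]: "u \<ominus>\<^bsub>FA\<^esub> v = u - v"
  by (simp add: a_minus_def)

lemma act_mult: "act p q c (u \<otimes>\<^bsub>FA\<^esub> v) w = act p q c u (act p q c v w)"
  unfolding act_def FA_mult lext_lext lext_single sc.scale_one wop_simps
  by (simp add: klin_lext_out[OF klin_wop])

lemma klin_act1: "klin (\<lambda>u. act p q c u v)" unfolding act_def by (rule klin_lext)

lemma klin_act2: "klin (act p q c u)"
  unfolding act_def by (intro klin_lext_fun klin_wop)

section \<open>The algebra H and its action on the span of the monomials\<close>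

locale H_data =
  fixes p q c :: "'k::field"
  assumes pq: "p \<noteq> 0" "q \<noteq> 0"
begin

abbreviation "ff \<equiv> [:0, p:]"
abbreviation "gg \<equiv> monom c 2"
abbreviation "J \<equiv> H_ideal q ff gg"
abbreviation "H \<equiv> H_algebra q ff gg"
abbreviation "GH \<equiv> H_grading q ff gg"

interpretation F: k_algebra FA by (rule FA_k_algebra)

lemma poly_at_f: "poly_at FA ff (var T) = scale p (var T)"
  using pq by (simp add: poly_at_def var_def F.finsum_insert atMost_Suc)

lemma poly_at_g: "poly_at FA gg (var T) = scale c (var T \<otimes>\<^bsub>FA\<^esub> var T)"
\<comment> \<open>For \<open>c = 0\<close> the degree of \<open>gg\<close> is 0 instead of 2, so the
  sum defining \<open>poly_at\<close> has a different range.\<close>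
proof (cases "c = 0")
  case True
  thus ?thesis by (simp add: poly_at_def)
next
  case False
  hence "degree gg = 2" by (simp add: degree_monom_eq)
  moreover have "{..2::nat} = {0, 1, 2}" by auto
  ultimately show ?thesis using False
    by (simp add: poly_at_def var_def F.finsum_insert numeral_2_eq_2)
qed

definition "rels = {var T \<otimes>\<^bsub>FA\<^esub> var X - scale p (var X \<otimes>\<^bsub>FA\<^esub> var T), var Y \<otimes>\<^bsub>FA\<^esub> var T - scale p (var T \<otimes>\<^bsub>FA\<^esub> var Y),
   var Y \<otimes>\<^bsub>FA\<^esub> var X - scale q (var X \<otimes>\<^bsub>FA\<^esub> var Y) - scale c (var T \<otimes>\<^bsub>FA\<^esub> (var T :: gen list \<Rightarrow>\<^sub>0 'k))}"

lemma J_eq: "J = genideal FA rels"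
  unfolding H_ideal_def Let_def poly_at_f poly_at_g rels_def
  by (simp add: var_def)

lemma J_ideal: "ideal J FA"
  unfolding J_eq by (rule F.genideal_ideal) auto

sublocale Q: quotient_algebra J FA
  by (intro quotient_algebra.intro FA_k_algebra J_ideal)

lemma H_def': "H = quot FA J" by (simp add: H_algebra_def)

text \<open>The elements acting by zero form an ideal, and by \<open>gop_rel\<close> it contains the
  relations; so the action descends to H.\<close>

lemma J_act: "u \<in> J \<Longrightarrow> act p q c u v = 0"
proof -
  let ?K = "{u :: gen list \<Rightarrow>\<^sub>0 'k. \<forall>v. act p q c u v = 0}"
  note s1 = klin_simps[OF klin_act1] and s2 = klin_simps[OF klin_act2]
  have "ideal ?K FA"
  proof (rule idealI[OF F.ring_axioms])
    show "subgroup ?K (add_monoid FA)"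
      by (rule F.add.subgroupI) (auto simp: s1 intro!: exI[of _ 0] simp flip: a_inv_def)
  qed (auto simp: act_mult s2)
  moreover have "rels \<subseteq> ?K"
    by (auto simp: rels_def s1 act_mult gop_rel) (simp_all add: var_def act_def gop_rel del: gop.simps)
  ultimately show "u \<in> J \<Longrightarrow> act p q c u v = 0"
    unfolding J_eq using F.genideal_minimal by blast
qed

abbreviation cl :: "(gen list \<Rightarrow>\<^sub>0 'k) \<Rightarrow> (gen list \<Rightarrow>\<^sub>0 'k) set" where "cl u \<equiv> J +>\<^bsub>FA\<^esub> u"

lemma H_k_algebra: "k_algebra H" unfolding H_def' by (rule Q.quot_k_algebra)

lemma H_carrier: "C \<in> carrier H \<longleftrightarrow> (\<exists>u. C = cl u)"
  unfolding H_def' by (simp add: Q.cls_carrier)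

lemma cl_simps: "cl u \<in> carrier H" "cl u \<oplus>\<^bsub>H\<^esub> cl v = cl (u + v)" "cl u \<otimes>\<^bsub>H\<^esub> cl v = cl (u \<otimes>\<^bsub>FA\<^esub> v)"
   "z \<odot>\<^bsub>H\<^esub> cl u = cl (scale z u)" "\<zero>\<^bsub>H\<^esub> = cl 0" "\<one>\<^bsub>H\<^esub> = cl (bas [])"
  unfolding H_def' by (simp_all add: Q.cls_add Q.cls_mult Q.cls_scale Q.cls_zero Q.cls_one)

lemma cl_eq_iff: "cl u = cl v \<longleftrightarrow> u - v \<in> J"
  using Q.cls_eq_iff[of u v] by simp

text \<open>Coordinates of a class: the result of letting it act on the monomial 1.\<close>

definition \<psi> :: "(gen list \<Rightarrow>\<^sub>0 'k) set \<Rightarrow> 'k pbw" where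
  "\<psi> C = the_elem ((\<lambda>u. act p q c u (bas (0, 0, 0))) ` C)"

lemma \<psi>_cl: "\<psi> (cl u) = act p q c u (bas (0, 0, 0))"
  unfolding \<psi>_def
proof (rule Q.the_elem_cls)
  fix v assume "v \<ominus>\<^bsub>FA\<^esub> u \<in> J"
  hence "act p q c (v - u) (bas (0, 0, 0)) = 0" by (intro J_act) simp
  thus "act p q c v (bas (0, 0, 0)) = act p q c u (bas (0, 0, 0))" by (simp add: klin_diff[OF klin_act1])
qed simp

abbreviation "xx \<equiv> cl (var X)"
abbreviation "yy \<equiv> cl (var Y)"
abbreviation "tt \<equiv> cl (var T)"

lemma H_rel:
  "tt \<otimes>\<^bsub>H\<^esub> xx = p \<odot>\<^bsub>H\<^esub> (xx \<otimes>\<^bsub>H\<^esub> tt)" "yy \<otimes>\<^bsub>H\<^esub> tt = p \<odot>\<^bsub>H\<^esub> (tt \<otimes>\<^bsub>H\<^esub> yy)"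
  "yy \<otimes>\<^bsub>H\<^esub> xx = q \<odot>\<^bsub>H\<^esub> (xx \<otimes>\<^bsub>H\<^esub> yy) \<oplus>\<^bsub>H\<^esub> c \<odot>\<^bsub>H\<^esub> (tt \<otimes>\<^bsub>H\<^esub> tt)"
proof -
  have "rels \<subseteq> J" unfolding J_eq by (rule F.genideal_self) auto
  thus "tt \<otimes>\<^bsub>H\<^esub> xx = p \<odot>\<^bsub>H\<^esub> (xx \<otimes>\<^bsub>H\<^esub> tt)" "yy \<otimes>\<^bsub>H\<^esub> tt = p \<odot>\<^bsub>H\<^esub> (tt \<otimes>\<^bsub>H\<^esub> yy)"
    "yy \<otimes>\<^bsub>H\<^esub> xx = q \<odot>\<^bsub>H\<^esub> (xx \<otimes>\<^bsub>H\<^esub> yy) \<oplus>\<^bsub>H\<^esub> c \<odot>\<^bsub>H\<^esub> (tt \<otimes>\<^bsub>H\<^esub> tt)"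
    by (simp_all add: cl_simps cl_eq_iff rels_def diff_diff_eq)
qed

end

section \<open>Gradings read off from coordinates\<close>

definition restr :: "('i \<Rightarrow> bool) \<Rightarrow> ('i \<Rightarrow>\<^sub>0 'k::field) \<Rightarrow> ('i \<Rightarrow>\<^sub>0 'k)" where
  "restr Q u = lext (\<lambda>i. if Q i then bas i else 0) u"

lemma lk_restr: "lk (restr Q u) i = (if Q i then lk u i else 0)"
proof -
  have "lk (restr Q u) i = (\<Sum>j\<in>keys u. if j = i then (if Q i then lk u i else 0) else 0)"
    unfolding restr_def lk_lext by (intro sum.cong refl) (auto simp: lookup_single when_def)
  thus ?thesis by (auto simp: in_keys_iff)
qed

lemma klin_restr: "klin (restr Q)"
  unfolding restr_def[abs_def] by (rule klin_lext)

lemma sum_restr: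
  fixes deg :: "'i \<Rightarrow> int"
  assumes "finite S" "deg ` keys u \<subseteq> S"
  shows "(\<Sum>n\<in>S. restr (\<lambda>i. deg i = n) u) = u"
proof (rule poly_mapping_eqI)
  fix i
  have "lk (\<Sum>n\<in>S. restr (\<lambda>i. deg i = n) u) i = (\<Sum>n\<in>S. if deg i = n then lk u i else 0)"
    by (simp add: lk_restr)
  also have "\<dots> = lk u i"
    using assms by (cases "i \<in> keys u") (auto simp: in_keys_iff)
  finally show "lk (\<Sum>n\<in>S. restr (\<lambda>i. deg i = n) u) i = lk u i" .
qed

lemma coord_finsum:
  fixes \<theta> :: "'a \<Rightarrow> ('i \<Rightarrow>\<^sub>0 'k::field)"
  assumes "abelian_group R" "\<And>a b. a \<in> carrier R \<Longrightarrow> b \<in> carrier R \<Longrightarrow> \<theta> (a \<oplus>\<^bsub>R\<^esub> b) = \<theta> a + \<theta> b"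
    "\<And>j. j \<in> J \<Longrightarrow> f j \<in> carrier R"
  shows "\<theta> (\<Oplus>\<^bsub>R\<^esub>j\<in>J. f j) = (\<Sum>j\<in>J. \<theta> (f j))"
proof -
  interpret R: abelian_group R by fact
  have z: "\<theta> \<zero>\<^bsub>R\<^esub> = 0" using assms(2)[of "\<zero>\<^bsub>R\<^esub>" "\<zero>\<^bsub>R\<^esub>"] by simp
  show ?thesis using assms(3)
  proof (induction J rule: infinite_finite_induct)
    case (insert j J)
    have "\<theta> (\<Oplus>\<^bsub>R\<^esub>j\<in>insert j J. f j) = \<theta> (f j \<oplus>\<^bsub>R\<^esub> (\<Oplus>\<^bsub>R\<^esub>j\<in>J. f j))"
      using insert by (subst R.finsum_insert) auto
    also have "\<dots> = \<theta> (f j) + \<theta> (\<Oplus>\<^bsub>R\<^esub>j\<in>J. f j)"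
      using insert by (intro assms(2) R.finsum_closed) auto
    finally show ?case using insert by simp
  qed (auto simp: z)
qed

text \<open>A degree function on the basis decides the grading. The lemma serves H, the trivial
  module, H \<otimes> H^op and the bimodule H.\<close>

lemma coord_grading:
  fixes R :: "('a, 'r) ring_scheme" and \<theta> :: "'a \<Rightarrow> ('i \<Rightarrow>\<^sub>0 'k::field)" and deg :: "'i \<Rightarrow> int"
  assumes R: "abelian_group R" and bij: "bij_betw \<theta> (carrier R) UNIV"
    and add: "\<And>a b. a \<in> carrier R \<Longrightarrow> b \<in> carrier R \<Longrightarrow> \<theta> (a \<oplus>\<^bsub>R\<^esub> b) = \<theta> a + \<theta> b"
    and G: "\<And>n. G n = {a \<in> carrier R. deg ` keys (\<theta> a) \<subseteq> {n}}"
  shows "internal_direct_sum R G"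
proof -
  interpret R: abelian_group R by fact
  define \<phi> where "\<phi> = inv_into (carrier R) \<theta>"
  have \<phi>: "\<phi> u \<in> carrier R" "\<theta> (\<phi> u) = u" for u
    using bij unfolding \<phi>_def bij_betw_def by (auto intro: inv_into_into f_inv_into_f)
  have inj: "a = b" if "a \<in> carrier R" "b \<in> carrier R" "\<theta> a = \<theta> b" for a b
    using that bij by (auto simp: bij_betw_def inj_on_def)
  have z: "\<theta> \<zero>\<^bsub>R\<^esub> = 0" using add[of "\<zero>\<^bsub>R\<^esub>" "\<zero>\<^bsub>R\<^esub>"] by simp
  have um: "\<theta> (\<ominus>\<^bsub>R\<^esub> a) = - \<theta> a" if "a \<in> carrier R" for a
    using add[of "\<ominus>\<^bsub>R\<^esub> a" a] that z by (simp add: R.l_neg eq_neg_iff_add_eq_0)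
  define \<pi> where "\<pi> n a = \<phi> (restr (\<lambda>i. deg i = n) (\<theta> a))" for n a
  have \<pi>z: "\<pi> n a = \<zero>\<^bsub>R\<^esub> \<longleftrightarrow> restr (\<lambda>i. deg i = n) (\<theta> a) = 0" for n a
    unfolding \<pi>_def using inj[of "\<phi> (restr (\<lambda>i. deg i = n) (\<theta> a))" "\<zero>\<^bsub>R\<^esub>"] \<phi> z by (metis R.zero_closed)
  have supp: "{n. \<pi> n a \<noteq> \<zero>\<^bsub>R\<^esub>} = deg ` keys (\<theta> a)" for a
    unfolding \<pi>z by (auto simp: poly_mapping_eq_iff fun_eq_iff lk_restr in_keys_iff split: if_splits)
  show ?thesis
  proof (rule internal_direct_sumI[where \<pi> = \<pi>, OF R])
    show "additive_subgroup (G n) R" for n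
    proof (rule additive_subgroupI[OF R])
      show "x \<oplus>\<^bsub>R\<^esub> y \<in> G n" if "x \<in> G n" "y \<in> G n" for x y
        using that Poly_Mapping.keys_add[of "\<theta> x" "\<theta> y"] by (auto simp: G add image_subset_iff)
    qed (auto simp: G z um)
    show "\<pi> n (x \<oplus>\<^bsub>R\<^esub> y) = \<pi> n x \<oplus>\<^bsub>R\<^esub> \<pi> n y" if "x \<in> carrier R" "y \<in> carrier R" for n x y
      using that by (intro inj) (auto simp: \<pi>_def \<phi> add klin_add[OF klin_restr])
    show "\<pi> n x = x" if "x \<in> G n" for n x
    proof (rule inj)
      show "\<theta> (\<pi> n x) = \<theta> x" unfolding \<pi>_def \<phi>
        using that by (intro poly_mapping_eqI) (auto simp: lk_restr G in_keys_iff image_subset_iff)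
    qed (use that in \<open>auto simp: \<pi>_def \<phi> G\<close>)
    show "\<pi> n x = \<zero>\<^bsub>R\<^esub>" if "x \<in> G m" "m \<noteq> n" for m n x
      unfolding \<pi>z using that by (intro poly_mapping_eqI) (auto simp: lk_restr G in_keys_iff image_subset_iff)
    show "\<pi> n x \<in> G n" if "x \<in> carrier R" for n x
      using that by (auto simp: G \<pi>_def \<phi> in_keys_iff lk_restr split: if_splits)
    show "finite {n. \<pi> n x \<noteq> \<zero>\<^bsub>R\<^esub>}" for x by (simp add: supp)
    show "x = (\<Oplus>\<^bsub>R\<^esub>n\<in>{n. \<pi> n x \<noteq> \<zero>\<^bsub>R\<^esub>}. \<pi> n x)" if x: "x \<in> carrier R" for x
    proof (rule inj[OF x])
      show "(\<Oplus>\<^bsub>R\<^esub>n\<in>{n. \<pi> n x \<noteq> \<zero>\<^bsub>R\<^esub>}. \<pi> n x) \<in> carrier R"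
        by (rule R.finsum_closed) (auto simp: \<pi>_def \<phi>)
      have "\<theta> (\<Oplus>\<^bsub>R\<^esub>n\<in>{n. \<pi> n x \<noteq> \<zero>\<^bsub>R\<^esub>}. \<pi> n x) = (\<Sum>n\<in>{n. \<pi> n x \<noteq> \<zero>\<^bsub>R\<^esub>}. \<theta> (\<pi> n x))"
        by (rule coord_finsum[OF R add]) (auto simp: \<pi>_def \<phi>)
      also have "\<dots> = \<theta> x" unfolding supp unfolding \<pi>_def \<phi> by (rule sum_restr) auto
      finally show "\<theta> x = \<theta> (\<Oplus>\<^bsub>R\<^esub>n\<in>{n. \<pi> n x \<noteq> \<zero>\<^bsub>R\<^esub>}. \<pi> n x)" by simp
    qed
  qed
qed

section \<open>Spanning and independence of the monomials\<close>

context H_data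
begin

interpretation F: k_algebra FA by (rule FA_k_algebra)
interpretation H: k_algebra H by (rule H_k_algebra)

lemma J_closed: "0 \<in> J" "u \<in> J \<Longrightarrow> v \<in> J \<Longrightarrow> u + v \<in> J"
  using additive_subgroup.zero_closed[OF ideal.axioms(1)[OF J_ideal]]
    additive_subgroup.a_closed[OF ideal.axioms(1)[OF J_ideal], of u v] by simp_all

definition word :: "nat \<times> nat \<times> nat \<Rightarrow> gen list" where
  "word = (\<lambda>(i, j, k). replicate i X @ replicate j T @ replicate k Y)"

definition nf :: "'k pbw \<Rightarrow> gen list \<Rightarrow>\<^sub>0 'k" where "nf = lext (\<lambda>i. bas (word i))"

lemma klin_nf: "klin nf" unfolding nf_def by (rule klin_lext)

lemma J_lext: "(\<And>i. i \<in> keys u \<Longrightarrow> f i \<in> J) \<Longrightarrow> lext f u \<in> J"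
proof -
  assume f: "\<And>i. i \<in> keys u \<Longrightarrow> f i \<in> J"
  have "(\<Sum>i\<in>A. scale (lk u i) (f i)) \<in> J" if "finite A" "A \<subseteq> keys u" for A
    using that
  proof (induction A rule: finite_induct)
    case empty thus ?case using J_closed by simp
  next
    case (insert a A)
    thus ?case using J_closed(2)[of "scale (lk u a) (f a)" "\<Sum>i\<in>A. scale (lk u i) (f i)"]
        Q.I_scale[of "f a" "lk u a"] f by simp
  qed
  thus ?thesis by (simp add: lext_def)
qed

lemma J_klinI: "klin F \<Longrightarrow> (\<And>i. F (bas i) \<in> J) \<Longrightarrow> F u \<in> J"
  using J_lext[of u "\<lambda>i. F (bas i)"] by (simp add: klin_expand[symmetric])

lemma gens_in [simp]: "cl u \<in> carrier H" by (rule cl_simps)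

lemmas H_pbm = H.x_pbm[OF gens_in gens_in gens_in H_rel] H.t_pbm[OF gens_in gens_in gens_in H_rel]
  H.y_pbm[OF gens_in gens_in gens_in H_rel] H.pbm_x[OF gens_in gens_in gens_in H_rel]
  H.pbm_t[OF gens_in gens_in gens_in H_rel] H.pbm_y[OF gens_in gens_in gens_in H_rel]

abbreviation "pm \<equiv> H.pbm xx yy tt"

lemma pm_c [simp]: "pm i j k \<in> carrier H" by (rule H.pbm_c[OF gens_in gens_in gens_in H_rel])

lemma cl_replicate: "cl (bas (replicate i a)) = cl (var a) [^]\<^bsub>H\<^esub> i"
proof (induction i)
  case (Suc i)
  have "cl (bas (replicate (Suc i) a)) = cl (bas (replicate i a)) \<otimes>\<^bsub>H\<^esub> cl (var a)"
    by (simp add: cl_simps var_def replicate_append_same)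
  thus ?case by (simp add: Suc)
qed (simp add: cl_simps)

lemma cl_word: "cl (bas (word (i, j, k))) = pm i j k"
proof -
  have "cl (bas (word (i, j, k))) = cl (bas (replicate i X)) \<otimes>\<^bsub>H\<^esub> (cl (bas (replicate j T)) \<otimes>\<^bsub>H\<^esub> cl (bas (replicate k Y)))"
    by (simp add: word_def cl_simps)
  thus ?thesis by (simp add: cl_replicate H.pbm_def[OF gens_in gens_in gens_in H_rel])
qed

lemma cl_sg_word: "cl (sg (word (i, j, k)) z) = z \<odot>\<^bsub>H\<^esub> pm i j k"
proof -
  have "sg (word (i, j, k)) z = scale z (bas (word (i, j, k)))" by simp
  thus ?thesis by (simp only: cl_simps(4)[symmetric] cl_word)
qed

lemma klin_FA_mult: "klin (\<lambda>v. u \<otimes>\<^bsub>FA\<^esub> v)"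
  unfolding FA_mult by (intro klin_lext_fun klin_lext)

lemma cl_add: "cl (u + v) = cl u \<oplus>\<^bsub>H\<^esub> cl v" by (simp add: cl_simps)

text \<open>Both sides are linear in \<open>v\<close> modulo the ideal, so monomials suffice, and
  there the rules \<open>H_pbm\<close> apply. Thus left multiplication by generators stays in the
  span of the monomials.\<close>

lemma cl_gop: "cl (nf (gop p q c a v)) = cl (var a) \<otimes>\<^bsub>H\<^esub> cl (nf v)"
proof -
  have "nf (gop p q c a v) - var a \<otimes>\<^bsub>FA\<^esub> nf v \<in> J"
  proof (rule J_klinI[of "\<lambda>v. nf (gop p q c a v) - var a \<otimes>\<^bsub>FA\<^esub> nf v"])
    show "klin (\<lambda>v. nf (gop p q c a v) - var a \<otimes>\<^bsub>FA\<^esub> nf v)"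
      by (intro klin_sub klin_compose[OF klin_nf klin_gop] klin_compose[OF klin_FA_mult klin_nf])
    fix v :: "nat \<times> nat \<times> nat"
    obtain i j k where v: "v = (i, j, k)" by (cases v) auto
    have "cl (nf (gop p q c a (bas v))) = cl (var a) \<otimes>\<^bsub>H\<^esub> cl (nf (bas v))"
      by (cases a) (simp_all add: v nf_def lext_simps cl_word cl_sg_word H_pbm cl_add H.scale_one)
    thus "nf (gop p q c a (bas v)) - var a \<otimes>\<^bsub>FA\<^esub> nf (bas v) \<in> J"
      by (simp add: cl_simps cl_eq_iff)
  qed
  thus ?thesis by (simp add: cl_simps cl_eq_iff)
qed

text \<open>Spanning: by induction on a word, its class equals that of the normal form computed by
  the action.\<close>

lemma cl_nf_act: "cl (nf (act p q c u (bas (0, 0, 0)))) = cl u"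
proof -
  have w: "cl (nf (wop p q c w (bas (0, 0, 0)))) = cl (bas w)" for w
  proof (induction w)
    case Nil thus ?case by (simp add: nf_def word_def)
  next
    case (Cons a w)
    have "cl (bas (a # w)) = cl (var a) \<otimes>\<^bsub>H\<^esub> cl (bas w)" by (simp add: cl_simps var_def)
    thus ?case by (simp add: cl_gop Cons)
  qed
  have "nf (act p q c u (bas (0, 0, 0))) - u \<in> J"
  proof (rule J_klinI[of "\<lambda>u. nf (act p q c u (bas (0, 0, 0))) - u"])
    show "klin (\<lambda>u. nf (act p q c u (bas (0, 0, 0))) - u)"
      by (intro klin_sub klin_compose[OF klin_nf klin_act1] klin_id)
  qed (use w in \<open>simp add: act_def cl_eq_iff\<close>)
  thus ?thesis by (simp add: cl_eq_iff)
qed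

text \<open>Independence: in the order of \<open>word\<close> first y, then t, then x act on 1, and
  at each stage the coefficient is 1 and no correction term occurs.\<close>

lemma act_nf: "act p q c (nf u) (bas (0, 0, 0)) = u"
proof -
  have X: "wop p q c (replicate n X) (bas (i, j, k)) = bas (n + i, j, k)" for n i j k by (induction n) auto
  have T: "wop p q c (replicate n T) (bas (0, j, k)) = bas (0, n + j, k)" for n j k by (induction n) auto
  have Y: "wop p q c (replicate n Y) (bas (0, 0, k)) = bas (0, 0, n + k)" for n k by (induction n) auto
  show ?thesis
  proof (rule klin_eqI[of "\<lambda>u. act p q c (nf u) (bas (0, 0, 0))" "\<lambda>u. u"])
    show "klin (\<lambda>u. act p q c (nf u) (bas (0, 0, 0)))" by (rule klin_compose[OF klin_act1 klin_nf])
    show "act p q c (nf (bas i)) (bas (0, 0, 0)) = bas i" for i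
      by (cases i) (simp add: nf_def act_def word_def X T Y)
  qed (rule klin_id)
qed

lemma \<psi>_nf: "\<psi> (cl (nf u)) = u" by (simp add: \<psi>_cl act_nf)

lemma cl_nf: "C \<in> carrier H \<Longrightarrow> cl (nf (\<psi> C)) = C"
  by (auto simp: H_carrier \<psi>_cl cl_nf_act)

lemma H_coord: "coord_algebra H \<psi>"
proof (intro coord_algebra.intro H_k_algebra coord_algebra_axioms.intro)
  show "bij_betw \<psi> (carrier H) UNIV"
    by (rule bij_betw_byWitness[where f' = "\<lambda>u. cl (nf u)"]) (auto simp: \<psi>_nf cl_nf)
qed (auto simp: H_carrier cl_simps \<psi>_cl klin_simps[OF klin_act1])

end

sublocale H_data \<subseteq> C: coord_algebra H \<psi> by (rule H_coord)

section \<open>Multiplication operators of H\<close>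

context H_data
begin

lemma \<phi>_eq: "C.\<phi> u = cl (nf u)"
  by (rule C.\<theta>_inj[THEN iffD1]) (auto simp: \<psi>_nf)

lemma \<psi>_one: "\<psi> \<one>\<^bsub>H\<^esub> = bas (0, 0, 0)"
  by (simp add: cl_simps \<psi>_cl act_def)

lemma Lm_cl: "C.Lm (cl u) v = act p q c u v"
proof -
  have "C.Lm (cl u) v = \<psi> (cl (u \<otimes>\<^bsub>FA\<^esub> nf v))" by (simp add: C.Lm_def \<phi>_eq cl_simps)
  thus ?thesis by (simp add: \<psi>_cl act_mult act_nf)
qed

lemma Lm_var: "C.Lm (cl (var a)) = gop p q c a"
  by (rule ext) (simp add: Lm_cl act_def var_def)

lemma \<phi>_bas: "C.\<phi> (bas (i, j, k)) = pm i j k"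
  by (simp add: \<phi>_eq nf_def cl_word)

lemma \<psi>_pm: "\<psi> (pm i j k) = bas (i, j, k)"
  using \<phi>_bas[of i j k] by (metis C.\<theta>_\<phi>)

lemma Rm_bas: "C.Rm xx (bas (i, 0, 0)) = bas (Suc i, 0, 0)" "C.Rm yy (bas (i, j, k)) = bas (i, j, Suc k)"
  "C.Rm tt (bas (i, j, k)) = sg (i, Suc j, k) (p ^ k)"
  by (simp_all add: C.Rm_def \<phi>_bas H_pbm C.\<theta>_scale \<psi>_pm pm_c)

lemma Rm_rel:
  "C.Rm xx (C.Rm tt u) = scale p (C.Rm tt (C.Rm xx u))" "C.Rm tt (C.Rm yy u) = scale p (C.Rm yy (C.Rm tt u))"
  "C.Rm xx (C.Rm yy u) = scale q (C.Rm yy (C.Rm xx u)) + scale c (C.Rm tt (C.Rm tt u))"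
  by (simp_all add: C.Rm_mult[symmetric] H_rel C.Rm_scale C.Rm_add C.m_closed C.scale_closed)

lemma Lm_rel:
  "C.Lm yy (C.Lm tt u) = scale p (C.Lm tt (C.Lm yy u))" "C.Lm tt (C.Lm xx u) = scale p (C.Lm xx (C.Lm tt u))"
  "C.Lm yy (C.Lm xx u) = scale q (C.Lm xx (C.Lm yy u)) + scale c (C.Lm tt (C.Lm tt u))"
  by (simp_all add: C.Lm_mult[symmetric] H_rel C.Lm_scale C.Lm_add C.m_closed C.scale_closed)

text \<open>Remainders of the successive divisions: combinations of monomials without t, of powers
  of x or of y, and of 1, with coefficients in the second factor. \<open>W1\<close> belongs to the
  order t, y, x of right multiplications, \<open>V1\<close> to the order t, x, y of left
  ones.\<close>

definition "W0 = (KS {i. fst (snd i) = 0} :: ((nat \<times> nat \<times> nat) \<times> 's \<Rightarrow>\<^sub>0 'k) set)"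
definition "W1 = (KS {i. fst (snd i) = 0 \<and> snd (snd i) = 0} :: ((nat \<times> nat \<times> nat) \<times> 's \<Rightarrow>\<^sub>0 'k) set)"
definition "V1 = (KS {i. fst (snd i) = 0 \<and> fst i = 0} :: ((nat \<times> nat \<times> nat) \<times> 's \<Rightarrow>\<^sub>0 'k) set)"
definition "W2 = (KS {(0, 0, 0)} :: ((nat \<times> nat \<times> nat) \<times> 's \<Rightarrow>\<^sub>0 'k) set)"

lemma W2_first: "u \<in> W2 \<Longrightarrow> \<exists>w. u = tens (bas (0, 0, 0)) w"
proof -
  assume u: "u \<in> W2"
  have "u = tens (bas (0, 0, 0)) (lext (\<lambda>(i, m). bas m) u)"
  proof (rule klin_eq_onI[of "\<lambda>u. u" "\<lambda>u. tens (bas (0, 0, 0)) (lext (\<lambda>(i, m). bas m) u)"])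
    fix x assume "x \<in> keys u"
    hence "fst x = (0, 0, 0)" using u by (auto simp: W2_def KS_def)
    thus "bas x = tens (bas (0, 0, 0)) (lext (\<lambda>(i, m). bas m) (bas x))" by (cases x) simp
  qed (auto intro: klin_id klin_compose[OF klin_tens2 klin_lext])
  thus ?thesis by blast
qed

lemma \<phi>_one: "C.\<phi> (bas (0, 0, 0)) = \<one>\<^bsub>H\<^esub>"
  using C.\<phi>_\<theta>[of "\<one>\<^bsub>H\<^esub>"] by (simp add: \<psi>_one)

lemma right_ops:
  fixes b1 b2 b3 :: "('s \<Rightarrow>\<^sub>0 'k) \<Rightarrow> ('s \<Rightarrow>\<^sub>0 'k)"
  assumes b: "klin b1" "klin b2" "klin b3"
    and rel_b: "\<And>u. b3 (b1 u) = scale p (b1 (b3 u))" "\<And>u. b2 (b3 u) = scale p (b3 (b2 u))"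
      "\<And>u. b2 (b1 u) = scale q (b1 (b2 u)) + scale c (b3 (b3 u))"
  shows "koszul_ops p q c (op1 (C.Rm xx)) (op1 (C.Rm yy)) (op1 (C.Rm tt)) (op2 b1) (op2 b2) (op2 b3) W0 W1 W2"
proof -
  have eq: "{i. fst (snd i) = (0::nat) \<and> snd (snd i) = (0::nat) \<and> fst i = (0::nat)} = {(0, 0, 0)}" by auto
  show ?thesis unfolding W0_def W1_def W2_def eq[symmetric]
  proof (rule koszul_ops_tensorI[OF pq C.klin_Rm C.klin_Rm C.klin_Rm b Rm_rel rel_b])
    show "weighted_shift (C.Rm tt) UNIV (\<lambda>(i, j, k). (i, Suc j, k)) (\<lambda>(i, j, k). p ^ k) (\<lambda>i. fst (snd i))"
      by unfold_locales (auto simp: Rm_bas pq inj_on_def image_iff gr0_conv_Suc)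
    show "weighted_shift (C.Rm yy) {i. fst (snd i) = 0} (\<lambda>(i, j, k). (i, j, Suc k)) (\<lambda>_. 1) (\<lambda>i. snd (snd i))"
      by unfold_locales (auto simp: Rm_bas inj_on_def image_iff gr0_conv_Suc)
    show "weighted_shift (C.Rm xx) {i. fst (snd i) = 0 \<and> snd (snd i) = 0} (\<lambda>(i, j, k). (Suc i, j, k)) (\<lambda>_. 1) fst"
      by unfold_locales (auto simp: Rm_bas inj_on_def image_iff gr0_conv_Suc)
  qed auto
qed

text \<open>Read from the left, the relations are the same with x and y exchanged; accordingly
  \<open>C.Lm yy\<close> and \<open>C.Lm xx\<close> take the places of \<open>C.Rm xx\<close> and
  \<open>C.Rm yy\<close>, and the weight of t is p^i instead of p^k.\<close>

lemma left_ops: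
  fixes b1 b2 b3 :: "('s \<Rightarrow>\<^sub>0 'k) \<Rightarrow> ('s \<Rightarrow>\<^sub>0 'k)"
  assumes b: "klin b1" "klin b2" "klin b3"
    and rel_b: "\<And>u. b3 (b1 u) = scale p (b1 (b3 u))" "\<And>u. b2 (b3 u) = scale p (b3 (b2 u))"
      "\<And>u. b2 (b1 u) = scale q (b1 (b2 u)) + scale c (b3 (b3 u))"
  shows "koszul_ops p q c (op1 (C.Lm yy)) (op1 (C.Lm xx)) (op1 (C.Lm tt)) (op2 b1) (op2 b2) (op2 b3) W0 V1 W2"
proof -
  have eq: "{i. fst (snd i) = (0::nat) \<and> fst i = (0::nat) \<and> snd (snd i) = (0::nat)} = {(0, 0, 0)}" by auto
  show ?thesis unfolding W0_def V1_def W2_def eq[symmetric]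
  proof (rule koszul_ops_tensorI[OF pq C.klin_Lm C.klin_Lm C.klin_Lm b Lm_rel rel_b])
    show "weighted_shift (C.Lm tt) UNIV (\<lambda>(i, j, k). (i, Suc j, k)) (\<lambda>(i, j, k). p ^ i) (\<lambda>i. fst (snd i))"
      by unfold_locales (auto simp: Lm_var pq inj_on_def image_iff gr0_conv_Suc)
    show "weighted_shift (C.Lm xx) {i. fst (snd i) = 0} (\<lambda>(i, j, k). (Suc i, j, k)) (\<lambda>_. 1) fst"
      by unfold_locales (auto simp: Lm_var inj_on_def image_iff gr0_conv_Suc)
    show "weighted_shift (C.Lm yy) {i. fst (snd i) = 0 \<and> fst i = 0} (\<lambda>(i, j, k). (i, j, Suc k)) (\<lambda>_. 1) (\<lambda>i. snd (snd i))"
      by unfold_locales (auto simp: Lm_var inj_on_def image_iff gr0_conv_Suc)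
  qed auto
qed

section \<open>The grading of H\<close>

definition deg :: "nat \<times> nat \<times> nat \<Rightarrow> int" where "deg = (\<lambda>(i, j, k). int (i + j + k))"

lemma gop_deg: "deg ` keys u \<subseteq> {n} \<Longrightarrow> deg ` keys (gop p q c a u) \<subseteq> {n + 1}"
proof -
  assume u: "deg ` keys u \<subseteq> {n}"
  have k: "deg i = n" if "i \<in> keys u" for i using u that by auto
  have step: "deg ` keys (gop p q c a (bas i)) \<subseteq> {deg i + 1}" for i
  proof (cases a)
    case Y
    obtain i1 j k where i: "i = (i1, j, k)" by (cases i) auto
    show ?thesis
    proof (cases i1)
      case 0
      thus ?thesis by (auto simp: Y i deg_def split: if_splits)
    next
      case (Suc m)
      show ?thesis
        using Poly_Mapping.keys_add[of "sg (i1, j, Suc k) (q ^ i1 * p ^ j)" "sg (i1 - 1, j + 2, k) (gauss p q c i1)"]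
        by (auto simp: Y i deg_def Suc split: if_splits)
    qed
  qed (cases i; auto simp: deg_def split: if_splits)+
  show "deg ` keys (gop p q c a u) \<subseteq> {n + 1}"
  proof clarify
    fix i' j' k' assume "(i', j', k') \<in> keys (gop p q c a u)"
    then obtain i where "i \<in> keys u" "(i', j', k') \<in> keys (gop p q c a (bas i))"
      using subsetD[OF klin_keys[OF klin_gop]] by blast
    thus "deg (i', j', k') = n + 1" using step[of i] k[of i] by auto
  qed
qed

text \<open>The grading by word length agrees with the degree of monomials since each
  \<open>gop\<close> raises the degree by exactly one, the correction term included: it trades x and
  y for t^2.\<close>

lemma GH_iff: "C \<in> GH n \<longleftrightarrow> C \<in> carrier H \<and> deg ` keys (\<psi> C) \<subseteq> {n}"
proof
  assume "C \<in> GH n"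
  then obtain u where u: "C = cl u" "\<And>w. w \<in> keys u \<Longrightarrow> int (length w) = n"
    by (auto simp: H_grading_def quot_grading_def)
  have w: "deg ` keys (wop p q c w (bas (0, 0, 0))) \<subseteq> {int (length w)}" for w
  proof (induction w)
    case (Cons a w)
    thus ?case using gop_deg[of "wop p q c w (bas (0, 0, 0))" "int (length w)" a] by (simp add: add.commute)
  qed (simp add: deg_def)
  have "keys (\<psi> C) \<subseteq> (\<Union>w\<in>keys u. keys (wop p q c w (bas (0, 0, 0))))"
    unfolding u(1) \<psi>_cl act_def by (rule keys_lext)
  thus "C \<in> carrier H \<and> deg ` keys (\<psi> C) \<subseteq> {n}" using u w by fastforce
next
  assume C: "C \<in> carrier H \<and> deg ` keys (\<psi> C) \<subseteq> {n}"
  have "int (length w) = n" if w: "w \<in> keys (nf (\<psi> C))" for w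
  proof -
    obtain i where "i \<in> keys (\<psi> C)" "w = word i"
      using w keys_lext[of "\<lambda>i. bas (word i)" "\<psi> C"] unfolding nf_def by auto
    thus ?thesis using C by (cases i) (auto simp: word_def deg_def)
  qed
  moreover have "C = cl (nf (\<psi> C))" using cl_nf C by simp
  ultimately show "C \<in> GH n" unfolding H_grading_def quot_grading_def by blast
qed

lemma GH_ids: "internal_direct_sum H GH"
proof (rule coord_grading[where \<theta> = \<psi> and deg = deg])
  show "abelian_group H" by (rule C.abelian_group_axioms)
  show "GH n = {a \<in> carrier H. deg ` keys (\<psi> a) \<subseteq> {n}}" for n by (simp add: set_eq_iff GH_iff)
qed (simp_all add: C.bij C.\<theta>_add)

lemma GH_mult: assumes "a \<in> GH i" "b \<in> GH j" shows "a \<otimes>\<^bsub>H\<^esub> b \<in> GH (i + j)"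
proof -
  obtain u v where uv: "a = cl u" "b = cl v" "\<And>w. w \<in> keys u \<Longrightarrow> int (length w) = i" "\<And>w. w \<in> keys v \<Longrightarrow> int (length w) = j"
    using assms by (auto simp: H_grading_def quot_grading_def)
  have "int (length w) = i + j" if "w \<in> keys (u \<otimes>\<^bsub>FA\<^esub> v)" for w
  proof -
    have "w \<in> (\<Union>a\<in>keys u. keys (lext (\<lambda>b. bas (a @ b)) v))"
      using that keys_lext[of "\<lambda>a. lext (\<lambda>b. bas (a @ b)) v" u] unfolding FA_mult by (rule subsetD[rotated])
    then obtain w1 where w1: "w1 \<in> keys u" "w \<in> keys (lext (\<lambda>b. bas (w1 @ b)) v)" by (rule UN_E)
    have "w \<in> (\<Union>b\<in>keys v. keys (bas (w1 @ b) :: gen list \<Rightarrow>\<^sub>0 'k))"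
      using w1(2) keys_lext[of "\<lambda>b. bas (w1 @ b)" v] by (rule subsetD[rotated])
    then obtain w2 where "w2 \<in> keys v" "w = w1 @ w2" by auto
    thus ?thesis using uv(3)[OF w1(1)] uv(4) by simp
  qed
  moreover have "a \<otimes>\<^bsub>H\<^esub> b = cl (u \<otimes>\<^bsub>FA\<^esub> v)" using uv by (simp add: cl_simps)
  ultimately show ?thesis unfolding H_grading_def quot_grading_def by auto
qed

lemma GH_graded_ring: "graded_ring H GH"
  unfolding graded_ring_def
  by (intro conjI allI ballI C.ring_axioms GH_ids GH_mult) (auto simp: GH_iff \<psi>_one deg_def)

lemma GH_scale: "a \<in> GH n \<Longrightarrow> z \<odot>\<^bsub>H\<^esub> a \<in> GH n"
  using keys_scale[of z "\<psi> a"] by (auto simp: GH_iff C.\<theta>_scale C.scale_closed image_subset_iff)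

lemma H_graded_algebra: "graded_algebra H GH"
proof -
  have "GH n = {\<zero>\<^bsub>H\<^esub>}" if "n < 0" for n
  proof (intro subset_antisym subsetI)
    fix a assume "a \<in> GH n"
    hence a: "a \<in> carrier H" "deg ` keys (\<psi> a) \<subseteq> {n}" by (auto simp: GH_iff)
    have "i \<notin> keys (\<psi> a)" for i
    proof
      assume "i \<in> keys (\<psi> a)"
      hence "deg i = n" using a(2) by auto
      moreover have "deg i \<ge> 0" by (cases i) (simp add: deg_def)
      ultimately show False using that by simp
    qed
    hence "keys (\<psi> a) = {}" by blast
    hence "\<psi> a = 0" by simp
    thus "a \<in> {\<zero>\<^bsub>H\<^esub>}" using C.\<theta>_zero_iff[OF a(1)] by simp
  qed (auto simp: GH_iff)
  thus ?thesis unfolding graded_algebra_def using H_k_algebra GH_graded_ring GH_scale by blast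
qed

lemma H_one_neq: "\<one>\<^bsub>H\<^esub> \<noteq> \<zero>\<^bsub>H\<^esub>"
  using \<psi>_one C.\<theta>_zero by (metis zero_neq_one lookup_single_eq lookup_zero)

lemma deg_zero: "deg i = 0 \<longleftrightarrow> i = (0, 0, 0)"
  by (cases i) (auto simp: deg_def)

lemma H_connected: "connected_graded_algebra H GH"
proof -
  have "a \<in> range (\<lambda>z. z \<odot>\<^bsub>H\<^esub> \<one>\<^bsub>H\<^esub>)" if "a \<in> GH 0" for a
  proof -
    have a: "a \<in> carrier H" "keys (\<psi> a) \<subseteq> {(0, 0, 0)}" using that by (auto simp: GH_iff image_subset_iff deg_zero)
    have "\<psi> a = sg (0, 0, 0) (lk (\<psi> a) (0, 0, 0))"
      using a(2) by (intro poly_mapping_eqI) (auto simp: lookup_single when_def in_keys_iff)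
    hence "\<psi> a = \<psi> (lk (\<psi> a) (0, 0, 0) \<odot>\<^bsub>H\<^esub> \<one>\<^bsub>H\<^esub>)" by (simp add: C.\<theta>_scale \<psi>_one)
    hence "a = lk (\<psi> a) (0, 0, 0) \<odot>\<^bsub>H\<^esub> \<one>\<^bsub>H\<^esub>" using C.\<theta>_inj a(1) C.scale_closed by blast
    thus ?thesis by blast
  qed
  moreover have "z \<odot>\<^bsub>H\<^esub> \<one>\<^bsub>H\<^esub> \<in> GH 0" for z using GH_scale graded_ringD(3)[OF GH_graded_ring] by blast
  ultimately show ?thesis unfolding connected_graded_algebra_def using H_graded_algebra H_one_neq by blast
qed

lemma positive_part_iff: "a \<in> positive_part H GH \<longleftrightarrow> a \<in> carrier H \<and> lk (\<psi> a) (0, 0, 0) = 0"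
proof
  assume "a \<in> positive_part H GH"
  then obtain N f where a: "a = (\<Oplus>\<^bsub>H\<^esub>n\<in>N. f n)" "finite N" "N \<subseteq> {1..}" "\<And>n. n \<in> N \<Longrightarrow> f n \<in> GH n"
    unfolding positive_part_def by blast
  have f: "f n \<in> carrier H" "lk (\<psi> (f n)) (0, 0, 0) = 0" if "n \<in> N" for n
  proof -
    have "f n \<in> GH n" "n \<ge> 1" using that a by auto
    hence "f n \<in> carrier H" "(0, 0, 0) \<notin> keys (\<psi> (f n))" using deg_zero[of "(0, 0, 0)"]
      by (auto simp: GH_iff)
    thus "f n \<in> carrier H" "lk (\<psi> (f n)) (0, 0, 0) = 0" by (simp_all add: in_keys_iff)
  qed
  have "a \<in> carrier H" unfolding a(1) using f by (intro C.finsum_closed) auto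
  thus "a \<in> carrier H \<and> lk (\<psi> a) (0, 0, 0) = 0" unfolding a(1) using C.\<theta>_finsum[of N f] f by simp
next
  assume a: "a \<in> carrier H \<and> lk (\<psi> a) (0, 0, 0) = 0"
  define N where "N = deg ` keys (\<psi> a)"
  define f where "f n = C.\<phi> (restr (\<lambda>i. deg i = n) (\<psi> a))" for n
  have "a = (\<Oplus>\<^bsub>H\<^esub>n\<in>N. f n)"
  proof (rule C.\<theta>_inj[THEN iffD1])
    show "\<psi> a = \<psi> (\<Oplus>\<^bsub>H\<^esub>n\<in>N. f n)"
      using C.\<theta>_finsum[of N f] sum_restr[of N deg "\<psi> a"] by (simp add: N_def f_def)
  qed (use a f_def in auto)
  moreover have "finite N" by (simp add: N_def)
  moreover have "N \<subseteq> {1..}"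
  proof
    fix n assume "n \<in> N"
    then obtain i where i: "i \<in> keys (\<psi> a)" "n = deg i" by (auto simp: N_def)
    hence "i \<noteq> (0, 0, 0)" using a by (auto simp: in_keys_iff)
    moreover have "deg i \<ge> 0" by (cases i) (simp add: deg_def)
    ultimately show "n \<in> {1..}" using deg_zero[of i] i by auto
  qed
  moreover have "f n \<in> GH n" for n
    by (auto simp: GH_iff f_def in_keys_iff lk_restr split: if_splits)
  ultimately show "a \<in> positive_part H GH" unfolding positive_part_def by blast
qed

lemma gens_GH: "cl (var a) \<in> GH 1"
  unfolding H_grading_def quot_grading_def by (auto simp: var_def split: if_splits)

end

section \<open>The trivial module\<close>

context H_data
begin

definition aug :: "(gen list \<Rightarrow>\<^sub>0 'k) set \<Rightarrow> 'k" where "aug a = lk (\<psi> a) (0, 0, 0)"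

lemma gop_000: "lk (gop p q c a v) (0, 0, 0) = 0"
proof -
  have "lk (gop p q c a (bas i)) (0, 0, 0) = 0" for i
    by (cases a; cases i) (auto simp: lookup_add lookup_single when_def)
  moreover have "gop p q c a v = lext (\<lambda>i. gop p q c a (bas i)) v" by (rule klin_expand[OF klin_gop])
  ultimately show ?thesis by (simp only: lk_lext mult_zero_right sum.neutral_const)
qed

text \<open>Every generator produces vectors with constant coefficient 0, so only the empty word of
  the left factor contributes.\<close>

lemma aug_mult: assumes "a \<in> carrier H" "b \<in> carrier H" shows "aug (a \<otimes>\<^bsub>H\<^esub> b) = aug a * aug b"
proof -
  obtain u where u: "a = cl u" using assms by (auto simp: H_carrier)
  have w: "lk (wop p q c w v) (0, 0, 0) = (if w = [] then lk v (0, 0, 0) else 0)" for w v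
    by (cases w) (simp_all add: gop_000)
  have *: "lk (act p q c u v) (0, 0, 0) = lk u [] * lk v (0, 0, 0)" for v
  proof -
    have "lk (act p q c u v) (0, 0, 0) = (\<Sum>w\<in>keys u. if w = [] then lk u [] * lk v (0, 0, 0) else 0)"
      unfolding act_def lk_lext by (intro sum.cong refl) (auto simp: w)
    thus ?thesis by (auto simp: in_keys_iff)
  qed
  have "aug (a \<otimes>\<^bsub>H\<^esub> b) = lk u [] * aug b"
    using C.\<theta>_mult_L[OF assms(2), of a] by (simp add: aug_def u Lm_cl *)
  moreover have "aug a = lk u []" using * by (simp add: aug_def u \<psi>_cl lookup_single)
  ultimately show ?thesis by simp
qed

lemma aug_simps: "a \<in> carrier H \<Longrightarrow> b \<in> carrier H \<Longrightarrow> aug (a \<oplus>\<^bsub>H\<^esub> b) = aug a + aug b"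
  "a \<in> carrier H \<Longrightarrow> aug (\<ominus>\<^bsub>H\<^esub> a) = - aug a" "aug \<zero>\<^bsub>H\<^esub> = 0" "aug \<one>\<^bsub>H\<^esub> = 1"
  "a \<in> carrier H \<Longrightarrow> b \<in> carrier H \<Longrightarrow> aug (a \<ominus>\<^bsub>H\<^esub> b) = aug a - aug b"
  "a \<in> carrier H \<Longrightarrow> aug (z \<odot>\<^bsub>H\<^esub> a) = z * aug a"
  by (simp_all add: aug_def C.\<theta>_add C.\<theta>_uminus C.\<theta>_minus C.\<theta>_scale \<psi>_one lookup_add lookup_minus lookup_single)

lemma aug_GH: "a \<in> GH n \<Longrightarrow> n \<noteq> 0 \<Longrightarrow> aug a = 0"
proof -
  assume "a \<in> GH n" "n \<noteq> 0"
  hence "(0, 0, 0) \<notin> keys (\<psi> a)" using deg_zero[of "(0, 0, 0)"] by (auto simp: GH_iff)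
  thus "aug a = 0" by (simp add: aug_def in_keys_iff)
qed

definition "PP = {a \<in> carrier H. aug a = 0}"

lemma positive_part_H: "positive_part H GH = PP"
  by (auto simp: positive_part_iff PP_def aug_def)

lemma positive_part_opp: "positive_part (opp H) GH = PP"
proof -
  have "finsum (opp H) f N = finsum H f N" for f and N :: "int set" by (simp add: finsum_def opp_def)
  hence "positive_part (opp H) GH = positive_part H GH" by (simp add: positive_part_def)
  thus ?thesis by (simp add: positive_part_H)
qed

end

text \<open>The trivial module over \<open>H\<close> and over the opposite algebra are treated at once: \<open>A\<close> is one of the
  two rings.\<close>

locale H_side = H_data p q c for p q c :: "'k::field" +
  fixes A :: "('k, (gen list \<Rightarrow>\<^sub>0 'k) set) module"
  assumes A_ring: "ring A"
    and A_simps: "carrier A = carrier H" "zero A = zero H" "add A = add H"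
    and A_mult: "a \<in> carrier H \<Longrightarrow> b \<in> carrier H \<Longrightarrow> aug (a \<otimes>\<^bsub>A\<^esub> b) = aug a * aug b"
begin

abbreviation "N \<equiv> quot (regular A) PP"
abbreviation "\<epsilon> \<equiv> (\<lambda>a. PP +>\<^bsub>regular A\<^esub> a)"

lemma reg: "left_module A (regular A)" by (rule ring.regular_left_module[OF A_ring])

lemma reg_uminus: assumes "a \<in> carrier H" shows "\<ominus>\<^bsub>regular A\<^esub> a = \<ominus>\<^bsub>H\<^esub> a"
proof -
  interpret R: left_module A "regular A" by (rule reg)
  show ?thesis using assms by (intro R.M.minus_equality) (simp_all add: A_simps C.l_neg)
qed

sublocale Nq: quotient_group PP "regular A"
proof (rule quotient_groupI)
  show "abelian_group (regular A)" by (rule left_module.axioms(2)[OF reg])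
qed (auto simp: PP_def A_simps aug_simps reg_uminus)

lemma N_module: "left_module A N"
  and \<epsilon>_smult: "a \<in> carrier A \<Longrightarrow> x \<in> carrier A \<Longrightarrow> a \<odot>\<^bsub>N\<^esub> \<epsilon> x = \<epsilon> (a \<otimes>\<^bsub>A\<^esub> x)"
proof -
  have sm: "a \<odot>\<^bsub>regular A\<^esub> x \<in> PP" if "a \<in> carrier A" "x \<in> PP" for a x
    using that monoid.m_closed[OF ring.is_monoid[OF A_ring], of a x] by (auto simp: PP_def A_simps A_mult)
  show "left_module A N" by (rule quot_left_module(1)[OF reg Nq.quotient_group_axioms sm])
  show "a \<in> carrier A \<Longrightarrow> x \<in> carrier A \<Longrightarrow> a \<odot>\<^bsub>N\<^esub> \<epsilon> x = \<epsilon> (a \<otimes>\<^bsub>A\<^esub> x)"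
    using quot_left_module(2)[OF reg Nq.quotient_group_axioms sm, of a x] by simp
qed

lemma \<epsilon>_lin: "linmap A (regular A) N \<epsilon>"
  unfolding linmap_def using \<epsilon>_smult Nq.cos_in Nq.cos_add by auto

lemma \<epsilon>_surj: "\<epsilon> ` carrier A = carrier N"
  by (auto simp: quot_carrier_iff)

lemma \<epsilon>_zero_iff: "a \<in> carrier H \<Longrightarrow> \<epsilon> a = \<zero>\<^bsub>N\<^esub> \<longleftrightarrow> aug a = 0"
proof -
  assume a: "a \<in> carrier H"
  have z: "\<zero>\<^bsub>N\<^esub> = \<epsilon> \<zero>\<^bsub>H\<^esub>" using Nq.cos_zero by (simp add: quot_simps A_simps)
  have "\<epsilon> a = \<epsilon> \<zero>\<^bsub>H\<^esub> \<longleftrightarrow> a \<ominus>\<^bsub>regular A\<^esub> \<zero>\<^bsub>H\<^esub> \<in> PP"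
    by (rule Nq.cos_eq_iff) (simp_all add: a A_simps)
  also have "a \<ominus>\<^bsub>regular A\<^esub> \<zero>\<^bsub>H\<^esub> = a" using a by (simp add: a_minus_def reg_uminus A_simps)
  also have "a \<in> PP \<longleftrightarrow> aug a = 0" using a by (simp add: PP_def)
  finally show "\<epsilon> a = \<zero>\<^bsub>N\<^esub> \<longleftrightarrow> aug a = 0" by (simp only: z)
qed

lemma \<epsilon>_eq_iff: "a \<in> carrier H \<Longrightarrow> b \<in> carrier H \<Longrightarrow> \<epsilon> a = \<epsilon> b \<longleftrightarrow> aug a = aug b"
proof -
  assume ab: "a \<in> carrier H" "b \<in> carrier H"
  have "a \<ominus>\<^bsub>regular A\<^esub> b = a \<ominus>\<^bsub>H\<^esub> b" using ab by (simp add: a_minus_def reg_uminus A_simps)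
  thus "\<epsilon> a = \<epsilon> b \<longleftrightarrow> aug a = aug b"
    using Nq.cos_eq_iff[of a b] ab by (simp add: A_simps PP_def aug_simps)
qed

text \<open>The trivial module is one-dimensional in degree 0. Coordinates indexed by the unit type
  put it within reach of \<open>coord_grading\<close>.\<close>

lemma N_ids: "internal_direct_sum N (\<lambda>n. \<epsilon> ` GH n)"
proof -
  define rep where "rep C = (SOME a. a \<in> carrier H \<and> \<epsilon> a = C)" for C
  have rep: "rep C \<in> carrier H \<and> \<epsilon> (rep C) = C" if "C \<in> carrier N" for C
  proof -
    have "\<exists>a. a \<in> carrier H \<and> \<epsilon> a = C" using that by (auto simp: quot_carrier_iff A_simps)
    thus ?thesis unfolding rep_def by (rule someI_ex)
  qed
  define \<theta> where "\<theta> C = sg () (aug (rep C))" for C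
  have \<theta>: "\<theta> (\<epsilon> a) = sg () (aug a)" if "a \<in> carrier H" for a
  proof -
    have "\<epsilon> a \<in> carrier N" using that by (auto simp: quot_carrier_iff A_simps)
    from rep[OF this] have "aug (rep (\<epsilon> a)) = aug a" using \<epsilon>_eq_iff[of "rep (\<epsilon> a)" a] that by simp
    thus ?thesis by (simp add: \<theta>_def)
  qed
  have unit: "sg () (lk u ()) = u" for u :: "unit \<Rightarrow>\<^sub>0 'k"
    by (rule poly_mapping_eqI) (simp add: lookup_single)
  show ?thesis
  proof (rule coord_grading[where \<theta> = \<theta> and deg = "\<lambda>_. 0"])
    show "abelian_group N" by (rule left_module.axioms(2)[OF N_module])
    show "bij_betw \<theta> (carrier N) UNIV"
    proof (rule bij_betw_byWitness[where f' = "\<lambda>u. \<epsilon> (lk u () \<odot>\<^bsub>H\<^esub> \<one>\<^bsub>H\<^esub>)"])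
      show "\<forall>C\<in>carrier N. \<epsilon> (lk (\<theta> C) () \<odot>\<^bsub>H\<^esub> \<one>\<^bsub>H\<^esub>) = C"
      proof
        fix C assume C: "C \<in> carrier N"
        have "\<epsilon> (lk (\<theta> C) () \<odot>\<^bsub>H\<^esub> \<one>\<^bsub>H\<^esub>) = \<epsilon> (rep C)"
          by (subst \<epsilon>_eq_iff) (use rep[OF C] in \<open>simp_all add: \<theta>_def lookup_single aug_simps C.scale_closed\<close>)
        thus "\<epsilon> (lk (\<theta> C) () \<odot>\<^bsub>H\<^esub> \<one>\<^bsub>H\<^esub>) = C" using rep[OF C] by simp
      qed
      show "\<forall>u\<in>UNIV. \<theta> (\<epsilon> (lk u () \<odot>\<^bsub>H\<^esub> \<one>\<^bsub>H\<^esub>)) = u"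
        by (simp add: \<theta> C.scale_closed aug_simps unit)
      show "(\<lambda>u. \<epsilon> (lk u () \<odot>\<^bsub>H\<^esub> \<one>\<^bsub>H\<^esub>)) ` UNIV \<subseteq> carrier N"
      proof clarify
        fix u :: "unit \<Rightarrow>\<^sub>0 'k"
        have "lk u () \<odot>\<^bsub>H\<^esub> \<one>\<^bsub>H\<^esub> \<in> carrier (regular A)" by (simp add: A_simps C.scale_closed)
        thus "\<epsilon> (lk u () \<odot>\<^bsub>H\<^esub> \<one>\<^bsub>H\<^esub>) \<in> carrier N" by (rule Nq.cos_in)
      qed
    qed auto
    show "\<theta> (C \<oplus>\<^bsub>N\<^esub> C') = \<theta> C + \<theta> C'" if CC: "C \<in> carrier N" "C' \<in> carrier N" for C C'
    proof -
      obtain a b where ab: "a \<in> carrier H" "C = \<epsilon> a" "b \<in> carrier H" "C' = \<epsilon> b"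
        using CC by (auto simp: quot_carrier_iff A_simps)
      have "C \<oplus>\<^bsub>N\<^esub> C' = \<epsilon> (a \<oplus>\<^bsub>H\<^esub> b)" using Nq.cos_add[of a b] ab by (simp add: A_simps)
      thus ?thesis using ab by (simp add: \<theta> aug_simps single_add)
    qed
    show "\<epsilon> ` GH n = {C \<in> carrier N. (\<lambda>_. 0) ` keys (\<theta> C) \<subseteq> {n}}" for n
    proof (intro subset_antisym subsetI)
      fix C assume "C \<in> \<epsilon> ` GH n"
      then obtain a where a: "a \<in> GH n" "C = \<epsilon> a" by auto
      hence ac: "a \<in> carrier H" by (simp add: GH_iff)
      show "C \<in> {C \<in> carrier N. (\<lambda>_. 0) ` keys (\<theta> C) \<subseteq> {n}}"
        using ac aug_GH[OF a(1)] by (auto simp: a(2) \<theta> quot_carrier_iff A_simps split: if_splits)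
    next
      fix C assume "C \<in> {C \<in> carrier N. (\<lambda>_. 0) ` keys (\<theta> C) \<subseteq> {n}}"
      then obtain a where a: "a \<in> carrier H" "C = \<epsilon> a" "(\<lambda>_. 0) ` keys (\<theta> C) \<subseteq> {n}"
        by (auto simp: quot_carrier_iff A_simps)
      show "C \<in> \<epsilon> ` GH n"
      proof (cases "n = 0")
        case True
        have "aug a \<odot>\<^bsub>H\<^esub> \<one>\<^bsub>H\<^esub> \<in> GH n" using GH_scale graded_ringD(3)[OF GH_graded_ring] True by blast
        moreover have "C = \<epsilon> (aug a \<odot>\<^bsub>H\<^esub> \<one>\<^bsub>H\<^esub>)"
          unfolding a(2) by (subst \<epsilon>_eq_iff) (use a(1) in \<open>simp_all add: aug_simps C.scale_closed\<close>)
        ultimately show ?thesis by blast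
      next
        case False
        hence "aug a = 0" using a by (auto simp: \<theta> split: if_splits)
        hence "C = \<epsilon> \<zero>\<^bsub>H\<^esub>" unfolding a(2) by (subst \<epsilon>_eq_iff) (use a(1) in \<open>simp_all add: aug_simps\<close>)
        moreover have "\<zero>\<^bsub>H\<^esub> \<in> GH n" by (auto simp: GH_iff)
        ultimately show ?thesis by blast
      qed
    qed
  qed
qed

end

section \<open>The Koszul resolution of the trivial module\<close>

context H_data
begin

sublocale HL: H_side p q c H
  by unfold_locales (auto simp: aug_mult C.ring_axioms)

sublocale HR: H_side p q c "opp H"
  by (intro H_side.intro H_side_axioms.intro H_data_axioms C.opp_ring) (simp_all add: aug_mult mult.commute)

lemma trivial_eq: "trivial_module H GH = HL.N" "trivial_module (opp H) GH = HR.N"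
  "trivial_grading H GH = (\<lambda>n. HL.\<epsilon> ` GH n)" "trivial_grading (opp H) GH = (\<lambda>n. HR.\<epsilon> ` GH n)"
  by (simp_all add: trivial_module_def trivial_grading_def positive_part_H positive_part_opp quot_grading_def fun_eq_iff)

lemma trivial_graded: "graded_module H GH HL.N (\<lambda>n. HL.\<epsilon> ` GH n)"
  unfolding graded_module_def
proof (intro conjI GH_graded_ring HL.N_module HL.N_ids allI ballI)
  fix i j a C assume a: "a \<in> GH i" and "C \<in> HL.\<epsilon> ` GH j"
  then obtain b where b: "b \<in> GH j" "C = HL.\<epsilon> b" by auto
  have "a \<odot>\<^bsub>HL.N\<^esub> C = HL.\<epsilon> (a \<otimes>\<^bsub>H\<^esub> b)" using a b by (auto simp: GH_iff HL.\<epsilon>_smult)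
  thus "a \<odot>\<^bsub>HL.N\<^esub> C \<in> HL.\<epsilon> ` GH (i + j)" using GH_mult[OF a b(1)] by blast
qed

text \<open>The second factor is the field, with the unit type as index set, so that H itself is
  written as H \<otimes> k.\<close>

definition \<theta>1 :: "(gen list \<Rightarrow>\<^sub>0 'k) set \<Rightarrow> ((nat \<times> nat \<times> nat) \<times> unit \<Rightarrow>\<^sub>0 'k)" where
  "\<theta>1 a = tens (\<psi> a) (bas ())"

lemma \<theta>1_coord: "coord_algebra H \<theta>1"
proof (intro coord_algebra.intro H_k_algebra coord_algebra_axioms.intro)
  have "tens v (bas ()) = u" if "\<And>i. lk v i = lk u (i, ())" for u :: "(nat \<times> nat \<times> nat) \<times> unit \<Rightarrow>\<^sub>0 'k" and v
    by (rule poly_mapping_eqI) (use that in \<open>auto simp: lk_tens lookup_single\<close>)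
  moreover have "lk (lext (\<lambda>(i, s). bas i) u) i = lk u (i, ())" for u :: "(nat \<times> nat \<times> nat) \<times> unit \<Rightarrow>\<^sub>0 'k" and i
  proof -
    have "lk (lext (\<lambda>(i, s). bas i) u) i = (\<Sum>x\<in>keys u. if x = (i, ()) then lk u (i, ()) else 0)"
      unfolding lk_lext by (intro sum.cong refl) (auto simp: lookup_single when_def split: if_splits)
    thus ?thesis by (auto simp: in_keys_iff)
  qed
  ultimately have surj: "tens (lext (\<lambda>(i, s). bas i) u) (bas ()) = u" for u :: "(nat \<times> nat \<times> nat) \<times> unit \<Rightarrow>\<^sub>0 'k" by blast
  have inj: "lext (\<lambda>(i, s). bas i) (tens v (bas ())) = v" for v :: "'k pbw"
    by (rule klin_eqI[of "\<lambda>v. lext (\<lambda>(i, s). bas i) (tens v (bas ()))" "\<lambda>v. v"])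
      (auto intro: klin_compose[OF klin_lext klin_tens1] klin_id)
  show "bij_betw \<theta>1 (carrier H) UNIV"
    by (rule bij_betw_byWitness[where f' = "\<lambda>u. C.\<phi> (lext (\<lambda>(i, s). bas i) u)"])
      (auto simp: \<theta>1_def surj inj C.\<phi>_\<theta>)
qed (auto simp: \<theta>1_def C.\<theta>_add C.\<theta>_scale klin_simps[OF klin_tens1])

interpretation C1: coord_algebra H \<theta>1 by (rule \<theta>1_coord)

lemma C1_Rm: "a \<in> carrier H \<Longrightarrow> C1.Rm a = op1 (C.Rm a)" and C1_Lm: "a \<in> carrier H \<Longrightarrow> C1.Lm a = op1 (C.Lm a)"
proof -
  assume a: "a \<in> carrier H"
  have "C1.Rm a u = op1 (C.Rm a) u" "C1.Lm a u = op1 (C.Lm a) u" for u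
  proof -
    have u: "u = tens (\<psi> (C1.\<phi> u)) (bas ())" using C1.\<theta>_\<phi>[of u] by (simp add: \<theta>1_def)
    have "C1.Rm a u = tens (C.Rm a (\<psi> (C1.\<phi> u))) (bas ())" "C1.Lm a u = tens (C.Lm a (\<psi> (C1.\<phi> u))) (bas ())"
      by (simp_all add: C1.Rm_def C1.Lm_def \<theta>1_def C.\<theta>_mult_R C.\<theta>_mult_L)
    thus "C1.Rm a u = op1 (C.Rm a) u" "C1.Lm a u = op1 (C.Lm a) u"
      by (subst (2) u, simp add: op1_tens C.klin_Rm C.klin_Lm a)+
  qed
  thus "C1.Rm a = op1 (C.Rm a)" "C1.Lm a = op1 (C.Lm a)" by auto
qed

text \<open>On k the generators act by 0, which satisfies every relation; so the second system of
  generators is zero. The cokernels on the two sides are the left and the right trivial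
  module.\<close>

lemma koszul_ring_H: "koszul_ring_aug H \<theta>1 GH p q c xx yy tt \<zero>\<^bsub>H\<^esub> \<zero>\<^bsub>H\<^esub> \<zero>\<^bsub>H\<^esub> W0 W1 W2 W0 V1 W2
  HL.N (\<lambda>n. HL.\<epsilon> ` GH n) HL.\<epsilon> HR.N (\<lambda>n. HR.\<epsilon> ` GH n) HR.\<epsilon>"
proof (intro koszul_ring_aug.intro koszul_ring.intro \<theta>1_coord koszul_ring_axioms.intro koszul_ring_aug_axioms.intro
    GH_graded_ring H_one_neq GH_scale gens_GH trivial_graded HL.\<epsilon>_lin HL.\<epsilon>_surj HR.N_module HR.\<epsilon>_lin)
  have z2: "op2 (\<lambda>u. 0) = (\<lambda>u. 0 :: (nat \<times> nat \<times> nat) \<times> unit \<Rightarrow>\<^sub>0 'k)" by (rule ext) simp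
  have rz: "C1.Rm \<zero>\<^bsub>H\<^esub> = (\<lambda>u. 0)" "C1.Lm \<zero>\<^bsub>H\<^esub> = (\<lambda>u. 0)" by (simp_all add: fun_eq_iff C1.Rm_zero C1.Lm_zero)
  show "koszul_ops p q c (C1.Rm xx) (C1.Rm yy) (C1.Rm tt) (C1.Rm \<zero>\<^bsub>H\<^esub>) (C1.Rm \<zero>\<^bsub>H\<^esub>) (C1.Rm \<zero>\<^bsub>H\<^esub>) W0 W1 W2"
    using right_ops[of "\<lambda>u. 0 :: unit \<Rightarrow>\<^sub>0 'k" "\<lambda>u. 0" "\<lambda>u. 0"]
    by (simp add: klin_zero_fun z2 rz C1_Rm)
  show "koszul_ops p q c (C1.Lm yy) (C1.Lm xx) (C1.Lm tt) (\<lambda>u. scale (p * q) (C1.Lm \<zero>\<^bsub>H\<^esub> u))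
      (\<lambda>u. scale (1 / (p * q)) (C1.Lm \<zero>\<^bsub>H\<^esub> u)) (C1.Lm \<zero>\<^bsub>H\<^esub>) W0 V1 W2"
    using left_ops[of "\<lambda>u. 0 :: unit \<Rightarrow>\<^sub>0 'k" "\<lambda>u. 0" "\<lambda>u. 0"]
    by (simp add: klin_zero_fun z2 rz C1_Lm)
  have ag: "aug (cl (var a)) = 0" for a by (rule aug_GH[OF gens_GH]) simp
  note sc = C.scale_closed C.m_closed
  show "HL.\<epsilon> (xx \<ominus>\<^bsub>H\<^esub> \<zero>\<^bsub>H\<^esub>) = \<zero>\<^bsub>HL.N\<^esub>" "HL.\<epsilon> (yy \<ominus>\<^bsub>H\<^esub> \<zero>\<^bsub>H\<^esub>) = \<zero>\<^bsub>HL.N\<^esub>" "HL.\<epsilon> (tt \<ominus>\<^bsub>H\<^esub> \<zero>\<^bsub>H\<^esub>) = \<zero>\<^bsub>HL.N\<^esub>"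
    by (subst HL.\<epsilon>_zero_iff; simp add: aug_simps ag)+
  show "HR.\<epsilon> (yy \<ominus>\<^bsub>H\<^esub> (p * q) \<odot>\<^bsub>H\<^esub> \<zero>\<^bsub>H\<^esub>) = \<zero>\<^bsub>HR.N\<^esub>" "HR.\<epsilon> ((p * q) \<odot>\<^bsub>H\<^esub> xx \<ominus>\<^bsub>H\<^esub> \<zero>\<^bsub>H\<^esub>) = \<zero>\<^bsub>HR.N\<^esub>"
    "HR.\<epsilon> (\<ominus>\<^bsub>H\<^esub> (p \<odot>\<^bsub>H\<^esub> (tt \<ominus>\<^bsub>H\<^esub> \<zero>\<^bsub>H\<^esub>))) = \<zero>\<^bsub>HR.N\<^esub>"
    by (subst HR.\<epsilon>_zero_iff; simp add: aug_simps ag sc)+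
  have zero: "a = \<zero>\<^bsub>H\<^esub>" if a: "a \<in> carrier H" "\<theta>1 a \<in> W2" "aug a = 0" for a
  proof -
    have "keys (\<psi> a) \<subseteq> {(0, 0, 0)}" using a(2) by (auto simp: \<theta>1_def W2_def KS_def keys_tens)
    moreover have "(0, 0, 0) \<notin> keys (\<psi> a)" using a(3) by (simp add: aug_def in_keys_iff)
    ultimately have "keys (\<psi> a) = {}" by blast
    thus ?thesis using C.\<theta>_zero_iff[OF a(1)] by simp
  qed
  show "a = \<zero>\<^bsub>H\<^esub>" if "a \<in> carrier H" "\<theta>1 a \<in> W2" "HL.\<epsilon> a = \<zero>\<^bsub>HL.N\<^esub>" for a
    using zero[OF that(1,2)] that HL.\<epsilon>_zero_iff by blast
  show "a = \<zero>\<^bsub>H\<^esub>" if "a \<in> carrier H" "\<theta>1 a \<in> W2" "HR.\<epsilon> a = \<zero>\<^bsub>HR.N\<^esub>" for a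
    using zero[OF that(1,2)] that HR.\<epsilon>_zero_iff by blast
  show "HR.\<epsilon> ` carrier H = carrier HR.N" using HR.\<epsilon>_surj by simp
qed (auto simp: GH_iff)

end

section \<open>Coordinates of vector spaces\<close>

text \<open>A basis from Zorn's lemma, for a vector space given by a carrier and a scalar action.
  The basis is a set and not a type, so coordinates are indexed by all of \<open>'m\<close> and
  supported in \<open>S\<close>.\<close>

lemma exists_coordinates:
  fixes M :: "('m, 'r) ring_scheme" and s :: "'k::field \<Rightarrow> 'm \<Rightarrow> 'm"
  assumes M: "abelian_group M" and s: "\<And>c x. x \<in> carrier M \<Longrightarrow> s c x \<in> carrier M"
    and s_add: "\<And>c d x. x \<in> carrier M \<Longrightarrow> s (c + d) x = s c x \<oplus>\<^bsub>M\<^esub> s d x"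
    and s_add': "\<And>c x y. x \<in> carrier M \<Longrightarrow> y \<in> carrier M \<Longrightarrow> s c (x \<oplus>\<^bsub>M\<^esub> y) = s c x \<oplus>\<^bsub>M\<^esub> s c y"
    and s_mult: "\<And>c d x. x \<in> carrier M \<Longrightarrow> s (c * d) x = s c (s d x)"
    and s_one: "\<And>x. x \<in> carrier M \<Longrightarrow> s 1 x = x"
  shows "\<exists>S \<kappa>. S \<subseteq> carrier M \<and> bij_betw \<kappa> (carrier M) {u :: 'm \<Rightarrow>\<^sub>0 'k. keys u \<subseteq> S} \<and>
    (\<forall>x\<in>carrier M. \<forall>y\<in>carrier M. \<kappa> (x \<oplus>\<^bsub>M\<^esub> y) = \<kappa> x + \<kappa> y) \<and>
    (\<forall>c. \<forall>x\<in>carrier M. \<kappa> (s c x) = scale c (\<kappa> x)) \<and> (\<forall>m\<in>S. \<kappa> m = bas m)"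
proof -
  interpret M: abelian_group M by fact
  define ev where "ev u = (\<Oplus>\<^bsub>M\<^esub>m\<in>keys u. s (lk u m) m)" for u :: "'m \<Rightarrow>\<^sub>0 'k"
  have s0: "s 0 x = \<zero>\<^bsub>M\<^esub>" if "x \<in> carrier M" for x
    using s_add[OF that, of 0 0] s[OF that, of 0] by (metis M.r_neg1 M.l_neg add_0)
  have sz: "s c \<zero>\<^bsub>M\<^esub> = \<zero>\<^bsub>M\<^esub>" for c
    using s_add'[of "\<zero>\<^bsub>M\<^esub>" "\<zero>\<^bsub>M\<^esub>" c] s[of "\<zero>\<^bsub>M\<^esub>" c] by (metis M.r_neg1 M.l_neg M.l_zero M.zero_closed)
  have ev_sup: "ev u = (\<Oplus>\<^bsub>M\<^esub>m\<in>A. s (lk u m) m)" if "finite A" "keys u \<subseteq> A" "A \<subseteq> carrier M" for u A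
    unfolding ev_def using that s s0
    by (intro M.add.finprod_mono_neutral_cong_left) (auto simp: in_keys_iff)
  have ev_c: "ev u \<in> carrier M" if "keys u \<subseteq> carrier M" for u
    unfolding ev_def using that s by (intro M.finsum_closed) auto
  have ev_add: "ev (u + v) = ev u \<oplus>\<^bsub>M\<^esub> ev v" if uv: "keys u \<subseteq> carrier M" "keys v \<subseteq> carrier M" for u v
  proof -
    let ?A = "keys u \<union> keys v"
    have A: "finite ?A" "?A \<subseteq> carrier M" using uv by auto
    have "ev (u + v) = (\<Oplus>\<^bsub>M\<^esub>m\<in>?A. s (lk (u + v) m) m)"
      using A Poly_Mapping.keys_add[of u v] by (intro ev_sup)
    also have "\<dots> = (\<Oplus>\<^bsub>M\<^esub>m\<in>?A. s (lk u m) m \<oplus>\<^bsub>M\<^esub> s (lk v m) m)"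
      using A s s_add by (intro M.finsum_cong') (auto simp: lookup_add)
    also have "\<dots> = (\<Oplus>\<^bsub>M\<^esub>m\<in>?A. s (lk u m) m) \<oplus>\<^bsub>M\<^esub> (\<Oplus>\<^bsub>M\<^esub>m\<in>?A. s (lk v m) m)"
      using A s by (intro M.finsum_addf) auto
    also have "\<dots> = ev u \<oplus>\<^bsub>M\<^esub> ev v" using A by (simp add: ev_sup[of ?A])
    finally show ?thesis .
  qed
  have ev_scale: "ev (scale c u) = s c (ev u)" if u: "keys u \<subseteq> carrier M" for c u
  proof -
    have "ev (scale c u) = (\<Oplus>\<^bsub>M\<^esub>m\<in>keys u. s (lk (scale c u) m) m)"
      using u keys_scale[of c u] by (intro ev_sup) auto
    also have "\<dots> = (\<Oplus>\<^bsub>M\<^esub>m\<in>keys u. s c (s (lk u m) m))"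
      using u s s_mult by (intro M.finsum_cong') auto
    also have "\<dots> = s c (\<Oplus>\<^bsub>M\<^esub>m\<in>keys u. s (lk u m) m)"
      by (rule additive_map_finsum(1)[OF M M, symmetric]) (use u s s_add' in auto)
    finally show ?thesis by (simp add: ev_def)
  qed
  have ev_bas: "ev (sg m c) = s c m" if "m \<in> carrier M" for m c
    using ev_sup[of "{m}" "sg m c"] that s by simp
  define indep where "indep S \<longleftrightarrow> S \<subseteq> carrier M \<and> (\<forall>u. keys u \<subseteq> S \<longrightarrow> ev u = \<zero>\<^bsub>M\<^esub> \<longrightarrow> u = 0)" for S
  have "\<exists>S\<in>Collect indep. \<forall>S'\<in>Collect indep. S \<subseteq> S' \<longrightarrow> S' = S"
  proof (rule subset_Zorn')
    fix CC assume CC: "subset.chain (Collect indep) CC"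
    have "u = 0" if u: "keys u \<subseteq> \<Union>CC" "ev u = \<zero>\<^bsub>M\<^esub>" for u
    proof (cases "CC = {}")
      case False
      obtain S where "S \<in> CC" "keys u \<subseteq> S"
        using finite_subset_Union_chain[OF _ u(1) False CC] by auto
      thus ?thesis using CC u(2) by (auto simp: subset.chain_def indep_def)
    qed (use u in auto)
    moreover have "\<Union>CC \<subseteq> carrier M"
    proof
      fix x assume "x \<in> \<Union>CC"
      then obtain S where S: "x \<in> S" "S \<in> CC" by (rule UnionE)
      have "indep S" using CC S(2) unfolding subset.chain_def by (simp add: subset_eq)
      thus "x \<in> carrier M" using S(1) unfolding indep_def by (simp add: subset_eq)
    qed
    ultimately show "\<Union>CC \<in> Collect indep" by (simp add: indep_def)
  qed
  then obtain S where S: "indep S" and max: "\<And>S'. indep S' \<Longrightarrow> S \<subseteq> S' \<Longrightarrow> S' = S" by auto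
  have Sc: "S \<subseteq> carrier M" using S by (simp add: indep_def)
  have span: "\<exists>u. keys u \<subseteq> S \<and> ev u = m" if m: "m \<in> carrier M" for m
  proof (cases "m \<in> S")
    case True
    thus ?thesis using ev_bas[OF m, of 1] s_one[OF m] by (intro exI[of _ "bas m"]) simp
  next
    case False
    \<comment> \<open>Adjoining \<open>m\<close> creates a dependency by maximality; it must involve
      \<open>m\<close> and can be solved for it.\<close>
    hence "\<not> indep (insert m S)" using max[of "insert m S"] by blast
    then obtain u where u: "keys u \<subseteq> insert m S" "ev u = \<zero>\<^bsub>M\<^esub>" "u \<noteq> 0" using m Sc by (auto simp: indep_def)
    let ?a = "lk u m" and ?u' = "u - sg m (lk u m)"
    have ku': "keys ?u' \<subseteq> S"
    proof
      fix i assume "i \<in> keys ?u'"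
      hence "i \<noteq> m" "i \<in> keys u" by (auto simp: in_keys_iff lookup_minus lookup_single when_def split: if_splits)
      thus "i \<in> S" using u(1) by auto
    qed
    have a: "?a \<noteq> 0"
    proof
      assume "?a = 0"
      hence "keys u \<subseteq> S" using ku' by simp
      thus False using u S by (auto simp: indep_def)
    qed
    have "ev u = ev (sg m ?a + ?u')" by simp
    also have "\<dots> = s ?a m \<oplus>\<^bsub>M\<^esub> ev ?u'" using ku' Sc m by (subst ev_add) (auto simp: ev_bas)
    finally have 1: "s ?a m \<oplus>\<^bsub>M\<^esub> ev ?u' = \<zero>\<^bsub>M\<^esub>" using u(2) by simp
    have e': "ev ?u' \<in> carrier M" using ev_c ku' Sc by blast
    have "s (1 / ?a) (s ?a m \<oplus>\<^bsub>M\<^esub> ev ?u') = m \<oplus>\<^bsub>M\<^esub> s (1 / ?a) (ev ?u')"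
      using m e' s a s_one by (simp add: s_add' s_mult[symmetric])
    hence 2: "m \<oplus>\<^bsub>M\<^esub> s (1 / ?a) (ev ?u') = \<zero>\<^bsub>M\<^esub>" using 1 sz by simp
    have "s (- (1 / ?a)) (ev ?u') \<oplus>\<^bsub>M\<^esub> s (1 / ?a) (ev ?u') = \<zero>\<^bsub>M\<^esub>"
      using s_add[OF e', of "- (1 / ?a)" "1 / ?a"] s0[OF e'] by simp
    hence "m = s (- (1 / ?a)) (ev ?u')" using 2 m e' s by (metis M.add.right_cancel)
    also have "\<dots> = ev (scale (- (1 / ?a)) ?u')" by (rule ev_scale[OF subset_trans[OF ku' Sc], symmetric])
    finally have "m = ev (scale (- (1 / ?a)) ?u')" .
    moreover have "keys (scale (- (1 / ?a)) ?u') \<subseteq> S" by (rule subset_trans[OF keys_scale ku'])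
    ultimately show ?thesis by (intro exI[of _ "scale (- (1 / ?a)) ?u'"]) simp
  qed
  let ?U = "{u :: 'm \<Rightarrow>\<^sub>0 'k. keys u \<subseteq> S}"
  have inj: "inj_on ev ?U"
  proof (rule inj_onI)
    fix u v assume uv: "u \<in> ?U" "v \<in> ?U" "ev u = ev v"
    have "ev u = ev (v + (u - v))" by simp
    also have "\<dots> = ev v \<oplus>\<^bsub>M\<^esub> ev (u - v)" using uv Sc keys_diff[of u v] by (intro ev_add) auto
    finally have "ev v \<oplus>\<^bsub>M\<^esub> ev (u - v) = ev v" using uv by simp
    moreover have "ev v \<in> carrier M" "ev (u - v) \<in> carrier M" using uv Sc keys_diff[of u v] by (auto intro!: ev_c)
    ultimately have "ev (u - v) = \<zero>\<^bsub>M\<^esub>" by (metis M.r_neg1 M.l_neg)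
    moreover have "keys (u - v) \<subseteq> S" using uv keys_diff[of u v] by auto
    ultimately have "u - v = 0" using S unfolding indep_def by blast
    thus "u = v" by simp
  qed
  have "ev u \<in> carrier M" if "keys u \<subseteq> S" for u by (rule ev_c[OF subset_trans[OF that Sc]])
  hence "ev ` ?U = carrier M" using span by (auto simp: image_iff)
  hence bij: "bij_betw ev ?U (carrier M)" using inj by (simp add: bij_betw_def)
  define \<kappa> where "\<kappa> = inv_into ?U ev"
  have \<kappa>: "\<kappa> x \<in> ?U" "ev (\<kappa> x) = x" if "x \<in> carrier M" for x
  proof -
    have x: "x \<in> ev ` ?U" using that bij by (simp add: bij_betw_def)
    show "\<kappa> x \<in> ?U" "ev (\<kappa> x) = x" unfolding \<kappa>_def by (rule inv_into_into[OF x], rule f_inv_into_f[OF x])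
  qed
  have \<kappa>_eq: "\<kappa> (ev u) = u" if "keys u \<subseteq> S" for u
    unfolding \<kappa>_def by (rule inv_into_f_f[OF inj]) (use that in simp)
  have k\<kappa>: "keys (\<kappa> x) \<subseteq> carrier M" "keys (\<kappa> x) \<subseteq> S" if "x \<in> carrier M" for x using \<kappa>[OF that] Sc by auto
  show ?thesis
  proof (intro exI[of _ S] exI[of _ \<kappa>] conjI ballI allI Sc)
    show "bij_betw \<kappa> (carrier M) ?U" unfolding \<kappa>_def by (rule bij_betw_inv_into[OF bij])
    show "\<kappa> (x \<oplus>\<^bsub>M\<^esub> y) = \<kappa> x + \<kappa> y" if "x \<in> carrier M" "y \<in> carrier M" for x y
      using \<kappa>_eq[of "\<kappa> x + \<kappa> y"] ev_add[OF k\<kappa>(1)[OF that(1)] k\<kappa>(1)[OF that(2)]] \<kappa>(2) that k\<kappa>(2)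
        Poly_Mapping.keys_add[of "\<kappa> x" "\<kappa> y"] by fastforce
    show "\<kappa> (s c x) = scale c (\<kappa> x)" if "x \<in> carrier M" for c x
      using \<kappa>_eq[of "scale c (\<kappa> x)"] ev_scale[OF k\<kappa>(1)[OF that]] \<kappa>(2)[OF that] k\<kappa>(2)[OF that]
        keys_scale[of c "\<kappa> x"] by (metis order_trans)
    show "\<kappa> m = bas m" if "m \<in> S" for m
      using \<kappa>_eq[of "bas m"] ev_bas[of m 1] s_one[of m] that Sc by auto
  qed
qed

text \<open>The coefficient in the first factor that stands in front of the basis vector
  \<open>s\<close> of the second.\<close>

definition slice :: "('i \<times> 's \<Rightarrow>\<^sub>0 'k::field) \<Rightarrow> 's \<Rightarrow> ('i \<Rightarrow>\<^sub>0 'k)" where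
  "slice u s = lext (\<lambda>(i, s'). if s' = s then bas i else 0) u"

lemma lk_slice: "lk (slice u s) i = lk u (i, s)"
proof -
  have "lk (slice u s) i = (\<Sum>x\<in>keys u. if x = (i, s) then lk u (i, s) else 0)"
    unfolding slice_def lk_lext by (intro sum.cong refl) (auto simp: lookup_single when_def split: if_splits)
  thus ?thesis by (auto simp: in_keys_iff)
qed

lemma slice_nonzero: "slice u s \<noteq> 0 \<Longrightarrow> s \<in> snd ` keys u"
proof -
  assume "slice u s \<noteq> 0"
  then obtain i where "lk (slice u s) i \<noteq> 0" by (metis lookup_zero poly_mapping_eqI)
  hence "(i, s) \<in> keys u" by (simp add: lk_slice in_keys_iff)
  thus ?thesis by force
qed

text \<open>\<open>S\<close> is a basis of \<open>M\<close> and \<open>\<kappa>\<close> the coordinate map, so that \<open>H \<otimes> M\<close> is the free module on \<open>S\<close>.\<close>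

locale H_module = H_data p q c + M: left_module "H_algebra q [:0, p:] (monom c 2)" M
  for p q c :: "'k::field" and M :: "((gen list \<Rightarrow>\<^sub>0 'k) set, 'm, 'u) module_scheme" +
  fixes S and \<kappa> :: "'m \<Rightarrow> ('m \<Rightarrow>\<^sub>0 'k)"
  assumes Sc: "S \<subseteq> carrier M" and \<kappa>_bij: "bij_betw \<kappa> (carrier M) {u. keys u \<subseteq> S}"
    and \<kappa>_add: "x \<in> carrier M \<Longrightarrow> y \<in> carrier M \<Longrightarrow> \<kappa> (x \<oplus>\<^bsub>M\<^esub> y) = \<kappa> x + \<kappa> y"
    and \<kappa>_scale: "x \<in> carrier M \<Longrightarrow> \<kappa> ((z \<odot>\<^bsub>H\<^esub> \<one>\<^bsub>H\<^esub>) \<odot>\<^bsub>M\<^esub> x) = scale z (\<kappa> x)"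
    and \<kappa>_bas: "m \<in> S \<Longrightarrow> \<kappa> m = bas m"
begin

definition rS :: "('m \<Rightarrow>\<^sub>0 'k) \<Rightarrow> ('m \<Rightarrow>\<^sub>0 'k)" where "rS = restr (\<lambda>m. m \<in> S)"

lemma klin_rS: "klin rS" unfolding rS_def by (rule klin_restr)

lemma keys_rS: "keys (rS u) \<subseteq> S"
  by (auto simp: rS_def in_keys_iff lk_restr split: if_splits)

lemma rS_id: "keys u \<subseteq> S \<Longrightarrow> rS u = u"
  by (rule poly_mapping_eqI) (auto simp: rS_def lk_restr in_keys_iff)

definition E :: "('m \<Rightarrow>\<^sub>0 'k) \<Rightarrow> 'm" where "E u = inv_into (carrier M) \<kappa> (rS u)"

lemma E_in [simp]: "E u \<in> carrier M" and \<kappa>_E: "\<kappa> (E u) = rS u"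
proof -
  have "rS u \<in> \<kappa> ` carrier M" using \<kappa>_bij keys_rS by (auto simp: bij_betw_def)
  thus "E u \<in> carrier M" "\<kappa> (E u) = rS u" unfolding E_def by (auto intro: inv_into_into f_inv_into_f)
qed

lemma \<kappa>_inj: "x \<in> carrier M \<Longrightarrow> y \<in> carrier M \<Longrightarrow> \<kappa> x = \<kappa> y \<Longrightarrow> x = y"
  using \<kappa>_bij by (auto simp: bij_betw_def inj_on_def)

lemma keys_\<kappa>: "x \<in> carrier M \<Longrightarrow> keys (\<kappa> x) \<subseteq> S"
  using \<kappa>_bij by (auto simp: bij_betw_def)

lemma E_\<kappa>: "x \<in> carrier M \<Longrightarrow> E (\<kappa> x) = x"
  by (rule \<kappa>_inj) (auto simp: \<kappa>_E rS_id keys_\<kappa>)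

lemma E_add: "E (u + v) = E u \<oplus>\<^bsub>M\<^esub> E v"
  by (rule \<kappa>_inj) (simp_all add: \<kappa>_E \<kappa>_add klin_add[OF klin_rS])

lemma E_scale: "E (scale z u) = (z \<odot>\<^bsub>H\<^esub> \<one>\<^bsub>H\<^esub>) \<odot>\<^bsub>M\<^esub> E u"
  by (rule \<kappa>_inj) (simp_all add: \<kappa>_E \<kappa>_scale klin_scale[OF klin_rS] M.smult_closed C.scale_closed)

definition ac :: "(gen list \<Rightarrow>\<^sub>0 'k) set \<Rightarrow> ('m \<Rightarrow>\<^sub>0 'k) \<Rightarrow> ('m \<Rightarrow>\<^sub>0 'k)" where "ac h u = \<kappa> (h \<odot>\<^bsub>M\<^esub> E u)"

lemma smult_scalar: "h \<in> carrier H \<Longrightarrow> x \<in> carrier M \<Longrightarrow>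
    h \<odot>\<^bsub>M\<^esub> ((z \<odot>\<^bsub>H\<^esub> \<one>\<^bsub>H\<^esub>) \<odot>\<^bsub>M\<^esub> x) = (z \<odot>\<^bsub>H\<^esub> \<one>\<^bsub>H\<^esub>) \<odot>\<^bsub>M\<^esub> (h \<odot>\<^bsub>M\<^esub> x)"
  by (simp add: M.smult_assoc[symmetric] C.scale_closed C.scale_swap)

lemma smult_scalar': "h \<in> carrier H \<Longrightarrow> x \<in> carrier M \<Longrightarrow>
    (z \<odot>\<^bsub>H\<^esub> h) \<odot>\<^bsub>M\<^esub> x = (z \<odot>\<^bsub>H\<^esub> \<one>\<^bsub>H\<^esub>) \<odot>\<^bsub>M\<^esub> (h \<odot>\<^bsub>M\<^esub> x)"
  by (simp add: M.smult_assoc[symmetric] C.scale_closed C.scale_swap)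

lemma klin_ac: "h \<in> carrier H \<Longrightarrow> klin (ac h)"
  by (rule klinI) (simp_all add: ac_def E_add E_scale M.smult_r_distr M.smult_closed smult_scalar \<kappa>_add \<kappa>_scale C.scale_closed)

lemma ac_mult: "h \<in> carrier H \<Longrightarrow> h' \<in> carrier H \<Longrightarrow> ac (h \<otimes>\<^bsub>H\<^esub> h') u = ac h (ac h' u)"
  by (simp add: ac_def E_\<kappa> M.smult_closed M.smult_assoc)

lemma ac_add: "h \<in> carrier H \<Longrightarrow> h' \<in> carrier H \<Longrightarrow> ac (h \<oplus>\<^bsub>H\<^esub> h') u = ac h u + ac h' u"
  by (simp add: ac_def M.smult_closed M.smult_l_distr \<kappa>_add)

lemma ac_scale: "h \<in> carrier H \<Longrightarrow> ac (z \<odot>\<^bsub>H\<^esub> h) u = scale z (ac h u)"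
  unfolding ac_def by (subst smult_scalar') (simp_all add: M.smult_closed \<kappa>_scale)

lemma ac_one: "ac \<one>\<^bsub>H\<^esub> u = rS u"
  by (simp add: ac_def M.smult_one \<kappa>_E)

lemma rS_ac: "h \<in> carrier H \<Longrightarrow> rS (ac h u) = ac h u" "h \<in> carrier H \<Longrightarrow> ac h (rS u) = ac h u"
proof -
  assume h: "h \<in> carrier H"
  show "rS (ac h u) = ac h u" unfolding ac_def by (rule rS_id[OF keys_\<kappa>]) (simp add: M.smult_closed h)
  have "E (rS u) = E u" by (rule \<kappa>_inj) (simp_all add: \<kappa>_E rS_id[OF keys_rS])
  thus "ac h (rS u) = ac h u" by (simp add: ac_def)
qed

lemma ac_rel: "ac tt (ac xx u) = scale p (ac xx (ac tt u))" "ac yy (ac tt u) = scale p (ac tt (ac yy u))"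
  "ac yy (ac xx u) = scale q (ac xx (ac yy u)) + scale c (ac tt (ac tt u))"
  by (simp_all add: ac_mult[symmetric] H_rel ac_add ac_scale C.scale_closed C.m_closed)

sublocale K: koszul_ops p q c "op1 (C.Rm xx)" "op1 (C.Rm yy)" "op1 (C.Rm tt)"
    "op2 (ac xx)" "op2 (ac yy)" "op2 (ac tt)" W0 W1 W2
  by (rule right_ops) (simp_all add: klin_ac ac_rel)

text \<open>Exactness is proved on the enlarged space. As the projection \<open>pS\<close> commutes
  with the differentials, it passes to H \<otimes> M.\<close>

definition pS :: "((nat \<times> nat \<times> nat) \<times> 'm \<Rightarrow>\<^sub>0 'k) \<Rightarrow> ((nat \<times> nat \<times> nat) \<times> 'm \<Rightarrow>\<^sub>0 'k)" where "pS = op2 rS"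

lemma klin_pS: "klin pS" unfolding pS_def by (rule klin_op2)

lemma lk_pS: "lk (pS u) (i, m) = (if m \<in> S then lk u (i, m) else 0)"
proof -
  have "pS u = restr (\<lambda>(i, m). m \<in> S) u"
  proof (rule klin_eqI[OF klin_pS klin_restr])
    fix i :: "(nat \<times> nat \<times> nat) \<times> 'm"
    obtain j m where i: "i = (j, m)" by (cases i) blast
    have "rS (bas m :: _ \<Rightarrow>\<^sub>0 'k) = (if m \<in> S then bas m else 0)"
      by (rule poly_mapping_eqI) (simp add: rS_def lk_restr lookup_single when_def)
    moreover have "restr (\<lambda>(i, m). m \<in> S) (bas (j, m) :: _ \<Rightarrow>\<^sub>0 'k) = (if m \<in> S then bas (j, m) else 0)"
      by (rule poly_mapping_eqI) (auto simp: lk_restr lookup_single when_def)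
    ultimately show "pS (bas i) = restr (\<lambda>(i, m). m \<in> S) (bas i)"
      by (simp add: i pS_def klin_zero[OF klin_tens2])
  qed
  thus ?thesis by (simp add: lk_restr)
qed

lemma pS_ops: "h \<in> carrier H \<Longrightarrow> pS (op1 (C.Rm h) u) = op1 (C.Rm h) (pS u)"
  "h \<in> carrier H \<Longrightarrow> pS (op1 (C.Lm h) u) = op1 (C.Lm h) (pS u)"
  "h \<in> carrier H \<Longrightarrow> pS (op2 (ac h) u) = op2 (ac h) (pS u)"
  by (simp_all add: pS_def op1_op2_commute klin_rS C.klin_Rm C.klin_Lm op2_op2 klin_ac rS_ac)

lemma pS_K: "pS (K.d1 a b e) = K.d1 (pS a) (pS b) (pS e)" "pS (K.d2x a b) = K.d2x (pS a) (pS b)"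
  "pS (K.d2y a b) = K.d2y (pS a) (pS b)" "pS (K.d2t a b e) = K.d2t (pS a) (pS b) (pS e)"
  "pS (K.d3u a) = K.d3u (pS a)" "pS (K.d3v a) = K.d3v (pS a)" "pS (K.d3w a) = K.d3w (pS a)"
  by (simp_all add: K.d1_def K.d2x_def K.d2y_def K.d2t_def K.d3u_def K.d3v_def K.d3w_def
      klin_simps[OF klin_pS] pS_ops)

text \<open>Left multiplication on the first factor is the module structure of the resolution. It
  commutes with right multiplications and with the second factor, so the differentials are
  linear.\<close>

lemma L_ops: "h \<in> carrier H \<Longrightarrow> h' \<in> carrier H \<Longrightarrow> op1 (C.Lm h) (op1 (C.Rm h') u) = op1 (C.Rm h') (op1 (C.Lm h) u)"
  "h \<in> carrier H \<Longrightarrow> h' \<in> carrier H \<Longrightarrow> op1 (C.Lm h) (op2 (ac h') u) = op2 (ac h') (op1 (C.Lm h) u)"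
  by (simp_all add: op1_op1 C.klin_Rm C.klin_Lm C.Lm_Rm op1_op2_commute klin_ac)

lemma L_K:
  assumes "h \<in> carrier H"
  shows "op1 (C.Lm h) (K.d1 a b e) = K.d1 (op1 (C.Lm h) a) (op1 (C.Lm h) b) (op1 (C.Lm h) e)"
  "op1 (C.Lm h) (K.d2x a b) = K.d2x (op1 (C.Lm h) a) (op1 (C.Lm h) b)"
  "op1 (C.Lm h) (K.d2y a b) = K.d2y (op1 (C.Lm h) a) (op1 (C.Lm h) b)"
  "op1 (C.Lm h) (K.d2t a b e) = K.d2t (op1 (C.Lm h) a) (op1 (C.Lm h) b) (op1 (C.Lm h) e)"
  "op1 (C.Lm h) (K.d3u a) = K.d3u (op1 (C.Lm h) a)" "op1 (C.Lm h) (K.d3v a) = K.d3v (op1 (C.Lm h) a)"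
  "op1 (C.Lm h) (K.d3w a) = K.d3w (op1 (C.Lm h) a)"
  by (simp_all add: K.d1_def K.d2x_def K.d2y_def K.d2t_def K.d3u_def K.d3v_def K.d3w_def
      klin_simps[OF klin_op1] L_ops assms)

definition Dt :: "nat \<Rightarrow> (nat \<Rightarrow> ((nat \<times> nat \<times> nat) \<times> 'm \<Rightarrow>\<^sub>0 'k)) \<Rightarrow> nat \<Rightarrow> ((nat \<times> nat \<times> nat) \<times> 'm \<Rightarrow>\<^sub>0 'k)" where
  "Dt i z k = (if i = 0 then K.d1 (z 0) (z 1) (z 2)
    else if i = 1 then (if k = 0 then K.d2x (z 0) (z 2) else if k = 1 then K.d2y (z 1) (z 2) else K.d2t (z 0) (z 1) (z 2))
    else if i = 2 then (if k = 0 then K.d3u (z 0) else if k = 1 then K.d3v (z 0) else K.d3w (z 0)) else 0)"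

lemma pS_Dt: "pS (Dt i z k) = Dt i (\<lambda>k. pS (z k)) k"
  by (simp add: Dt_def pS_K klin_zero[OF klin_pS])

lemma L_Dt: "h \<in> carrier H \<Longrightarrow> op1 (C.Lm h) (Dt i z k) = Dt i (\<lambda>k. op1 (C.Lm h) (z k)) k"
  by (simp add: Dt_def L_K klin_zero[OF klin_op1])

lemma Dt_add: "Dt i (\<lambda>k. z k + z' k) k = Dt i z k + Dt i z' k"
  by (simp add: Dt_def K.d1_def K.d2x_def K.d2y_def K.d2t_def K.d3u_def K.d3v_def K.d3w_def K.opl
      sc.scale_right_distrib sc.scale_right_diff_distrib algebra_simps)

lemma Dt_Dt: assumes "k < kn i" shows "Dt i (Dt (Suc i) z) k = 0"
proof -
  consider "i = 0" | "i = 1" | "i = 2" | j where "i = Suc (Suc (Suc j))"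
    by (metis One_nat_def Suc_1 not0_implies_Suc)
  thus ?thesis
  proof cases
    case 1
    thus ?thesis by (simp add: Dt_def K.d1_d2)
  next
    case 2
    thus ?thesis by (simp add: Dt_def K.d2_d3)
  next
    case 3
    thus ?thesis by (simp add: Dt_def K.d3u_def K.d3v_def K.d3w_def K.opl)
  qed (simp add: Dt_def)
qed

lemma Dt_exact:
  assumes "\<And>k. k < kn i \<Longrightarrow> Dt i z k = 0"
  shows "\<exists>z'. \<forall>k<kn (Suc i). z k = Dt (Suc i) z' k"
proof -
  consider "i = 0" | "i = 1" | "i = 2" | j where "i = Suc (Suc (Suc j))"
    by (metis One_nat_def Suc_1 not0_implies_Suc)
  thus ?thesis
  proof cases
    case 1
    hence "K.d1 (z 0) (z 1) (z 2) = 0" using assms[of 0] by (simp add: Dt_def)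
    then obtain u v w where "z 0 = K.d2x u w" "z 1 = K.d2y v w" "z 2 = K.d2t u v w" using K.exact1 by blast
    thus ?thesis by (intro exI[of _ "\<lambda>k. if k = 0 then u else if k = 1 then v else w"])
        (simp add: 1 all_less_3 Dt_def)
  next
    case 2
    hence "K.d2x (z 0) (z 2) = 0" "K.d2y (z 1) (z 2) = 0" using assms[of 0] assms[of 1] by (simp_all add: Dt_def)
    then obtain u where "z 0 = K.d3u u" "z 1 = K.d3v u" "z 2 = K.d3w u" using K.exact2 by blast
    thus ?thesis by (intro exI[of _ "\<lambda>k. u"]) (simp add: 2 numeral_2_eq_2[symmetric] all_less_3 Dt_def)
  next
    case 3
    hence "K.d3w (z 0) = 0" using assms[of 2] by (simp add: Dt_def)
    hence "z 0 = 0" by (rule K.exact3)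
    thus ?thesis by (intro exI[of _ "\<lambda>k. 0"]) (simp add: 3 numeral_2_eq_2 Dt_def)
  next
    case 4
    thus ?thesis by (simp add: Dt_def)
  qed
qed

end

section \<open>A free resolution of an arbitrary module\<close>

context H_module
begin

text \<open>A pair of a component and a basis element encoded in the list type of
  \<open>res\<close>: the length determines \<open>k\<close>, the head is \<open>m\<close>. The
  successor keeps the list nonempty for \<open>k = 0\<close>.\<close>

definition idx :: "nat \<Rightarrow> 'm \<Rightarrow> ('m + (gen list \<Rightarrow>\<^sub>0 'k) set) list" where
  "idx k m = replicate (Suc k) (Inl m)"

lemma idx_simps [simp]: "length (idx k m) = Suc k" "hd (idx k m) = Inl m" "idx k m = idx k' m' \<longleftrightarrow> k = k' \<and> m = m'"
proof -
  show 1: "length (idx k m) = Suc k" "hd (idx k m) = Inl m" for k m by (simp_all add: idx_def)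
  show "idx k m = idx k' m' \<longleftrightarrow> k = k' \<and> m = m'"
    using 1[of k m] 1[of k' m'] by (metis Suc_inject sum.inject(1))
qed

definition basis :: "nat \<Rightarrow> ('m + (gen list \<Rightarrow>\<^sub>0 'k) set) list set" where
  "basis n = (\<lambda>(k, m). idx k m) ` ({..<n} \<times> S)"

lemma idx_basis [simp]: "idx k m \<in> basis n \<longleftrightarrow> k < n \<and> m \<in> S"
  by (auto simp: basis_def)

abbreviation "F n \<equiv> free_module H (basis n)"

lemma F_module: "left_module H (F n)" by (rule C.free_left_module)

text \<open>The \<open>k\<close>-th component of an element of the free module as a coordinate
  vector of H \<otimes> M; \<open>build\<close> is the way back, up to \<open>pS\<close>.\<close>

definition co :: "nat \<Rightarrow> (('m + (gen list \<Rightarrow>\<^sub>0 'k) set) list \<Rightarrow> (gen list \<Rightarrow>\<^sub>0 'k) set) \<Rightarrow> ((nat \<times> nat \<times> nat) \<times> 'm \<Rightarrow>\<^sub>0 'k)" where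
  "co k u = (\<Sum>m | u (idx k m) \<noteq> \<zero>\<^bsub>H\<^esub>. tens (\<psi> (u (idx k m))) (bas m))"

lemma F_carrier: "u \<in> carrier (F n) \<Longrightarrow> u l \<in> carrier H"
  by (rule C.free_in_carrier)

lemma F_finite: assumes "u \<in> carrier (F n)" shows "finite {m. u (idx k m) \<noteq> \<zero>\<^bsub>H\<^esub>}"
proof -
  have "finite ((\<lambda>m. idx k m) ` {m. u (idx k m) \<noteq> \<zero>\<^bsub>H\<^esub>})"
    by (rule finite_subset[of _ "{l. u l \<noteq> \<zero>\<^bsub>H\<^esub>}"]) (use assms in auto)
  thus ?thesis by (rule finite_imageD) (simp add: inj_on_def)
qed

lemma co_superset:
  assumes "finite A" "{m. u (idx k m) \<noteq> \<zero>\<^bsub>H\<^esub>} \<subseteq> A"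
  shows "co k u = (\<Sum>m\<in>A. tens (\<psi> (u (idx k m))) (bas m))"
  unfolding co_def by (rule sum.mono_neutral_left[OF assms]) (auto simp: tens_simps)

lemma lk_co: assumes "u \<in> carrier (F n)" shows "lk (co k u) (i, m) = lk (\<psi> (u (idx k m))) i"
proof -
  let ?A = "{m. u (idx k m) \<noteq> \<zero>\<^bsub>H\<^esub>}"
  have "lk (co k u) (i, m) = (\<Sum>m'\<in>?A. if m' = m then lk (\<psi> (u (idx k m))) i else 0)"
    unfolding co_def lk_sum by (intro sum.cong refl) (simp add: lk_tens lookup_single when_def)
  also have "\<dots> = lk (\<psi> (u (idx k m))) i" using F_finite[OF assms, of k] by auto
  finally show ?thesis .
qed

lemma co_eqI:
  assumes u: "u \<in> carrier (F n)" and v: "v \<in> carrier (F n)" and eq: "\<And>k. k < n \<Longrightarrow> co k u = co k v"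
  shows "u = v"
proof (rule free_module_eqI[OF u v])
  fix l assume "l \<in> basis n"
  then obtain k m where l: "l = idx k m" "k < n" by (auto simp: basis_def)
  have "lk (\<psi> (u l)) i = lk (\<psi> (v l)) i" for i
    using arg_cong[OF eq[OF l(2)], of "\<lambda>w. lk w (i, m)"] by (simp add: lk_co[OF u] lk_co[OF v] l(1))
  hence "\<psi> (u l) = \<psi> (v l)" by (rule poly_mapping_eqI)
  thus "u l = v l" using F_carrier[OF u] F_carrier[OF v] C.\<theta>_inj by blast
qed

lemma co_zero: "co k \<zero>\<^bsub>F n\<^esub> = 0"
  by (simp add: co_def)

lemma co_add:
  assumes u: "u \<in> carrier (F n)" and v: "v \<in> carrier (F n)"
  shows "co k (u \<oplus>\<^bsub>F n\<^esub> v) = co k u + co k v"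
proof -
  interpret Fn: left_module H "F n" by (rule F_module)
  have uv: "u \<oplus>\<^bsub>F n\<^esub> v \<in> carrier (F n)" using u v by (rule Fn.M.a_closed)
  show ?thesis
  proof (rule poly_mapping_eqI)
    fix x :: "(nat \<times> nat \<times> nat) \<times> 'm"
    obtain i m where x: "x = (i, m)" by (cases x) blast
    show "lk (co k (u \<oplus>\<^bsub>F n\<^esub> v)) x = lk (co k u + co k v) x"
      unfolding x lookup_add lk_co[OF u] lk_co[OF v] lk_co[OF uv]
      using F_carrier[OF u] F_carrier[OF v] by (simp add: C.\<theta>_add lookup_add)
  qed
qed

lemma co_smult:
  assumes a: "a \<in> carrier H" and u: "u \<in> carrier (F n)"
  shows "co k (a \<odot>\<^bsub>F n\<^esub> u) = op1 (C.Lm a) (co k u)"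
proof -
  let ?A = "{m. u (idx k m) \<noteq> \<zero>\<^bsub>H\<^esub>}"
  have "{m. (a \<odot>\<^bsub>F n\<^esub> u) (idx k m) \<noteq> \<zero>\<^bsub>H\<^esub>} \<subseteq> ?A" using C.r_null[OF a] by (auto simp only: free_simps)
  hence "co k (a \<odot>\<^bsub>F n\<^esub> u) = (\<Sum>m\<in>?A. tens (\<psi> ((a \<odot>\<^bsub>F n\<^esub> u) (idx k m))) (bas m))"
    by (rule co_superset[OF F_finite[OF u]])
  also have "\<dots> = (\<Sum>m\<in>?A. op1 (C.Lm a) (tens (\<psi> (u (idx k m))) (bas m)))"
    by (intro sum.cong refl) (simp only: free_simps op1_tens[OF C.klin_Lm[OF a]] C.\<theta>_mult_L[OF F_carrier[OF u]])
  also have "\<dots> = op1 (C.Lm a) (co k u)" by (simp add: co_def op_simps)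
  finally show ?thesis .
qed

lemma pS_co: assumes u: "u \<in> carrier (F n)" shows "pS (co k u) = co k u"
proof (rule poly_mapping_eqI)
  fix x :: "(nat \<times> nat \<times> nat) \<times> 'm"
  obtain i m where x: "x = (i, m)" by (cases x) blast
  have "m \<notin> S \<Longrightarrow> u (idx k m) = \<zero>\<^bsub>H\<^esub>" using u by simp
  thus "lk (pS (co k u)) x = lk (co k u) x" by (auto simp: x lk_pS lk_co[OF u])
qed

definition build :: "nat \<Rightarrow> (nat \<Rightarrow> ((nat \<times> nat \<times> nat) \<times> 'm \<Rightarrow>\<^sub>0 'k)) \<Rightarrow>
    ('m + (gen list \<Rightarrow>\<^sub>0 'k) set) list \<Rightarrow> (gen list \<Rightarrow>\<^sub>0 'k) set" where
  "build n z l = (if l \<in> basis n then C.\<phi> (slice (z (length l - 1)) (projl (hd l))) else \<zero>\<^bsub>H\<^esub>)"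

lemma build_in: "build n z \<in> carrier (F n)"
proof -
  have "{l. build n z l \<noteq> \<zero>\<^bsub>H\<^esub>} \<subseteq> (\<Union>k<n. idx k ` snd ` keys (z k))"
  proof
    fix l assume "l \<in> {l. build n z l \<noteq> \<zero>\<^bsub>H\<^esub>}"
    hence l: "build n z l \<noteq> \<zero>\<^bsub>H\<^esub>" by simp
    hence "l \<in> basis n" by (auto simp: build_def split: if_splits)
    then obtain k m where km: "l = idx k m" "k < n" "m \<in> S" by (auto simp: basis_def)
    have "slice (z k) m \<noteq> 0" using l km by (auto simp: build_def)
    hence "m \<in> snd ` keys (z k)" by (rule slice_nonzero)
    thus "l \<in> (\<Union>k<n. idx k ` snd ` keys (z k))" using km by blast
  qed
  hence "finite {l. build n z l \<noteq> \<zero>\<^bsub>H\<^esub>}" by (rule finite_subset) simp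
  thus ?thesis by (simp add: build_def)
qed

lemma co_build: assumes "k < n" shows "co k (build n z) = pS (z k)"
proof (rule poly_mapping_eqI)
  fix x :: "(nat \<times> nat \<times> nat) \<times> 'm"
  obtain i m where x: "x = (i, m)" by (cases x) blast
  show "lk (co k (build n z)) x = lk (pS (z k)) x"
    using assms by (simp add: x lk_co[OF build_in] lk_pS build_def lk_slice C.\<theta>_zero)
qed

definition df :: "nat \<Rightarrow> (('m + (gen list \<Rightarrow>\<^sub>0 'k) set) list \<Rightarrow> (gen list \<Rightarrow>\<^sub>0 'k) set) \<Rightarrow>
    ('m + (gen list \<Rightarrow>\<^sub>0 'k) set) list \<Rightarrow> (gen list \<Rightarrow>\<^sub>0 'k) set" where
  "df i u = build (kn i) (Dt i (\<lambda>k. co k u))"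

lemma co_df: "u \<in> carrier (F n) \<Longrightarrow> k < kn i \<Longrightarrow> co k (df i u) = Dt i (\<lambda>k. co k u) k"
  by (simp add: df_def co_build pS_Dt pS_co del: free_simps)

lemma df_linmap: "linmap H (F (kn (Suc i))) (F (kn i)) (df i)"
proof -
  interpret F1: left_module H "F (kn (Suc i))" by (rule F_module)
  interpret F0: left_module H "F (kn i)" by (rule F_module)
  have df_in: "df i u \<in> carrier (F (kn i))" for u unfolding df_def by (rule build_in)
  show ?thesis unfolding linmap_def
  proof (intro conjI ballI df_in)
    fix u v assume uv: "u \<in> carrier (F (kn (Suc i)))" "v \<in> carrier (F (kn (Suc i)))"
    note s = F1.M.a_closed[OF uv]
    show "df i (u \<oplus>\<^bsub>F (kn (Suc i))\<^esub> v) = df i u \<oplus>\<^bsub>F (kn i)\<^esub> df i v"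
      by (rule co_eqI[OF df_in F0.M.a_closed[OF df_in df_in]])
        (simp only: co_df[OF s] co_add[OF df_in df_in] co_df[OF uv(1)] co_df[OF uv(2)] co_add[OF uv] Dt_add)
  next
    fix a u assume a: "a \<in> carrier H" and u: "u \<in> carrier (F (kn (Suc i)))"
    note s = F1.smult_closed[OF a u]
    show "df i (a \<odot>\<^bsub>F (kn (Suc i))\<^esub> u) = a \<odot>\<^bsub>F (kn i)\<^esub> df i u"
      by (rule co_eqI[OF df_in F0.smult_closed[OF a df_in]])
        (simp only: co_df[OF s] co_smult[OF a df_in] co_df[OF u] co_smult[OF a u] L_Dt[OF a])
  qed
qed

lemma Dt_cong: assumes "\<And>k. k < kn (Suc i) \<Longrightarrow> z k = z' k" shows "Dt i z k = Dt i z' k"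
proof -
  consider "i = 0" | "i = 1" | "i = 2" | j where "i = Suc (Suc (Suc j))"
    by (metis One_nat_def Suc_1 not0_implies_Suc)
  thus ?thesis
    by cases (use assms[of 0] assms[of 1] assms[of 2] in \<open>simp_all add: Dt_def numeral_2_eq_2\<close>)
qed

lemma co_df_build: "k < kn i \<Longrightarrow> co k (df i (build (kn (Suc i)) z)) = pS (Dt i z k)"
  unfolding co_df[OF build_in] pS_Dt by (rule Dt_cong) (simp add: co_build)

text \<open>The action map H \<otimes> M \<rightarrow> M in coordinates.\<close>

definition eh :: "((nat \<times> nat \<times> nat) \<times> 'm \<Rightarrow>\<^sub>0 'k) \<Rightarrow> ('m \<Rightarrow>\<^sub>0 'k)" where
  "eh = lext (\<lambda>(i, m). ac (C.\<phi> (bas i)) (bas m))"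

lemma klin_eh: "klin eh" unfolding eh_def by (rule klin_lext)

lemma eh_tens: "eh (tens u v) = ac (C.\<phi> u) v"
proof (rule klin_eqI[of "\<lambda>v. eh (tens u v)" "ac (C.\<phi> u)"])
  fix m
  show "eh (tens u (bas m)) = ac (C.\<phi> u) (bas m)"
  proof (rule klin_eqI[of "\<lambda>u. eh (tens u (bas m))" "\<lambda>u. ac (C.\<phi> u) (bas m)"])
    show "klin (\<lambda>u. ac (C.\<phi> u) (bas m))"
      by (rule klinI) (simp_all add: C.\<phi>_add C.\<phi>_scale ac_add ac_scale)
    show "klin (\<lambda>u. eh (tens u (bas m)))" by (rule klin_compose[OF klin_eh klin_tens1])
  qed (simp add: eh_def)
qed (auto intro: klin_compose[OF klin_eh klin_tens2] klin_ac)

lemma \<phi>_Lm: "a \<in> carrier H \<Longrightarrow> C.\<phi> (C.Lm a u) = a \<otimes>\<^bsub>H\<^esub> C.\<phi> u"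
  and \<phi>_Rm: "a \<in> carrier H \<Longrightarrow> C.\<phi> (C.Rm a u) = C.\<phi> u \<otimes>\<^bsub>H\<^esub> a"
  by (simp_all add: C.Lm_def C.Rm_def C.\<phi>_\<theta> C.m_closed)

lemma eh_L: assumes a: "a \<in> carrier H" shows "eh (op1 (C.Lm a) u) = ac a (eh u)"
  by (rule tens_eqI[of "\<lambda>u. eh (op1 (C.Lm a) u)" "\<lambda>u. ac a (eh u)"])
    (auto intro: klin_compose[OF klin_eh klin_op1] klin_compose[OF klin_ac[OF a] klin_eh]
      simp: op1_tens[OF C.klin_Lm[OF a]] eh_tens \<phi>_Lm[OF a] ac_mult[OF a] simp del: tens_sg)

text \<open>Both sides come from (ha)m = h(am); hence the action map kills the image of
  \<open>d1\<close>.\<close>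

lemma eh_RL: assumes a: "a \<in> carrier H" shows "eh (op1 (C.Rm a) u) = eh (op2 (ac a) u)"
  by (rule tens_eqI[of "\<lambda>u. eh (op1 (C.Rm a) u)" "\<lambda>u. eh (op2 (ac a) u)"])
    (auto intro: klin_compose[OF klin_eh klin_op1] klin_compose[OF klin_eh klin_op2]
      simp: op1_tens[OF C.klin_Rm[OF a]] op2_tens[OF klin_ac[OF a]] eh_tens \<phi>_Rm[OF a] ac_mult a simp del: tens_sg)

lemma eh_d1: "eh (K.d1 a b e) = 0"
  by (simp add: K.d1_def klin_simps[OF klin_eh] eh_RL)

lemma rS_eh: "rS (eh u) = eh u"
  by (rule tens_eqI[of "\<lambda>u. rS (eh u)" eh])
    (auto intro: klin_compose[OF klin_rS klin_eh] klin_eh simp: eh_tens rS_ac simp del: tens_sg)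

text \<open>Modulo the image of \<open>d1\<close> every vector has the form 1 \<otimes> w, and the
  action map sends this to the projection of w.\<close>

lemma eh_exact:
  assumes "eh u = 0" shows "\<exists>a b e. pS u = pS (K.d1 a b e)"
proof -
  obtain m a b e where m: "m \<in> W2" "u = m + K.d1 a b e" using K.exact0_span by blast
  obtain w where w: "m = tens (bas (0, 0, 0)) w" using W2_first[OF m(1)] by blast
  have "rS w = 0" using assms by (simp add: m(2) w klin_simps[OF klin_eh] eh_d1 eh_tens \<phi>_one ac_one)
  hence "pS m = 0" by (simp add: w pS_def op2_tens[OF klin_rS] tens_simps)
  hence "pS u = pS (K.d1 a b e)" by (simp add: m(2) klin_simps[OF klin_pS])
  thus ?thesis by blast
qed

definition eM :: "(('m + (gen list \<Rightarrow>\<^sub>0 'k) set) list \<Rightarrow> (gen list \<Rightarrow>\<^sub>0 'k) set) \<Rightarrow> 'm" where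
  "eM u = E (eh (co 0 u))"

lemma E_ac: "a \<in> carrier H \<Longrightarrow> E (ac a u) = a \<odot>\<^bsub>M\<^esub> E u"
  by (simp add: ac_def E_\<kappa> M.smult_closed)

lemma eM_linmap: "linmap H (F n) M eM"
  unfolding linmap_def eM_def
  by (intro conjI ballI E_in) (simp_all only: co_add co_smult klin_add[OF klin_eh] E_add eh_L E_ac)

lemma eM_zero_iff: "eM u = \<zero>\<^bsub>M\<^esub> \<longleftrightarrow> eh (co 0 u) = 0"
proof -
  have \<kappa>0: "\<kappa> \<zero>\<^bsub>M\<^esub> = 0" using \<kappa>_add[of "\<zero>\<^bsub>M\<^esub>" "\<zero>\<^bsub>M\<^esub>"] by simp
  have "eM u = \<zero>\<^bsub>M\<^esub> \<longleftrightarrow> \<kappa> (eM u) = 0" using \<kappa>_inj[of "eM u" "\<zero>\<^bsub>M\<^esub>"] by (auto simp: eM_def \<kappa>0)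
  thus ?thesis by (simp add: eM_def \<kappa>_E rS_eh)
qed

lemma free_resolution:
  "\<exists>P :: nat \<Rightarrow> ((gen list \<Rightarrow>\<^sub>0 'k) set, ((gen list \<Rightarrow>\<^sub>0 'k) set, 'm) res) module. \<exists>d e.
    projective_resolution H M P d e \<and> length_at_most P 3"
proof -
  define P where "P i = F (kn i)" for i
  define d where "d i = restrict (df i) (carrier (P (Suc i)))" for i
  define e where "e = restrict eM (carrier (P 0))"
  have df_in: "df i u \<in> carrier (P i)" for i u unfolding df_def P_def by (rule build_in)
  have z_in: "\<zero>\<^bsub>P i\<^esub> \<in> carrier (P i)" for i unfolding P_def by simp
  have zero_iff: "u = \<zero>\<^bsub>P i\<^esub> \<longleftrightarrow> (\<forall>k<kn i. co k u = 0)" if "u \<in> carrier (P i)" for u i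
    using co_eqI[OF that[unfolded P_def] z_in[unfolded P_def]] by (auto simp only: P_def co_zero)
  have "projective_resolution H M P d e" unfolding projective_resolution_def
  proof (intro conjI allI)
    show "left_module H M" by (rule M.left_module_axioms)
    show "projective H (P i)" for i unfolding P_def by (rule C.projective_free[OF H_one_neq])
    show "d i \<in> lin_maps H (P (Suc i)) (P i)" for i
      unfolding d_def P_def by (rule linmap_restrict[OF F_module df_linmap])
    show "e \<in> lin_maps H (P 0) M"
      unfolding e_def P_def by (rule linmap_restrict[OF F_module eM_linmap])
    show "e ` carrier (P 0) = carrier M"
    proof (intro subset_antisym subsetI)
      fix x assume x: "x \<in> carrier M"
      \<comment> \<open>The preimage of \<open>x\<close> is 1 \<otimes> x.\<close>
      let ?u = "build 1 (\<lambda>_. tens (bas (0, 0, 0)) (\<kappa> x))"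
      have u: "?u \<in> carrier (P 0)" unfolding P_def kn_simps by (rule build_in)
      have "co 0 ?u = tens (bas (0, 0, 0)) (\<kappa> x)"
        by (simp add: co_build pS_def op2_tens[OF klin_rS] rS_id[OF keys_\<kappa>[OF x]])
      hence "eM ?u = x"
        by (simp add: eM_def eh_tens \<phi>_one ac_one rS_id[OF keys_\<kappa>[OF x]] E_\<kappa>[OF x])
      thus "x \<in> e ` carrier (P 0)" using u unfolding e_def by (intro image_eqI[of _ _ ?u]) simp_all
    qed (auto simp: e_def eM_def simp del: free_simps)
    show "{x \<in> carrier (P 0). e x = \<zero>\<^bsub>M\<^esub>} = d 0 ` carrier (P 1)"
    proof (intro subset_antisym subsetI)
      fix u assume "u \<in> {x \<in> carrier (P 0). e x = \<zero>\<^bsub>M\<^esub>}"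
      hence u: "u \<in> carrier (P 0)" and "e u = \<zero>\<^bsub>M\<^esub>" by simp_all
      hence u2: "eh (co 0 u) = 0" by (simp add: e_def eM_zero_iff)
      obtain z0 z1 z2 where z: "pS (co 0 u) = pS (K.d1 z0 z1 z2)" using eh_exact[OF u2] by blast
      let ?v = "build (kn (Suc 0)) (\<lambda>k. if k = 0 then z0 else if k = 1 then z1 else z2)"
      have v: "?v \<in> carrier (P 1)" unfolding P_def One_nat_def by (rule build_in)
      have "df 0 ?v = u"
      proof (rule co_eqI[OF df_in[of 0, unfolded P_def] u[unfolded P_def]])
        fix k assume k: "k < kn 0"
        have "co k (df 0 ?v) = pS (K.d1 z0 z1 z2)" unfolding co_df_build[OF k] by (simp add: Dt_def)
        also have "\<dots> = co k u" using z pS_co[OF u[unfolded P_def]] k by simp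
        finally show "co k (df 0 ?v) = co k u" .
      qed
      thus "u \<in> d 0 ` carrier (P 1)" using v by (intro image_eqI[of _ _ ?v]) (simp_all add: d_def)
    next
      fix u assume "u \<in> d 0 ` carrier (P 1)"
      then obtain v where v: "v \<in> carrier (P 1)" "u = df 0 v" by (auto simp: d_def)
      have "co 0 u = Dt 0 (\<lambda>k. co k v) 0" unfolding v(2) by (rule co_df[OF v(1)[unfolded P_def]]) simp
      hence "eh (co 0 u) = 0" by (simp add: Dt_def eh_d1)
      thus "u \<in> {x \<in> carrier (P 0). e x = \<zero>\<^bsub>M\<^esub>}"
        using df_in[of 0 v] by (simp add: v(2) e_def eM_zero_iff)
    qed
    show "{x \<in> carrier (P (Suc i)). d i x = \<zero>\<^bsub>P i\<^esub>} = d (Suc i) ` carrier (P (Suc (Suc i)))" for i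
    proof (intro subset_antisym subsetI)
      fix u assume "u \<in> {x \<in> carrier (P (Suc i)). d i x = \<zero>\<^bsub>P i\<^esub>}"
      hence u: "u \<in> carrier (P (Suc i))" and "d i u = \<zero>\<^bsub>P i\<^esub>" by simp_all
      hence u2: "df i u = \<zero>\<^bsub>P i\<^esub>" by (simp add: d_def)
      have "Dt i (\<lambda>k. co k u) k = 0" if "k < kn i" for k
        using u2 zero_iff[OF df_in] co_df[OF u[unfolded P_def] that] that by simp
      then obtain z where z: "\<And>k. k < kn (Suc i) \<Longrightarrow> co k u = Dt (Suc i) z k" using Dt_exact by blast
      let ?v = "build (kn (Suc (Suc i))) z"
      have v: "?v \<in> carrier (P (Suc (Suc i)))" unfolding P_def by (rule build_in)
      have "df (Suc i) ?v = u"
        by (rule co_eqI[OF df_in[of "Suc i", unfolded P_def] u[unfolded P_def]])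
          (simp only: co_df_build z[symmetric] pS_co[OF u[unfolded P_def]])
      thus "u \<in> d (Suc i) ` carrier (P (Suc (Suc i)))"
        using v by (intro image_eqI[of _ _ ?v]) (simp_all add: d_def)
    next
      fix u assume "u \<in> d (Suc i) ` carrier (P (Suc (Suc i)))"
      then obtain v where v: "v \<in> carrier (P (Suc (Suc i)))" "u = df (Suc i) v" by (auto simp: d_def)
      have u: "u \<in> carrier (P (Suc i))" unfolding v(2) by (rule df_in)
      have "co k (df i u) = 0" if k: "k < kn i" for k
      proof -
        have "co k (df i u) = Dt i (\<lambda>k. co k u) k" by (rule co_df[OF u[unfolded P_def] k])
        also have "\<dots> = Dt i (Dt (Suc i) (\<lambda>k. co k v)) k"
          unfolding v(2) by (rule Dt_cong) (rule co_df[OF v(1)[unfolded P_def]])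
        also have "\<dots> = 0" by (rule Dt_Dt[OF k])
        finally show ?thesis .
      qed
      hence "df i u = \<zero>\<^bsub>P i\<^esub>" using zero_iff[OF df_in] by simp
      thus "u \<in> {x \<in> carrier (P (Suc i)). d i x = \<zero>\<^bsub>P i\<^esub>}" using u by (simp add: d_def)
    qed
  qed
  moreover have "length_at_most P 3" unfolding length_at_most_def
  proof (intro allI impI)
    fix i :: nat assume "i > 3"
    hence "kn i = 0" by (simp add: kn_def)
    hence "u = \<zero>\<^bsub>P i\<^esub>" if "u \<in> carrier (P i)" for u using zero_iff[OF that] by simp
    thus "carrier (P i) = {\<zero>\<^bsub>P i\<^esub>}" using z_in by blast
  qed
  ultimately show ?thesis by blast
qed

end

text \<open>A module becomes a vector space through the scalar multiples of 1, and a choice of basis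
  provides the data of \<open>H_module\<close>.\<close>

lemma (in H_data) resolution_exists:
  fixes M :: "((gen list \<Rightarrow>\<^sub>0 'k) set, 'm, 'u) module_scheme"
  assumes "left_module H M"
  shows "\<exists>P :: nat \<Rightarrow> ((gen list \<Rightarrow>\<^sub>0 'k) set, ((gen list \<Rightarrow>\<^sub>0 'k) set, 'm) res) module. \<exists>d e.
    projective_resolution H M P d e \<and> length_at_most P 3"
proof -
  interpret M: left_module H M by fact
  let ?s = "\<lambda>z x. (z \<odot>\<^bsub>H\<^esub> \<one>\<^bsub>H\<^esub>) \<odot>\<^bsub>M\<^esub> x"
  have z1: "z \<odot>\<^bsub>H\<^esub> \<one>\<^bsub>H\<^esub> \<in> carrier H" for z by (simp add: C.scale_closed)
  have "\<exists>S \<kappa>. S \<subseteq> carrier M \<and> bij_betw \<kappa> (carrier M) {u :: 'm \<Rightarrow>\<^sub>0 'k. keys u \<subseteq> S} \<and>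
    (\<forall>x\<in>carrier M. \<forall>y\<in>carrier M. \<kappa> (x \<oplus>\<^bsub>M\<^esub> y) = \<kappa> x + \<kappa> y) \<and>
    (\<forall>c. \<forall>x\<in>carrier M. \<kappa> (?s c x) = scale c (\<kappa> x)) \<and> (\<forall>m\<in>S. \<kappa> m = bas m)"
  proof (rule exists_coordinates)
    show "?s (a * b) x = ?s a (?s b x)" if "x \<in> carrier M" for a b x
    proof -
      have "(a * b) \<odot>\<^bsub>H\<^esub> \<one>\<^bsub>H\<^esub> = (a \<odot>\<^bsub>H\<^esub> \<one>\<^bsub>H\<^esub>) \<otimes>\<^bsub>H\<^esub> (b \<odot>\<^bsub>H\<^esub> \<one>\<^bsub>H\<^esub>)"
        by (simp add: C.scale_mult_l[symmetric] C.scale_scale z1)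
      thus ?thesis using M.smult_assoc[OF z1 z1 that] by simp
    qed
  qed (simp_all add: M.smult_closed z1 M.smult_r_distr C.scale_l_distr M.smult_l_distr C.scale_one M.smult_one M.M.abelian_group_axioms)
  then obtain S \<kappa> where "S \<subseteq> carrier M" "bij_betw \<kappa> (carrier M) {u :: 'm \<Rightarrow>\<^sub>0 'k. keys u \<subseteq> S}"
    "\<And>x y. x \<in> carrier M \<Longrightarrow> y \<in> carrier M \<Longrightarrow> \<kappa> (x \<oplus>\<^bsub>M\<^esub> y) = \<kappa> x + \<kappa> y"
    "\<And>c x. x \<in> carrier M \<Longrightarrow> \<kappa> (?s c x) = scale c (\<kappa> x)" "\<And>m. m \<in> S \<Longrightarrow> \<kappa> m = bas m" by blast
  then interpret HM: H_module p q c M S \<kappa> by unfold_locales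
  show ?thesis by (rule HM.free_resolution)
qed

section \<open>Global dimension\<close>

text \<open>\<open>global_dim\<close> ranges over modules in a sum type whose left summand is the
  type of sets of ring elements. The elements of the trivial module are such sets, so it is moved
  there.\<close>

definition Inl_module :: "('a, 'n, 't) module_scheme \<Rightarrow> ('a, 'n + 'm) module" where
  "Inl_module N = \<lparr>carrier = Inl ` carrier N, mult = undefined, one = undefined, zero = Inl \<zero>\<^bsub>N\<^esub>,
     add = (\<lambda>x y. Inl (projl x \<oplus>\<^bsub>N\<^esub> projl y)), smult = (\<lambda>a x. Inl (a \<odot>\<^bsub>N\<^esub> projl x))\<rparr>"

lemma Inl_module_simps [simp]:
  "carrier (Inl_module N) = Inl ` carrier N" "\<zero>\<^bsub>Inl_module N\<^esub> = Inl \<zero>\<^bsub>N\<^esub>"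
  "x \<oplus>\<^bsub>Inl_module N\<^esub> y = Inl (projl x \<oplus>\<^bsub>N\<^esub> projl y)" "a \<odot>\<^bsub>Inl_module N\<^esub> x = Inl (a \<odot>\<^bsub>N\<^esub> projl x)"
  by (simp_all add: Inl_module_def)

lemma Inl_module: assumes "left_module A N" shows "left_module A (Inl_module N)"
proof -
  interpret N: left_module A N by fact
  have "abelian_group (Inl_module N)"
  proof (rule abelian_groupI)
    fix x assume "x \<in> carrier (Inl_module N)"
    then obtain y where "y \<in> carrier N" "x = Inl y" by auto
    thus "\<exists>y\<in>carrier (Inl_module N). y \<oplus>\<^bsub>Inl_module N\<^esub> x = \<zero>\<^bsub>Inl_module N\<^esub>"
      by (intro bexI[of _ "Inl (\<ominus>\<^bsub>N\<^esub> y)"]) (simp_all add: N.l_neg)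
  qed (auto simp: N.M.a_ac)
  thus ?thesis
    by (intro left_module.intro N.ring_axioms left_module_axioms.intro)
      (auto simp: N.smult_closed N.smult_l_distr N.smult_r_distr N.smult_assoc N.smult_one)
qed

lemma projective_resolution_Inl:
  assumes N: "left_module A N" and P: "projective_resolution A (Inl_module N) P d e"
  shows "projective_resolution A N P d (restrict (\<lambda>x. projl (e x)) (carrier (P 0)))"
proof -
  note PD = projective_resolutionD[OF P]
  have e: "e x \<in> Inl ` carrier N" if "x \<in> carrier (P 0)" for x using linmapD(1)[OF PD(4) that] by simp
  have lin: "linmap A (P 0) N (\<lambda>x. projl (e x))"
    unfolding linmap_def
  proof (intro conjI ballI)
    fix x assume "x \<in> carrier (P 0)"
    thus "projl (e x) \<in> carrier N" using e[of x] by auto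
  qed (simp_all add: linmapD(2,3)[OF PD(4)])
  have z: "projl (e x) = \<zero>\<^bsub>N\<^esub> \<longleftrightarrow> e x = \<zero>\<^bsub>Inl_module N\<^esub>" if "x \<in> carrier (P 0)" for x
    using e[OF that] by auto
  have "(\<lambda>x. projl (e x)) ` carrier (P 0) = projl ` (e ` carrier (P 0))" by (simp only: image_image)
  also have "\<dots> = carrier N" unfolding PD(6) by (simp add: image_image)
  finally have surj: "(\<lambda>x. projl (e x)) ` carrier (P 0) = carrier N" .
  have "{x \<in> carrier (P 0). projl (e x) = \<zero>\<^bsub>N\<^esub>} = {x \<in> carrier (P 0). e x = \<zero>\<^bsub>Inl_module N\<^esub>}"
    using z by (intro Collect_cong conj_cong refl) simp
  hence ker: "{x \<in> carrier (P 0). projl (e x) = \<zero>\<^bsub>N\<^esub>} = d 0 ` carrier (P 1)"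
    using P by (simp only: projective_resolution_def)
  have ker': "{x \<in> carrier (P 0). restrict (\<lambda>x. projl (e x)) (carrier (P 0)) x = \<zero>\<^bsub>N\<^esub>} = d 0 ` carrier (P 1)"
    unfolding ker[symmetric] by (intro Collect_cong conj_cong refl) simp
  show ?thesis using P unfolding projective_resolution_def
    by (intro conjI N linmap_restrict[OF PD(2) lin] ker') (simp_all add: surj)
qed

context H_data
begin

interpretation KH: koszul_ring_aug H \<theta>1 GH p q c xx yy tt "\<zero>\<^bsub>H\<^esub>" "\<zero>\<^bsub>H\<^esub>" "\<zero>\<^bsub>H\<^esub>" W0 W1 W2 W0 V1 W2
  HL.N "\<lambda>n. HL.\<epsilon> ` GH n" HL.\<epsilon> HR.N "\<lambda>n. HR.\<epsilon> ` GH n" HR.\<epsilon>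
  by (rule koszul_ring_H)

text \<open>A shorter resolution would make the last Koszul differential split injective
  (\<open>resolution_retraction\<close>). Its entries have degree 1, so after applying the
  retraction and the augmentation the image of 1 would be 0.\<close>

lemma resolution_length:
  assumes P: "projective_resolution H HL.N P d e" and len: "length_at_most P n"
  shows "n \<ge> 3"
proof (rule ccontr)
  assume "\<not> n \<ge> 3"
  \<comment> \<open>Any bound below 3 implies the bound 2, the index at which the retraction is
    available.\<close>
  hence len2: "length_at_most P 2" using len by (simp add: length_at_most_def)
  let ?Q = "KH.M.Q"
  have F: "projective_resolution H HL.N ?Q KH.M.d KH.M.e"
    using KH.M.resolution by (simp add: graded_projective_resolution_def)
  have "carrier (?Q (Suc (Suc 2))) = {\<zero>\<^bsub>?Q (Suc (Suc 2))\<^esub>}"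
    by (rule KH.M.P_length[unfolded length_at_most_def, rule_format]) simp
  from resolution_retraction[OF F P len2 this]
  obtain h where h: "linmap H (?Q 2) (?Q (Suc 2)) h" "\<And>x. x \<in> carrier (?Q (Suc 2)) \<Longrightarrow> h (KH.M.d 2 x) = x" by auto
  have ev: "linmap H (?Q (Suc 2)) (regular H) (\<lambda>u. u (tg 0))"
    unfolding linmap_def by (auto simp: KH.M.P_simps dest: KH.M.Pc)
  let ?G = "\<lambda>u. HL.\<epsilon> (h u (tg 0))"
  have G: "linmap H (?Q 2) HL.N ?G"
    by (rule linmap_compose[OF HL.\<epsilon>_lin linmap_compose[OF ev h(1)]])
  interpret N: left_module H HL.N by (rule HL.N_module)
  define x :: "((gen list \<Rightarrow>\<^sub>0 'k) set, (gen list \<Rightarrow>\<^sub>0 'k) set set) res" where "x = C.dl (tg 0)"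
  have x: "x \<in> KH.M.GQ (Suc 2) 3" "x (tg 0) = \<one>\<^bsub>H\<^esub>" using KH.M.dl_GP[of 0 "Suc 2"] by (simp_all add: x_def)
  hence xc: "x \<in> carrier (?Q (Suc 2))" by (simp add: KH.M.GP_def)
  have dx: "KH.M.d 2 x \<in> KH.M.GQ 2 3" using KH.M.d_degree[of 2 3] x(1) by blast
  have dc: "KH.M.d 2 x \<in> carrier (?Q 2)" by (rule linmapD(1)[OF KH.M.d_linmap xc])
  have "HL.\<epsilon> \<one>\<^bsub>H\<^esub> = ?G (KH.M.d 2 x)" by (simp add: h(2)[OF xc] x(2))
  also have "\<dots> = (\<Oplus>\<^bsub>HL.N\<^esub>k\<in>{..<kn 2}. KH.M.d 2 x (tg k) \<odot>\<^bsub>HL.N\<^esub> ?G (C.dl (tg k)))"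
    by (rule C.linmap_free_tg[OF HL.N_module G[unfolded KH.M.P_def] dc[unfolded KH.M.P_def]])
  also have "\<dots> = \<zero>\<^bsub>HL.N\<^esub>"
  proof (rule N.M.finsum_all_zero)
    fix k assume k: "k \<in> {..<kn 2}"
    let ?a = "KH.M.d 2 x (tg k)" and ?b = "h (C.dl (tg k)) (tg 0)"
    have a: "?a \<in> GH 1" using dx k unfolding KH.M.GP_def by simp
    hence ac: "?a \<in> carrier H" by (simp add: GH_iff)
    have "C.dl (tg k) \<in> carrier (?Q 2)" using KH.M.dlQ[of k 2] k by simp
    hence b: "?b \<in> carrier H" by (rule KH.M.Pc[OF linmapD(1)[OF h(1)]])
    have "?a \<odot>\<^bsub>HL.N\<^esub> ?G (C.dl (tg k)) = HL.\<epsilon> (?a \<otimes>\<^bsub>H\<^esub> ?b)" by (rule HL.\<epsilon>_smult[OF ac b])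
    also have "\<dots> = \<zero>\<^bsub>HL.N\<^esub>" using HL.\<epsilon>_zero_iff[OF C.m_closed[OF ac b]] aug_mult[OF ac b] aug_GH[OF a] by simp
    finally show "?a \<odot>\<^bsub>HL.N\<^esub> ?G (C.dl (tg k)) = \<zero>\<^bsub>HL.N\<^esub>" .
  qed
  finally show False using HL.\<epsilon>_zero_iff[of "\<one>\<^bsub>H\<^esub>"] by (simp add: aug_simps)
qed

lemma H_global_dim: "global_dim TYPE('m) H = 3"
proof (rule antisym)
  show "global_dim TYPE('m) H \<le> 3"
    unfolding global_dim_def
  proof (rule SUP_least)
    fix M :: "((gen list \<Rightarrow>\<^sub>0 'k) set, (gen list \<Rightarrow>\<^sub>0 'k) set set + 'm) module"
    assume "M \<in> {M. left_module H M}"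
    hence "left_module H M" by simp
    from resolution_exists[OF this] have "proj_dim H M \<le> enat 3"
      unfolding proj_dim_def by (intro INF_lower) simp
    thus "proj_dim H M \<le> 3" by (simp add: numeral_eq_enat)
  qed
  let ?N = "Inl_module HL.N :: (_, _ + 'm) module"
  have "enat 3 \<le> proj_dim H ?N" unfolding proj_dim_def
    using resolution_length[OF projective_resolution_Inl[OF HL.N_module]] by (intro INF_greatest) auto
  also have "\<dots> \<le> global_dim TYPE('m) H"
    unfolding global_dim_def using Inl_module[OF HL.N_module] by (intro SUP_upper) simp
  finally show "3 \<le> global_dim TYPE('m) H" by (simp add: numeral_eq_enat)
qed

lemma H_koszul: "koszul H GH"
  unfolding koszul_def trivial_eq using H_connected KH.M.resolution KH.M.P_generates_degree by blast

lemma H_AS_regular: "AS_regular TYPE('m) H GH 3"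
  unfolding AS_regular_def trivial_eq
  using H_connected H_global_dim KH.M.Ext_zero_not_3 KH.M.Ext_top by (auto simp: numeral_eq_enat)

end

section \<open>Coordinates of tensor products\<close>

lemma lext_diff_fun: "lext (\<lambda>i. f i - g i) u = lext f u - lext g u"
  by (simp add: lext_def sc.scale_right_diff_distrib sum_subtractf)

lemma monoid_algebra_mult_left: "klin (\<lambda>v. u \<otimes>\<^bsub>monoid_algebra W\<^esub> v)"
  and monoid_algebra_mult_right: "klin (\<lambda>u. u \<otimes>\<^bsub>monoid_algebra W\<^esub> v)"
  unfolding monoid_algebra_mult by (intro klin_lext_fun klin_lext, rule klin_lext)

lemma monoid_algebra_minus:
  assumes "Group.monoid W" "keys u \<subseteq> carrier W" "keys v \<subseteq> carrier W"
  shows "u \<ominus>\<^bsub>monoid_algebra W\<^esub> v = (u - v :: 'w \<Rightarrow>\<^sub>0 'k::field)"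
proof -
  interpret k_algebra "monoid_algebra W :: ('k, 'w \<Rightarrow>\<^sub>0 'k) module" by (rule monoid_algebra_k_algebra[OF assms(1)])
  have "\<ominus>\<^bsub>monoid_algebra W\<^esub> v = - v" by (rule minus_equality) (use assms in simp_all)
  thus ?thesis by (simp add: a_minus_def)
qed

locale coord_tensor = A: coord_algebra A \<alpha> + C: coord_algebra C \<gamma>
  for A :: "('k::field, 'a, 's) module_scheme" and \<alpha> :: "'a \<Rightarrow> ('i \<Rightarrow>\<^sub>0 'k)"
    and C :: "('k, 'c, 't) module_scheme" and \<gamma> :: "'c \<Rightarrow> ('j \<Rightarrow>\<^sub>0 'k)"
begin

abbreviation "MA \<equiv> monoid_algebra (A \<times>\<times> C) :: ('k, 'a \<times> 'c \<Rightarrow>\<^sub>0 'k) module"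
abbreviation "I \<equiv> tensor_ideal A C"
abbreviation "Ten \<equiv> tensor A C"

lemma AC_monoid: "Group.monoid (A \<times>\<times> C)"
  by (rule DirProd_monoid) unfold_locales

interpretation MA: k_algebra MA by (rule monoid_algebra_k_algebra[OF AC_monoid])

lemma MA_minus: "u \<in> carrier MA \<Longrightarrow> v \<in> carrier MA \<Longrightarrow> u \<ominus>\<^bsub>MA\<^esub> v = u - v"
  by (rule monoid_algebra_minus[OF AC_monoid]) simp_all

text \<open>The tensor product is presented by generators and relators; it is understood by showing
  that \<open>tensor_ideal\<close> is exactly the kernel of \<open>\<beta>\<close> on the monoid
  algebra.\<close>

definition \<beta> :: "('a \<times> 'c \<Rightarrow>\<^sub>0 'k) \<Rightarrow> ('i \<times> 'j \<Rightarrow>\<^sub>0 'k)" where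
  "\<beta> = lext (\<lambda>(a, b). tens (\<alpha> a) (\<gamma> b))"

lemma klin_\<beta>: "klin \<beta>" unfolding \<beta>_def by (rule klin_lext)

lemma \<beta>_bas [simp]: "\<beta> (sg (a, b) z) = scale z (tens (\<alpha> a) (\<gamma> b))" by (simp add: \<beta>_def)

text \<open>Multiplication by a pure tensor acts on each factor separately. This makes the kernel an
  ideal and later yields \<open>T_Lm\<close>.\<close>

lemma \<beta>_left:
  assumes a: "a \<in> carrier A" "b \<in> carrier C" and z: "z \<in> carrier MA"
  shows "\<beta> (bas (a, b) \<otimes>\<^bsub>MA\<^esub> z) = op1 (A.Lm a) (op2 (C.Lm b) (\<beta> z))"
proof (rule klin_eq_onI[of "\<lambda>z. \<beta> (bas (a, b) \<otimes>\<^bsub>MA\<^esub> z)" "\<lambda>z. op1 (A.Lm a) (op2 (C.Lm b) (\<beta> z))"])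
  show "klin (\<lambda>z. \<beta> (bas (a, b) \<otimes>\<^bsub>MA\<^esub> z))" by (rule klin_compose[OF klin_\<beta> monoid_algebra_mult_left])
  show "klin (\<lambda>z. op1 (A.Lm a) (op2 (C.Lm b) (\<beta> z)))"
    by (intro klin_compose[OF klin_op1] klin_compose[OF klin_op2] klin_\<beta>)
  fix x assume "x \<in> keys z"
  then obtain a' b' where x: "x = (a', b')" "a' \<in> carrier A" "b' \<in> carrier C" using z by (cases x) auto
  show "\<beta> (bas (a, b) \<otimes>\<^bsub>MA\<^esub> bas x) = op1 (A.Lm a) (op2 (C.Lm b) (\<beta> (bas x)))"
    using a x by (simp add: op1_tens op2_tens A.klin_Lm C.klin_Lm A.\<theta>_mult_L C.\<theta>_mult_L)
qed

lemma \<beta>_right: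
  assumes a: "a \<in> carrier A" "b \<in> carrier C" and z: "z \<in> carrier MA"
  shows "\<beta> (z \<otimes>\<^bsub>MA\<^esub> bas (a, b)) = op1 (A.Rm a) (op2 (C.Rm b) (\<beta> z))"
proof (rule klin_eq_onI[of "\<lambda>z. \<beta> (z \<otimes>\<^bsub>MA\<^esub> bas (a, b))" "\<lambda>z. op1 (A.Rm a) (op2 (C.Rm b) (\<beta> z))"])
  show "klin (\<lambda>z. \<beta> (z \<otimes>\<^bsub>MA\<^esub> bas (a, b)))" by (rule klin_compose[OF klin_\<beta> monoid_algebra_mult_right])
  show "klin (\<lambda>z. op1 (A.Rm a) (op2 (C.Rm b) (\<beta> z)))"
    by (intro klin_compose[OF klin_op1] klin_compose[OF klin_op2] klin_\<beta>)
  fix x assume "x \<in> keys z"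
  then obtain a' b' where x: "x = (a', b')" "a' \<in> carrier A" "b' \<in> carrier C" using z by (cases x) auto
  show "\<beta> (bas x \<otimes>\<^bsub>MA\<^esub> bas (a, b)) = op1 (A.Rm a) (op2 (C.Rm b) (\<beta> (bas x)))"
    using a x by (simp add: op1_tens op2_tens A.klin_Rm C.klin_Rm A.\<theta>_mult_R C.\<theta>_mult_R)
qed

definition "Ker = {z \<in> carrier MA. \<beta> z = 0}"

lemma Ker_ideal: "ideal Ker MA"
proof (rule idealI[OF MA.ring_axioms])
  have "additive_subgroup Ker MA"
  proof (rule additive_subgroupI[OF MA.abelian_group_axioms])
    show "x \<oplus>\<^bsub>MA\<^esub> y \<in> Ker" if "x \<in> Ker" "y \<in> Ker" for x y
      using that MA.a_closed[of x y] by (auto simp: Ker_def klin_simps[OF klin_\<beta>])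
    fix x assume x: "x \<in> Ker"
    have "\<ominus>\<^bsub>MA\<^esub> x = 0 \<ominus>\<^bsub>MA\<^esub> x" using x by (simp add: Ker_def a_minus_def)
    also have "\<dots> = - x" using x MA_minus[of 0 x] by (simp add: Ker_def)
    finally show "\<ominus>\<^bsub>MA\<^esub> x \<in> Ker" using x by (simp add: Ker_def klin_simps[OF klin_\<beta>])
  qed (auto simp: Ker_def klin_simps[OF klin_\<beta>])
  thus "subgroup Ker (add_monoid MA)" by (rule additive_subgroup.a_subgroup)
  fix z w assume z: "z \<in> Ker" and w: "w \<in> carrier MA"
  have zc: "z \<in> carrier MA" and \<beta>z: "\<beta> z = 0" using z by (simp_all add: Ker_def)
  have k: "fst x \<in> carrier A" "snd x \<in> carrier C" if "x \<in> keys w" for x using w that by auto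
  have "\<beta> (w \<otimes>\<^bsub>MA\<^esub> z) = 0"
  proof (rule klin_eq_onI[of "\<lambda>w. \<beta> (w \<otimes>\<^bsub>MA\<^esub> z)" "\<lambda>w. 0"])
    show "klin (\<lambda>w. \<beta> (w \<otimes>\<^bsub>MA\<^esub> z))" by (rule klin_compose[OF klin_\<beta> monoid_algebra_mult_right])
    show "\<beta> (bas x \<otimes>\<^bsub>MA\<^esub> z) = 0" if "x \<in> keys w" for x
      using \<beta>_left[OF k[OF that] zc] by (simp add: \<beta>z op_simps)
  qed (rule klin_zero_fun)
  thus "w \<otimes>\<^bsub>MA\<^esub> z \<in> Ker" using MA.m_closed[OF w zc] by (simp add: Ker_def)
  have "\<beta> (z \<otimes>\<^bsub>MA\<^esub> w) = 0"
  proof (rule klin_eq_onI[of "\<lambda>w. \<beta> (z \<otimes>\<^bsub>MA\<^esub> w)" "\<lambda>w. 0"])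
    show "klin (\<lambda>w. \<beta> (z \<otimes>\<^bsub>MA\<^esub> w))" by (rule klin_compose[OF klin_\<beta> monoid_algebra_mult_left])
    show "\<beta> (z \<otimes>\<^bsub>MA\<^esub> bas x) = 0" if "x \<in> keys w" for x
      using \<beta>_right[OF k[OF that] zc] by (simp add: \<beta>z op_simps)
  qed (rule klin_zero_fun)
  thus "z \<otimes>\<^bsub>MA\<^esub> w \<in> Ker" using MA.m_closed[OF zc w] by (simp add: Ker_def)
qed

lemma relators_carrier: "tensor_relators A C \<subseteq> carrier MA"
proof
  fix z assume z: "z \<in> tensor_relators A C"
  have d: "keys (u - v) \<subseteq> carrier A \<times> carrier C"
    if "keys u \<subseteq> carrier A \<times> carrier C" "keys v \<subseteq> carrier A \<times> carrier C" for u v :: "'a \<times> 'c \<Rightarrow>\<^sub>0 'k"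
    using that keys_diff[of u v] by (meson Un_least subset_trans)
  have b: "keys (sg (a, b) r :: 'a \<times> 'c \<Rightarrow>\<^sub>0 'k) \<subseteq> carrier A \<times> carrier C" if "a \<in> carrier A" "b \<in> carrier C" for a b r
    using that by simp
  have "keys z \<subseteq> carrier A \<times> carrier C"
    using z unfolding tensor_relators_def Let_def
    by (elim UnE CollectE exE conjE; simp only: scale_sg; intro d b; simp add: A.scale_closed C.scale_closed)
  thus "z \<in> carrier MA" by simp
qed

lemma I_ideal: "ideal I MA"
  unfolding tensor_ideal_def by (rule MA.genideal_ideal[OF relators_carrier])

sublocale Q: quotient_algebra I MA
  by (intro quotient_algebra.intro monoid_algebra_k_algebra AC_monoid I_ideal)

lemma I_Ker: "z \<in> I \<Longrightarrow> \<beta> z = 0"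
proof -
  have "tensor_relators A C \<subseteq> Ker"
  proof
    fix z assume z: "z \<in> tensor_relators A C"
    have "\<beta> z = 0" using z unfolding tensor_relators_def Let_def
      by (auto simp: klin_simps[OF klin_\<beta>] tens_simps A.\<theta>_add C.\<theta>_add A.\<theta>_scale C.\<theta>_scale simp del: scale_sg)
    thus "z \<in> Ker" using subsetD[OF relators_carrier z] by (simp add: Ker_def)
  qed
  thus "z \<in> I \<Longrightarrow> \<beta> z = 0" unfolding tensor_ideal_def
    using MA.genideal_minimal[OF Ker_ideal] by (auto simp: Ker_def)
qed

lemma relators_I:
  "a \<in> carrier A \<Longrightarrow> a' \<in> carrier A \<Longrightarrow> b \<in> carrier C \<Longrightarrow> bas (a \<oplus>\<^bsub>A\<^esub> a', b) - bas (a, b) - bas (a', b) \<in> I"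
  "a \<in> carrier A \<Longrightarrow> b \<in> carrier C \<Longrightarrow> b' \<in> carrier C \<Longrightarrow> bas (a, b \<oplus>\<^bsub>C\<^esub> b') - bas (a, b) - bas (a, b') \<in> I"
  "a \<in> carrier A \<Longrightarrow> b \<in> carrier C \<Longrightarrow> bas (z \<odot>\<^bsub>A\<^esub> a, b) - scale z (bas (a, b)) \<in> I"
  "a \<in> carrier A \<Longrightarrow> b \<in> carrier C \<Longrightarrow> bas (a, z \<odot>\<^bsub>C\<^esub> b) - scale z (bas (a, b)) \<in> I"
  unfolding tensor_ideal_def
  by (rule subsetD[OF MA.genideal_self[OF relators_carrier]]; unfold tensor_relators_def Let_def; blast)+

lemma I_zero: "0 \<in> I" and I_add: "u \<in> I \<Longrightarrow> v \<in> I \<Longrightarrow> u + v \<in> I"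
  using additive_subgroup.zero_closed[OF ideal.axioms(1)[OF I_ideal]]
    additive_subgroup.a_closed[OF ideal.axioms(1)[OF I_ideal], of u v] by simp_all

lemma I_scale: "u \<in> I \<Longrightarrow> scale z u \<in> I"
  using Q.I_scale[of u z] by simp

lemma I_lext: assumes "\<And>i. i \<in> keys u \<Longrightarrow> f i \<in> I" shows "lext f u \<in> I"
proof -
  have "(\<Sum>i\<in>N. scale (lk u i) (f i)) \<in> I" if "finite N" "N \<subseteq> keys u" for N
    using that by (induction N rule: finite_induct) (auto simp: I_zero intro!: I_add I_scale assms)
  thus ?thesis by (simp add: lext_def)
qed

text \<open>A map that is linear only modulo the ideal agrees modulo the ideal with the linear
  extension of its values on the basis. It is applied to each argument of a pure tensor in
  turn.\<close>

lemma linear_mod_I: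
  fixes f :: "('n \<Rightarrow>\<^sub>0 'k) \<Rightarrow> ('a \<times> 'c \<Rightarrow>\<^sub>0 'k)"
  assumes add: "\<And>u v. f (u + v) - f u - f v \<in> I" and scl: "\<And>z u. f (scale z u) - scale z (f u) \<in> I"
  shows "f u - lext (\<lambda>i. f (bas i)) u \<in> I"
proof -
  have "f (\<Sum>i\<in>N. sg i (lk u i)) - (\<Sum>i\<in>N. scale (lk u i) (f (bas i))) \<in> I" if "finite N" for N
    using that
  proof (induction N rule: finite_induct)
    case empty
    show ?case using scl[of 0 0] by simp
  next
    case (insert j N)
    let ?S = "\<Sum>i\<in>N. sg i (lk u i)" and ?R = "\<Sum>i\<in>N. scale (lk u i) (f (bas i))" and ?s = "sg j (lk u j)"
    have "f (?s + ?S) - (scale (lk u j) (f (bas j)) + ?R) =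
      (f (?s + ?S) - f ?s - f ?S) + ((f (scale (lk u j) (bas j)) - scale (lk u j) (f (bas j))) + (f ?S - ?R))"
      by simp
    also have "\<dots> \<in> I" by (intro I_add add scl insert.IH)
    finally show ?case using insert.hyps by simp
  qed
  from this[OF finite_keys] have "f (\<Sum>i\<in>keys u. sg i (lk u i)) - lext (\<lambda>i. f (bas i)) u \<in> I"
    unfolding lext_def .
  moreover have "(\<Sum>i\<in>keys u. sg i (lk u i)) = u"
    using lext_bas[of u] unfolding lext_def scale_sg mult_1_right .
  ultimately show ?thesis by (simp only:)
qed

text \<open>A linear section of \<open>\<beta>\<close>, with values in the span of tensors of basis
  elements.\<close>

definition \<sigma> :: "('i \<times> 'j \<Rightarrow>\<^sub>0 'k) \<Rightarrow> ('a \<times> 'c \<Rightarrow>\<^sub>0 'k)" where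
  "\<sigma> = lext (\<lambda>(i, j). bas (A.\<phi> (bas i), C.\<phi> (bas j)))"

lemma klin_\<sigma>: "klin \<sigma>" unfolding \<sigma>_def by (rule klin_lext)

lemma \<sigma>_bas [simp]: "\<sigma> (bas (i, j)) = bas (A.\<phi> (bas i), C.\<phi> (bas j))" by (simp add: \<sigma>_def)

lemma \<sigma>_carrier [simp]: "\<sigma> u \<in> carrier MA"
  using keys_lext[of "\<lambda>(i, j). bas (A.\<phi> (bas i), C.\<phi> (bas j))" u]
  by (fastforce simp: \<sigma>_def split: if_splits)

lemma \<beta>_\<sigma>: "\<beta> (\<sigma> u) = u"
  by (rule klin_eqI[of "\<lambda>u. \<beta> (\<sigma> u)" "\<lambda>u. u"]) (auto intro: klin_compose[OF klin_\<beta> klin_\<sigma>] klin_id)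

lemma pure_mod_I: "bas (A.\<phi> u, C.\<phi> v) - \<sigma> (tens u v) \<in> I"
proof -
  have 1: "bas (A.\<phi> u, C.\<phi> v) - lext (\<lambda>i. bas (A.\<phi> (bas i), C.\<phi> v)) u \<in> I"
    by (rule linear_mod_I[where f = "\<lambda>u. bas (A.\<phi> u, C.\<phi> v)"]) (simp_all only: A.\<phi>_add A.\<phi>_scale A.\<phi>_in C.\<phi>_in relators_I)
  have "bas (A.\<phi> (bas i), C.\<phi> v) - lext (\<lambda>j. bas (A.\<phi> (bas i), C.\<phi> (bas j))) v \<in> I" for i
    by (rule linear_mod_I[where f = "\<lambda>v. bas (A.\<phi> (bas i), C.\<phi> v)"]) (simp_all only: C.\<phi>_add C.\<phi>_scale A.\<phi>_in C.\<phi>_in relators_I)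
  hence "lext (\<lambda>i. bas (A.\<phi> (bas i), C.\<phi> v) - lext (\<lambda>j. bas (A.\<phi> (bas i), C.\<phi> (bas j))) v) u \<in> I"
    by (intro I_lext)
  from I_add[OF 1 this] show ?thesis by (simp add: lext_diff_fun \<sigma>_def tens_def lext_lext)
qed

text \<open>The converse of \<open>I_Ker\<close>: what \<open>\<beta>\<close> kills lies in the
  ideal.\<close>

lemma mod_I: assumes "z \<in> carrier MA" shows "z - \<sigma> (\<beta> z) \<in> I"
proof -
  have "lext (\<lambda>x. bas x - \<sigma> (\<beta> (bas x))) z \<in> I"
  proof (rule I_lext)
    fix x assume "x \<in> keys z"
    then obtain a b where x: "x = (a, b)" "a \<in> carrier A" "b \<in> carrier C" using assms by (cases x) auto
    show "bas x - \<sigma> (\<beta> (bas x)) \<in> I"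
      using pure_mod_I[of "\<alpha> a" "\<gamma> b"] x by (simp add: A.\<phi>_\<theta> C.\<phi>_\<theta>)
  qed
  thus ?thesis by (simp add: lext_diff_fun klin_expand[OF klin_compose[OF klin_\<sigma> klin_\<beta>], symmetric])
qed

abbreviation cls :: "('a \<times> 'c \<Rightarrow>\<^sub>0 'k) \<Rightarrow> ('a \<times> 'c \<Rightarrow>\<^sub>0 'k) set" where "cls u \<equiv> I +>\<^bsub>MA\<^esub> u"

definition \<Theta> :: "('a \<times> 'c \<Rightarrow>\<^sub>0 'k) set \<Rightarrow> ('i \<times> 'j \<Rightarrow>\<^sub>0 'k)" where "\<Theta> Z = the_elem (\<beta> ` Z)"

text \<open>A function that factors through \<open>\<beta>\<close> is constant on classes, since
  elements of one class have equal image under \<open>\<beta>\<close>.\<close>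

lemma cls_lift:
  assumes "\<And>w. w \<in> carrier MA \<Longrightarrow> f w = L (\<beta> w)" "z \<in> carrier MA"
  shows "the_elem (f ` cls z) = L (\<beta> z)"
proof -
  have "the_elem (f ` cls z) = f z"
  proof (rule Q.the_elem_cls[OF _ assms(2)])
    fix y assume y: "y \<in> carrier MA" "y \<ominus>\<^bsub>MA\<^esub> z \<in> I"
    hence "\<beta> (y - z) = 0" using I_Ker[OF y(2)] MA_minus[OF y(1) assms(2)] by simp
    hence "\<beta> y = \<beta> z" by (simp add: klin_diff[OF klin_\<beta>])
    thus "f y = f z" using assms y(1) by simp
  qed
  thus ?thesis using assms by simp
qed

lemma \<Theta>_cls: "z \<in> carrier MA \<Longrightarrow> \<Theta> (cls z) = \<beta> z"
  unfolding \<Theta>_def by (rule cls_lift[where L = "\<lambda>u. u", OF refl])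

lemma Ten_carrier: "Z \<in> carrier Ten \<longleftrightarrow> (\<exists>z\<in>carrier MA. Z = cls z)"
  unfolding tensor_def by (rule Q.cls_carrier)

lemma cls_simps:
  "z \<in> carrier MA \<Longrightarrow> cls z \<in> carrier Ten"
  "z \<in> carrier MA \<Longrightarrow> w \<in> carrier MA \<Longrightarrow> cls z \<oplus>\<^bsub>Ten\<^esub> cls w = cls (z + w)"
  "z \<in> carrier MA \<Longrightarrow> w \<in> carrier MA \<Longrightarrow> cls z \<otimes>\<^bsub>Ten\<^esub> cls w = cls (z \<otimes>\<^bsub>MA\<^esub> w)"
  "z \<in> carrier MA \<Longrightarrow> r \<odot>\<^bsub>Ten\<^esub> cls z = cls (scale r z)"
  "\<zero>\<^bsub>Ten\<^esub> = cls 0" "\<one>\<^bsub>Ten\<^esub> = cls (bas (\<one>\<^bsub>A\<^esub>, \<one>\<^bsub>C\<^esub>))"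
  unfolding tensor_def
  by (simp_all add: Q.cls_add Q.cls_mult Q.cls_scale Q.cls_zero Q.cls_one del: monoid_algebra_simps(1))

lemma cls_\<sigma>: "Z \<in> carrier Ten \<Longrightarrow> cls (\<sigma> (\<Theta> Z)) = Z"
proof -
  assume "Z \<in> carrier Ten"
  then obtain z where z: "z \<in> carrier MA" "Z = cls z" using Ten_carrier by blast
  have "z - \<sigma> (\<beta> z) \<in> I" by (rule mod_I[OF z(1)])
  hence "cls z = cls (\<sigma> (\<beta> z))" using Q.cls_eq_iff[OF z(1) \<sigma>_carrier] MA_minus[OF z(1) \<sigma>_carrier] by simp
  thus "cls (\<sigma> (\<Theta> Z)) = Z" unfolding z(2) \<Theta>_cls[OF z(1)] by (rule sym)
qed

lemma Ten_coord: "coord_algebra Ten \<Theta>"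
proof (intro coord_algebra.intro coord_algebra_axioms.intro)
  show "k_algebra Ten" unfolding tensor_def by (rule Q.quot_k_algebra)
  show "bij_betw \<Theta> (carrier Ten) UNIV"
  proof (rule bij_betw_byWitness[where f' = "\<lambda>u. cls (\<sigma> u)"])
    show "(\<lambda>u. cls (\<sigma> u)) ` UNIV \<subseteq> carrier Ten" using cls_simps(1)[OF \<sigma>_carrier] by blast
    show "\<forall>Z\<in>carrier Ten. cls (\<sigma> (\<Theta> Z)) = Z" using cls_\<sigma> by blast
    show "\<forall>u\<in>UNIV. \<Theta> (cls (\<sigma> u)) = u" by (simp only: \<Theta>_cls[OF \<sigma>_carrier] \<beta>_\<sigma> simp_thms ball_simps)
  qed simp
  fix Z Z' z assume Z: "Z \<in> carrier Ten"
  then obtain u where u: "u \<in> carrier MA" "Z = cls u" using Ten_carrier by blast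
  show "\<Theta> (z \<odot>\<^bsub>Ten\<^esub> Z) = scale z (\<Theta> Z)"
    using MA.scale_closed[OF u(1), of z] u(1) unfolding u(2) cls_simps(4)[OF u(1)]
    by (simp only: \<Theta>_cls klin_scale[OF klin_\<beta>] monoid_algebra_simps(5))
  assume "Z' \<in> carrier Ten"
  then obtain v where v: "v \<in> carrier MA" "Z' = cls v" using Ten_carrier by blast
  show "\<Theta> (Z \<oplus>\<^bsub>Ten\<^esub> Z') = \<Theta> Z + \<Theta> Z'"
    using MA.a_closed[OF u(1) v(1)] unfolding u(2) v(2) cls_simps(2)[OF u(1) v(1)]
    by (simp only: \<Theta>_cls u(1) v(1) klin_add[OF klin_\<beta>] monoid_algebra_simps(4))
qed

sublocale T: coord_algebra Ten \<Theta> by (rule Ten_coord)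

definition pure :: "'a \<Rightarrow> 'c \<Rightarrow> ('a \<times> 'c \<Rightarrow>\<^sub>0 'k) set" where "pure a b = cls (bas (a, b))"

lemma bas_MA: "a \<in> carrier A \<Longrightarrow> b \<in> carrier C \<Longrightarrow> bas (a, b) \<in> carrier MA" by simp

lemma pure_in: "a \<in> carrier A \<Longrightarrow> b \<in> carrier C \<Longrightarrow> pure a b \<in> carrier Ten"
  unfolding pure_def by (rule cls_simps(1)[OF bas_MA])

lemma \<Theta>_pure: "a \<in> carrier A \<Longrightarrow> b \<in> carrier C \<Longrightarrow> \<Theta> (pure a b) = tens (\<alpha> a) (\<gamma> b)"
  unfolding pure_def by (simp add: \<Theta>_cls[OF bas_MA])

lemma pure_\<phi>: "T.\<phi> (tens u v) = pure (A.\<phi> u) (C.\<phi> v)"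
  by (rule T.\<theta>_inj[THEN iffD1]) (simp_all add: \<Theta>_pure pure_in)

lemma pure_one: "\<one>\<^bsub>Ten\<^esub> = pure \<one>\<^bsub>A\<^esub> \<one>\<^bsub>C\<^esub>" by (simp only: cls_simps(6) pure_def)

lemma pure_mult:
  assumes "a \<in> carrier A" "b \<in> carrier C" "a' \<in> carrier A" "b' \<in> carrier C"
  shows "pure a b \<otimes>\<^bsub>Ten\<^esub> pure a' b' = pure (a \<otimes>\<^bsub>A\<^esub> a') (b \<otimes>\<^bsub>C\<^esub> b')"
  unfolding pure_def by (simp add: cls_simps(3)[OF bas_MA bas_MA] assms)

lemma T_Lm: assumes "a \<in> carrier A" "b \<in> carrier C" shows "T.Lm (pure a b) u = op1 (A.Lm a) (op2 (C.Lm b) u)"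
proof -
  have Z: "T.\<phi> u \<in> carrier Ten" by simp
  then obtain z where z: "z \<in> carrier MA" "T.\<phi> u = cls z" using Ten_carrier by blast
  have "u = \<beta> z" using T.\<theta>_\<phi>[of u] z by (simp only: \<Theta>_cls)
  thus ?thesis unfolding T.Lm_def z(2) pure_def cls_simps(3)[OF bas_MA[OF assms] z(1)]
    by (simp only: \<Theta>_cls MA.m_closed bas_MA assms z(1) \<beta>_left)
qed

lemma T_Rm: assumes "a \<in> carrier A" "b \<in> carrier C" shows "T.Rm (pure a b) u = op1 (A.Rm a) (op2 (C.Rm b) u)"
proof -
  have Z: "T.\<phi> u \<in> carrier Ten" by simp
  then obtain z where z: "z \<in> carrier MA" "T.\<phi> u = cls z" using Ten_carrier by blast
  have "u = \<beta> z" using T.\<theta>_\<phi>[of u] z by (simp only: \<Theta>_cls)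
  thus ?thesis unfolding T.Rm_def z(2) pure_def cls_simps(3)[OF z(1) bas_MA[OF assms]]
    by (simp only: \<Theta>_cls MA.m_closed bas_MA assms z(1) \<beta>_right)
qed

end

section \<open>The enveloping algebra\<close>

lemma (in coord_algebra) opp_coord: "coord_algebra (opp R) \<theta>"
proof (intro coord_algebra.intro coord_algebra_axioms.intro k_algebra.intro k_algebra_axioms.intro opp_ring)
  have [simp]: "smult (opp R) = smult R" by (simp add: opp_def)
  show "bij_betw \<theta> (carrier (opp R)) UNIV" using bij by simp
qed (simp_all add: opp_def \<theta>_add \<theta>_scale scale_closed scale_l_distr scale_r_distr scale_scale scale_one
    scale_mult_l[symmetric] scale_mult_r[symmetric])

locale coord_env = coord_algebra R \<theta> for R :: "('k::field, 'a, 's) module_scheme" (structure)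
    and \<theta> :: "'a \<Rightarrow> ('i \<Rightarrow>\<^sub>0 'k)"
begin

sublocale V: coord_tensor R \<theta> "opp R" \<theta>
  by (intro coord_tensor.intro coord_algebra_axioms opp_coord)

abbreviation "Env \<equiv> enveloping R"

lemma Env_eq: "Env = tensor R (opp R)" by (simp add: enveloping_def)

lemma V_\<phi> [simp]: "V.C.\<phi> = \<phi>" by (simp add: V.C.\<phi>_def \<phi>_def)

lemma V_Lm [simp]: "V.C.Lm = Rm" and V_Rm [simp]: "V.C.Rm = Lm"
  by (simp_all add: fun_eq_iff V.C.Lm_def V.C.Rm_def Lm_def Rm_def)

text \<open>Both bimodules have scalar multiplications \<open>tensor_lift R (h m) Z\<close> with \<open>h m (u, v)\<close> bilinear in
  \<open>u, v\<close>; in coordinates this is a linear function of \<open>\<Theta> Z\<close>.\<close>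

definition lift :: "('a \<times> 'a \<Rightarrow> 'a) \<Rightarrow> ('i \<times> 'i \<Rightarrow>\<^sub>0 'k) \<Rightarrow> ('i \<Rightarrow>\<^sub>0 'k)" where
  "lift h = lext (\<lambda>(i, j). \<theta> (h (\<phi> (bas i), \<phi> (bas j))))"

definition bilin :: "('a \<times> 'a \<Rightarrow> 'a) \<Rightarrow> bool" where
  "bilin h \<longleftrightarrow> (\<forall>u\<in>carrier R. \<forall>v\<in>carrier R. h (u, v) \<in> carrier R) \<and>
    (\<forall>v\<in>carrier R. klin (\<lambda>u. \<theta> (h (\<phi> u, v)))) \<and> (\<forall>u\<in>carrier R. klin (\<lambda>v. \<theta> (h (u, \<phi> v))))"

lemma klin_lift: "klin (lift h)" unfolding lift_def by (rule klin_lext)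

lemma lift_tens: assumes h: "bilin h" shows "lift h (tens u v) = \<theta> (h (\<phi> u, \<phi> v))"
proof (rule klin_eqI[of "\<lambda>u. lift h (tens u v)" "\<lambda>u. \<theta> (h (\<phi> u, \<phi> v))"])
  show "klin (\<lambda>u. lift h (tens u v))" by (rule klin_compose[OF klin_lift klin_tens1])
  show "klin (\<lambda>u. \<theta> (h (\<phi> u, \<phi> v)))" using h by (simp add: bilin_def)
  fix i
  show "lift h (tens (bas i) v) = \<theta> (h (\<phi> (bas i), \<phi> v))"
  proof (rule klin_eqI[of "\<lambda>v. lift h (tens (bas i) v)" "\<lambda>v. \<theta> (h (\<phi> (bas i), \<phi> v))"])
    show "klin (\<lambda>v. lift h (tens (bas i) v))" by (rule klin_compose[OF klin_lift klin_tens2])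
    show "klin (\<lambda>v. \<theta> (h (\<phi> (bas i), \<phi> v)))" using h by (simp add: bilin_def)
  qed (simp add: lift_def)
qed

lemma lift_pure: "bilin h \<Longrightarrow> a \<in> carrier R \<Longrightarrow> b \<in> carrier R \<Longrightarrow> lift h (tens (\<theta> a) (\<theta> b)) = \<theta> (h (a, b))"
  by (simp add: lift_tens \<phi>_\<theta>)

lemma tensor_lift_eq:
  assumes h: "bilin h" and Z: "Z \<in> carrier Env"
  shows "tensor_lift R h Z = \<phi> (lift h (V.\<Theta> Z))"
proof -
  obtain z where z: "z \<in> carrier V.MA" "Z = V.cls z" using Z V.Ten_carrier unfolding Env_eq by blast
  have hc: "h w \<in> carrier R" if "w \<in> carrier R \<times> carrier R" for w using h that by (auto simp: bilin_def)
  have "(\<Oplus>w\<in>keys z. lk z w \<odot> h w) = \<phi> (lift h (V.\<beta> z))" if z: "z \<in> carrier V.MA" for z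
  proof -
    have k: "keys z \<subseteq> carrier R \<times> carrier R" using z by simp
    have "\<theta> (\<Oplus>w\<in>keys z. lk z w \<odot> h w) = (\<Sum>w\<in>keys z. \<theta> (lk z w \<odot> h w))"
      using k hc by (intro \<theta>_finsum scale_closed) blast
    also have "\<dots> = lext (\<lambda>w. \<theta> (h w)) z"
      unfolding lext_def using k hc by (intro sum.cong refl \<theta>_scale) blast
    also have "\<dots> = lift h (V.\<beta> z)"
    proof (rule klin_eq_onI[of "lext (\<lambda>w. \<theta> (h w))" "\<lambda>z. lift h (V.\<beta> z)"])
      fix w assume "w \<in> keys z"
      then obtain a b where "w = (a, b)" "a \<in> carrier R" "b \<in> carrier R" using k by (cases w) auto
      thus "lext (\<lambda>w. \<theta> (h w)) (bas w) = lift h (V.\<beta> (bas w))" by (simp add: lift_pure[OF h])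
    qed (rule klin_lext, rule klin_compose[OF klin_lift V.klin_\<beta>])
    finally have "\<theta> (\<Oplus>w\<in>keys z. lk z w \<odot> h w) = \<theta> (\<phi> (lift h (V.\<beta> z)))" by simp
    moreover have "(\<Oplus>w\<in>keys z. lk z w \<odot> h w) \<in> carrier R"
      using k hc by (intro finsum_closed Pi_I scale_closed) blast
    ultimately show ?thesis using \<theta>_inj \<phi>_in by blast
  qed
  from V.cls_lift[where f = "\<lambda>z. \<Oplus>w\<in>keys z. lk z w \<odot> h w" and L = "\<lambda>u. \<phi> (lift h u)", OF this z(1)] show ?thesis
    unfolding tensor_lift_def z(2) V.\<Theta>_cls[OF z(1)] by simp
qed

text \<open>One proof for both bimodules: \<open>E\<close> is the enveloping algebra or its
  opposite. Associativity is checked on pure tensors in \<open>h_mult\<close> and extends because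
  both sides are linear in each of the two coordinate vectors.\<close>

lemma lift_module:
  fixes s :: "('a \<times> 'a \<Rightarrow>\<^sub>0 'k) set \<Rightarrow> 'a \<Rightarrow> 'a" and E :: "('k, ('k, 'a) env) module"
  assumes E: "ring E" "carrier E = carrier Env" "zero E = zero Env" "add E = add Env" "one E = one Env"
    and E_lin: "\<And>Z. Z \<in> carrier Env \<Longrightarrow> klin (\<lambda>u. V.\<Theta> (V.T.\<phi> u \<otimes>\<^bsub>E\<^esub> Z))" "\<And>Z. Z \<in> carrier Env \<Longrightarrow> klin (\<lambda>u. V.\<Theta> (Z \<otimes>\<^bsub>E\<^esub> V.T.\<phi> u))"
    and h: "\<And>m. m \<in> carrier R \<Longrightarrow> bilin (h m)"
    and h_lin: "\<And>a b. a \<in> carrier R \<Longrightarrow> b \<in> carrier R \<Longrightarrow> klin (\<lambda>u. \<theta> (h (\<phi> u) (a, b)))"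
    and h_one: "\<And>m. m \<in> carrier R \<Longrightarrow> h m (\<one>, \<one>) = m"
    and h_mult: "\<And>m a b a' b'. m \<in> carrier R \<Longrightarrow> a \<in> carrier R \<Longrightarrow> b \<in> carrier R \<Longrightarrow> a' \<in> carrier R \<Longrightarrow> b' \<in> carrier R \<Longrightarrow>
      lift (h m) (V.\<Theta> (V.pure a b \<otimes>\<^bsub>E\<^esub> V.pure a' b')) = \<theta> (h (h m (a', b')) (a, b))"
  shows "left_module E (with_smult R (\<lambda>Z m. tensor_lift R (h m) Z))"
proof -
  let ?M = "with_smult R (\<lambda>Z m. tensor_lift R (h m) Z)"
  interpret E: ring E by (rule E(1))
  have s: "Z \<odot>\<^bsub>?M\<^esub> m = \<phi> (lift (h m) (V.\<Theta> Z))" if "Z \<in> carrier E" "m \<in> carrier R" for Z m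
    using tensor_lift_eq[OF h[OF that(2)]] that E by simp
  have T_add: "V.\<Theta> (Z \<oplus>\<^bsub>E\<^esub> Z') = V.\<Theta> Z + V.\<Theta> Z'" if "Z \<in> carrier E" "Z' \<in> carrier E" for Z Z'
    using that V.T.\<theta>_add E unfolding Env_eq by simp
  have lin_m: "klin (\<lambda>v. lift (h (\<phi> v)) w)" for w
    unfolding lift_def by (intro klin_lext_fun) (auto intro!: h_lin split: prod.split)
  have lift_h: "lift (h m) w = lift (h (\<phi> (\<theta> m))) w" if "m \<in> carrier R" for m w using that by (simp add: \<phi>_\<theta>)
  have assoc: "lift (h m) (V.\<Theta> (Z \<otimes>\<^bsub>E\<^esub> Z')) = lift (h (\<phi> (lift (h m) (V.\<Theta> Z')))) (V.\<Theta> Z)"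
    if Z: "Z \<in> carrier E" "Z' \<in> carrier E" and m: "m \<in> carrier R" for Z Z' m
  proof -
    have "lift (h m) (V.\<Theta> (V.T.\<phi> u \<otimes>\<^bsub>E\<^esub> V.T.\<phi> u')) = lift (h (\<phi> (lift (h m) u'))) u" for u u'
    proof (rule tens_eqI[of "\<lambda>u. lift (h m) (V.\<Theta> (V.T.\<phi> u \<otimes>\<^bsub>E\<^esub> V.T.\<phi> u'))" "\<lambda>u. lift (h (\<phi> (lift (h m) u'))) u"])
      show "klin (\<lambda>u. lift (h m) (V.\<Theta> (V.T.\<phi> u \<otimes>\<^bsub>E\<^esub> V.T.\<phi> u')))"
        by (intro klin_compose[OF klin_lift] E_lin) (simp add: Env_eq)
      show "klin (\<lambda>u. lift (h (\<phi> (lift (h m) u'))) u)" by (rule klin_lift)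
      fix i j
      let ?t = "tens (bas i) (bas j) :: 'i \<times> 'i \<Rightarrow>\<^sub>0 'k"
      show "lift (h m) (V.\<Theta> (V.T.\<phi> ?t \<otimes>\<^bsub>E\<^esub> V.T.\<phi> u')) = lift (h (\<phi> (lift (h m) u'))) ?t"
      proof (rule tens_eqI[of "\<lambda>u'. lift (h m) (V.\<Theta> (V.T.\<phi> ?t \<otimes>\<^bsub>E\<^esub> V.T.\<phi> u'))" "\<lambda>u'. lift (h (\<phi> (lift (h m) u'))) ?t"])
        show "klin (\<lambda>u'. lift (h m) (V.\<Theta> (V.T.\<phi> ?t \<otimes>\<^bsub>E\<^esub> V.T.\<phi> u')))"
          by (intro klin_compose[OF klin_lift] E_lin) (simp add: Env_eq)
        show "klin (\<lambda>u'. lift (h (\<phi> (lift (h m) u'))) ?t)" by (rule klin_compose[OF lin_m klin_lift])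
        fix i' j'
        let ?t' = "tens (bas i') (bas j') :: 'i \<times> 'i \<Rightarrow>\<^sub>0 'k"
        have "h m (\<phi> (bas i'), \<phi> (bas j')) \<in> carrier R" using h[OF m] by (simp add: bilin_def)
        thus "lift (h m) (V.\<Theta> (V.T.\<phi> ?t \<otimes>\<^bsub>E\<^esub> V.T.\<phi> ?t')) = lift (h (\<phi> (lift (h m) ?t'))) ?t"
          using h_mult[OF m, of "\<phi> (bas i)" "\<phi> (bas j)" "\<phi> (bas i')" "\<phi> (bas j')"]
          by (simp add: V.pure_\<phi> lift_tens h m \<phi>_\<theta> del: tens_sg)
      qed
    qed
    from this[of "V.\<Theta> Z" "V.\<Theta> Z'"] show ?thesis using Z V.T.\<phi>_\<theta> E unfolding Env_eq by simp
  qed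
  have cl: "Z \<odot>\<^bsub>?M\<^esub> m \<in> carrier R" if "Z \<in> carrier E" "m \<in> carrier R" for Z m using s[OF that] by simp
  have "abelian_group ?M" by (rule abelian_group_cong[OF abelian_group_axioms]) simp_all
  thus ?thesis
  proof (intro left_module.intro left_module_axioms.intro E.ring_axioms)
    fix m assume m: "m \<in> carrier ?M"
    hence m': "m \<in> carrier R" by simp
    have "V.\<Theta> \<one>\<^bsub>E\<^esub> = tens (\<theta> \<one>) (\<theta> \<one>)"
      using V.pure_one V.\<Theta>_pure[of \<one> \<one>] unfolding E Env_eq by simp
    thus "\<one>\<^bsub>E\<^esub> \<odot>\<^bsub>?M\<^esub> m = m"
      using s[OF E.one_closed m'] lift_pure[OF h[OF m'], of \<one> \<one>] m' by (simp add: h_one \<phi>_\<theta>)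
    fix Z assume Z: "Z \<in> carrier E"
    show "Z \<odot>\<^bsub>?M\<^esub> m \<in> carrier ?M" using cl[OF Z m'] by simp
    show "Z \<odot>\<^bsub>?M\<^esub> (m \<oplus>\<^bsub>?M\<^esub> m') = Z \<odot>\<^bsub>?M\<^esub> m \<oplus>\<^bsub>?M\<^esub> Z \<odot>\<^bsub>?M\<^esub> m'" if "m' \<in> carrier ?M" for m'
    proof -
      have mm: "m' \<in> carrier R" using that by simp
      have "lift (h (m \<oplus> m')) (V.\<Theta> Z) = lift (h m) (V.\<Theta> Z) + lift (h m') (V.\<Theta> Z)"
        using klin_add[OF lin_m[of "V.\<Theta> Z"], of "\<theta> m" "\<theta> m'"] m' mm by (simp add: \<phi>_add \<phi>_\<theta>)
      hence "Z \<odot>\<^bsub>?M\<^esub> (m \<oplus> m') = \<phi> (lift (h m) (V.\<Theta> Z)) \<oplus> \<phi> (lift (h m') (V.\<Theta> Z))"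
        unfolding s[OF Z a_closed[OF m' mm]] by (simp only: \<phi>_add)
      thus ?thesis unfolding s[OF Z m'] s[OF Z mm] by simp
    qed
    fix Z' assume Z': "Z' \<in> carrier E"
    have "(Z \<oplus>\<^bsub>E\<^esub> Z') \<odot>\<^bsub>?M\<^esub> m = \<phi> (lift (h m) (V.\<Theta> Z)) \<oplus> \<phi> (lift (h m) (V.\<Theta> Z'))"
      unfolding s[OF E.a_closed[OF Z Z'] m'] T_add[OF Z Z'] by (simp only: klin_add[OF klin_lift] \<phi>_add)
    thus "(Z \<oplus>\<^bsub>E\<^esub> Z') \<odot>\<^bsub>?M\<^esub> m = Z \<odot>\<^bsub>?M\<^esub> m \<oplus>\<^bsub>?M\<^esub> Z' \<odot>\<^bsub>?M\<^esub> m" unfolding s[OF Z m'] s[OF Z' m'] by simp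
    show "(Z \<otimes>\<^bsub>E\<^esub> Z') \<odot>\<^bsub>?M\<^esub> m = Z \<odot>\<^bsub>?M\<^esub> (Z' \<odot>\<^bsub>?M\<^esub> m)"
      unfolding s[OF E.m_closed[OF Z Z'] m'] s[OF Z cl[OF Z' m']] unfolding s[OF Z' m'] assoc[OF Z Z' m'] ..
  qed
qed

lemma Env_ring: "ring Env" unfolding Env_eq by (rule V.T.ring_axioms)

lemma Env_lin:
  assumes "Z \<in> carrier Env"
  shows "klin (\<lambda>u. V.\<Theta> (V.T.\<phi> u \<otimes>\<^bsub>Env\<^esub> Z))" "klin (\<lambda>u. V.\<Theta> (Z \<otimes>\<^bsub>Env\<^esub> V.T.\<phi> u))"
  using V.T.klin_Rm[of Z] V.T.klin_Lm[of Z] assms unfolding Env_eq V.T.Lm_def[abs_def] V.T.Rm_def[abs_def] by simp_all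

lemma pure_mult_Env:
  "a \<in> carrier R \<Longrightarrow> b \<in> carrier R \<Longrightarrow> a' \<in> carrier R \<Longrightarrow> b' \<in> carrier R \<Longrightarrow>
    V.pure a b \<otimes>\<^bsub>Env\<^esub> V.pure a' b' = V.pure (a \<otimes> a') (b' \<otimes> b)"
  unfolding Env_eq by (simp add: V.pure_mult)

definition bimod_map :: "'a \<Rightarrow> 'a \<times> 'a \<Rightarrow> 'a" where "bimod_map m = (\<lambda>(u, v). u \<otimes> m \<otimes> v)"

lemma bimod_bilin: "m \<in> carrier R \<Longrightarrow> bilin (bimod_map m)"
  unfolding bilin_def bimod_map_def
  by (intro conjI ballI klinI)
    (simp_all add: m_closed \<phi>_add \<phi>_scale l_distr r_distr \<theta>_add \<theta>_scale scale_mult_l[symmetric] scale_mult_r[symmetric])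

lemma bimodule_eq: "bimodule R = with_smult R (\<lambda>Z m. tensor_lift R (bimod_map m) Z)"
  by (simp add: bimodule_def bimod_map_def)

lemma bimodule_left_module: "left_module Env (bimodule R)"
  unfolding bimodule_eq
proof (rule lift_module)
  show "bilin (bimod_map m)" if "m \<in> carrier R" for m by (rule bimod_bilin[OF that])
  fix m a b a' b'
  assume m: "m \<in> carrier R" and ab: "a \<in> carrier R" "b \<in> carrier R" "a' \<in> carrier R" "b' \<in> carrier R"
  show "lift (bimod_map m) (V.\<Theta> (V.pure a b \<otimes>\<^bsub>Env\<^esub> V.pure a' b')) = \<theta> (bimod_map (bimod_map m (a', b')) (a, b))"
    using m ab by (simp add: pure_mult_Env V.\<Theta>_pure lift_pure bimod_bilin) (simp add: bimod_map_def m_assoc m_closed)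
next
  fix a b assume "a \<in> carrier R" "b \<in> carrier R"
  thus "klin (\<lambda>u. \<theta> (bimod_map (\<phi> u) (a, b)))" unfolding bimod_map_def
    by (intro klinI) (simp_all add: m_closed \<phi>_add \<phi>_scale l_distr r_distr \<theta>_add \<theta>_scale scale_mult_l[symmetric] scale_mult_r[symmetric])
qed (simp_all add: Env_ring Env_lin bimod_map_def)

lemma bimodule_smult: "Z \<in> carrier Env \<Longrightarrow> m \<in> carrier R \<Longrightarrow> Z \<odot>\<^bsub>bimodule R\<^esub> m = \<phi> (lift (bimod_map m) (V.\<Theta> Z))"
  by (simp add: bimodule_eq tensor_lift_eq bimod_bilin)

end

locale coord_env_twist = coord_env R \<theta> for R :: "('k::field, 'a, 's) module_scheme" (structure)
    and \<theta> :: "'a \<Rightarrow> ('i \<Rightarrow>\<^sub>0 'k)" +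
  fixes \<nu> :: "'a \<Rightarrow> 'a"
  assumes \<nu>_hom: "\<nu> \<in> ring_hom R R" and \<nu>_scale: "x \<in> carrier R \<Longrightarrow> \<nu> (z \<odot> x) = z \<odot> \<nu> x"
begin

lemma \<nu>_simps [simp]: "x \<in> carrier R \<Longrightarrow> \<nu> x \<in> carrier R" "x \<in> carrier R \<Longrightarrow> y \<in> carrier R \<Longrightarrow> \<nu> (x \<otimes> y) = \<nu> x \<otimes> \<nu> y"
  "x \<in> carrier R \<Longrightarrow> y \<in> carrier R \<Longrightarrow> \<nu> (x \<oplus> y) = \<nu> x \<oplus> \<nu> y" "\<nu> \<one> = \<one>"
  using \<nu>_hom by (auto simp: ring_hom_def)

definition twist_map :: "'a \<Rightarrow> 'a \<times> 'a \<Rightarrow> 'a" where "twist_map m = (\<lambda>(u, v). v \<otimes> m \<otimes> \<nu> u)"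

lemma twist_bilin: "m \<in> carrier R \<Longrightarrow> bilin (twist_map m)"
  unfolding bilin_def twist_map_def
  by (intro conjI ballI klinI)
    (simp_all add: m_closed \<phi>_add \<phi>_scale l_distr r_distr \<theta>_add \<theta>_scale \<nu>_scale scale_mult_l[symmetric] scale_mult_r[symmetric])

lemma twisted_eq: "twisted_bimodule R \<nu> = with_smult R (\<lambda>Z m. tensor_lift R (twist_map m) Z)"
  by (simp add: twisted_bimodule_def twist_map_def)

lemma twisted_left_module: "left_module (opp Env) (twisted_bimodule R \<nu>)"
  unfolding twisted_eq
proof (rule lift_module)
  show "ring (opp Env)" by (rule ring.opp_ring[OF Env_ring])
  show "bilin (twist_map m)" if "m \<in> carrier R" for m by (rule twist_bilin[OF that])
  fix m a b a' b'
  assume m: "m \<in> carrier R" and ab: "a \<in> carrier R" "b \<in> carrier R" "a' \<in> carrier R" "b' \<in> carrier R"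
  show "lift (twist_map m) (V.\<Theta> (V.pure a b \<otimes>\<^bsub>opp Env\<^esub> V.pure a' b')) = \<theta> (twist_map (twist_map m (a', b')) (a, b))"
    using m ab by (simp add: pure_mult_Env V.\<Theta>_pure lift_pure twist_bilin) (simp add: twist_map_def m_assoc m_closed)
next
  fix a b assume "a \<in> carrier R" "b \<in> carrier R"
  thus "klin (\<lambda>u. \<theta> (twist_map (\<phi> u) (a, b)))" unfolding twist_map_def
    by (intro klinI) (simp_all add: m_closed \<phi>_add \<phi>_scale l_distr r_distr \<theta>_add \<theta>_scale scale_mult_l[symmetric] scale_mult_r[symmetric])
qed (simp_all add: Env_lin twist_map_def)

lemma twisted_smult: "Z \<in> carrier Env \<Longrightarrow> m \<in> carrier R \<Longrightarrow> Z \<odot>\<^bsub>twisted_bimodule R \<nu>\<^esub> m = \<phi> (lift (twist_map m) (V.\<Theta> Z))"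
  by (simp add: twisted_eq tensor_lift_eq twist_bilin)

end

section \<open>The skew Calabi--Yau property\<close>

lemma keys_lextE:
  assumes "x \<in> keys (lext f u)" obtains y where "y \<in> keys u" "x \<in> keys (f y)"
  using keys_lext[of f u] assms by blast

lemma klin_keysE:
  assumes "klin F" "x \<in> keys (F u)" obtains y where "y \<in> keys u" "x \<in> keys (F (bas y))"
  using klin_keys[OF assms(1), of u] assms(2) by blast

context H_data
begin

text \<open>The Nakayama automorphism \<open>x \<mapsto> (p q)\<^sup>-\<^sup>1 x\<close>, \<open>y \<mapsto> p q y\<close>, \<open>t \<mapsto> t\<close>.\<close>

definition gw :: "gen \<Rightarrow> 'k" where "gw a = (case a of X \<Rightarrow> 1 / (p * q) | Y \<Rightarrow> p * q | T \<Rightarrow> 1)"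

text \<open>The factor by which the automorphism multiplies x^i t^j y^k.\<close>

definition wt :: "nat \<times> nat \<times> nat \<Rightarrow> 'k" where "wt = (\<lambda>(i, j, k). (1 / (p * q)) ^ i * (p * q) ^ k)"

definition VV :: "'k pbw \<Rightarrow> 'k pbw" where "VV = lext (\<lambda>i. sg i (wt i))"

definition \<nu>H :: "(gen list \<Rightarrow>\<^sub>0 'k) set \<Rightarrow> (gen list \<Rightarrow>\<^sub>0 'k) set" where "\<nu>H a = C.\<phi> (VV (\<psi> a))"

definition \<Lambda> :: "(gen list \<Rightarrow>\<^sub>0 'k) \<Rightarrow> (gen list \<Rightarrow>\<^sub>0 'k)" where "\<Lambda> = lext (\<lambda>w. sg w (prod_list (map gw w)))"

lemma klin_VV: "klin VV" unfolding VV_def by (rule klin_lext)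

lemma VV_sg [simp]: "VV (sg i z) = sg i (z * wt i)" by (simp add: VV_def)

text \<open>The weights respect the relations because yx, xy and t^2 all have weight 1. In the
  action of y the correction term, with one x fewer and t^2 more, is therefore scaled like the main
  term.\<close>

lemma VV_gop: "VV (gop p q c a v) = scale (gw a) (gop p q c a (VV v))"
proof (rule klin_eqI[of "\<lambda>v. VV (gop p q c a v)" "\<lambda>v. scale (gw a) (gop p q c a (VV v))"])
  show "klin (\<lambda>v. VV (gop p q c a v))" by (rule klin_compose[OF klin_VV klin_gop])
  show "klin (\<lambda>v. scale (gw a) (gop p q c a (VV v)))" by (intro klin_smult klin_compose[OF klin_gop klin_VV])
  fix x :: "nat \<times> nat \<times> nat"
  obtain i j k where x: "x = (i, j, k)" by (cases x) auto
  show "VV (gop p q c a (bas x)) = scale (gw a) (gop p q c a (VV (bas x)))"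
  proof (cases a)
    case Y
    show ?thesis
    proof (cases i)
      case 0
      thus ?thesis by (simp add: x Y wt_def gw_def klin_simps[OF klin_VV] sc.scale_right_distrib mult_ac)
    next
      case (Suc m)
      thus ?thesis using pq
        by (simp add: x Y wt_def gw_def klin_simps[OF klin_VV] sc.scale_right_distrib mult_ac del: gauss.simps)
    qed
  qed (simp_all add: x wt_def gw_def mult_ac)
qed

text \<open>\<open>\<Lambda>\<close> is the automorphism on the free algebra. Extending
  \<open>VV_gop\<close> from generators to words makes \<open>\<nu>H\<close> multiplicative without
  computing products of monomials.\<close>

lemma VV_act: "VV (act p q c u v) = act p q c (\<Lambda> u) (VV v)"
proof (rule klin_eqI[of "\<lambda>u. VV (act p q c u v)" "\<lambda>u. act p q c (\<Lambda> u) (VV v)"])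
  show "klin (\<lambda>u. VV (act p q c u v))" by (rule klin_compose[OF klin_VV klin_act1])
  show "klin (\<lambda>u. act p q c (\<Lambda> u) (VV v))"
    unfolding \<Lambda>_def by (rule klin_compose[OF klin_act1 klin_lext])
  fix w
  have "VV (wop p q c w v) = scale (prod_list (map gw w)) (wop p q c w (VV v))"
    by (induction w) (simp_all add: VV_gop klin_scale[OF klin_gop])
  thus "VV (act p q c (bas w) v) = act p q c (\<Lambda> (bas w)) (VV v)" by (simp add: act_def \<Lambda>_def)
qed

lemma \<nu>H_cl: "\<nu>H (cl u) = cl (\<Lambda> u)"
proof -
  have "VV (bas (0, 0, 0)) = bas (0, 0, 0)" by (simp add: wt_def)
  hence "\<psi> (\<nu>H (cl u)) = \<psi> (cl (\<Lambda> u))" by (simp add: \<nu>H_def \<psi>_cl VV_act)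
  thus ?thesis using C.\<theta>_inj[of "\<nu>H (cl u)" "cl (\<Lambda> u)"] by (simp add: \<nu>H_def)
qed

lemma \<nu>H_gen: "\<nu>H (cl (var a)) = gw a \<odot>\<^bsub>H\<^esub> cl (var a)"
  by (simp add: \<nu>H_cl \<Lambda>_def var_def cl_simps)

lemma \<nu>H_in: "\<nu>H a \<in> carrier H" by (simp add: \<nu>H_def)

lemma \<nu>H_mult: assumes "a \<in> carrier H" "b \<in> carrier H" shows "\<nu>H (a \<otimes>\<^bsub>H\<^esub> b) = \<nu>H a \<otimes>\<^bsub>H\<^esub> \<nu>H b"
proof -
  obtain u where u: "a = cl u" using assms by (auto simp: H_carrier)
  have "\<nu>H a \<in> carrier H" "\<nu>H b \<in> carrier H" by (simp_all add: \<nu>H_def)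
  moreover have "\<psi> (\<nu>H (a \<otimes>\<^bsub>H\<^esub> b)) = \<psi> (\<nu>H a \<otimes>\<^bsub>H\<^esub> \<nu>H b)"
    unfolding C.\<theta>_mult_L[OF \<open>\<nu>H b \<in> carrier H\<close>] unfolding u \<nu>H_cl Lm_cl
    by (simp add: \<nu>H_def C.\<theta>_mult_L[OF assms(2)] Lm_cl VV_act)
  ultimately show ?thesis using C.\<theta>_inj \<nu>H_in C.m_closed by blast
qed

lemma \<nu>H_one: "\<nu>H \<one>\<^bsub>H\<^esub> = \<one>\<^bsub>H\<^esub>"
  by (simp add: cl_simps \<nu>H_cl \<Lambda>_def)

lemma \<nu>H_scale: "a \<in> carrier H \<Longrightarrow> \<nu>H (z \<odot>\<^bsub>H\<^esub> a) = z \<odot>\<^bsub>H\<^esub> \<nu>H a"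
  by (simp add: \<nu>H_def C.\<theta>_scale klin_scale[OF klin_VV] C.\<phi>_scale)

lemma \<nu>H_hom: "\<nu>H \<in> ring_hom H H"
  by (rule ring_hom_memI)
    (simp_all add: \<nu>H_in \<nu>H_mult \<nu>H_one, simp add: \<nu>H_def C.\<theta>_add klin_add[OF klin_VV] C.\<phi>_add)

lemma \<nu>H_automorphism: "algebra_automorphism H \<nu>H"
proof -
  define U where "U = lext (\<lambda>i. sg i (1 / wt i))"
  have U_sg: "U (sg i z) = sg i (z * (1 / wt i))" for i z by (simp add: U_def)
  have kU: "klin U" unfolding U_def by (rule klin_lext)
  have w: "wt i \<noteq> 0" for i using pq by (cases i) (simp add: wt_def)
  have UV: "U (VV u) = u" for u
    by (rule klin_eqI[of "\<lambda>u. U (VV u)" "\<lambda>u. u"])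
      (auto intro: klin_compose[OF kU klin_VV] klin_id simp: U_sg w)
  have VU: "VV (U u) = u" for u
    by (rule klin_eqI[of "\<lambda>u. VV (U u)" "\<lambda>u. u"])
      (auto intro: klin_compose[OF klin_VV kU] klin_id simp: U_sg w)
  have "bij_betw \<nu>H (carrier H) (carrier H)"
    by (rule bij_betw_byWitness[where f' = "\<lambda>a. C.\<phi> (U (\<psi> a))"]) (auto simp: \<nu>H_def UV VU C.\<phi>_\<theta>)
  thus ?thesis unfolding algebra_automorphism_def using \<nu>H_hom \<nu>H_scale by blast
qed

lemma \<nu>H_GH: "a \<in> GH n \<Longrightarrow> \<nu>H a \<in> GH n"
proof -
  have "keys (VV u) \<subseteq> keys u" for u
    using keys_lext[of "\<lambda>i. sg i (wt i)" u] by (auto simp: VV_def split: if_splits)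
  thus "a \<in> GH n \<Longrightarrow> \<nu>H a \<in> GH n" 
    using image_mono[of "keys (VV (\<psi> a))" "keys (\<psi> a)" deg] unfolding GH_iff \<nu>H_def by simp blast
qed

sublocale EV: coord_env_twist H \<psi> \<nu>H
  by (intro coord_env_twist.intro coord_env.intro C.coord_algebra_axioms coord_env_twist_axioms.intro \<nu>H_hom \<nu>H_scale)

abbreviation "ET \<equiv> tensor H (opp H)"
abbreviation "GE \<equiv> enveloping_grading H GH"

definition deg2 :: "(nat \<times> nat \<times> nat) \<times> (nat \<times> nat \<times> nat) \<Rightarrow> int" where "deg2 = (\<lambda>(i, j). deg i + deg j)"

lemma \<phi>_bas_GH: "C.\<phi> (bas i) \<in> GH (deg i)"
  by (simp add: GH_iff)

lemma GH_keys: "a \<in> GH n \<Longrightarrow> i \<in> keys (\<psi> a) \<Longrightarrow> deg i = n"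
  by (auto simp: GH_iff)

lemma GE_iff: "Z \<in> GE n \<longleftrightarrow> Z \<in> carrier ET \<and> deg2 ` keys (EV.V.\<Theta> Z) \<subseteq> {n}"
proof
  assume "Z \<in> GE n"
  then obtain u where u: "Z = EV.V.cls u" "\<And>a b. (a, b) \<in> keys u \<Longrightarrow> \<exists>i j. i + j = n \<and> a \<in> GH i \<and> b \<in> GH j"
    unfolding enveloping_grading_def tensor_grading_def quot_grading_def by blast
  have uc: "u \<in> carrier EV.V.MA"
  proof -
    have "w \<in> carrier H \<times> carrier H" if "w \<in> keys u" for w
    proof -
      obtain a b where ab: "w = (a, b)" by (cases w) blast
      obtain i j where "a \<in> GH i" "b \<in> GH j" using u(2)[of a b] \<open>w \<in> keys u\<close> ab by blast
      thus ?thesis by (simp add: ab GH_iff)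
    qed
    hence "keys u \<subseteq> carrier H \<times> carrier H" by (rule subsetI)
    thus ?thesis by simp
  qed
  have "deg2 x = n" if x: "x \<in> keys (EV.V.\<beta> u)" for x
  proof -
    from x[unfolded EV.V.\<beta>_def] obtain y where y: "y \<in> keys u" "x \<in> keys ((\<lambda>(a, b). tens (\<psi> a) (\<psi> b)) y)"
      by (rule keys_lextE)
    obtain a b where ab: "y = (a, b)" by (cases y) blast
    obtain i j where "i + j = n" "a \<in> GH i" "b \<in> GH j" using u(2) y(1) ab by blast
    moreover have "fst x \<in> keys (\<psi> a)" "snd x \<in> keys (\<psi> b)" using y(2) by (auto simp: ab keys_tens)
    ultimately show ?thesis using GH_keys[of a i "fst x"] GH_keys[of b j "snd x"] by (simp add: deg2_def case_prod_unfold)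
  qed
  thus "Z \<in> carrier ET \<and> deg2 ` keys (EV.V.\<Theta> Z) \<subseteq> {n}"
    using EV.V.cls_simps(1)[OF uc] unfolding u(1) EV.V.\<Theta>_cls[OF uc] by blast
next
  assume Z: "Z \<in> carrier ET \<and> deg2 ` keys (EV.V.\<Theta> Z) \<subseteq> {n}"
  let ?u = "EV.V.\<sigma> (EV.V.\<Theta> Z)"
  have "\<exists>i j. i + j = n \<and> a \<in> GH i \<and> b \<in> GH j" if ab: "(a, b) \<in> keys ?u" for a b
  proof -
    from ab[unfolded EV.V.\<sigma>_def] obtain y where y: "y \<in> keys (EV.V.\<Theta> Z)" "(a, b) \<in> keys ((\<lambda>(i, j). bas (C.\<phi> (bas i), EV.V.C.\<phi> (bas j)) :: _ \<Rightarrow>\<^sub>0 'k) y)"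
      by (rule keys_lextE)
    obtain i j where ij: "y = (i, j)" by (cases y) blast
    have "deg i + deg j = n" using Z y(1) ij by (auto simp: deg2_def)
    moreover have "a = C.\<phi> (bas i)" "b = C.\<phi> (bas j)" using y(2) by (simp_all add: ij)
    ultimately show ?thesis using \<phi>_bas_GH by blast
  qed
  hence "EV.V.cls ?u \<in> GE n" unfolding enveloping_grading_def tensor_grading_def quot_grading_def by blast
  thus "Z \<in> GE n" using EV.V.cls_\<sigma> Z by simp
qed

lemma pure_GE: "a \<in> GH i \<Longrightarrow> b \<in> GH j \<Longrightarrow> EV.V.pure a b \<in> GE (i + j)"
proof -
  assume ab: "a \<in> GH i" "b \<in> GH j"
  hence c: "a \<in> carrier H" "b \<in> carrier (opp H)" by (simp_all add: GH_iff)
  show "EV.V.pure a b \<in> GE (i + j)"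
    using ab GH_keys by (auto simp: GE_iff EV.V.pure_in[OF c] EV.V.\<Theta>_pure[OF c] keys_tens deg2_def)
qed

lemma GE_mult: assumes Z: "Z \<in> GE m" and Z': "Z' \<in> GE n" shows "Z \<otimes>\<^bsub>ET\<^esub> Z' \<in> GE (m + n)"
proof -
  have c: "Z \<in> carrier ET" "Z' \<in> carrier ET" using Z Z' by (simp_all add: GE_iff)
  \<comment> \<open>The product is linear in each coordinate vector, so a monomial in its support
    already occurs in a product of two pure tensors of basis elements.\<close>
  let ?B = "\<lambda>u u'. EV.V.\<Theta> (EV.V.T.\<phi> u \<otimes>\<^bsub>ET\<^esub> EV.V.T.\<phi> u')"
  have k1: "klin (\<lambda>u. ?B u u')" and k2: "klin (\<lambda>u'. ?B u u')" for u u'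
    using EV.V.T.klin_Rm[of "EV.V.T.\<phi> u'"] EV.V.T.klin_Lm[of "EV.V.T.\<phi> u"]
    unfolding EV.V.T.Rm_def[abs_def] EV.V.T.Lm_def[abs_def] by simp_all
  have "deg2 x = m + n" if x: "x \<in> keys (?B (EV.V.\<Theta> Z) (EV.V.\<Theta> Z'))" for x
  proof -
    obtain y where y: "y \<in> keys (EV.V.\<Theta> Z)" "x \<in> keys (?B (bas y) (EV.V.\<Theta> Z'))"
      using klin_keysE[OF k1 x] .
    obtain y' where y': "y' \<in> keys (EV.V.\<Theta> Z')" "x \<in> keys (?B (bas y) (bas y'))"
      using klin_keysE[OF k2 y(2)] .
    obtain i j i' j' where ij: "y = (i, j)" "y' = (i', j')" by (cases y, cases y') blast
    have d: "deg2 y = m" "deg2 y' = n" using y(1) y'(1) Z Z' by (auto simp: GE_iff)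
    have tb: "EV.V.T.\<phi> (bas (i, j)) = EV.V.pure (C.\<phi> (bas i)) (C.\<phi> (bas j))" for i j
      using EV.V.pure_\<phi>[of "bas i" "bas j"] by simp
    have "?B (bas y) (bas y') = tens (\<psi> (C.\<phi> (bas i) \<otimes>\<^bsub>H\<^esub> C.\<phi> (bas i'))) (\<psi> (C.\<phi> (bas j') \<otimes>\<^bsub>H\<^esub> C.\<phi> (bas j)))"
      by (simp add: ij tb EV.V.pure_mult EV.V.\<Theta>_pure C.m_closed)
    hence "fst x \<in> keys (\<psi> (C.\<phi> (bas i) \<otimes>\<^bsub>H\<^esub> C.\<phi> (bas i')))" "snd x \<in> keys (\<psi> (C.\<phi> (bas j') \<otimes>\<^bsub>H\<^esub> C.\<phi> (bas j)))"
      using y'(2) by (auto simp: keys_tens)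
    hence "deg (fst x) = deg i + deg i'" "deg (snd x) = deg j' + deg j"
      using GH_keys[OF GH_mult[OF \<phi>_bas_GH \<phi>_bas_GH]] by blast+
    thus ?thesis using d by (simp add: deg2_def ij case_prod_unfold)
  qed
  thus ?thesis using EV.V.T.m_closed[OF c] by (auto simp: GE_iff EV.V.T.\<phi>_\<theta> c)
qed

lemma pure_one_one: "\<one>\<^bsub>ET\<^esub> = EV.V.pure \<one>\<^bsub>H\<^esub> \<one>\<^bsub>H\<^esub>" using EV.V.pure_one by simp

lemma GE_graded_ring: "graded_ring ET GE"
  unfolding graded_ring_def
proof (intro conjI allI ballI GE_mult EV.V.T.ring_axioms)
  show "internal_direct_sum ET GE"
    by (rule coord_grading[where \<theta> = EV.V.\<Theta> and deg = deg2])
      (simp_all add: EV.V.T.abelian_group_axioms EV.V.T.bij EV.V.T.\<theta>_add set_eq_iff GE_iff)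
  have "\<one>\<^bsub>H\<^esub> \<in> GH 0" by (rule graded_ringD(3)[OF GH_graded_ring])
  from pure_GE[OF this this] show "\<one>\<^bsub>ET\<^esub> \<in> GE 0" by (simp add: pure_one_one)
qed

lemma ET_one_neq: "\<one>\<^bsub>ET\<^esub> \<noteq> \<zero>\<^bsub>ET\<^esub>"
proof
  assume "\<one>\<^bsub>ET\<^esub> = \<zero>\<^bsub>ET\<^esub>"
  hence "EV.V.\<Theta> (EV.V.pure \<one>\<^bsub>H\<^esub> \<one>\<^bsub>H\<^esub>) = 0" using pure_one_one EV.V.T.\<theta>_zero by simp
  hence "(bas ((0, 0, 0), (0, 0, 0)) :: (nat \<times> nat \<times> nat) \<times> (nat \<times> nat \<times> nat) \<Rightarrow>\<^sub>0 'k) = 0" by (simp add: EV.V.\<Theta>_pure \<psi>_one)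
  thus False by (metis lookup_single_eq lookup_zero zero_neq_one)
qed

lemma GE_scale: "Z \<in> GE n \<Longrightarrow> z \<odot>\<^bsub>ET\<^esub> Z \<in> GE n"
  using keys_scale[of z "EV.V.\<Theta> Z"] by (auto simp: GE_iff EV.V.T.\<theta>_scale EV.V.T.scale_closed image_subset_iff)

lemma lift_keys:
  assumes "Z \<in> GE m" "x \<in> keys (EV.lift h (EV.V.\<Theta> Z))"
    and "\<And>i j. h (C.\<phi> (bas i), C.\<phi> (bas j)) \<in> GH (deg i + deg j + n)"
  shows "deg x = m + n"
proof -
  from assms(2)[unfolded EV.lift_def] obtain y where y: "y \<in> keys (EV.V.\<Theta> Z)" "x \<in> keys ((\<lambda>(i, j). \<psi> (h (C.\<phi> (bas i), C.\<phi> (bas j)))) y)"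
    by (rule keys_lextE)
  obtain i j where ij: "y = (i, j)" by (cases y) blast
  have "deg x = deg i + deg j + n" using y(2) GH_keys[OF assms(3)[of i j]] by (simp add: ij)
  moreover have "deg i + deg j = m" using assms(1) y(1) by (auto simp: GE_iff ij deg2_def)
  ultimately show ?thesis by simp
qed

lemma bimodule_graded: "graded_module ET GE (bimodule H) GH"
  unfolding graded_module_def
proof (intro conjI allI ballI GE_graded_ring)
  show "left_module ET (bimodule H)" using EV.bimodule_left_module unfolding EV.Env_eq .
  show "internal_direct_sum (bimodule H) GH"
  proof (rule coord_grading[where \<theta> = \<psi> and deg = deg])
    show "abelian_group (bimodule H)" by (rule left_module.axioms(2)[OF EV.bimodule_left_module])
  qed (simp_all add: EV.bimodule_eq C.bij C.\<theta>_add set_eq_iff GH_iff)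
  fix i j Z m assume Z: "Z \<in> GE i" and m: "m \<in> GH j"
  hence c: "Z \<in> carrier EV.Env" "m \<in> carrier H" by (simp_all add: GE_iff GH_iff EV.Env_eq)
  have "EV.bimod_map m (C.\<phi> (bas k), C.\<phi> (bas l)) \<in> GH (deg k + deg l + j)" for k l
    using GH_mult[OF GH_mult[OF \<phi>_bas_GH[of k] m] \<phi>_bas_GH[of l]] by (simp add: EV.bimod_map_def add_ac)
  from lift_keys[OF Z _ this] show "Z \<odot>\<^bsub>bimodule H\<^esub> m \<in> GH (i + j)"
    unfolding EV.bimodule_smult[OF c] by (auto simp: GH_iff)
qed

end

lemma orbit_linmap: "left_module A M \<Longrightarrow> m \<in> carrier M \<Longrightarrow> linmap A (regular A) M (\<lambda>a. a \<odot>\<^bsub>M\<^esub> m)"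
  unfolding linmap_def
  by (simp add: left_module.smult_closed left_module.smult_l_distr left_module.smult_assoc)

section \<open>The bimodule resolution and its dual\<close>

context H_data
begin

text \<open>Orbit map of 1, as is \<open>\<epsilon>T\<close>: linear by \<open>orbit_linmap\<close>,
  and surjective because a \<otimes> 1 is sent to a, respectively 1 \<otimes> a for
  \<open>\<epsilon>T\<close>.\<close>

definition \<epsilon>B :: "('k, (gen list \<Rightarrow>\<^sub>0 'k) set) env \<Rightarrow> (gen list \<Rightarrow>\<^sub>0 'k) set" where
  "\<epsilon>B Z = Z \<odot>\<^bsub>bimodule H\<^esub> \<one>\<^bsub>H\<^esub>"

definition \<epsilon>T :: "('k, (gen list \<Rightarrow>\<^sub>0 'k) set) env \<Rightarrow> (gen list \<Rightarrow>\<^sub>0 'k) set" where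
  "\<epsilon>T Z = Z \<odot>\<^bsub>twisted_bimodule H \<nu>H\<^esub> \<one>\<^bsub>H\<^esub>"

abbreviation "hB \<equiv> EV.bimod_map \<one>\<^bsub>H\<^esub>"
abbreviation "hT \<equiv> EV.twist_map \<one>\<^bsub>H\<^esub>"

lemma \<epsilon>_eq: "Z \<in> carrier ET \<Longrightarrow> \<epsilon>B Z = C.\<phi> (EV.lift hB (EV.V.\<Theta> Z))"
  "Z \<in> carrier ET \<Longrightarrow> \<epsilon>T Z = C.\<phi> (EV.lift hT (EV.V.\<Theta> Z))"
  using EV.bimodule_smult[of Z "\<one>\<^bsub>H\<^esub>"] EV.twisted_smult[of Z "\<one>\<^bsub>H\<^esub>"] by (simp_all add: \<epsilon>B_def \<epsilon>T_def EV.Env_eq)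

lemma bilin_h: "EV.bilin hB" "EV.bilin hT"
  by (simp_all add: EV.bimod_bilin EV.twist_bilin)

lemma \<epsilon>_pure: "a \<in> carrier H \<Longrightarrow> b \<in> carrier H \<Longrightarrow> \<epsilon>B (EV.V.pure a b) = a \<otimes>\<^bsub>H\<^esub> b"
  "a \<in> carrier H \<Longrightarrow> b \<in> carrier H \<Longrightarrow> \<epsilon>T (EV.V.pure a b) = b \<otimes>\<^bsub>H\<^esub> \<nu>H a"
  by (simp_all add: \<epsilon>_eq EV.V.pure_in EV.V.\<Theta>_pure EV.lift_pure bilin_h)
    (simp_all add: EV.bimod_map_def EV.twist_map_def C.\<phi>_\<theta> C.m_closed)

lemma bimodule_ET: "left_module ET (bimodule H)" "left_module (opp ET) (twisted_bimodule H \<nu>H)"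
  using EV.bimodule_left_module EV.twisted_left_module unfolding EV.Env_eq .

lemma \<epsilon>_lin: "linmap ET (regular ET) (bimodule H) \<epsilon>B" "linmap (opp ET) (regular (opp ET)) (twisted_bimodule H \<nu>H) \<epsilon>T"
  unfolding \<epsilon>B_def[abs_def] \<epsilon>T_def[abs_def]
  by (rule orbit_linmap[OF bimodule_ET(1)], simp add: EV.bimodule_eq,
      rule orbit_linmap[OF bimodule_ET(2)], simp add: EV.twisted_eq)

lemma \<epsilon>_GE: "Z \<in> GE n \<Longrightarrow> \<epsilon>B Z \<in> GH n" "Z \<in> GE n \<Longrightarrow> \<epsilon>T Z \<in> GH n"
proof -
  assume Z: "Z \<in> GE n"
  hence c: "Z \<in> carrier ET" by (simp add: GE_iff)
  have "hB (C.\<phi> (bas k), C.\<phi> (bas l)) \<in> GH (deg k + deg l + 0)" for k l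
    using GH_mult[OF \<phi>_bas_GH[of k] \<phi>_bas_GH[of l]] by (simp add: EV.bimod_map_def)
  from lift_keys[OF Z _ this] show "\<epsilon>B Z \<in> GH n" by (auto simp: \<epsilon>_eq c GH_iff)
  have "hT (C.\<phi> (bas k), C.\<phi> (bas l)) \<in> GH (deg k + deg l + 0)" for k l
    using GH_mult[OF \<phi>_bas_GH[of l] \<nu>H_GH[OF \<phi>_bas_GH[of k]]] by (simp add: EV.twist_map_def add.commute)
  from lift_keys[OF Z _ this] show "\<epsilon>T Z \<in> GH n" by (auto simp: \<epsilon>_eq c GH_iff)
qed

lemma \<epsilon>_surj: "\<epsilon>B ` carrier ET = carrier (bimodule H)" "\<epsilon>T ` carrier ET = carrier (twisted_bimodule H \<nu>H)" "\<epsilon>T ` GE n = GH n"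
proof -
  have m: "\<epsilon>B (EV.V.pure a \<one>\<^bsub>H\<^esub>) = a" "\<epsilon>T (EV.V.pure \<one>\<^bsub>H\<^esub> a) = a"
    "EV.V.pure a \<one>\<^bsub>H\<^esub> \<in> carrier ET" "EV.V.pure \<one>\<^bsub>H\<^esub> a \<in> carrier ET" if "a \<in> carrier H" for a
    using that by (simp_all add: \<epsilon>_pure \<nu>H_one EV.V.pure_in)
  have i: "\<epsilon>B Z \<in> carrier H" "\<epsilon>T Z \<in> carrier H" if "Z \<in> carrier ET" for Z using that by (simp_all add: \<epsilon>_eq)
  show "\<epsilon>B ` carrier ET = carrier (bimodule H)"
    unfolding EV.bimodule_eq with_smult_simps using m(1,3) i(1) by (auto simp: image_iff)
  show "\<epsilon>T ` carrier ET = carrier (twisted_bimodule H \<nu>H)"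
    unfolding EV.twisted_eq with_smult_simps using m(2,4) i(2) by (auto simp: image_iff)
  have "a \<in> \<epsilon>T ` GE n" if a: "a \<in> GH n" for a
  proof -
    have "EV.V.pure \<one>\<^bsub>H\<^esub> a \<in> GE (0 + n)" by (rule pure_GE[OF graded_ringD(3)[OF GH_graded_ring] a])
    thus ?thesis using m(2)[of a] a by (intro image_eqI[of _ _ "EV.V.pure \<one>\<^bsub>H\<^esub> a"]) (simp_all add: GH_iff)
  qed
  thus "\<epsilon>T ` GE n = GH n" using \<epsilon>_GE(2) by blast
qed

text \<open>An element with coordinates in \<open>W2\<close> is 1 \<otimes> w, and both maps send it
  to w, since the automorphism fixes 1.\<close>

lemma \<epsilon>_inj: assumes Z: "Z \<in> carrier ET" "EV.V.\<Theta> Z \<in> W2" and "\<epsilon>B Z = \<zero>\<^bsub>H\<^esub> \<or> \<epsilon>T Z = \<zero>\<^bsub>H\<^esub>" shows "Z = \<zero>\<^bsub>ET\<^esub>"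
proof -
  obtain w where w: "EV.V.\<Theta> Z = tens (bas (0, 0, 0)) w" using W2_first[OF Z(2)] by blast
  have "\<epsilon>B Z = C.\<phi> w" "\<epsilon>T Z = C.\<phi> w"
    by (simp_all add: \<epsilon>_eq[OF Z(1)] w EV.lift_tens bilin_h \<phi>_one)
      (simp_all add: EV.bimod_map_def EV.twist_map_def \<nu>H_one)
  hence "C.\<phi> w = \<zero>\<^bsub>H\<^esub>" using assms(3) by auto
  hence "w = 0" using C.\<theta>_\<phi>[of w] by simp
  thus ?thesis using EV.V.T.\<theta>_zero_iff[OF Z(1)] by (simp add: w tens_simps)
qed

abbreviation "eL a \<equiv> EV.V.pure a \<one>\<^bsub>H\<^esub>"
abbreviation "eR a \<equiv> EV.V.pure \<one>\<^bsub>H\<^esub> a"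

text \<open>The second factor is the opposite algebra, so right multiplication by 1 \<otimes> a is
  left multiplication by a there. This is the shape required by \<open>right_ops\<close>, and dually
  by \<open>left_ops\<close>.\<close>

lemma eLR_simps: assumes "a \<in> carrier H"
  shows "EV.V.T.Rm (eL a) = op1 (C.Rm a)" "EV.V.T.Rm (eR a) = op2 (C.Lm a)"
    "EV.V.T.Lm (eL a) = op1 (C.Lm a)" "EV.V.T.Lm (eR a) = op2 (C.Rm a)"
proof -
  have 1: "C.Lm \<one>\<^bsub>H\<^esub> = (\<lambda>u. u)" "C.Rm \<one>\<^bsub>H\<^esub> = (\<lambda>u. u)" by (simp_all add: fun_eq_iff C.Lm_one C.Rm_one)
  show "EV.V.T.Rm (eL a) = op1 (C.Rm a)" "EV.V.T.Rm (eR a) = op2 (C.Lm a)"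
    "EV.V.T.Lm (eL a) = op1 (C.Lm a)" "EV.V.T.Lm (eR a) = op2 (C.Rm a)"
    using assms by (simp_all add: fun_eq_iff EV.V.T_Lm EV.V.T_Rm 1 op1_id op2_id)
qed

lemma eLR_in [simp]: "a \<in> carrier H \<Longrightarrow> eL a \<in> carrier ET" "a \<in> carrier H \<Longrightarrow> eR a \<in> carrier ET"
  by (simp_all add: EV.V.pure_in)

lemma eLR_GE: "eL (cl (var a)) \<in> GE 1" "eR (cl (var a)) \<in> GE 1"
  using pure_GE[OF gens_GH[of a] graded_ringD(3)[OF GH_graded_ring]]
    pure_GE[OF graded_ringD(3)[OF GH_graded_ring] gens_GH[of a]] by simp_all

lemma \<epsilon>B_minus: "a \<in> carrier H \<Longrightarrow> \<epsilon>B (eL a \<ominus>\<^bsub>ET\<^esub> eR a) = \<zero>\<^bsub>H\<^esub>"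
  by (simp add: \<epsilon>_eq EV.V.T.\<theta>_minus klin_simps[OF EV.klin_lift] EV.V.\<Theta>_pure EV.lift_pure bilin_h)
    (simp add: EV.bimod_map_def)

lemma \<epsilon>T_zero:
  assumes "Z \<in> carrier ET" "EV.lift hT (EV.V.\<Theta> Z) = 0" shows "\<epsilon>T Z = \<zero>\<^bsub>H\<^esub>"
  using assms by (simp add: \<epsilon>_eq)

lemma lift_eLR: "a \<in> carrier H \<Longrightarrow> EV.lift hT (EV.V.\<Theta> (eL a)) = \<psi> (\<nu>H a)"
  "a \<in> carrier H \<Longrightarrow> EV.lift hT (EV.V.\<Theta> (eR a)) = \<psi> a"
  by (simp_all add: EV.V.\<Theta>_pure EV.lift_pure bilin_h) (simp_all add: EV.twist_map_def \<nu>H_in \<nu>H_one)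

lemma koszul_ring_ET: "koszul_ring_aug ET EV.V.\<Theta> GE p q c (eL xx) (eL yy) (eL tt) (eR xx) (eR yy) (eR tt) W0 W1 W2 W0 V1 W2
  (bimodule H) GH \<epsilon>B (twisted_bimodule H \<nu>H) GH \<epsilon>T"
proof (intro koszul_ring_aug.intro koszul_ring.intro EV.V.Ten_coord koszul_ring_axioms.intro koszul_ring_aug_axioms.intro
    GE_graded_ring ET_one_neq GE_scale eLR_GE bimodule_graded \<epsilon>_lin \<epsilon>_surj \<epsilon>_GE bimodule_ET(2))
  show "koszul_ops p q c (EV.V.T.Rm (eL xx)) (EV.V.T.Rm (eL yy)) (EV.V.T.Rm (eL tt))
      (EV.V.T.Rm (eR xx)) (EV.V.T.Rm (eR yy)) (EV.V.T.Rm (eR tt)) W0 W1 W2"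
    unfolding eLR_simps[OF gens_in] by (rule right_ops) (simp_all add: C.klin_Lm Lm_rel)
  have sc: "scale z (op2 (C.Rm a) u) = op2 (\<lambda>u. scale z (C.Rm a u)) u" for z a and u :: "(nat \<times> nat \<times> nat) \<times> (nat \<times> nat \<times> nat) \<Rightarrow>\<^sub>0 'k"
    by (simp only: op2_smult)
  have pqn: "p * q \<noteq> 0" using pq by simp
  have kR: "klin (C.Rm (cl u))" for u by (rule C.klin_Rm) simp
  \<comment> \<open>Rescaling by p q and its inverse preserves the relations: the factors cancel in
    products of x and y, and the relations with t are homogeneous in x and in y.\<close>
  show "koszul_ops p q c (EV.V.T.Lm (eL yy)) (EV.V.T.Lm (eL xx)) (EV.V.T.Lm (eL tt))
      (\<lambda>u. scale (p * q) (EV.V.T.Lm (eR yy) u)) (\<lambda>u. scale (1 / (p * q)) (EV.V.T.Lm (eR xx) u)) (EV.V.T.Lm (eR tt)) W0 V1 W2"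
    unfolding eLR_simps[OF gens_in] sc
    by (rule left_ops)
      (use pqn in \<open>simp_all add: klin_smult kR klin_scale[OF kR] Rm_rel sc.scale_right_distrib mult_ac\<close>)
  have z: "\<zero>\<^bsub>bimodule H\<^esub> = \<zero>\<^bsub>H\<^esub>" "\<zero>\<^bsub>twisted_bimodule H \<nu>H\<^esub> = \<zero>\<^bsub>H\<^esub>" by (simp_all add: EV.bimodule_eq EV.twisted_eq)
  show "\<epsilon>B (eL xx \<ominus>\<^bsub>ET\<^esub> eR xx) = \<zero>\<^bsub>bimodule H\<^esub>" "\<epsilon>B (eL yy \<ominus>\<^bsub>ET\<^esub> eR yy) = \<zero>\<^bsub>bimodule H\<^esub>"
    "\<epsilon>B (eL tt \<ominus>\<^bsub>ET\<^esub> eR tt) = \<zero>\<^bsub>bimodule H\<^esub>"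
    by (simp_all add: z \<epsilon>B_minus)
  note ts = EV.V.T.\<theta>_minus EV.V.T.\<theta>_scale EV.V.T.\<theta>_uminus EV.V.T.scale_closed EV.V.T.minus_closed EV.V.T.a_inv_closed
    klin_simps[OF EV.klin_lift] lift_eLR \<nu>H_gen C.\<theta>_scale C.scale_closed
  \<comment> \<open>Here the automorphism is forced: y \<otimes> 1 is sent to the image of y and 1
    \<otimes> y to y, so the entries of the last matrix vanish exactly when y goes to p q y, x to
    x/(p q) and t to t.\<close>
  show "\<epsilon>T (eL yy \<ominus>\<^bsub>ET\<^esub> (p * q) \<odot>\<^bsub>ET\<^esub> eR yy) = \<zero>\<^bsub>twisted_bimodule H \<nu>H\<^esub>"
    "\<epsilon>T ((p * q) \<odot>\<^bsub>ET\<^esub> eL xx \<ominus>\<^bsub>ET\<^esub> eR xx) = \<zero>\<^bsub>twisted_bimodule H \<nu>H\<^esub>"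
    "\<epsilon>T (\<ominus>\<^bsub>ET\<^esub> (p \<odot>\<^bsub>ET\<^esub> (eL tt \<ominus>\<^bsub>ET\<^esub> eR tt))) = \<zero>\<^bsub>twisted_bimodule H \<nu>H\<^esub>"
    unfolding z using pqn by (intro \<epsilon>T_zero; simp add: ts gw_def)+
  show "Z = \<zero>\<^bsub>ET\<^esub>" if "Z \<in> carrier ET" "EV.V.\<Theta> Z \<in> W2" "\<epsilon>B Z = \<zero>\<^bsub>bimodule H\<^esub>" for Z
    using \<epsilon>_inj[OF that(1,2)] that(3) z by simp
  show "Z = \<zero>\<^bsub>ET\<^esub>" if "Z \<in> carrier ET" "EV.V.\<Theta> Z \<in> W2" "\<epsilon>T Z = \<zero>\<^bsub>twisted_bimodule H \<nu>H\<^esub>" for Z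
    using \<epsilon>_inj[OF that(1,2)] that(3) z by simp
qed

interpretation KE: koszul_ring_aug ET EV.V.\<Theta> GE p q c "eL xx" "eL yy" "eL tt" "eR xx" "eR yy" "eR tt" W0 W1 W2 W0 V1 W2
  "bimodule H" GH \<epsilon>B "twisted_bimodule H \<nu>H" GH \<epsilon>T
  by (rule koszul_ring_ET)

lemma H_skew_CY: "graded_skew_CY H GH 3"
  unfolding graded_skew_CY_def EV.Env_eq
proof (intro conjI)
  show "graded_algebra H GH" by (rule H_graded_algebra)
  have "projective_resolution ET (bimodule H) KE.M.Q KE.M.d KE.M.e"
    using KE.M.resolution by (simp add: graded_projective_resolution_def)
  moreover have "length_at_most KE.M.Q 3" by (rule KE.M.P_length)
  moreover have "\<forall>i. finitely_generated ET (KE.M.Q i)" using KE.M.P_finitely_generated by blast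
  ultimately show "\<exists>(P :: nat \<Rightarrow> (('k, (gen list \<Rightarrow>\<^sub>0 'k) set) env, (('k, (gen list \<Rightarrow>\<^sub>0 'k) set) env, (gen list \<Rightarrow>\<^sub>0 'k) set) res) module) d e n.
      projective_resolution ET (bimodule H) P d e \<and> length_at_most P n \<and> (\<forall>i. finitely_generated ET (P i))" by blast
  show "\<exists>\<nu> l. algebra_automorphism H \<nu> \<and> (\<forall>i. i \<noteq> 3 \<longrightarrow> Ext_zero ET GE (bimodule H) GH i) \<and>
      Ext_iso ET GE (bimodule H) GH 3 (twisted_bimodule H \<nu>) (shift GH l)"
    using \<nu>H_automorphism KE.M.Ext_zero_not_3 KE.M.Ext_top by blast
qed

end

theorem corollary5p6:
  fixes p q :: "'k::field" and f g :: "'k poly"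
  assumes "p \<noteq> 0" and "q \<noteq> 0"
    and "f = [:0, p:]"
    and "\<exists>c. g = monom c 2"
  shows "koszul (H_algebra q f g) (H_grading q f g) \<and>
    AS_regular TYPE('m) (H_algebra q f g) (H_grading q f g) 3 \<and>
    graded_skew_CY (H_algebra q f g) (H_grading q f g) 3"
proof -
  obtain c where g: "g = monom c 2" using assms(4) by blast
  interpret H_data p q c by unfold_locales (fact assms)+
  show ?thesis unfolding assms(3) g by (intro conjI H_koszul H_AS_regular H_skew_CY)
qed

end
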